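(* Let $R$ and $S$ be Morita equivalent non-Artinian HNP rings. Then there is an isomorphism $G(R)\cong G(S)$ of ideal class groups, and under this isomorphism the image of $G_{\max}(R)$ is $G_{\max}(S)$.
   Context: Conventions. An HNP ring is a hereditary Noetherian prime ring. Modules are right modules. A right $R$-ideal is a right ideal of $R$ containing a non-zero-divisor. $K_0(R)$ is the Grothendieck group of finitely generated projective modules, $[P]$ the class of $P$. $\operatorname{udim}$ is uniform dimension. Towers. For simple modules $V,W$, $W$ is a successor of $V$ if $\operatorname{Ext}^1_R(V,W)\neq\mathbf 0$. A simple module is unfaithful if its annihilator is nonzero. (Known: an unfaithful successor of a simple module is its unique successor up to isomorphism.) A tower is a finite sequence $(W_1),\dots,(W_n)$, $n\ge1$, of isomorphism classes of simple modules, pairwise distinct, with $(W_i)$ the unique unfaithful successor of $(W_{i-1})$ for $i\in[2,n]$, and maximal with these properties. It is either a faithful tower ($W_1$ faithful, the others unfaithful) or a cycle tower (all unfaithful, $W_1$ the unfaithful successor of $W_n$). Cyclic permutations of cycle towers are identified; each isomorphism class of simple modules lies in exactly one tower. Ideal class group. For a finitely generated projective module $P$ and an unfaithful simple module $W$ with $M=\operatorname{ann}_R(W)$, $\rho(P,W)$ is the length of $P/PM$; also $\rho(P,\mathbf 0)=\operatorname{udim}P$. Let $\operatorname{modspec}(R)$ be a set of representatives of isomorphism classes of unfaithful simple modules together with the zero module. The genus $\Psi(P)=(\rho(P,W))_{W\in\operatorname{modspec}(R)}$ extends to a homomorphism $\Psi^+\colon K_0(R)\to\mathbb Z^{\operatorname{modspec}(R)}$,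 and $G(R)=\ker(\Psi^+)$. For a module $M$ of finite length, $(M)$ is its class in the Grothendieck group of finite length modules (free abelian on isomorphism classes of simples), and $(T)=\sum_{(V)\in T}(V)$ for a tower $T$. A right $R$-ideal $I$ is tower-maximal if $(R/I)=(T)$ for some tower $T$; then $\Psi(I)=\Psi(R)$. Put $G_{\max}(R)=\{[I]-[R]: I\text{ a tower-maximal right }R\text{-ideal}\}\subset G(R)$ (equivalently, the differences $\mathsf S(I)-\mathsf S(R)$ of Steinitz classes). *)

theory Defs
  imports "HOL-Algebra.Module" "HOL-Algebra.Ideal" "HOL-Algebra.Product_Groups"
    "HOL-Algebra.Free_Abelian_Groups" "HOL-Library.Sublist"
begin

section \<open>Right modules\<close>

text \<open>Right modules reuse the library record \<open>module\<close>: the term \<open>a \<odot>\<^bsub>M\<^esub> x\<close> stands for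
  the right action \<open>x a\<close>, so associativity reads \<open>x (a b) = (x a) b\<close>.  The fields \<open>mult\<close> and
  \<open>one\<close>, which the record inherits from \<open>ring\<close>, play no role.\<close>

locale right_module = R?: ring R + M?: abelian_group M
  for R :: "('r, 'k) ring_scheme" (structure) and M :: "('r, 'm) module" (structure) +
  assumes smult_closed [simp, intro]:
      "\<lbrakk>a \<in> carrier R; x \<in> carrier M\<rbrakk> \<Longrightarrow> a \<odot>\<^bsub>M\<^esub> x \<in> carrier M"
    and smult_l_distr:
      "\<lbrakk>a \<in> carrier R; b \<in> carrier R; x \<in> carrier M\<rbrakk> \<Longrightarrow>
        (a \<oplus>\<^bsub>R\<^esub> b) \<odot>\<^bsub>M\<^esub> x = a \<odot>\<^bsub>M\<^esub> x \<oplus>\<^bsub>M\<^esub> b \<odot>\<^bsub>M\<^esub> x"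
    and smult_r_distr:
      "\<lbrakk>a \<in> carrier R; x \<in> carrier M; y \<in> carrier M\<rbrakk> \<Longrightarrow>
        a \<odot>\<^bsub>M\<^esub> (x \<oplus>\<^bsub>M\<^esub> y) = a \<odot>\<^bsub>M\<^esub> x \<oplus>\<^bsub>M\<^esub> a \<odot>\<^bsub>M\<^esub> y"
    and smult_assoc:
      "\<lbrakk>a \<in> carrier R; b \<in> carrier R; x \<in> carrier M\<rbrakk> \<Longrightarrow>
        (a \<otimes>\<^bsub>R\<^esub> b) \<odot>\<^bsub>M\<^esub> x = b \<odot>\<^bsub>M\<^esub> (a \<odot>\<^bsub>M\<^esub> x)"
    and smult_one [simp]:
      "x \<in> carrier M \<Longrightarrow> \<one>\<^bsub>R\<^esub> \<odot>\<^bsub>M\<^esub> x = x"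

definition zero_module :: "('r, 'k) ring_scheme \<Rightarrow> ('r, 'm) module \<Rightarrow> bool" where
  "zero_module R M \<longleftrightarrow> right_module R M \<and> carrier M = {\<zero>\<^bsub>M\<^esub>}"

definition reg_module :: "('r, 'k) ring_scheme \<Rightarrow> ('r, 'r) module" where
  "reg_module R = \<lparr>carrier = carrier R, mult = mult R, one = \<one>\<^bsub>R\<^esub>, ring.zero = \<zero>\<^bsub>R\<^esub>,
     add = add R, smult = (\<lambda>a x. x \<otimes>\<^bsub>R\<^esub> a)\<rparr>"

abbreviation sub_mod :: "('r, 'm) module \<Rightarrow> 'm set \<Rightarrow> ('r, 'm) module" where
  "sub_mod M N \<equiv> M\<lparr>carrier := N\<rparr>"

definition quot_module :: "('r, 'm) module \<Rightarrow> 'm set \<Rightarrow> ('r, 'm set) module" where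
  "quot_module M N = \<lparr>carrier = a_rcosets\<^bsub>M\<^esub> N, mult = (\<lambda>X Y. N), one = N, ring.zero = N,
     add = set_add M, smult = (\<lambda>a X. \<Union>x\<in>X. N +>\<^bsub>M\<^esub> (a \<odot>\<^bsub>M\<^esub> x))\<rparr>"

text \<open>Homomorphisms are extensional functions, so that they are equal iff they agree on the
  carrier.\<close>

definition rhom :: "('r, 'k) ring_scheme \<Rightarrow> ('r, 'm) module \<Rightarrow> ('r, 'n) module \<Rightarrow> ('m \<Rightarrow> 'n) set" where
  "rhom R M N = {f \<in> carrier M \<rightarrow>\<^sub>E carrier N.
     (\<forall>x\<in>carrier M. \<forall>y\<in>carrier M. f (x \<oplus>\<^bsub>M\<^esub> y) = f x \<oplus>\<^bsub>N\<^esub> f y) \<and>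
     (\<forall>a\<in>carrier R. \<forall>x\<in>carrier M. f (a \<odot>\<^bsub>M\<^esub> x) = a \<odot>\<^bsub>N\<^esub> f x)}"

definition riso :: "('r, 'k) ring_scheme \<Rightarrow> ('r, 'm) module \<Rightarrow> ('r, 'n) module \<Rightarrow> ('m \<Rightarrow> 'n) set" where
  "riso R M N = {f \<in> rhom R M N. bij_betw f (carrier M) (carrier N)}"

definition short_exact ::
  "('r, 'k) ring_scheme \<Rightarrow> ('r, 'l) module \<Rightarrow> ('r, 'm) module \<Rightarrow> ('r, 'n) module
    \<Rightarrow> ('l \<Rightarrow> 'm) \<Rightarrow> ('m \<Rightarrow> 'n) \<Rightarrow> bool" where
  "short_exact R L M N f g \<longleftrightarrow> f \<in> rhom R L M \<and> g \<in> rhom R M N \<and>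
     inj_on f (carrier L) \<and> g ` carrier M = carrier N \<and>
     f ` carrier L = {x \<in> carrier M. g x = \<zero>\<^bsub>N\<^esub>}"

definition rspan :: "('r, 'k) ring_scheme \<Rightarrow> ('r, 'm) module \<Rightarrow> 'm set \<Rightarrow> 'm set" where
  "rspan R M A = \<Inter>{N. submodule N R M \<and> A \<subseteq> N}"

definition fin_gen :: "('r, 'k) ring_scheme \<Rightarrow> ('r, 'm) module \<Rightarrow> bool" where
  "fin_gen R M \<longleftrightarrow> (\<exists>A. finite A \<and> A \<subseteq> carrier M \<and> rspan R M A = carrier M)"

text \<open>HOL cannot quantify over types inside a definition, so the lifting property is
  tested only against modules \<open>M\<close>, \<open>N\<close> carried by subsets of the types \<open>'p \<Rightarrow> 'r\<close> and \<open>'p\<close>.  This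
  loses nothing: the free module on the set \<open>carrier P\<close> and \<open>P\<close> itself are among these, and lifting
  the identity of \<open>P\<close> to that free module makes \<open>P\<close> a direct summand of it.\<close>

definition proj_module :: "('r, 'k) ring_scheme \<Rightarrow> ('r, 'p) module \<Rightarrow> bool" where
  "proj_module R P \<longleftrightarrow> right_module R P \<and>
     (\<forall>(M :: ('r, 'p \<Rightarrow> 'r) module) (N :: ('r, 'p) module) g f.
        right_module R M \<and> right_module R N \<and>
        g \<in> rhom R M N \<and> g ` carrier M = carrier N \<and> f \<in> rhom R P N \<longrightarrow>
        (\<exists>h \<in> rhom R P M. \<forall>x\<in>carrier P. g (h x) = f x))"

definition simple_module :: "('r, 'k) ring_scheme \<Rightarrow> ('r, 'm) module \<Rightarrow> bool" where
  "simple_module R M \<longleftrightarrow> right_module R M \<and> carrier M \<noteq> {\<zero>\<^bsub>M\<^esub>} \<and>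
     (\<forall>N. submodule N R M \<longrightarrow> N = {\<zero>\<^bsub>M\<^esub>} \<or> N = carrier M)"

definition ann :: "('r, 'k) ring_scheme \<Rightarrow> ('r, 'm) module \<Rightarrow> 'r set" where
  "ann R M = {a \<in> carrier R. \<forall>x\<in>carrier M. a \<odot>\<^bsub>M\<^esub> x = \<zero>\<^bsub>M\<^esub>}"

definition unfaithful_simple :: "('r, 'k) ring_scheme \<Rightarrow> ('r, 'm) module \<Rightarrow> bool" where
  "unfaithful_simple R W \<longleftrightarrow> simple_module R W \<and> ann R W \<noteq> {\<zero>\<^bsub>R\<^esub>}"


section \<open>Length and uniform dimension\<close>

definition comp_series :: "('r, 'k) ring_scheme \<Rightarrow> ('r, 'm) module \<Rightarrow> 'm set list \<Rightarrow> bool" where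
  "comp_series R M Ns \<longleftrightarrow> Ns \<noteq> [] \<and> (\<forall>N\<in>set Ns. submodule N R M) \<and>
     hd Ns = {\<zero>\<^bsub>M\<^esub>} \<and> last Ns = carrier M \<and>
     (\<forall>i. Suc i < length Ns \<longrightarrow> Ns ! i \<subseteq> Ns ! Suc i \<and>
        simple_module R (quot_module (sub_mod M (Ns ! Suc i)) (Ns ! i)))"

definition finite_length :: "('r, 'k) ring_scheme \<Rightarrow> ('r, 'm) module \<Rightarrow> bool" where
  "finite_length R M \<longleftrightarrow> right_module R M \<and> (\<exists>Ns. comp_series R M Ns)"

definition mod_length :: "('r, 'k) ring_scheme \<Rightarrow> ('r, 'm) module \<Rightarrow> nat" where
  "mod_length R M = (THE n. \<exists>Ns. comp_series R M Ns \<and> length Ns = Suc n)"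

definition uniform_submodule :: "('r, 'k) ring_scheme \<Rightarrow> ('r, 'm) module \<Rightarrow> 'm set \<Rightarrow> bool" where
  "uniform_submodule R M U \<longleftrightarrow> submodule U R M \<and> U \<noteq> {\<zero>\<^bsub>M\<^esub>} \<and>
     (\<forall>A B. submodule A R M \<and> submodule B R M \<and> A \<subseteq> U \<and> B \<subseteq> U \<and>
        A \<noteq> {\<zero>\<^bsub>M\<^esub>} \<and> B \<noteq> {\<zero>\<^bsub>M\<^esub>} \<longrightarrow> A \<inter> B \<noteq> {\<zero>\<^bsub>M\<^esub>})"

definition essential_submodule :: "('r, 'k) ring_scheme \<Rightarrow> ('r, 'm) module \<Rightarrow> 'm set \<Rightarrow> bool" where
  "essential_submodule R M E \<longleftrightarrow> submodule E R M \<and>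
     (\<forall>A. submodule A R M \<and> A \<noteq> {\<zero>\<^bsub>M\<^esub>} \<longrightarrow> A \<inter> E \<noteq> {\<zero>\<^bsub>M\<^esub>})"

definition udim :: "('r, 'k) ring_scheme \<Rightarrow> ('r, 'm) module \<Rightarrow> nat" where
  "udim R M = (THE n. \<exists>U :: nat \<Rightarrow> 'm set.
     (\<forall>i<n. uniform_submodule R M (U i)) \<and>
     (\<forall>x \<in> (\<Pi> i\<in>{..<n}. U i). finsum M x {..<n} = \<zero>\<^bsub>M\<^esub> \<longrightarrow> (\<forall>i<n. x i = \<zero>\<^bsub>M\<^esub>)) \<and>
     essential_submodule R M ((\<lambda>x. finsum M x {..<n}) ` (\<Pi> i\<in>{..<n}. U i)))"


section \<open>Hereditary Noetherian prime rings\<close>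

definition opp_ring :: "('r, 'k) ring_scheme \<Rightarrow> ('r, 'k) ring_scheme" where
  "opp_ring R = R\<lparr>mult := \<lambda>a b. b \<otimes>\<^bsub>R\<^esub> a\<rparr>"

abbreviation right_ideal :: "'r set \<Rightarrow> ('r, 'k) ring_scheme \<Rightarrow> bool" where
  "right_ideal I R \<equiv> submodule I R (reg_module R)"

definition right_hereditary :: "('r, 'k) ring_scheme \<Rightarrow> bool" where
  "right_hereditary R \<longleftrightarrow> (\<forall>I. right_ideal I R \<longrightarrow> proj_module R (sub_mod (reg_module R) I))"

definition right_noetherian :: "('r, 'k) ring_scheme \<Rightarrow> bool" where
  "right_noetherian R \<longleftrightarrow> (\<forall>I. right_ideal I R \<longrightarrow> fin_gen R (sub_mod (reg_module R) I))"

definition right_artinian :: "('r, 'k) ring_scheme \<Rightarrow> bool" where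
  "right_artinian R \<longleftrightarrow> (\<forall>I :: nat \<Rightarrow> 'r set. (\<forall>n. right_ideal (I n) R \<and> I (Suc n) \<subseteq> I n) \<longrightarrow>
     (\<exists>n. \<forall>m\<ge>n. I m = I n))"

definition artinian_ring :: "('r, 'k) ring_scheme \<Rightarrow> bool" where
  "artinian_ring R \<longleftrightarrow> right_artinian R \<and> right_artinian (opp_ring R)"

definition prime_ring :: "('r, 'k) ring_scheme \<Rightarrow> bool" where
  "prime_ring R \<longleftrightarrow> \<one>\<^bsub>R\<^esub> \<noteq> \<zero>\<^bsub>R\<^esub> \<and>
     (\<forall>I J. ideal I R \<and> ideal J R \<and> (\<forall>a\<in>I. \<forall>b\<in>J. a \<otimes>\<^bsub>R\<^esub> b = \<zero>\<^bsub>R\<^esub>) \<longrightarrow>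
        I = {\<zero>\<^bsub>R\<^esub>} \<or> J = {\<zero>\<^bsub>R\<^esub>})"

definition hnp_ring :: "('r, 'k) ring_scheme \<Rightarrow> bool" where
  "hnp_ring R \<longleftrightarrow> ring R \<and> prime_ring R \<and>
     right_hereditary R \<and> right_hereditary (opp_ring R) \<and>
     right_noetherian R \<and> right_noetherian (opp_ring R)"

definition non_zero_divisor :: "('r, 'k) ring_scheme \<Rightarrow> 'r \<Rightarrow> bool" where
  "non_zero_divisor R c \<longleftrightarrow> c \<in> carrier R \<and>
     (\<forall>x\<in>carrier R. c \<otimes>\<^bsub>R\<^esub> x = \<zero>\<^bsub>R\<^esub> \<or> x \<otimes>\<^bsub>R\<^esub> c = \<zero>\<^bsub>R\<^esub> \<longrightarrow> x = \<zero>\<^bsub>R\<^esub>)"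

definition right_R_ideal :: "'r set \<Rightarrow> ('r, 'k) ring_scheme \<Rightarrow> bool" where
  "right_R_ideal I R \<longleftrightarrow> right_ideal I R \<and> (\<exists>c\<in>I. non_zero_divisor R c)"


section \<open>Universes and Morita equivalence\<close>

text \<open>A type \<open>'u\<close> serves as a universe: the small right modules are those of type
  \<open>('r, 'u) module\<close>.  If \<open>'u\<close> is infinite and at least as large as \<open>R\<close>, then every right module of
  cardinality at most \<open>|'u|\<close>, in particular every finitely generated one, is isomorphic to a small
  one.\<close>

definition universe_for :: "'u itself \<Rightarrow> ('r, 'k) ring_scheme \<Rightarrow> bool" where
  "universe_for (_ :: 'u itself) R \<longleftrightarrow>
     infinite (UNIV :: 'u set) \<and> (\<exists>f :: 'r \<Rightarrow> 'u. inj_on f (carrier R))"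

definition mod_functor ::
  "('r, 'k) ring_scheme \<Rightarrow> ('s, 'l) ring_scheme \<Rightarrow> (('r, 'u) module \<Rightarrow> ('s, 'v) module) \<Rightarrow>
   (('r, 'u) module \<Rightarrow> ('r, 'u) module \<Rightarrow> ('u \<Rightarrow> 'u) \<Rightarrow> ('v \<Rightarrow> 'v)) \<Rightarrow> bool" where
  "mod_functor R S Fo Fm \<longleftrightarrow>
     (\<forall>M. right_module R M \<longrightarrow> right_module S (Fo M)) \<and>
     (\<forall>M N f. right_module R M \<and> right_module R N \<and> f \<in> rhom R M N \<longrightarrow>
        Fm M N f \<in> rhom S (Fo M) (Fo N)) \<and>
     (\<forall>M. right_module R M \<longrightarrow> Fm M M (\<lambda>x\<in>carrier M. x) = (\<lambda>x\<in>carrier (Fo M). x)) \<and>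
     (\<forall>L M N f g. right_module R L \<and> right_module R M \<and> right_module R N \<and>
        f \<in> rhom R L M \<and> g \<in> rhom R M N \<longrightarrow>
        Fm L N (compose (carrier L) g f) = compose (carrier (Fo L)) (Fm M N g) (Fm L M f))"

definition nat_iso_id ::
  "('r, 'k) ring_scheme \<Rightarrow> (('r, 'u) module \<Rightarrow> ('r, 'u) module) \<Rightarrow>
   (('r, 'u) module \<Rightarrow> ('r, 'u) module \<Rightarrow> ('u \<Rightarrow> 'u) \<Rightarrow> ('u \<Rightarrow> 'u)) \<Rightarrow> bool" where
  "nat_iso_id R Ho Hm \<longleftrightarrow> (\<exists>\<eta>.
     (\<forall>M. right_module R M \<longrightarrow> \<eta> M \<in> riso R M (Ho M)) \<and>
     (\<forall>M N f. right_module R M \<and> right_module R N \<and> f \<in> rhom R M N \<longrightarrow>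
        compose (carrier M) (Hm M N f) (\<eta> M) = compose (carrier M) (\<eta> N) f))"

text \<open>Equivalence of the categories of small right modules.  For a sufficiently large universe
  this is Morita equivalence of \<open>R\<close> and \<open>S\<close>: an equivalence between the categories of all modules
  restricts to the modules of cardinality at most \<open>|'u|\<close>, and conversely an equivalence of the
  latter maps \<open>R\<close> to a finitely generated projective generator with endomorphism ring \<open>R\<close>.\<close>

definition morita_equivalent ::
  "'u itself \<Rightarrow> ('r, 'k) ring_scheme \<Rightarrow> ('s, 'l) ring_scheme \<Rightarrow> bool" where
  "morita_equivalent (_ :: 'u itself) R S \<longleftrightarrow>
     (\<exists>(Fo :: ('r, 'u) module \<Rightarrow> ('s, 'u) module) Fm
       (Go :: ('s, 'u) module \<Rightarrow> ('r, 'u) module) Gm.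
        mod_functor R S Fo Fm \<and> mod_functor S R Go Gm \<and>
        nat_iso_id R (\<lambda>M. Go (Fo M)) (\<lambda>M N f. Gm (Fo M) (Fo N) (Fm M N f)) \<and>
        nat_iso_id S (\<lambda>M. Fo (Go M)) (\<lambda>M N f. Fm (Go M) (Go N) (Gm M N f)))"


section \<open>Grothendieck groups\<close>

text \<open>The isomorphism class of a module within the universe \<open>'u\<close>; \<open>M\<close> itself may be carried by
  another type, as in the case of a right ideal or of a quotient.\<close>

definition iso_class :: "('r, 'k) ring_scheme \<Rightarrow> ('r, 'm) module \<Rightarrow> ('r, 'u) module set" where
  "iso_class R M = {N. right_module R N \<and> riso R M N \<noteq> {}}"

type_synonym ('r, 'u) groth_elem = "(('r, 'u) module set \<Rightarrow>\<^sub>0 int) set"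

text \<open>The Grothendieck group of a class \<open>C\<close> of modules: the free abelian group on the isomorphism
  classes modulo \<open>[M] = [L] + [N]\<close> for each short exact sequence \<open>0 \<rightarrow> L \<rightarrow> M \<rightarrow> N \<rightarrow> 0\<close> in \<open>C\<close>.\<close>

definition groth_free ::
  "('r, 'k) ring_scheme \<Rightarrow> ('r, 'u) module set \<Rightarrow> (('r, 'u) module set \<Rightarrow>\<^sub>0 int) monoid" where
  "groth_free R C = free_Abelian_group (iso_class R ` C)"

definition groth_rel ::
  "('r, 'k) ring_scheme \<Rightarrow> ('r, 'u) module set \<Rightarrow> ('r, 'u) groth_elem" where
  "groth_rel R C = generate (groth_free R C)
     {frag_of (iso_class R M) - frag_of (iso_class R L) - frag_of (iso_class R N) | L M N.
        L \<in> C \<and> M \<in> C \<and> N \<in> C \<and> (\<exists>f g. short_exact R L M N f g)}"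

definition groth :: "('r, 'k) ring_scheme \<Rightarrow> ('r, 'u) module set \<Rightarrow> ('r, 'u) groth_elem monoid" where
  "groth R C = groth_free R C Mod groth_rel R C"

definition groth_class ::
  "('r, 'k) ring_scheme \<Rightarrow> ('r, 'u) module set \<Rightarrow> ('r, 'u) module set \<Rightarrow> ('r, 'u) groth_elem" where
  "groth_class R C c = groth_rel R C #>\<^bsub>groth_free R C\<^esub> frag_of c"

definition fgproj_modules :: "('r, 'k) ring_scheme \<Rightarrow> ('r, 'u) module set" where
  "fgproj_modules R = {P. right_module R P \<and> fin_gen R P \<and> proj_module R P}"

definition fl_modules :: "('r, 'k) ring_scheme \<Rightarrow> ('r, 'u) module set" where
  "fl_modules R = {M. finite_length R M}"

definition K0 :: "('r, 'k) ring_scheme \<Rightarrow> ('r, 'u) groth_elem monoid" where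
  "K0 R = groth R (fgproj_modules R)"

definition K0_class :: "('r, 'k) ring_scheme \<Rightarrow> ('r, 'm) module \<Rightarrow> ('r, 'u) groth_elem" where
  "K0_class R P = groth_class R (fgproj_modules R) (iso_class R P)"


section \<open>Genus and ideal class group\<close>

definition mod_mult_ideal :: "('r, 'm) module \<Rightarrow> 'r set \<Rightarrow> 'm set" where
  "mod_mult_ideal P J = generate (add_monoid P) {a \<odot>\<^bsub>P\<^esub> x | a x. a \<in> J \<and> x \<in> carrier P}"

definition rho :: "('r, 'k) ring_scheme \<Rightarrow> ('r, 'm) module \<Rightarrow> ('r, 'n) module \<Rightarrow> nat" where
  "rho R P W = (if carrier W = {\<zero>\<^bsub>W\<^esub>} then udim R P
     else mod_length R (quot_module P (mod_mult_ideal P (ann R W))))"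

definition modspec :: "('r, 'k) ring_scheme \<Rightarrow> ('r, 'u) module set" where
  "modspec R = (\<lambda>c. SOME W. W \<in> c) `
     (iso_class R ` {W :: ('r, 'u) module. unfaithful_simple R W \<or> zero_module R W})"

definition genus :: "('r, 'k) ring_scheme \<Rightarrow> ('r, 'm) module \<Rightarrow> (('r, 'u) module \<Rightarrow> int)" where
  "genus R P = (\<lambda>W\<in>modspec R. int (rho R P W))"

definition genus_group :: "('r, 'k) ring_scheme \<Rightarrow> (('r, 'u) module \<Rightarrow> int) monoid" where
  "genus_group R = product_group (modspec R) (\<lambda>_. integer_group)"

definition genus_plus ::
  "('r, 'k) ring_scheme \<Rightarrow> ('r, 'u) groth_elem \<Rightarrow> (('r, 'u) module \<Rightarrow> int)" where
  "genus_plus R = (THE h. h \<in> extensional (carrier (K0 R)) \<and> h \<in> hom (K0 R) (genus_group R) \<and>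
     (\<forall>P \<in> (fgproj_modules R :: ('r, 'u) module set). h (K0_class R P) = genus R P))"

definition class_group :: "('r, 'k) ring_scheme \<Rightarrow> ('r, 'u) groth_elem monoid" where
  "class_group R = (K0 R)\<lparr>carrier := kernel (K0 R) (genus_group R) (genus_plus R)\<rparr>"


section \<open>Extensions and towers\<close>

definition free_on :: "('r, 'k) ring_scheme \<Rightarrow> ('r, 'm) module \<Rightarrow> ('r, 'm \<Rightarrow> 'r) module" where
  "free_on R V = \<lparr>carrier = {a. (\<forall>v. a v \<in> carrier R) \<and> (\<forall>v. v \<notin> carrier V \<longrightarrow> a v = \<zero>\<^bsub>R\<^esub>) \<and>
       finite {v. a v \<noteq> \<zero>\<^bsub>R\<^esub>}},
     mult = (\<lambda>a b v. \<zero>\<^bsub>R\<^esub>), one = (\<lambda>v. \<zero>\<^bsub>R\<^esub>), ring.zero = (\<lambda>v. \<zero>\<^bsub>R\<^esub>),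
     add = (\<lambda>a b v. a v \<oplus>\<^bsub>R\<^esub> b v), smult = (\<lambda>r a v. a v \<otimes>\<^bsub>R\<^esub> r)\<rparr>"

definition free_eval :: "('r, 'k) ring_scheme \<Rightarrow> ('r, 'm) module \<Rightarrow> ('m \<Rightarrow> 'r) \<Rightarrow> 'm" where
  "free_eval R V a = finsum V (\<lambda>v. a v \<odot>\<^bsub>V\<^esub> v) {v. a v \<noteq> \<zero>\<^bsub>R\<^esub>}"

definition free_ker :: "('r, 'k) ring_scheme \<Rightarrow> ('r, 'm) module \<Rightarrow> ('m \<Rightarrow> 'r) set" where
  "free_ker R V = {a \<in> carrier (free_on R V). free_eval R V a = \<zero>\<^bsub>V\<^esub>}"

definition hom_group ::
  "('r, 'k) ring_scheme \<Rightarrow> ('r, 'm) module \<Rightarrow> ('r, 'n) module \<Rightarrow> ('m \<Rightarrow> 'n) monoid" where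
  "hom_group R M N = \<lparr>carrier = rhom R M N, mult = (\<lambda>f g. \<lambda>x\<in>carrier M. f x \<oplus>\<^bsub>N\<^esub> g x),
     one = (\<lambda>x\<in>carrier M. \<zero>\<^bsub>N\<^esub>)\<rparr>"

text \<open>Let \<open>0 \<rightarrow> K \<rightarrow> F \<rightarrow> V \<rightarrow> 0\<close> be the canonical presentation of \<open>V\<close>, with \<open>F\<close> free on the set
  \<open>carrier V\<close> and \<open>F \<rightarrow> V\<close> sending \<open>(a\<^sub>v)\<close> to \<open>\<Sum> v a\<^sub>v\<close>.  As \<open>F\<close> is projective,
  \<open>Ext\<^sup>1(V, W)\<close> is the cokernel of the restriction map \<open>Hom(F, W) \<rightarrow> Hom(K, W)\<close>.\<close>

definition Ext1 ::
  "('r, 'k) ring_scheme \<Rightarrow> ('r, 'm) module \<Rightarrow> ('r, 'n) module \<Rightarrow> (('m \<Rightarrow> 'r) \<Rightarrow> 'n) set monoid" where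
  "Ext1 R V W = hom_group R (sub_mod (free_on R V) (free_ker R V)) W Mod
     ((\<lambda>h. restrict h (free_ker R V)) ` rhom R (free_on R V) W)"

definition successor :: "('r, 'k) ring_scheme \<Rightarrow> ('r, 'm) module \<Rightarrow> ('r, 'n) module \<Rightarrow> bool" where
  "successor R V W \<longleftrightarrow> simple_module R V \<and> simple_module R W \<and>
     carrier (Ext1 R V W) \<noteq> {\<one>\<^bsub>Ext1 R V W\<^esub>}"

definition unique_unfaithful_successor ::
  "('r, 'k) ring_scheme \<Rightarrow> ('r, 'u) module \<Rightarrow> ('r, 'u) module \<Rightarrow> bool" where
  "unique_unfaithful_successor R V W \<longleftrightarrow> successor R V W \<and> unfaithful_simple R W \<and>
     (\<forall>W' :: ('r, 'u) module. successor R V W' \<and> unfaithful_simple R W' \<longrightarrow> riso R W W' \<noteq> {})"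

definition successor_chain :: "('r, 'k) ring_scheme \<Rightarrow> ('r, 'u) module set list \<Rightarrow> bool" where
  "successor_chain R cs \<longleftrightarrow> cs \<noteq> [] \<and> distinct cs \<and>
     set cs \<subseteq> iso_class R ` {W :: ('r, 'u) module. simple_module R W} \<and>
     (\<forall>i. Suc i < length cs \<longrightarrow>
        (\<exists>V\<in>cs ! i. \<exists>W\<in>cs ! Suc i. unique_unfaithful_successor R V W))"

text \<open>Cycle towers occur once for each of their cyclic permutations; only the underlying set of
  isomorphism classes is used below.\<close>

definition tower :: "('r, 'k) ring_scheme \<Rightarrow> ('r, 'u) module set list \<Rightarrow> bool" where
  "tower R cs \<longleftrightarrow> successor_chain R cs \<and>
     (\<forall>ds. successor_chain R ds \<and> sublist cs ds \<longrightarrow> ds = cs)"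

definition fl_class :: "('r, 'k) ring_scheme \<Rightarrow> ('r, 'm) module \<Rightarrow> ('r, 'u) groth_elem" where
  "fl_class R M = groth_class R (fl_modules R) (iso_class R M)"

definition tower_class :: "('r, 'k) ring_scheme \<Rightarrow> ('r, 'u) module set list \<Rightarrow> ('r, 'u) groth_elem" where
  "tower_class R T =
     finprod (groth R (fl_modules R)) (groth_class R (fl_modules R)) (set T)"

definition tower_maximal :: "'u itself \<Rightarrow> ('r, 'k) ring_scheme \<Rightarrow> 'r set \<Rightarrow> bool" where
  "tower_maximal (_ :: 'u itself) R I \<longleftrightarrow> right_R_ideal I R \<and>
     finite_length R (quot_module (reg_module R) I) \<and>
     (\<exists>T :: ('r, 'u) module set list. tower R T \<and>
        fl_class R (quot_module (reg_module R) I) = tower_class R T)"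

text \<open>The difference \<open>[I] - [R]\<close>, in the multiplicative notation of the group record \<open>K0 R\<close>.\<close>

definition G_max :: "('r, 'k) ring_scheme \<Rightarrow> ('r, 'u) groth_elem set" where
  "G_max R = {K0_class R (sub_mod (reg_module R) I) \<otimes>\<^bsub>K0 R\<^esub> inv\<^bsub>K0 R\<^esub> K0_class R (reg_module R) | I.
     tower_maximal TYPE('u) R I}"

end

theory Submission
  imports Defs
begin

text \<open>An equivalence of module categories preserves submodule lattices, hence simple modules, lengths and
uniform dimensions, and it preserves extendability of homomorphisms along a projective presentation, which
detects successors.  So it maps towers to towers.  As \<open>P ann(W)\<close> is the common kernel of all
homomorphisms \<open>P \<rightarrow> W\<close>, the genus is categorical as well, and the induced isomorphism of \<open>K\<^sub>0\<close>
restricts to the ideal class groups.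

By Schanuel's lemma, \<open>[P] - [Q]\<close> for a projective presentation \<open>0 \<rightarrow> Q \<rightarrow> P \<rightarrow> M \<rightarrow> 0\<close> depends only on
the class of \<open>M\<close> in the Grothendieck group of finite length modules.  Hence \<open>[I] - [R]\<close> is determined by
the tower of \<open>R/I\<close>.  Every tower occurs: the product of its simple modules is cyclic, say \<open>R/I\<close>; as \<open>R\<close>
has no minimal right ideal unless it is Artinian, \<open>I\<close> is essential, and by Goldie's argument it
contains a non-zero-divisor.\<close>

text \<open>An equivalence need not send R to S, so a right ideal of R is not carried to a right
  ideal of S, and the elements of \<open>G_max\<close> cannot be transported ideal by ideal. This is
  the obstacle behind the detour through Euler characteristics: they leave only the simple classes
  of a tower, and ideals are produced afresh over the other ring.

  Additivity of the genus presupposes that P / P ann(W) has finite length. This rests on the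
  descending chain condition for right ideals above a nonzero ideal, the one place where conditions
  on left and right ideals are combined through duality.

  Functors act only on modules carried by the universe type, while right ideals, free modules,
  kernels and quotients live on other types. Finitely generated projectivity is therefore restated
  by dual bases, which mention no test modules, and modules are copied into the universe when
  needed. Length and rank are developed for modular lattices of sets, because the functor relates
  submodules only through their inclusions.\<close>

abbreviation nul :: "('a, 'b) ring_scheme => 'a set" where
 "nul G \<equiv> {\<zero>\<^bsub>G\<^esub>}"

section \<open>Chain conditions, Jordan-Hoelder and Goldie dimension in modular lattices\<close>

section \<open>Modular lattices of sets\<close>

definition covers :: "'a set set => 'a set => 'a set => bool" where
 "covers L A B \<longleftrightarrow> A \<in> L \<and> B \<in> L \<and> A \<subset> B \<and> (\<forall>X\<in>L. A <= X \<and> X <= B --> X = A \<or> X = B)"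

definition uniform_in :: "'a set set => 'a set => 'a set => bool" where
 "uniform_in L z U \<longleftrightarrow> U \<in> L \<and> U ~= z \<and>
  (\<forall>A\<in>L. \<forall>B\<in>L. A <= U \<and> B <= U \<and> A ~= z \<and> B ~= z --> A \<inter> B ~= z)"

definition essential_in :: "'a set set => 'a set => 'a set => 'a set => bool" where
 "essential_in L z E T \<longleftrightarrow> E \<in> L \<and> T \<in> L \<and> E <= T \<and> (\<forall>A\<in>L. A <= T \<and> A ~= z --> A \<inter> E ~= z)"

text \<open>Internal direct sums of \<open>n\<close> uniform elements, with \<open>sp\<close> as the
  join. Summands are added one at a time, so that independence is one disjointness condition per
  step and exchange arguments become inductions.\<close>

inductive uniform_sum :: "'a set set => ('a set => 'a set => 'a set) => 'a set => nat => 'a set => bool"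
 for L sp z where
 uniform_sum_0: "uniform_sum L sp z 0 z"
| uniform_sum_Suc: "[|uniform_sum L sp z n X; uniform_in L z U; X \<inter> U = z|]
  ==> uniform_sum L sp z (Suc n) (sp X U)"

definition acc_between :: "'a set set => 'a set => 'a set => bool" where
 "acc_between L A B \<longleftrightarrow> (\<forall>f :: nat => 'a set. (\<forall>n. f n \<in> L \<and> A <= f n \<and> f n <= B \<and> f n <= f (Suc n)) -->
  (\<exists>n. \<forall>m\<ge>n. f m = f n))"

definition dcc_between :: "'a set set => 'a set => 'a set => bool" where
 "dcc_between L A B \<longleftrightarrow> (\<forall>f :: nat => 'a set. (\<forall>n. f n \<in> L \<and> A <= f n \<and> f n <= B \<and> f (Suc n) <= f n) -->
  (\<exists>n. \<forall>m\<ge>n. f m = f n))"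

lemma acc_between_maximal:
 assumes acc: "acc_between L A B" and X: "X \<in> L" "A <= X" "X <= B" "P X"
 shows "\<exists>Y. Y \<in> L \<and> A <= Y \<and> Y <= B \<and> P Y \<and> (\<forall>Z. Z \<in> L --> Z <= B --> P Z --> Y <= Z --> Z = Y)"
proof (rule ccontr)
 assume neg: "\<not> ?thesis"
 let ?Q = "\<lambda>Y. Y \<in> L \<and> A <= Y \<and> Y <= B \<and> P Y"
 have "\<exists>Z. ?Q Z \<and> Y \<subset> Z" if Y: "?Q Y" for Y
 proof -
  obtain Z where "Z \<in> L" "Z <= B" "P Z" "Y <= Z" "Z ~= Y"
   using neg[unfolded not_ex, THEN spec[of _ Y]] Y by auto
  then show ?thesis using Y by blast
 qed
 then obtain g where g: "!!Y. ?Q Y ==> ?Q (g Y) \<and> Y \<subset> g Y"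
  by metis
 define f where "f n = (g ^^ n) X" for n
 have Q: "?Q (f n)" for n
  by (induction n) (use X g in "auto simp: f_def")
 have st: "f n \<subset> f (Suc n)" for n
  using g[OF Q[of n]] by (simp add: f_def)
 then obtain n where "\<forall>m\<ge>n. f m = f n"
  using acc Q unfolding acc_between_def by (metis psubset_imp_subset)
 then have "f (Suc n) = f n"
  using le_SucI by blast
 then show False
  using st by blast
qed

lemma dcc_between_minimal:
 assumes dcc: "dcc_between L A B" and X: "X \<in> L" "A <= X" "X <= B" "P X"
 shows "\<exists>Y. Y \<in> L \<and> A <= Y \<and> Y <= B \<and> P Y \<and> (\<forall>Z. Z \<in> L --> A <= Z --> P Z --> Z <= Y --> Z = Y)"
proof (rule ccontr)
 assume neg: "\<not> ?thesis"
 let ?Q = "\<lambda>Y. Y \<in> L \<and> A <= Y \<and> Y <= B \<and> P Y"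
 have "\<exists>Z. ?Q Z \<and> Z \<subset> Y" if Y: "?Q Y" for Y
 proof -
  obtain Z where "Z \<in> L" "A <= Z" "P Z" "Z <= Y" "Z ~= Y"
   using neg[unfolded not_ex, THEN spec[of _ Y]] Y by auto
  then show ?thesis using Y by blast
 qed
 then obtain g where g: "!!Y. ?Q Y ==> ?Q (g Y) \<and> g Y \<subset> Y"
  by metis
 define f where "f n = (g ^^ n) X" for n
 have Q: "?Q (f n)" for n
  by (induction n) (use X g in "auto simp: f_def")
 have st: "f (Suc n) \<subset> f n" for n
  using g[OF Q[of n]] by (simp add: f_def)
 then obtain n where "\<forall>m\<ge>n. f m = f n"
  using dcc Q unfolding dcc_between_def by (metis psubset_imp_subset)
 then have "f (Suc n) = f n"
  using le_SucI by blast
 then show False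
  using st by blast
qed

text \<open>Along a chain only comparable elements are compared, so injectivity of \<open>h\<close>
  on comparable pairs is enough to pull stabilisation back.\<close>

lemma acc_between_strict_embed:
 assumes acc: "acc_between L' A' B'"
  and h: "!!X. [|X \<in> L; A <= X; X <= B|] ==> h X \<in> L' \<and> A' <= h X \<and> h X <= B'"
  and mono: "!!X Y. [|X \<in> L; Y \<in> L; A <= X; X <= Y; Y <= B|] ==> h X <= h Y"
  and strict: "!!X Y. [|X \<in> L; Y \<in> L; A <= X; X <= Y; Y <= B; h X = h Y|] ==> X = Y"
 shows "acc_between L A B"
 unfolding acc_between_def
proof (intro allI impI)
 fix f :: "nat => 'b set" assume f: "\<forall>n. f n \<in> L \<and> A <= f n \<and> f n <= B \<and> f n <= f (Suc n)"
 have "\<forall>n. h (f n) \<in> L' \<and> A' <= h (f n) \<and> h (f n) <= B' \<and> h (f n) <= h (f (Suc n))"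
  using f h mono by meson
 then obtain n where n: "\<forall>m\<ge>n. h (f m) = h (f n)"
  using acc unfolding acc_between_def by (elim allE[of _ "\<lambda>n. h (f n)"]) auto
 have "f n <= f m" if "m \<ge> n" for m
  using f lift_Suc_mono_le[of f n m] that by blast
 then show "\<exists>n. \<forall>m\<ge>n. f m = f n"
  using f n strict by metis
qed

lemma dcc_between_strict_embed:
 assumes dcc: "dcc_between L' A' B'"
  and h: "!!X. [|X \<in> L; A <= X; X <= B|] ==> h X \<in> L' \<and> A' <= h X \<and> h X <= B'"
  and mono: "!!X Y. [|X \<in> L; Y \<in> L; A <= X; X <= Y; Y <= B|] ==> h X <= h Y"
  and strict: "!!X Y. [|X \<in> L; Y \<in> L; A <= X; X <= Y; Y <= B; h X = h Y|] ==> X = Y"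
 shows "dcc_between L A B"
 unfolding dcc_between_def
proof (intro allI impI)
 fix f :: "nat => 'b set" assume f: "\<forall>n. f n \<in> L \<and> A <= f n \<and> f n <= B \<and> f (Suc n) <= f n"
 have "\<forall>n. h (f n) \<in> L' \<and> A' <= h (f n) \<and> h (f n) <= B' \<and> h (f (Suc n)) <= h (f n)"
  using f h mono by meson
 then obtain n where n: "\<forall>m\<ge>n. h (f m) = h (f n)"
  using dcc unfolding dcc_between_def by (elim allE[of _ "\<lambda>n. h (f n)"]) auto
 have "f m <= f n" if "m \<ge> n" for m
  using f lift_Suc_antimono_le[of f n m] that by blast
 then show "\<exists>n. \<forall>m\<ge>n. f m = f n"
  using f n strict by metis
qed

text \<open>Take an element of the interval that is maximal among those reached from
  \<open>A\<close> by finitely many covering steps. If it is not \<open>B\<close>, an element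
  minimal strictly above it, supplied by the descending condition, gives one more step.\<close>

lemma finite_length_between:
 assumes acc: "acc_between L A B" and dcc: "dcc_between L A B" and L: "A \<in> L" "B \<in> L" "A <= B"
 shows "\<exists>n. (covers L ^^ n) A B"
proof -
 let ?P = "\<lambda>X. \<exists>n. (covers L ^^ n) A X"
 have "?P A" using relpowp_0_I[of "covers L"] by blast
 from acc_between_maximal[of L A B A ?P, OF acc L(1) order_refl L(3) this]
 obtain Y where Y: "Y \<in> L" "A <= Y" "Y <= B" "?P Y"
  and max: "!!Z. [|Z \<in> L; Z <= B; ?P Z; Y <= Z|] ==> Z = Y"
  by (elim exE conjE) metis
 have "Y = B"
 proof (rule ccontr)
  assume "Y ~= B"
  then have "Y \<subset> B" using Y by auto
  from dcc_between_minimal[of L A B B "\<lambda>X. Y \<subset> X", OF dcc L(2,3) order_refl this]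
  obtain X where X: "X \<in> L" "A <= X" "X <= B" "Y \<subset> X"
   and min: "!!Z. [|Z \<in> L; A <= Z; Y \<subset> Z; Z <= X|] ==> Z = X"
   by (elim exE conjE) metis
  have "covers L Y X"
   unfolding covers_def using Y X min by (metis psubsetI subset_trans)
  then have "\<exists>n. (covers L ^^ n) A X"
   using Y(4) relpowp_Suc_I by metis
  then show False
   using max X by blast
 qed
 then show ?thesis using Y by blast
qed

text \<open>Meets are intersections, but the join \<open>sp\<close> is a parameter because the join
  of two submodules is their sum and not their union. \<open>modular_le\<close> is the half of the
  modular law that is not automatic. No top element is fixed, so upper bounds are named explicitly
  in the results.\<close>

locale modular_sets =
 fixes L :: "'a set set" and sp :: "'a set => 'a set => 'a set" (infixl "|+|" 65) and z :: "'a set"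
 assumes inf_closed [simp]: "[|A \<in> L; B \<in> L|] ==> A \<inter> B \<in> L"
  and sup_closed [simp]: "[|A \<in> L; B \<in> L|] ==> A |+| B \<in> L"
  and sup_upper1: "[|A \<in> L; B \<in> L|] ==> A <= A |+| B"
  and sup_upper2: "[|A \<in> L; B \<in> L|] ==> B <= A |+| B"
  and sup_least: "[|A \<in> L; B \<in> L; C \<in> L; A <= C; B <= C|] ==> A |+| B <= C"
  and modular_le: "[|A \<in> L; B \<in> L; C \<in> L; A <= C|] ==> (A |+| B) \<inter> C <= A |+| (B \<inter> C)"
  and bot_closed [simp]: "z \<in> L"
  and bot_least: "A \<in> L ==> z <= A"
begin

lemma sup_commute: "[|A \<in> L; B \<in> L|] ==> A |+| B = B |+| A"
 by (meson subset_antisym sup_closed sup_least sup_upper1 sup_upper2)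

lemma sup_assoc: "[|A \<in> L; B \<in> L; C \<in> L|] ==> A |+| B |+| C = A |+| (B |+| C)"
 apply (rule subset_antisym)
 apply (intro sup_least sup_closed; (assumption | simp)?)
  apply (simp_all add: sup_upper1)
  apply (meson subset_trans sup_closed sup_upper1 sup_upper2)
 apply (meson subset_trans sup_closed sup_upper2)
 apply (intro sup_least sup_closed; (assumption | simp)?)
  apply (meson subset_trans sup_closed sup_upper1)
 apply (meson subset_trans sup_closed sup_upper1 sup_upper2)
 apply (simp add: sup_upper2)
 done

lemma sup_absorb2: "[|A \<in> L; B \<in> L; A <= B|] ==> A |+| B = B"
 by (meson order_refl subset_antisym sup_least sup_upper2)

lemma sup_absorb1: "[|A \<in> L; B \<in> L; B <= A|] ==> A |+| B = A"
 using sup_absorb2[of B A] sup_commute[of A B] by simp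

lemma sup_mono: "[|A \<in> L; B \<in> L; C \<in> L; D \<in> L; A <= C; B <= D|] ==> A |+| B <= C |+| D"
 by (meson subset_trans sup_closed sup_least sup_upper1 sup_upper2)

lemma modular: "[|A \<in> L; B \<in> L; C \<in> L; A <= C|] ==> (A |+| B) \<inter> C = A |+| (B \<inter> C)"
 apply (rule subset_antisym)
 apply (simp add: modular_le)
 apply (intro sup_least; (assumption | simp)?)
 apply (simp add: sup_upper1)
 by (meson le_infI1 sup_upper2)

lemma eq_bot: "[|A \<in> L; A <= z|] ==> A = z"
 using bot_least by auto

text \<open>By modularity, comparable elements with the same meet and the same join with
  \<open>B\<close> coincide; the meets and the joins of a chain become stationary in the two
  intervals.\<close>

lemma acc_between_trans:
 assumes L: "A \<in> L" "B \<in> L" "C \<in> L" "A <= B" "B <= C" and AB: "acc_between L A B" and BC: "acc_between L B C"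
 shows "acc_between L A C"
 unfolding acc_between_def
proof (intro allI impI)
 fix f :: "nat => 'a set" assume f: "\<forall>n. f n \<in> L \<and> A <= f n \<and> f n <= C \<and> f n <= f (Suc n)"
 have "\<forall>n. f n \<inter> B \<in> L \<and> A <= f n \<inter> B \<and> f n \<inter> B <= B \<and> f n \<inter> B <= f (Suc n) \<inter> B"
  using f L by (auto dest: subsetD)
 then obtain n where n: "\<forall>m\<ge>n. f m \<inter> B = f n \<inter> B"
  using AB unfolding acc_between_def by (elim allE[of _ "\<lambda>n. f n \<inter> B"]) auto
 have "\<forall>n. B |+| f n \<in> L \<and> B <= B |+| f n \<and> B |+| f n <= C \<and> B |+| f n <= B |+| f (Suc n)"
  using f L by (meson order_refl sup_closed sup_least sup_mono sup_upper1)
 then obtain k where k: "\<forall>m\<ge>k. B |+| f m = B |+| f k"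
  using BC unfolding acc_between_def by (elim allE[of _ "\<lambda>n. B |+| f n"]) auto
 have "f m = f (max n k)" if "m \<ge> max n k" for m
 proof -
  let ?a = "f (max n k)"
  have sub: "?a <= f m"
   using f lift_Suc_mono_le[of f "max n k" m] that by blast
  have "f m = (?a |+| B) \<inter> f m"
  proof -
   have "f m <= B |+| f m" using f L sup_upper2 by simp
   also have "\<dots> = ?a |+| B"
    using k that f L sup_commute by (metis max.boundedE max.cobounded2)
   finally show ?thesis by auto
  qed
  also have "\<dots> = ?a |+| (B \<inter> f m)"
   using modular f L sub by simp
  also have "B \<inter> f m = B \<inter> ?a"
   using n that by (metis inf_commute max.boundedE max.cobounded1)
  also have "?a |+| (B \<inter> ?a) = ?a"
   using f L sup_absorb1 by simp
  finally show ?thesis .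
 qed
 then show "\<exists>n. \<forall>m\<ge>n. f m = f n" by blast
qed

subsection \<open>Length\<close>

text \<open>An element \<open>X\<close> between the two joins equals
  \<open>C |+| (B \<inter> X)\<close> by modularity, and \<open>B \<inter> X\<close> lies between
  \<open>A\<close> and \<open>B\<close>, which leaves two possibilities.\<close>

lemma covers_sup:
 assumes "covers L A B" "C \<in> L"
 shows "A |+| C = B |+| C \<or> covers L (A |+| C) (B |+| C)"
proof (rule disjCI)
 assume nc: "\<not> covers L (A |+| C) (B |+| C)"
 have L: "A \<in> L" "B \<in> L" "A \<subset> B" and cov: "!!X. [|X \<in> L; A <= X; X <= B|] ==> X = A \<or> X = B"
  using assms by (auto simp: covers_def)
 show "A |+| C = B |+| C"
 proof (rule ccontr)
  assume ne: "A |+| C ~= B |+| C"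
  have "X = A |+| C \<or> X = B |+| C" if X: "X \<in> L" "A |+| C <= X" "X <= B |+| C" for X
  proof -
   have CX: "C <= X" "A <= X" using X L assms sup_upper1 sup_upper2 by (meson subset_trans)+
   have XX: "X = C |+| (B \<inter> X)"
    using modular[of C B X] X CX L assms sup_commute[of B C] by auto
   have "B \<inter> X = A \<or> B \<inter> X = B"
    using cov[of "B \<inter> X"] X CX L by auto
   then show ?thesis
    using XX sup_commute assms L by metis
  qed
  then have "covers L (A |+| C) (B |+| C)"
   unfolding covers_def using L assms ne sup_mono[of A C B C] by auto
  then show False using nc by simp
 qed
qed

lemma covers_chain_mem: "(covers L ^^ n) A B ==> A \<in> L ==> B \<in> L \<and> A <= B"
proof (induction n arbitrary: B)
 case (Suc n)
 then obtain X where "(covers L ^^ n) A X" "covers L X B" by auto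
 then show ?case using Suc by (fastforce simp: covers_def)
qed simp

lemma covers_chain_sup:
 "[|(covers L ^^ n) A B; A \<in> L; C \<in> L|] ==> \<exists>k\<le>n. (covers L ^^ k) (A |+| C) (B |+| C)"
proof (induction n arbitrary: B)
 case 0
 then show ?case by auto
next
 case (Suc n)
 then obtain X where X: "(covers L ^^ n) A X" "covers L X B" by auto
 obtain k where k: "k \<le> n" "(covers L ^^ k) (A |+| C) (X |+| C)"
  using Suc X by blast
 from covers_sup[OF X(2) Suc.prems(3)] show ?case
 proof
  assume "X |+| C = B |+| C"
  then show ?thesis using k by (metis le_SucI)
 next
  assume "covers L (X |+| C) (B |+| C)"
  then have "(covers L ^^ Suc k) (A |+| C) (B |+| C)" using k by auto
  then show ?thesis using k by (metis Suc_le_mono)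
 qed
qed

lemma covers_chain_upper:
 "[|(covers L ^^ n) A B; A \<in> L; C \<in> L; A <= C; C <= B|] ==> \<exists>k\<le>n. (covers L ^^ k) C B"
 using covers_chain_sup[of n A B C] covers_chain_mem[of n A B] sup_absorb1 sup_absorb2 by metis

text \<open>Jordan-Hoelder. If the chains start with different covers \<open>X\<close> and
  \<open>Y\<close> of \<open>A\<close>, both are covered by \<open>X |+| Y\<close>, and some chain
  leads from this join to \<open>B\<close>. Prefixing it by \<open>X\<close> and by \<open>Y\<close>
  lets the induction hypothesis compare it with both given chains.\<close>

theorem covers_chain_unique:
 "[|(covers L ^^ n) A B; (covers L ^^ m) A B; A \<in> L|] ==> n = m"
proof (induction n arbitrary: A m)
 case 0
 then have "A = B" by simp
 then show ?case
 proof (cases m)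
  case (Suc k)
  then obtain X where "covers L A X" "(covers L ^^ k) X B" using 0 relpowp_Suc_D2 by metis
  then have "A \<subset> X" "X <= B" using covers_chain_mem by (auto simp: covers_def)
  then show ?thesis using \<open>A = B\<close> by auto
 qed simp
next
 case (Suc n)
 obtain X where X: "covers L A X" "(covers L ^^ n) X B" using Suc.prems relpowp_Suc_D2 by metis
 have XL: "X \<in> L" "A \<subset> X" "X <= B" using X covers_chain_mem by (auto simp: covers_def)
 have "m ~= 0"
  using Suc.prems XL by (cases m) auto
 then obtain k where m: "m = Suc k" using not0_implies_Suc by blast
 obtain Y where Y: "covers L A Y" "(covers L ^^ k) Y B" using Suc.prems m relpowp_Suc_D2 by metis
 have YL: "Y \<in> L" "A \<subset> Y" "Y <= B" using Y covers_chain_mem by (auto simp: covers_def)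
 show ?case
 proof (cases "X = Y")
  case True
  then show ?thesis using Suc.IH X Y XL m by auto
 next
  case False
  let ?Z = "X |+| Y"
  have nXY: "\<not> Y <= X" "\<not> X <= Y"
   using X(1) Y(1) False by (auto simp: covers_def)
  have A: "A |+| Y = Y" "A |+| X = X" "Y |+| X = ?Z"
   using sup_absorb2 sup_commute Suc.prems XL YL by auto
  have "X ~= ?Z" "Y ~= ?Z"
   using nXY sup_upper1[of X Y] sup_upper2[of X Y] XL YL by auto
  then have c: "covers L X ?Z" "covers L Y ?Z"
   using covers_sup[OF X(1) YL(1)] covers_sup[OF Y(1) XL(1)] A by auto
  obtain j where j: "(covers L ^^ j) ?Z B"
   using covers_chain_upper[OF X(2), of ?Z] XL YL sup_upper1[of X Y] sup_least[of X Y B] covers_chain_mem[OF X(2)] sup_closed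
   by meson
  have "(covers L ^^ Suc j) X B" "(covers L ^^ Suc j) Y B"
   using c j by (blast intro: relpowp_Suc_I2)+
  then have "n = Suc j" "(covers L ^^ n) Y B"
   using Suc.IH[OF X(2), of "Suc j"] XL by auto
  then have "n = k"
   using Suc.IH[of Y k] Y YL by auto
  then show ?thesis using m by simp
 qed
qed

text \<open>The second isomorphism theorem. Joining with \<open>B\<close> may collapse covering
  steps in general, but here \<open>(X |+| B) \<inter> A = X\<close>, so no step is lost and the
  length stays exactly \<open>n\<close>.\<close>

lemma covers_chain_diamond:
 assumes AB: "A \<in> L" "B \<in> L"
 shows "(covers L ^^ n) (A \<inter> B) X ==> X <= A ==> (covers L ^^ n) B (X |+| B)"
proof (induction n arbitrary: X)
 case 0
 then show ?case using AB sup_absorb2[of "A \<inter> B" B] by auto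
next
 case (Suc n)
 then obtain Y where Y: "(covers L ^^ n) (A \<inter> B) Y" "covers L Y X" by auto
 have YL: "Y \<in> L" "X \<in> L" "Y \<subset> X" "A \<inter> B <= Y" using Y covers_chain_mem[OF Y(1)] AB by (auto simp: covers_def)
 have 1: "(covers L ^^ n) B (Y |+| B)" using Suc Y YL by auto
 have "(Y |+| B) \<inter> A = Y" "(X |+| B) \<inter> A = X"
  using modular[of Y B A] modular[of X B A] YL AB Suc.prems sup_absorb1[of Y "B \<inter> A"] sup_absorb1[of X "B \<inter> A"]
  by (auto simp: Int_commute)
 then have "Y |+| B ~= X |+| B" using YL(3) by (metis less_irrefl)
 then have "covers L (Y |+| B) (X |+| B)"
  using covers_sup[OF Y(2) AB(2)] by auto
 then show ?case using 1 by auto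
qed

subsection \<open>Uniform dimension\<close>

lemma indep_assoc:
 assumes "A \<in> L" "B \<in> L" "C \<in> L" "A \<inter> B = z" "(A |+| B) \<inter> C = z"
 shows "A \<inter> (B |+| C) = z"
proof -
 have "A \<inter> (B |+| C) <= (A |+| B) \<inter> (B |+| C)"
  using sup_upper1 assms by blast
 also have "\<dots> = B |+| (C \<inter> (A |+| B))"
  using modular[of B C "A |+| B"] assms sup_upper2 by (simp add: Int_commute)
 also have "\<dots> = B"
  using assms sup_absorb1[of B z] bot_least by (simp add: Int_commute)
 finally have "A \<inter> (B |+| C) <= z" using assms by blast
 then show ?thesis using eq_bot assms by simp
qed

lemma indep_assoc':
 assumes "A \<in> L" "B \<in> L" "C \<in> L" "B \<inter> C = z" "A \<inter> (B |+| C) = z"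
 shows "(A |+| B) \<inter> C = z"
 using indep_assoc[of C B A] assms sup_commute[of C B] sup_commute[of A B]
 by (simp add: Int_commute)

lemma essential_trans:
 assumes "essential_in L z A B" "essential_in L z B C"
 shows "essential_in L z A C"
proof -
 have L: "A \<in> L" "B \<in> L" "C \<in> L" "A <= B" "B <= C" using assms by (auto simp: essential_in_def)
 have "X \<inter> A ~= z" if X: "X \<in> L" "X <= C" "X ~= z" for X
 proof -
  have "X \<inter> B ~= z" using assms(2) X by (simp add: essential_in_def)
  then have "(X \<inter> B) \<inter> A ~= z" using assms(1) X L by (simp add: essential_in_def)
  moreover have "(X \<inter> B) \<inter> A = X \<inter> A" using L by blast
  ultimately show ?thesis by simp
 qed
 then show ?thesis using L by (auto simp: essential_in_def)
qed

lemma essential_mono: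
 assumes "essential_in L z A T" "A <= B" "B \<in> L" "B <= T"
 shows "essential_in L z B T"
proof -
 have "X \<inter> B ~= z" if "X \<in> L" "X <= T" "X ~= z" for X
 proof
  assume "X \<inter> B = z"
  then have "X \<inter> A <= z" using assms by auto
  then have "X \<inter> A = z" using assms that by (intro eq_bot) (auto simp: essential_in_def)
  then show False using assms that by (auto simp: essential_in_def)
 qed
 then show ?thesis using assms by (auto simp: essential_in_def)
qed

text \<open>Suppose \<open>D\<close> misses \<open>A |+| C\<close>. Then
  \<open>B \<inter> (C |+| D)\<close> is nonzero, as otherwise \<open>D\<close> would lie in
  \<open>C\<close>, and so it meets \<open>A\<close>. But by modularity \<open>C |+| D\<close> meets
  \<open>A |+| C\<close> only in \<open>C\<close>, which misses \<open>B\<close>.\<close>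

lemma essential_sup:
 assumes e: "essential_in L z A B" and C: "C \<in> L" "B \<inter> C = z"
 shows "essential_in L z (A |+| C) (B |+| C)"
proof -
 have L: "A \<in> L" "B \<in> L" "A <= B" and ess: "!!X. [|X \<in> L; X <= B; X ~= z|] ==> X \<inter> A ~= z"
  using e by (auto simp: essential_in_def)
 have "D \<inter> (A |+| C) ~= z" if D: "D \<in> L" "D <= B |+| C" "D ~= z" for D
 proof
  assume zero: "D \<inter> (A |+| C) = z"
  have CD: "C <= C |+| D" "D <= C |+| D" using C D sup_upper1 sup_upper2 by auto
  have DCB: "C |+| D <= C |+| B" using C D L sup_least sup_upper1 sup_commute[of B C] by auto
  have "C |+| D = C |+| (B \<inter> (C |+| D))"
   using modular[of C B "C |+| D"] CD DCB C D L by auto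
  then have ne: "B \<inter> (C |+| D) ~= z"
  proof (intro notI)
   assume 1: "C |+| D = C |+| (B \<inter> (C |+| D))" and 2: "B \<inter> (C |+| D) = z"
   then have "C |+| D = C" using sup_absorb1[of C z] C bot_least by simp
   then have "D <= A |+| C" using CD sup_upper2[of A C] C L by auto
   then show False using zero D by auto
  qed
  have "(B \<inter> (C |+| D)) \<inter> A ~= z"
   using ess[of "B \<inter> (C |+| D)"] ne C D L by auto
  moreover have "(C |+| D) \<inter> (A |+| C) = C"
   using modular[of C D "A |+| C"] zero C D L sup_upper2[of A C] sup_absorb1[of C z] bot_least by auto
  then have "(B \<inter> (C |+| D)) \<inter> A <= z"
   using sup_upper1[of A C] C L by auto
  ultimately show False using eq_bot C D L by (metis inf_closed sup_closed)
 qed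
 then show ?thesis using L C sup_mono[of A C B C] by (auto simp: essential_in_def)
qed

lemma essential_sup2:
 assumes "essential_in L z A B" "essential_in L z C D" "B \<inter> D = z"
 shows "essential_in L z (A |+| C) (B |+| D)"
proof -
 have L: "A \<in> L" "B \<in> L" "C \<in> L" "D \<in> L" "A <= B" "C <= D" using assms by (auto simp: essential_in_def)
 have "B \<inter> C <= z" using L assms by auto
 then have "B \<inter> C = z" using eq_bot L by simp
 then have "essential_in L z (A |+| C) (B |+| C)" using essential_sup assms L by blast
 moreover have "essential_in L z (C |+| B) (D |+| B)"
  using essential_sup[OF assms(2), of B] assms L by (simp add: Int_commute)
 ultimately show ?thesis
  using essential_trans sup_commute L by metis
qed

lemma uniform_sum_mem: "uniform_sum L (|+|) z n X ==> X \<in> L"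
 by (induction rule: uniform_sum.induct) (auto simp: uniform_in_def)

lemma uniform_sum_append:
 assumes "uniform_sum L (|+|) z n X"
 shows "uniform_sum L (|+|) z m Y ==> X \<inter> Y = z ==> uniform_sum L (|+|) z (n + m) (X |+| Y)"
proof (induction rule: uniform_sum.induct)
 case uniform_sum_0
 then show ?case using assms uniform_sum_mem[OF assms] sup_absorb1[of X z] bot_least by simp
next
 case (uniform_sum_Suc m Y U)
 have L: "X \<in> L" "Y \<in> L" "U \<in> L"
  using assms uniform_sum_Suc uniform_sum_mem by (auto simp: uniform_in_def)
 have "X \<inter> Y <= X \<inter> (Y |+| U)" using sup_upper1 L by blast
 then have "X \<inter> Y = z" using uniform_sum_Suc eq_bot L by simp
 then have "uniform_sum L (|+|) z (n + m) (X |+| Y)" using uniform_sum_Suc by simp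
 moreover have "(X |+| Y) \<inter> U = z"
  using indep_assoc' L uniform_sum_Suc by simp
 ultimately have "uniform_sum L (|+|) z (Suc (n + m)) (X |+| Y |+| U)"
  using uniform_sum_Suc uniform_sum.uniform_sum_Suc by blast
 then show ?case using sup_assoc L by simp
qed

text \<open>A uniform summand either misses \<open>B\<close> or meets it in an essential part of the
  summand. In the first case the summand is reordered to stand last, ready to be exchanged; if every
  summand meets \<open>B\<close>, the essential parts add up by
  \<open>essential_sup2\<close>.\<close>

lemma uniform_sum_exchange:
 assumes B: "B \<in> L"
 shows "uniform_sum L (|+|) z n X ==>
  (\<exists>k X1 U. n = Suc k \<and> uniform_sum L (|+|) z k X1 \<and> uniform_in L z U \<and> X1 \<inter> U = z \<and> X1 |+| U = X \<and> U \<inter> B = z)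
  \<or> essential_in L z (X \<inter> B) X"
proof (induction rule: uniform_sum.induct)
 case uniform_sum_0
 have "essential_in L z (z \<inter> B) z"
  using B eq_bot by (auto simp: essential_in_def)
 then show ?case ..
next
 case (uniform_sum_Suc n X U)
 have L: "X \<in> L" "U \<in> L"
  using uniform_sum_Suc uniform_sum_mem by (auto simp: uniform_in_def)
 show ?case
 proof (cases "U \<inter> B = z")
  case True
  then show ?thesis using uniform_sum_Suc by blast
 next
  case False
  have eU: "essential_in L z (U \<inter> B) U"
   using uniform_sum_Suc(2) False L B unfolding essential_in_def uniform_in_def by auto
  from uniform_sum_Suc.IH show ?thesis
  proof
   assume "essential_in L z (X \<inter> B) X"
   then have "essential_in L z ((X \<inter> B) |+| (U \<inter> B)) (X |+| U)"
    using essential_sup2 eU uniform_sum_Suc by blast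
   moreover have "(X \<inter> B) |+| (U \<inter> B) <= (X |+| U) \<inter> B"
    using L B sup_upper1[of X U] sup_upper2[of X U] by (intro sup_least) auto
   ultimately have "essential_in L z ((X |+| U) \<inter> B) (X |+| U)"
    using essential_mono L B by simp
   then show ?thesis ..
  next
   assume "\<exists>k X1 U. n = Suc k \<and> uniform_sum L (|+|) z k X1 \<and> uniform_in L z U \<and> X1 \<inter> U = z \<and> X1 |+| U = X \<and> U \<inter> B = z"
   then obtain k X1 V where V: "n = Suc k" "uniform_sum L (|+|) z k X1" "uniform_in L z V"
    "X1 \<inter> V = z" "X1 |+| V = X" "V \<inter> B = z" by blast
   have L': "X1 \<in> L" "V \<in> L" using V uniform_sum_mem by (auto simp: uniform_in_def)
   have "X1 \<inter> U <= X \<inter> U" using V sup_upper1 L' by blast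
   then have 1: "X1 \<inter> U = z" using uniform_sum_Suc eq_bot L L' by simp
   have "U \<inter> (X1 |+| V) = z" using uniform_sum_Suc V by auto
   then have 2: "(X1 |+| U) \<inter> V = z"
    using indep_assoc'[of U X1 V] V L L' sup_commute[of U X1] by auto
   have 3: "X1 |+| U |+| V = X |+| U"
    using V L L' sup_assoc sup_commute by metis
   have "uniform_sum L (|+|) z (Suc k) (X1 |+| U)"
    using uniform_sum.uniform_sum_Suc[OF V(2) uniform_sum_Suc.hyps(2) 1] .
   then show ?thesis using V(1,3,6) 2 3 by blast
  qed
 qed
qed

text \<open>Steinitz exchange, with \<open>Z\<close> collecting the summands of \<open>X\<close>
  that were already set aside. Removing the last summand \<open>V\<close> of \<open>Y\<close> leaves
  \<open>Z |+| Y\<close> disjoint from \<open>V\<close>, hence not essential, so some uniform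
  summand \<open>U\<close> of \<open>X\<close> misses it. Moving \<open>U\<close> to
  \<open>Z\<close> lowers both counts by one.\<close>

lemma uniform_sum_le:
 "[|uniform_sum L (|+|) z m Y; uniform_sum L (|+|) z n X; Z \<in> L; X \<inter> Z = z; essential_in L z (X |+| Z) T; Y <= T; Y \<inter> Z = z|]
 ==> m \<le> n"
proof (induction arbitrary: n X Z rule: uniform_sum.induct)
 case (uniform_sum_Suc m Y V)
 note Y = uniform_sum_Suc.hyps(1) and V = uniform_sum_Suc.hyps(2) and YV = uniform_sum_Suc.hyps(3)
 note X = uniform_sum_Suc.prems(1) and Z = uniform_sum_Suc.prems(2) and XZ = uniform_sum_Suc.prems(3)
  and eXZ = uniform_sum_Suc.prems(4) and YVT = uniform_sum_Suc.prems(5) and YVZ = uniform_sum_Suc.prems(6)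
 have L: "X \<in> L" "Y \<in> L" "V \<in> L" "Z \<in> L" "T \<in> L"
  using Y X V Z eXZ uniform_sum_mem by (auto simp: uniform_in_def essential_in_def)
 have VT: "V <= T" "Y <= T" using YVT L sup_upper1[of Y V] sup_upper2[of Y V] by auto
 have ZT: "Z <= T" "X <= T"
  using eXZ L sup_upper1[of X Z] sup_upper2[of X Z] by (auto simp: essential_in_def)
 have YZ: "Y \<inter> Z = z"
  using YVZ L sup_upper1[of Y V] by (intro eq_bot) auto
 let ?B = "Z |+| Y"
 have "?B \<inter> V = z"
  using indep_assoc'[of Z Y V] YV YVZ L by (simp add: Int_commute)
 then have nB: "\<not> essential_in L z ?B T"
  using V VT(1) L(3) unfolding essential_in_def uniform_in_def by (metis Int_commute)
 have BL: "?B \<in> L" "Z <= ?B" "?B <= T"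
  using L VT ZT by (simp_all add: sup_upper1 sup_least)
 have "\<not> essential_in L z (X \<inter> ?B) X"
 proof
  assume "essential_in L z (X \<inter> ?B) X"
  then have "essential_in L z ((X \<inter> ?B) |+| Z) (X |+| Z)"
   using essential_sup XZ L by simp
  then have "essential_in L z ((X \<inter> ?B) |+| Z) T"
   using essential_trans eXZ by blast
  moreover have "(X \<inter> ?B) |+| Z <= ?B" using L BL by (intro sup_least) auto
  ultimately show False using nB essential_mono BL by blast
 qed
 then obtain k X1 U where U: "n = Suc k" "uniform_sum L (|+|) z k X1" "uniform_in L z U" "X1 \<inter> U = z"
  "X1 |+| U = X" "U \<inter> ?B = z"
  using uniform_sum_exchange[OF BL(1) X] by blast
 have L': "X1 \<in> L" "U \<in> L" using U uniform_sum_mem by (auto simp: uniform_in_def)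
 have "X1 \<inter> (U |+| Z) = z" using indep_assoc[of X1 U Z] U L L' XZ by simp
 moreover have "X1 |+| (U |+| Z) = X |+| Z" using U L L' sup_assoc[of X1 U Z] by simp
 moreover have "Y \<inter> (U |+| Z) = z"
 proof -
  have "(U |+| Z) \<inter> Y = z"
   using indep_assoc'[of U Z Y] U L L' YZ by (simp add: Int_commute)
  then show ?thesis by (simp add: Int_commute)
 qed
 ultimately have "m \<le> k"
  using uniform_sum_Suc.IH[of k X1 "U |+| Z"] U L L' VT eXZ by simp
 then show ?case using U by simp
qed simp

theorem uniform_sum_unique:
 assumes "uniform_sum L (|+|) z m Y" "uniform_sum L (|+|) z n X"
  "essential_in L z X T" "essential_in L z Y T"
 shows "m = n"
proof -
 have L: "X \<in> L" "Y \<in> L" using assms by (auto simp: essential_in_def)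
 then have "X |+| z = X" "Y |+| z = Y" "X \<inter> z = z" "Y \<inter> z = z"
  using sup_absorb1 bot_least[of X] bot_least[of Y] by auto
 then show ?thesis
  using uniform_sum_le[of m Y n X z T] uniform_sum_le[of n X m Y z T] assms
  by (auto simp: essential_in_def)
qed

text \<open>\<open>B\<close> is maximal among the elements below \<open>A\<close> that miss some
  nonzero \<open>C\<close> below \<open>A\<close>; such a \<open>C\<close> is uniform. If
  \<open>D\<close> and \<open>E\<close> inside \<open>C\<close> were nonzero and disjoint,
  \<open>B |+| D\<close> would still miss \<open>E\<close> and be larger than
  \<open>B\<close>.\<close>

lemma uniform_exists:
 assumes acc: "acc_between L z T" and A: "A \<in> L" "A <= T" "A ~= z"
 obtains U where "uniform_in L z U" "U <= A"
proof -
 let ?P = "\<lambda>B. B <= A \<and> (\<exists>C\<in>L. C ~= z \<and> C <= A \<and> B \<inter> C = z)"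
 have zA: "z <= A" "z <= T" using A bot_least[of A] by auto
 then have "?P z" using A by (auto intro!: bexI[of _ A])
 from acc_between_maximal[of L z T z ?P, OF acc bot_closed order_refl zA(2) this]
 obtain B where B: "B \<in> L" "z <= B" "B <= T" "?P B"
  and max: "!!Z. [|Z \<in> L; Z <= T; ?P Z; B <= Z|] ==> Z = B"
  by (elim exE conjE) metis
 from B(4) obtain C where C: "C \<in> L" "C ~= z" "C <= A" "B \<inter> C = z" by blast
 have "D \<inter> E ~= z" if DE: "D \<in> L" "E \<in> L" "D <= C" "E <= C" "D ~= z" "E ~= z" for D E
 proof
  assume 0: "D \<inter> E = z"
  have "(B |+| D) \<inter> C = D"
   using modular[of D B C] DE C B sup_commute[of B D] sup_absorb1[of D z] bot_least[of D] by simp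
  then have "(B |+| D) \<inter> E = z"
   using DE 0 by blast
  moreover have BD: "B |+| D <= A" using B DE C A by (intro sup_least) auto
  ultimately have "?P (B |+| D)" using DE C by (intro conjI bexI[of _ E]) auto
  moreover have "B |+| D \<in> L" "B |+| D <= T" "B <= B |+| D"
   using BD A B DE sup_upper1[of B D] by auto
  ultimately have "B |+| D = B" by (intro max)
  then have "D <= B \<inter> C" using sup_upper2[of B D] B DE by auto
  then show False using C(4) DE eq_bot[of D] by simp
 qed
 then have "uniform_in L z C" using C by (auto simp: uniform_in_def)
 then show thesis using that C by blast
qed

text \<open>A maximal sum of uniform elements is essential, since a nonzero element missing it would
  contain one more uniform summand.\<close>

theorem uniform_sum_exists:
 assumes acc: "acc_between L z T" and T: "T \<in> L"
 shows "\<exists>n X. uniform_sum L (|+|) z n X \<and> essential_in L z X T"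
proof -
 define P where "P X = (\<exists>n. uniform_sum L (|+|) z n X)" for X
 have "P z" unfolding P_def by (rule exI, rule uniform_sum_0)
 from acc_between_maximal[of L z T z P, OF acc bot_closed order_refl bot_least[OF T] this]
 obtain X where X: "X \<in> L" "X <= T" "P X" and max: "!!Z. [|Z \<in> L; Z <= T; P Z; X <= Z|] ==> Z = X"
  by (elim exE conjE) metis
 from X(3) obtain n where n: "uniform_sum L (|+|) z n X" unfolding P_def by (elim exE)
 have "A \<inter> X ~= z" if A: "A \<in> L" "A <= T" "A ~= z" for A
 proof
  assume 0: "A \<inter> X = z"
  obtain U where U: "uniform_in L z U" "U <= A" using uniform_exists[OF acc A] .
  then have UL: "U \<in> L" "U ~= z" by (auto simp: uniform_in_def)
  have XU: "X \<inter> U = z" using U 0 X UL by (intro eq_bot) auto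
  have "P (X |+| U)" unfolding P_def by (rule exI, rule uniform_sum_Suc[OF n U(1) XU])
  moreover have "X |+| U \<in> L" "X |+| U <= T" "X <= X |+| U"
   using X U UL A T sup_upper1[of X U] sup_least[of X U T] by auto
  ultimately have "X |+| U = X" by (intro max)
  then show False using XU UL sup_upper2[of X U] X by auto
 qed
 then have "essential_in L z X T" using X(1,2) T by (simp add: essential_in_def)
 with n show ?thesis by (intro exI conjI)
qed

end

section \<open>Submodules of a right module as a modular lattice\<close>

section \<open>Right modules and their submodules\<close>

abbreviation submods :: "('r, 'k) ring_scheme => ('r, 'm) module => 'm set set" where
 "submods R M \<equiv> {N. submodule N R M}"

abbreviation rideals :: "('r, 'k) ring_scheme => 'r set set" where
 "rideals R \<equiv> submods R (reg_module R)"

abbreviation "chain R M n \<equiv> covers (submods R M) ^^ n"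

abbreviation "noeth R M \<equiv> acc_between (submods R M) (nul M) (carrier M)"

abbreviation "right_acc R \<equiv> acc_between (rideals R) (nul R) (carrier R)"

abbreviation "unisum R M \<equiv> uniform_sum (submods R M) (set_add M) (nul M)"

abbreviation "ess_in R M \<equiv> essential_in (submods R M) (nul M)"

context right_module
begin

lemma smult_zero_right [simp]: "a \<in> carrier R ==> a \<odot>\<^bsub>M\<^esub> \<zero>\<^bsub>M\<^esub> = \<zero>\<^bsub>M\<^esub>"
 using smult_r_distr[of a "\<zero>\<^bsub>M\<^esub>" "\<zero>\<^bsub>M\<^esub>"] M.add.r_cancel_one'[of "a \<odot>\<^bsub>M\<^esub> \<zero>\<^bsub>M\<^esub>" "a \<odot>\<^bsub>M\<^esub> \<zero>\<^bsub>M\<^esub>"]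
 by simp

lemma smult_zero_left [simp]: "x \<in> carrier M ==> \<zero>\<^bsub>R\<^esub> \<odot>\<^bsub>M\<^esub> x = \<zero>\<^bsub>M\<^esub>"
 using smult_l_distr[of "\<zero>\<^bsub>R\<^esub>" "\<zero>\<^bsub>R\<^esub>" x] M.add.r_cancel_one'[of "\<zero>\<^bsub>R\<^esub> \<odot>\<^bsub>M\<^esub> x" "\<zero>\<^bsub>R\<^esub> \<odot>\<^bsub>M\<^esub> x"]
 by simp

lemma smult_minus_one: "x \<in> carrier M ==> (\<ominus>\<^bsub>R\<^esub> \<one>\<^bsub>R\<^esub>) \<odot>\<^bsub>M\<^esub> x = \<ominus>\<^bsub>M\<^esub> x"
 using smult_l_distr[of "\<ominus>\<^bsub>R\<^esub> \<one>\<^bsub>R\<^esub>" "\<one>\<^bsub>R\<^esub>" x] R.l_neg[of "\<one>\<^bsub>R\<^esub>"] smult_zero_left[of x]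
  M.minus_equality[of "(\<ominus>\<^bsub>R\<^esub> \<one>\<^bsub>R\<^esub>) \<odot>\<^bsub>M\<^esub> x" x]
 by simp

lemma smult_minus_right:
 "[|a \<in> carrier R; x \<in> carrier M|] ==> a \<odot>\<^bsub>M\<^esub> (\<ominus>\<^bsub>M\<^esub> x) = \<ominus>\<^bsub>M\<^esub> (a \<odot>\<^bsub>M\<^esub> x)"
 using smult_r_distr[of a "\<ominus>\<^bsub>M\<^esub> x" x] M.minus_equality[of "a \<odot>\<^bsub>M\<^esub> (\<ominus>\<^bsub>M\<^esub> x)" "a \<odot>\<^bsub>M\<^esub> x"]
 by (simp add: M.l_neg)

text \<open>Closure under negatives comes for free, because -x is the action of -1 on x.\<close>

lemma submodule_iff:
 "submodule N R M \<longleftrightarrow> N <= carrier M \<and> \<zero>\<^bsub>M\<^esub> \<in> N \<and> (\<forall>x\<in>N. \<forall>y\<in>N. x \<oplus>\<^bsub>M\<^esub> y \<in> N) \<and>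
  (\<forall>a\<in>carrier R. \<forall>x\<in>N. a \<odot>\<^bsub>M\<^esub> x \<in> N)"
proof
 assume N: "submodule N R M"
 note sg = submodule.axioms(1)[OF N] and sm = submodule.smult_closed[OF N]
 show "N <= carrier M \<and> \<zero>\<^bsub>M\<^esub> \<in> N \<and> (\<forall>x\<in>N. \<forall>y\<in>N. x \<oplus>\<^bsub>M\<^esub> y \<in> N) \<and> (\<forall>a\<in>carrier R. \<forall>x\<in>N. a \<odot>\<^bsub>M\<^esub> x \<in> N)"
  using subgroup.subset[OF sg] subgroup.one_closed[OF sg] subgroup.m_closed[OF sg] sm by auto
next
 assume N: "N <= carrier M \<and> \<zero>\<^bsub>M\<^esub> \<in> N \<and> (\<forall>x\<in>N. \<forall>y\<in>N. x \<oplus>\<^bsub>M\<^esub> y \<in> N) \<and> (\<forall>a\<in>carrier R. \<forall>x\<in>N. a \<odot>\<^bsub>M\<^esub> x \<in> N)"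
 have "\<ominus>\<^bsub>M\<^esub> x \<in> N" if "x \<in> N" for x
 proof -
  have "x \<in> carrier M" "(\<ominus>\<^bsub>R\<^esub> \<one>\<^bsub>R\<^esub>) \<odot>\<^bsub>M\<^esub> x \<in> N" using N that by blast+
  then show ?thesis using smult_minus_one by simp
 qed
 then show "submodule N R M"
  using N by (intro submodule.intro subgroup.intro submodule_axioms.intro)
   (auto simp flip: a_inv_def)
qed

lemma submoduleI:
 assumes "N <= carrier M" "\<zero>\<^bsub>M\<^esub> \<in> N" "!!x y. [|x \<in> N; y \<in> N|] ==> x \<oplus>\<^bsub>M\<^esub> y \<in> N"
  "!!a x. [|a \<in> carrier R; x \<in> N|] ==> a \<odot>\<^bsub>M\<^esub> x \<in> N"
 shows "submodule N R M"
 unfolding submodule_iff using assms by (intro conjI ballI)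

lemma submoduleD:
 assumes "submodule N R M"
 shows "N <= carrier M" "\<zero>\<^bsub>M\<^esub> \<in> N" "!!x y. [|x \<in> N; y \<in> N|] ==> x \<oplus>\<^bsub>M\<^esub> y \<in> N"
  "!!a x. [|a \<in> carrier R; x \<in> N|] ==> a \<odot>\<^bsub>M\<^esub> x \<in> N" "!!x. x \<in> N ==> \<ominus>\<^bsub>M\<^esub> x \<in> N"
  "!!x y. [|x \<in> N; y \<in> N|] ==> x \<ominus>\<^bsub>M\<^esub> y \<in> N"
proof -
 show 1: "N <= carrier M" "\<zero>\<^bsub>M\<^esub> \<in> N" "!!x y. [|x \<in> N; y \<in> N|] ==> x \<oplus>\<^bsub>M\<^esub> y \<in> N"
  "!!a x. [|a \<in> carrier R; x \<in> N|] ==> a \<odot>\<^bsub>M\<^esub> x \<in> N"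
  using assms submodule_iff by auto
 show 2: "\<ominus>\<^bsub>M\<^esub> x \<in> N" if "x \<in> N" for x
 proof -
  have "x \<in> carrier M" "(\<ominus>\<^bsub>R\<^esub> \<one>\<^bsub>R\<^esub>) \<odot>\<^bsub>M\<^esub> x \<in> N" using 1(1,4) that by blast+
  then show ?thesis using smult_minus_one by simp
 qed
 show "!!x y. [|x \<in> N; y \<in> N|] ==> x \<ominus>\<^bsub>M\<^esub> y \<in> N"
  using 1 2 by (simp add: M.minus_eq)
qed

lemma submodule_carrier [simp]: "submodule (carrier M) R M"
 by (rule submoduleI) auto

lemma submodule_zero [simp]: "submodule (nul M) R M"
 by (rule submoduleI) auto

lemma submodule_Int: "[|submodule A R M; submodule B R M|] ==> submodule (A \<inter> B) R M"
 by (rule submoduleI) (auto dest: submoduleD)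

lemma set_add_iff: "x \<in> A <+>\<^bsub>M\<^esub> B \<longleftrightarrow> (\<exists>a\<in>A. \<exists>b\<in>B. x = a \<oplus>\<^bsub>M\<^esub> b)"
 by (auto simp: set_add_def')

lemma submodule_set_add:
 assumes A: "submodule A R M" and B: "submodule B R M"
 shows "submodule (A <+>\<^bsub>M\<^esub> B) R M"
proof (rule submoduleI)
 note A' = submoduleD[OF A] and B' = submoduleD[OF B]
 show "A <+>\<^bsub>M\<^esub> B <= carrier M" using A'(1) B'(1) by (auto simp: set_add_def')
 show "\<zero>\<^bsub>M\<^esub> \<in> A <+>\<^bsub>M\<^esub> B" using A'(2) B'(2) by (force simp: set_add_iff)
 fix x y assume "x \<in> A <+>\<^bsub>M\<^esub> B" "y \<in> A <+>\<^bsub>M\<^esub> B"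
 then obtain a b c d where "x = a \<oplus>\<^bsub>M\<^esub> b" "y = c \<oplus>\<^bsub>M\<^esub> d" "a \<in> A" "c \<in> A" "b \<in> B" "d \<in> B"
  by (auto simp: set_add_iff)
 moreover from this have "a \<in> carrier M" "b \<in> carrier M" "c \<in> carrier M" "d \<in> carrier M"
  using A'(1) B'(1) by auto
 ultimately show "x \<oplus>\<^bsub>M\<^esub> y \<in> A <+>\<^bsub>M\<^esub> B"
  unfolding set_add_iff using A'(3) B'(3)
  by (intro bexI[of _ "a \<oplus>\<^bsub>M\<^esub> c"] bexI[of _ "b \<oplus>\<^bsub>M\<^esub> d"]) (simp_all add: M.add.m_ac)
next
 fix a x assume "a \<in> carrier R" "x \<in> A <+>\<^bsub>M\<^esub> B"
 then show "a \<odot>\<^bsub>M\<^esub> x \<in> A <+>\<^bsub>M\<^esub> B"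
  using submoduleD[OF A] submoduleD[OF B]
  by (auto simp: set_add_iff subset_eq) (metis smult_r_distr)
qed

lemma modular_submods: "modular_sets (submods R M) (set_add M) (nul M)"
proof
 fix A B assume "A \<in> submods R M" "B \<in> submods R M"
 then have AB: "submodule A R M" "submodule B R M" by auto
 note A = submoduleD[OF AB(1)] and B = submoduleD[OF AB(2)]
 show "A \<inter> B \<in> submods R M" using AB submodule_Int by auto
 show "A <+>\<^bsub>M\<^esub> B \<in> submods R M" using AB submodule_set_add by auto
 show "A <= A <+>\<^bsub>M\<^esub> B"
 proof
  fix x assume "x \<in> A"
  then show "x \<in> A <+>\<^bsub>M\<^esub> B"
   unfolding set_add_iff using A(1) B(2) by (intro bexI[of _ x] bexI[of _ "\<zero>\<^bsub>M\<^esub>"]) auto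
 qed
 show "B <= A <+>\<^bsub>M\<^esub> B"
 proof
  fix x assume "x \<in> B"
  then show "x \<in> A <+>\<^bsub>M\<^esub> B"
   unfolding set_add_iff using B(1) A(2) by (intro bexI[of _ x] bexI[of _ "\<zero>\<^bsub>M\<^esub>"]) auto
 qed
 fix C assume "C \<in> submods R M"
 then have "submodule C R M" by simp
 note C = submoduleD[OF this]
 show "A <+>\<^bsub>M\<^esub> B <= C" if "A <= C" "B <= C"
  using that C(3) unfolding set_add_def' by blast
 show "(A <+>\<^bsub>M\<^esub> B) \<inter> C <= A <+>\<^bsub>M\<^esub> (B \<inter> C)" if AC: "A <= C"
 proof
  fix x assume "x \<in> (A <+>\<^bsub>M\<^esub> B) \<inter> C"
  then obtain a b where ab: "a \<in> A" "b \<in> B" "x = a \<oplus>\<^bsub>M\<^esub> b" "x \<in> C" by (auto simp: set_add_iff)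
  have c: "a \<in> carrier M" "b \<in> carrier M" using ab A B by auto
  have "b = \<ominus>\<^bsub>M\<^esub> a \<oplus>\<^bsub>M\<^esub> x" using ab c by (simp add: M.r_neg1)
  moreover have "\<ominus>\<^bsub>M\<^esub> a \<oplus>\<^bsub>M\<^esub> x \<in> C" using ab(1,4) AC C(3,5) by blast
  ultimately have "b \<in> C" by simp
  then show "x \<in> A <+>\<^bsub>M\<^esub> (B \<inter> C)" using ab by (auto simp: set_add_iff)
 qed
qed (use submoduleD(2) in "auto")

lemma right_module_sub:
 assumes "submodule N R M"
 shows "right_module R (sub_mod M N)"
proof -
 note N = submoduleD[OF assms]
 have "abelian_group (sub_mod M N)"
 proof (rule abelian_groupI)
  fix x assume "x \<in> carrier (sub_mod M N)"
  then show "\<exists>y\<in>carrier (sub_mod M N). y \<oplus>\<^bsub>sub_mod M N\<^esub> x = \<zero>\<^bsub>sub_mod M N\<^esub>"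
   using N by (intro bexI[of _ "\<ominus>\<^bsub>M\<^esub> x"]) (auto intro: M.l_neg)
 qed (use N in "auto simp: subset_eq M.add.m_ac")
 then show ?thesis
  using N by (intro right_module.intro right_module_axioms.intro R.ring_axioms)
   (auto simp: subset_eq smult_l_distr smult_r_distr smult_assoc)
qed

lemma submodule_sub_iff:
 assumes "submodule N R M"
 shows "submodule K R (sub_mod M N) \<longleftrightarrow> submodule K R M \<and> K <= N"
 using right_module.submodule_iff[OF right_module_sub[OF assms], of K] submodule_iff[of K] submoduleD(1)[OF assms]
 by auto

lemma submodule_Inter:
 assumes "!!N. N \<in> \<N> ==> submodule N R M" "\<N> ~= {}"
 shows "submodule (\<Inter>\<N>) R M"
proof (rule submoduleI)
 obtain N where "N \<in> \<N>" using assms by auto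
 then show "\<Inter>\<N> <= carrier M" using assms(1) submoduleD(1) by blast
qed (use assms(1) submoduleD in auto)

lemma submodule_rspan: "A <= carrier M ==> submodule (rspan R M A) R M"
 unfolding rspan_def by (rule submodule_Inter) (use submodule_carrier in blast)+

lemma rspan_incl: "A <= rspan R M A"
 unfolding rspan_def by auto

lemma rspan_least: "[|submodule N R M; A <= N|] ==> rspan R M A <= N"
 unfolding rspan_def by auto

end

lemma right_module_reg:
 assumes "ring R" shows "right_module R (reg_module R)"
proof -
 interpret R: ring R by fact
 have "abelian_group (reg_module R)"
 proof (rule abelian_groupI)
  fix x assume "x \<in> carrier (reg_module R)"
  then show "\<exists>y\<in>carrier (reg_module R). y \<oplus>\<^bsub>reg_module R\<^esub> x = \<zero>\<^bsub>reg_module R\<^esub>"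
   by (intro bexI[of _ "\<ominus>\<^bsub>R\<^esub> x"]) (auto simp: reg_module_def intro: R.l_neg)
 qed (simp_all add: reg_module_def R.a_assoc, simp add: R.a_comm)
 then show ?thesis
  by (intro right_module.intro right_module_axioms.intro assms)
   (auto simp: reg_module_def R.r_distr R.l_distr R.m_assoc)
qed

lemma reg_module_simps [simp]:
 "carrier (reg_module R) = carrier R" "\<zero>\<^bsub>reg_module R\<^esub> = \<zero>\<^bsub>R\<^esub>"
 "x \<oplus>\<^bsub>reg_module R\<^esub> y = x \<oplus>\<^bsub>R\<^esub> y" "a \<odot>\<^bsub>reg_module R\<^esub> x = x \<otimes>\<^bsub>R\<^esub> a"
 by (auto simp: reg_module_def)

section \<open>Module homomorphisms\<close>

lemma rhomI:
 assumes "!!x. x \<in> carrier M ==> f x \<in> carrier N"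
  "!!x y. [|x \<in> carrier M; y \<in> carrier M|] ==> f (x \<oplus>\<^bsub>M\<^esub> y) = f x \<oplus>\<^bsub>N\<^esub> f y"
  "!!a x. [|a \<in> carrier R; x \<in> carrier M|] ==> f (a \<odot>\<^bsub>M\<^esub> x) = a \<odot>\<^bsub>N\<^esub> f x"
  "f \<in> extensional (carrier M)"
 shows "f \<in> rhom R M N"
 using assms by (simp add: rhom_def PiE_def)

lemma rhom_restrictI:
 assumes "right_module R M" "!!x. x \<in> carrier M ==> f x \<in> carrier N"
  "!!x y. [|x \<in> carrier M; y \<in> carrier M|] ==> f (x \<oplus>\<^bsub>M\<^esub> y) = f x \<oplus>\<^bsub>N\<^esub> f y"
  "!!a x. [|a \<in> carrier R; x \<in> carrier M|] ==> f (a \<odot>\<^bsub>M\<^esub> x) = a \<odot>\<^bsub>N\<^esub> f x"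
 shows "restrict f (carrier M) \<in> rhom R M N"
proof -
 interpret right_module R M by fact
 show ?thesis using assms(2-) by (intro rhomI) auto
qed

lemma rhom_closed: "[|f \<in> rhom R M N; x \<in> carrier M|] ==> f x \<in> carrier N"
 by (auto simp: rhom_def)

lemma rhom_add: "[|f \<in> rhom R M N; x \<in> carrier M; y \<in> carrier M|] ==> f (x \<oplus>\<^bsub>M\<^esub> y) = f x \<oplus>\<^bsub>N\<^esub> f y"
 by (auto simp: rhom_def)

lemma rhom_smult: "[|f \<in> rhom R M N; a \<in> carrier R; x \<in> carrier M|] ==> f (a \<odot>\<^bsub>M\<^esub> x) = a \<odot>\<^bsub>N\<^esub> f x"
 by (auto simp: rhom_def)

lemma rhom_ext: "[|f \<in> rhom R M N; x \<notin> carrier M|] ==> f x = undefined"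
 by (auto simp: rhom_def)

lemma rhom_extensional: "f \<in> rhom R M N ==> f \<in> extensional (carrier M)"
 by (simp add: rhom_def PiE_def)

lemma rhom_eqI: "[|f \<in> rhom R M N; g \<in> rhom R M N'; !!x. x \<in> carrier M ==> f x = g x|] ==> f = g"
 by (meson extensionalityI rhom_extensional)

lemma rhom_zero:
 assumes "right_module R M" "right_module R N" "f \<in> rhom R M N"
 shows "f \<zero>\<^bsub>M\<^esub> = \<zero>\<^bsub>N\<^esub>"
proof -
 interpret M: right_module R M by fact
 interpret N: right_module R N by fact
 have "f (\<zero>\<^bsub>R\<^esub> \<odot>\<^bsub>M\<^esub> \<zero>\<^bsub>M\<^esub>) = \<zero>\<^bsub>R\<^esub> \<odot>\<^bsub>N\<^esub> f \<zero>\<^bsub>M\<^esub>"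
  by (rule rhom_smult[OF assms(3)]) auto
 then show ?thesis using rhom_closed[OF assms(3)] by simp
qed

lemma rhom_neg:
 assumes "right_module R M" "right_module R N" "f \<in> rhom R M N" "x \<in> carrier M"
 shows "f (\<ominus>\<^bsub>M\<^esub> x) = \<ominus>\<^bsub>N\<^esub> f x"
proof -
 interpret M: right_module R M by fact
 interpret N: right_module R N by fact
 show ?thesis
  using rhom_smult[OF assms(3), of "\<ominus>\<^bsub>R\<^esub> \<one>\<^bsub>R\<^esub>" x] M.smult_minus_one N.smult_minus_one assms(4)
   rhom_closed[OF assms(3,4)] by simp
qed

lemma rhom_minus:
 assumes "right_module R M" "right_module R N" "f \<in> rhom R M N" "x \<in> carrier M" "y \<in> carrier M"
 shows "f (x \<ominus>\<^bsub>M\<^esub> y) = f x \<ominus>\<^bsub>N\<^esub> f y"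
proof -
 interpret M: right_module R M by fact
 show ?thesis
  using assms rhom_add[OF assms(3), of x "\<ominus>\<^bsub>M\<^esub> y"] rhom_neg[OF assms(1-3), of y]
  by (simp add: a_minus_def)
qed

lemma rhom_compose:
 assumes "f \<in> rhom R L M" "g \<in> rhom R M N" "right_module R L"
 shows "compose (carrier L) g f \<in> rhom R L N"
proof -
 interpret right_module R L by fact
 show ?thesis
  using assms(1,2)
  by (intro rhomI) (auto simp: compose_def rhom_closed rhom_add rhom_smult)
qed

lemma rhom_id: "right_module R M ==> (\<lambda>x\<in>carrier M. x) \<in> rhom R M M"
 by (rule rhom_restrictI) auto

lemma rhom_const_zero:
 assumes "right_module R M" "right_module R N"
 shows "(\<lambda>x\<in>carrier M. \<zero>\<^bsub>N\<^esub>) \<in> rhom R M N"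
proof -
 interpret M: right_module R M by fact
 interpret N: right_module R N by fact
 show ?thesis by (rule rhom_restrictI[OF assms(1)]) auto
qed

lemma rhom_plus:
 assumes "right_module R M" "right_module R N" "f \<in> rhom R M N" "g \<in> rhom R M N"
 shows "(\<lambda>x\<in>carrier M. f x \<oplus>\<^bsub>N\<^esub> g x) \<in> rhom R M N"
proof -
 interpret M: right_module R M by fact
 interpret N: right_module R N by fact
 show ?thesis using assms(3,4)
  by (intro rhom_restrictI[OF assms(1)])
   (auto simp: rhom_closed rhom_add rhom_smult N.M.add.m_ac N.smult_r_distr)
qed

lemma rhom_uminus:
 assumes "right_module R M" "right_module R N" "f \<in> rhom R M N"
 shows "(\<lambda>x\<in>carrier M. \<ominus>\<^bsub>N\<^esub> f x) \<in> rhom R M N"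
proof -
 interpret M: right_module R M by fact
 interpret N: right_module R N by fact
 show ?thesis using assms(3)
  by (intro rhom_restrictI[OF assms(1)])
   (auto simp: rhom_closed rhom_add rhom_smult N.M.minus_add N.smult_minus_right)
qed

lemma rhom_incl:
 assumes "right_module R M" "submodule N R M"
 shows "(\<lambda>x\<in>N. x) \<in> rhom R (sub_mod M N) M"
proof -
 interpret right_module R M by fact
 show ?thesis
  using rhom_restrictI[OF right_module_sub[OF assms(2)], of "\<lambda>x. x" M] submoduleD(1)[OF assms(2)] by auto
qed

lemma rhom_restrict:
 assumes "right_module R M" "f \<in> rhom R M N" "submodule K R M"
 shows "restrict f K \<in> rhom R (sub_mod M K) N"
proof -
 interpret right_module R M by fact
 show ?thesis
  using rhom_restrictI[OF right_module_sub[OF assms(3)], of f N] submoduleD(1)[OF assms(3)] assms(2)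
  by (auto simp: rhom_closed rhom_add rhom_smult subset_eq)
qed

lemma rhom_codomain:
 assumes "f \<in> rhom R M N" "!!x. x \<in> carrier M ==> f x \<in> K"
 shows "f \<in> rhom R M (sub_mod N K)"
 using assms by (simp add: rhom_def PiE_def)

lemma rhom_codomain_sub: "[|f \<in> rhom R M (sub_mod N K); K <= carrier N|] ==> f \<in> rhom R M N"
 by (auto simp: rhom_def PiE_def)

lemma submodule_image:
 assumes "right_module R M" "right_module R N" "f \<in> rhom R M N" "submodule K R M"
 shows "submodule (f ` K) R N"
proof -
 interpret M: right_module R M by fact
 interpret N: right_module R N by fact
 note K = M.submoduleD[OF assms(4)]
 show ?thesis
 proof (rule N.submoduleI)
  show "f ` K <= carrier N" using K rhom_closed[OF assms(3)] by auto
  show "\<zero>\<^bsub>N\<^esub> \<in> f ` K" using K(2) rhom_zero[OF assms(1-3)] by force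
  fix x y assume "x \<in> f ` K" "y \<in> f ` K"
  then obtain a b where "a \<in> K" "b \<in> K" "x = f a" "y = f b" by auto
  then show "x \<oplus>\<^bsub>N\<^esub> y \<in> f ` K"
   using K by (auto simp: rhom_add[OF assms(3), symmetric] subset_eq)
 next
  fix a x assume "a \<in> carrier R" "x \<in> f ` K"
  then show "a \<odot>\<^bsub>N\<^esub> x \<in> f ` K"
   using K by (auto simp: rhom_smult[OF assms(3), symmetric] subset_eq)
 qed
qed

lemma submodule_vimage:
 assumes "right_module R M" "right_module R N" "f \<in> rhom R M N" "submodule K R N"
 shows "submodule {x \<in> carrier M. f x \<in> K} R M"
proof -
 interpret M: right_module R M by fact
 interpret N: right_module R N by fact
 note K = N.submoduleD[OF assms(4)]
 show ?thesis
 proof (rule M.submoduleI)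
  fix x y assume "x \<in> {x \<in> carrier M. f x \<in> K}" "y \<in> {x \<in> carrier M. f x \<in> K}"
  then show "x \<oplus>\<^bsub>M\<^esub> y \<in> {x \<in> carrier M. f x \<in> K}"
   using K(3) by (simp add: rhom_add[OF assms(3)])
 next
  fix a x assume "a \<in> carrier R" "x \<in> {x \<in> carrier M. f x \<in> K}"
  then show "a \<odot>\<^bsub>M\<^esub> x \<in> {x \<in> carrier M. f x \<in> K}"
   using K(4) by (simp add: rhom_smult[OF assms(3)])
 qed (use K(2) rhom_zero[OF assms(1-3)] in auto)
qed

abbreviation hker :: "('r, 'm) module => ('r, 'n) module => ('m => 'n) => 'm set" where
 "hker M N f \<equiv> {x \<in> carrier M. f x = \<zero>\<^bsub>N\<^esub>}"

lemma submodule_ker: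
 assumes "right_module R M" "right_module R N" "f \<in> rhom R M N"
 shows "submodule (hker M N f) R M"
 using submodule_vimage[OF assms right_module.submodule_zero[OF assms(2)]] by simp

lemma rhom_inj_iff:
 assumes "right_module R M" "right_module R N" "f \<in> rhom R M N"
 shows "inj_on f (carrier M) \<longleftrightarrow> hker M N f = nul M"
proof -
 interpret M: right_module R M by fact
 interpret N: right_module R N by fact
 note z = rhom_zero[OF assms]
 show ?thesis
 proof
  assume inj: "inj_on f (carrier M)"
  have "x = \<zero>\<^bsub>M\<^esub>" if "x \<in> carrier M" "f x = \<zero>\<^bsub>N\<^esub>" for x
   using inj_onD[OF inj _ that(1) M.zero_closed] that z by simp
  then show "hker M N f = nul M" using z by auto
 next
  assume k: "hker M N f = nul M"
  show "inj_on f (carrier M)"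
  proof (rule inj_onI)
   fix x y assume xy: "x \<in> carrier M" "y \<in> carrier M" "f x = f y"
   have "f (x \<ominus>\<^bsub>M\<^esub> y) = \<zero>\<^bsub>N\<^esub>"
    using rhom_minus[OF assms xy(1,2)] rhom_closed[OF assms(3) xy(2)] xy(3) by (simp add: N.M.minus_eq N.M.r_neg)
   then have "x \<ominus>\<^bsub>M\<^esub> y \<in> hker M N f" using xy by auto
   then have "x \<ominus>\<^bsub>M\<^esub> y = \<zero>\<^bsub>M\<^esub>" using k by auto
   then have "x \<ominus>\<^bsub>M\<^esub> y \<oplus>\<^bsub>M\<^esub> y = y" using xy by simp
   then show "x = y" using xy by (simp add: M.M.minus_eq M.M.a_assoc M.M.l_neg)
  qed
 qed
qed

lemma riso_inv:
 assumes "right_module R M" "right_module R N" "f \<in> riso R M N"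
 shows "restrict (inv_into (carrier M) f) (carrier N) \<in> riso R N M"
proof -
 interpret M: right_module R M by fact
 interpret N: right_module R N by fact
 have f: "f \<in> rhom R M N" and b: "bij_betw f (carrier M) (carrier N)" using assms(3) by (auto simp: riso_def)
 let ?g = "inv_into (carrier M) f"
 have g: "?g y \<in> carrier M" "f (?g y) = y" if "y \<in> carrier N" for y
  using b that by (auto simp: bij_betw_def f_inv_into_f inv_into_into)
 have inj: "x = y" if "f x = f y" "x \<in> carrier M" "y \<in> carrier M" for x y
  using b that by (auto simp: bij_betw_def inj_on_def)
 have "restrict ?g (carrier N) \<in> rhom R N M"
 proof (rule rhom_restrictI[OF assms(2)])
  fix x y assume "x \<in> carrier N" "y \<in> carrier N"
  then show "?g (x \<oplus>\<^bsub>N\<^esub> y) = ?g x \<oplus>\<^bsub>M\<^esub> ?g y"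
   using g by (intro inj) (auto simp: rhom_add[OF f])
 next
  fix a x assume "a \<in> carrier R" "x \<in> carrier N"
  then show "?g (a \<odot>\<^bsub>N\<^esub> x) = a \<odot>\<^bsub>M\<^esub> ?g x"
   using g by (intro inj) (auto simp: rhom_smult[OF f])
 qed (use g in auto)
 moreover have "bij_betw (restrict ?g (carrier N)) (carrier N) (carrier M)"
  by (rule iffD2[OF bij_betw_cong bij_betw_inv_into[OF b]]) simp
 ultimately show ?thesis by (simp add: riso_def)
qed

lemma riso_id: "right_module R M ==> (\<lambda>x\<in>carrier M. x) \<in> riso R M M"
 using rhom_id[of R M] by (auto simp: riso_def bij_betw_def inj_on_def)

lemma riso_compose:
 assumes "f \<in> riso R L M" "g \<in> riso R M N" "right_module R L"
 shows "compose (carrier L) g f \<in> riso R L N"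
 using assms rhom_compose[of f R L M g N] bij_betw_compose[of f "carrier L" "carrier M" g "carrier N"]
 by (auto simp: riso_def)

lemma riso_nonempty_sym:
 "[|right_module R M; right_module R N; riso R M N ~= {}|] ==> riso R N M ~= {}"
 using riso_inv by blast

lemma riso_nonempty_trans:
 "[|right_module R L; riso R L M ~= {}; riso R M N ~= {}|] ==> riso R L N ~= {}"
 using riso_compose by blast

lemma iso_class_eq_iff:
 fixes M N :: "('r, 'u) module"
 assumes "right_module R M" "right_module R N"
 shows "(iso_class R M :: ('r, 'u) module set) = iso_class R N \<longleftrightarrow> riso R M N ~= {}"
proof
 assume "(iso_class R M :: ('r, 'u) module set) = iso_class R N"
 moreover have "N \<in> iso_class R N" using riso_id assms by (auto simp: iso_class_def)
 ultimately show "riso R M N ~= {}" by (auto simp: iso_class_def)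
next
 assume "riso R M N ~= {}"
 then show "(iso_class R M :: ('r, 'u) module set) = iso_class R N"
  using assms riso_nonempty_sym riso_nonempty_trans unfolding iso_class_def by blast
qed

text \<open>\<open>M\<close> and \<open>N\<close> may live on types other than the universe, so
  neither has to be a member of the class; a small \<open>L\<close> is isomorphic to one exactly
  when it is isomorphic to the other.\<close>

lemma iso_class_cong:
 fixes M :: "('r, 'm) module" and N :: "('r, 'n) module"
 assumes "right_module R M" "right_module R N" "riso R M N ~= {}"
 shows "(iso_class R M :: ('r, 'u) module set) = iso_class R N"
proof -
 have "riso R M L ~= {} \<longleftrightarrow> riso R N L ~= {}" if "right_module R L" for L :: "('r, 'u) module"
  using assms that riso_nonempty_sym riso_nonempty_trans[of R N M L] riso_nonempty_trans[of R M N L] by blast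
 then show ?thesis unfolding iso_class_def by blast
qed

lemma iso_class_self: "right_module R M ==> M \<in> iso_class R M"
 using riso_id by (auto simp: iso_class_def)

text \<open>Transport of structure along a map that is injective on the carrier, where
  \<open>inv_into\<close> really inverts it. This is how a module on another type is moved into the
  universe type.\<close>

definition copy_module :: "('m => 'u) => ('r, 'm) module => ('r, 'u) module" where
 "copy_module e M = \<lparr>carrier = e ` carrier M, mult = (\<lambda>x y. x), one = e \<zero>\<^bsub>M\<^esub>, ring.zero = e \<zero>\<^bsub>M\<^esub>,
  add = (\<lambda>x y. e (inv_into (carrier M) e x \<oplus>\<^bsub>M\<^esub> inv_into (carrier M) e y)),
  smult = (\<lambda>a x. e (a \<odot>\<^bsub>M\<^esub> inv_into (carrier M) e x))\<rparr>"

lemma copy_module: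
 assumes "right_module R M" "inj_on e (carrier M)"
 shows "right_module R (copy_module e M)" "restrict e (carrier M) \<in> riso R M (copy_module e M)"
proof -
 interpret right_module R M by fact
 note [simp] = inv_into_f_f[OF assms(2)]
 have "abelian_group (copy_module e M)"
 proof (rule abelian_groupI)
  fix x assume "x \<in> carrier (copy_module e M)"
  then show "\<exists>y\<in>carrier (copy_module e M). y \<oplus>\<^bsub>copy_module e M\<^esub> x = \<zero>\<^bsub>copy_module e M\<^esub>"
   by (auto simp: copy_module_def M.l_neg intro!: bexI[of _ "\<ominus>\<^bsub>M\<^esub> _"])
 qed (auto simp: copy_module_def M.add.m_ac)
 then show *: "right_module R (copy_module e M)"
  by (intro right_module.intro right_module_axioms.intro R.ring_axioms)
   (auto simp: copy_module_def smult_l_distr smult_r_distr smult_assoc)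
 have "restrict e (carrier M) \<in> rhom R M (copy_module e M)"
  by (rule rhom_restrictI[OF assms(1)]) (auto simp: copy_module_def)
 then show "restrict e (carrier M) \<in> riso R M (copy_module e M)"
  using assms(2) by (auto simp: riso_def bij_betw_def inj_on_def copy_module_def)
qed

section \<open>Order isomorphisms of submodule lattices and what they preserve\<close>

section \<open>Lattice isomorphisms\<close>

text \<open>Injectivity follows from order reflection by antisymmetry. Compatibility with meets,
  joins and the bottom is derived, so applications only have to check the order.\<close>

definition lat_iso :: "'a set set => 'b set set => ('a set => 'b set) => bool" where
 "lat_iso L L' h \<longleftrightarrow> h ` L = L' \<and> (\<forall>A\<in>L. \<forall>B\<in>L. h A <= h B \<longleftrightarrow> A <= B)"

lemma lat_iso_in: "[|lat_iso L L' h; A \<in> L|] ==> h A \<in> L'"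
 by (auto simp: lat_iso_def)

lemma lat_iso_le: "[|lat_iso L L' h; A \<in> L; B \<in> L|] ==> h A <= h B \<longleftrightarrow> A <= B"
 by (simp add: lat_iso_def)

lemma lat_iso_eq: "[|lat_iso L L' h; A \<in> L; B \<in> L|] ==> h A = h B \<longleftrightarrow> A = B"
 by (simp add: set_eq_subset lat_iso_le)

lemma lat_iso_surj: "[|lat_iso L L' h; Y \<in> L'|] ==> \<exists>X\<in>L. Y = h X"
 unfolding lat_iso_def by blast

lemma lat_iso_covers:
 assumes h: "lat_iso L L' h" and L: "A \<in> L" "B \<in> L"
 shows "covers L' (h A) (h B) \<longleftrightarrow> covers L A B"
proof -
 have "(\<forall>Y\<in>L'. h A <= Y \<and> Y <= h B --> Y = h A \<or> Y = h B) \<longleftrightarrow> (\<forall>X\<in>L. h A <= h X \<and> h X <= h B --> h X = h A \<or> h X = h B)"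
  using lat_iso_surj[OF h] lat_iso_in[OF h] by metis
 then show ?thesis
  using L unfolding covers_def psubset_eq
  by (simp add: lat_iso_in[OF h] lat_iso_le[OF h] lat_iso_eq[OF h])
qed

lemma lat_iso_covers_chain:
 assumes h: "lat_iso L L' h"
 shows "[|A \<in> L; B \<in> L|] ==> (covers L' ^^ n) (h A) (h B) \<longleftrightarrow> (covers L ^^ n) A B"
proof (induction n arbitrary: B)
 case 0
 then show ?case using lat_iso_eq[OF h] by simp
next
 case (Suc n)
 have "(covers L' ^^ Suc n) (h A) (h B) \<longleftrightarrow> (\<exists>Y\<in>L'. (covers L' ^^ n) (h A) Y \<and> covers L' Y (h B))"
  by (auto simp: OO_def covers_def)
 also have "\<dots> \<longleftrightarrow> (\<exists>X\<in>L. (covers L' ^^ n) (h A) (h X) \<and> covers L' (h X) (h B))"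
  using lat_iso_surj[OF h] lat_iso_in[OF h] by metis
 also have "\<dots> \<longleftrightarrow> (\<exists>X\<in>L. (covers L ^^ n) A X \<and> covers L X B)"
  using Suc lat_iso_covers[OF h] by auto
 also have "\<dots> \<longleftrightarrow> (covers L ^^ Suc n) A B"
  by (auto simp: OO_def covers_def)
 finally show ?case .
qed

lemma covers_restrict:
 assumes "N <= A"
 shows "covers {X \<in> L. N <= X \<and> X <= T} A B \<longleftrightarrow> covers L A B \<and> B <= T"
proof
 assume c: "covers {X \<in> L. N <= X \<and> X <= T} A B"
 show "covers L A B \<and> B <= T"
 proof -
  have L: "A \<in> L" "B \<in> L" "A \<subset> B" "A <= T" "B <= T"
   and m: "!!X. [|X \<in> L; N <= X; X <= T; A <= X; X <= B|] ==> X = A \<or> X = B"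
   using c unfolding covers_def mem_Collect_eq by blast+
  have "X = A \<or> X = B" if "X \<in> L" "A <= X" "X <= B" for X
   using m[of X] that L assms by (meson subset_trans)
  then show ?thesis using L unfolding covers_def by blast
 qed
next
 assume c: "covers L A B \<and> B <= T"
 with assms have "A \<subset> B" "B <= T" "N <= A" "A \<in> L" "B \<in> L" by (simp_all add: covers_def)
 moreover from this have "N <= B" "A <= T" by auto
 ultimately show "covers {X \<in> L. N <= X \<and> X <= T} A B"
  using c unfolding covers_def mem_Collect_eq by blast
qed

lemma covers_chain_restrict:
 assumes "modular_sets L sp z" "N <= A" "A \<in> L" "A <= T"
 shows "(covers {X \<in> L. N <= X \<and> X <= T} ^^ n) A B \<longleftrightarrow> (covers L ^^ n) A B \<and> B <= T"
proof (induction n arbitrary: B)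
 case 0
 then show ?case using assms by auto
next
 case (Suc n)
 let ?L = "{X \<in> L. N <= X \<and> X <= T}"
 have step: "(covers ?L ^^ n) A Y \<and> covers ?L Y B \<longleftrightarrow> (covers L ^^ n) A Y \<and> covers L Y B \<and> B <= T" for Y
 proof (cases "(covers L ^^ n) A Y")
  case True
  then have "N <= Y" using modular_sets.covers_chain_mem[OF assms(1) True assms(3)] assms(2) by auto
  then have "covers ?L Y B \<longleftrightarrow> covers L Y B \<and> B <= T" by (rule covers_restrict)
  moreover have "covers L Y B ==> Y <= B" by (auto simp: covers_def)
  ultimately show ?thesis using Suc.IH[of Y] True by blast
 next
  case False
  then show ?thesis using Suc.IH[of Y] by simp
 qed
 have "(covers ?L ^^ Suc n) A B \<longleftrightarrow> (\<exists>Y. (covers ?L ^^ n) A Y \<and> covers ?L Y B)"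
  by (simp add: relcompp_apply)
 also have "\<dots> \<longleftrightarrow> (\<exists>Y. (covers L ^^ n) A Y \<and> covers L Y B \<and> B <= T)"
  by (simp only: step)
 also have "\<dots> \<longleftrightarrow> (covers L ^^ Suc n) A B \<and> B <= T"
  by (auto simp: relcompp_apply)
 finally show ?case .
qed

lemma lat_iso_Int:
 assumes "modular_sets L sp z" "modular_sets L' sp' z'" and h: "lat_iso L L' h" and L: "A \<in> L" "B \<in> L"
 shows "h (A \<inter> B) = h A \<inter> h B"
proof
 interpret L: modular_sets L sp z by fact
 interpret L': modular_sets L' sp' z' by fact
 show "h (A \<inter> B) <= h A \<inter> h B"
  using lat_iso_le[OF h L.inf_closed[OF L] L(1)] lat_iso_le[OF h L.inf_closed[OF L] L(2)] by simp
 have "h A \<inter> h B \<in> L'" using L lat_iso_in[OF h] by simp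
 then obtain X where X: "X \<in> L" "h A \<inter> h B = h X" using lat_iso_surj[OF h] by blast
 then have "X <= A \<inter> B" using lat_iso_le[OF h X(1) L(1)] lat_iso_le[OF h X(1) L(2)] by blast
 then show "h A \<inter> h B <= h (A \<inter> B)" using X L lat_iso_le[OF h] by simp
qed

lemma lat_iso_sup:
 assumes "modular_sets L sp z" "modular_sets L' sp' z'" and h: "lat_iso L L' h" and L: "A \<in> L" "B \<in> L"
 shows "h (sp A B) = sp' (h A) (h B)"
proof
 interpret L: modular_sets L sp z by fact
 interpret L': modular_sets L' sp' z' by fact
 note hL = lat_iso_in[OF h L(1)] lat_iso_in[OF h L(2)]
 have "sp' (h A) (h B) \<in> L'" using hL by simp
 then obtain X where X: "X \<in> L" "sp' (h A) (h B) = h X" using lat_iso_surj[OF h] by blast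
 have "A <= X" "B <= X"
  using L'.sup_upper1[OF hL] L'.sup_upper2[OF hL] X lat_iso_le[OF h L(1) X(1)] lat_iso_le[OF h L(2) X(1)] by auto
 then show "h (sp A B) <= sp' (h A) (h B)"
  using X L lat_iso_le[OF h, of "sp A B" X] L.sup_least[of A B X] by simp
 show "sp' (h A) (h B) <= h (sp A B)"
  using hL L L.sup_upper1[OF L] L.sup_upper2[OF L] lat_iso_in[OF h, of "sp A B"]
  by (intro L'.sup_least) (simp_all add: lat_iso_le[OF h])
qed

lemma lat_iso_bot:
 assumes "modular_sets L sp z" "modular_sets L' sp' z'" and h: "lat_iso L L' h"
 shows "h z = z'"
proof -
 interpret L: modular_sets L sp z by fact
 interpret L': modular_sets L' sp' z' by fact
 obtain X where "X \<in> L" "z' = h X" using lat_iso_surj[OF h L'.bot_closed] by blast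
 then have "h z <= z'" using lat_iso_le[OF h L.bot_closed] L.bot_least by simp
 then show ?thesis using L'.eq_bot lat_iso_in[OF h] by simp
qed

lemma lat_iso_inverse:
 assumes h: "lat_iso L L' h"
 shows "lat_iso L' L (inv_into L h)"
proof -
 have inj: "inj_on h L" using lat_iso_eq[OF h] by (auto intro: inj_onI)
 have im: "h ` L = L'" using h by (simp add: lat_iso_def)
 have i: "inv_into L h Y \<in> L" "h (inv_into L h Y) = Y" if "Y \<in> L'" for Y
  using that im inv_into_into[of Y h L] f_inv_into_f[of Y h L] by simp_all
 have "inv_into L h ` L' = L" using inj im by (auto simp: inj_on_def image_iff inv_into_f_f)
 moreover have "inv_into L h A <= inv_into L h B \<longleftrightarrow> A <= B" if "A \<in> L'" "B \<in> L'" for A B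
  using lat_iso_le[OF h i(1)[OF that(1)] i(1)[OF that(2)]] i(2) that by simp
 ultimately show ?thesis by (simp add: lat_iso_def)
qed

lemma lat_iso_uniform:
 assumes m: "modular_sets L sp z" "modular_sets L' sp' z'" and h: "lat_iso L L' h" and U: "uniform_in L z U"
 shows "uniform_in L' z' (h U)"
proof -
 interpret L: modular_sets L sp z by fact
 have UL: "U \<in> L" "U ~= z" using U by (auto simp: uniform_in_def)
 have "A \<inter> B ~= z'" if AB: "A \<in> L'" "B \<in> L'" "A <= h U" "B <= h U" "A ~= z'" "B ~= z'" for A B
 proof -
  obtain X Y where XY: "X \<in> L" "Y \<in> L" "A = h X" "B = h Y" using lat_iso_surj[OF h AB(1)] lat_iso_surj[OF h AB(2)] by auto
  have "X <= U" "Y <= U" "X ~= z" "Y ~= z" using that XY UL lat_iso_le[OF h] lat_iso_bot[OF m h] by auto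
  then have "X \<inter> Y ~= z" using U XY by (auto simp: uniform_in_def)
  then show ?thesis
   using XY lat_iso_Int[OF m h XY(1,2)] lat_iso_eq[OF h, of "X \<inter> Y" z] lat_iso_bot[OF m h] by simp
 qed
 moreover have "h U ~= z'" using UL lat_iso_eq[OF h UL(1) L.bot_closed] lat_iso_bot[OF m h] by simp
 ultimately show ?thesis using lat_iso_in[OF h UL(1)] by (simp add: uniform_in_def)
qed

lemma lat_iso_essential:
 assumes m: "modular_sets L sp z" "modular_sets L' sp' z'" and h: "lat_iso L L' h" and E: "essential_in L z E T"
 shows "essential_in L' z' (h E) (h T)"
proof -
 interpret L: modular_sets L sp z by fact
 have EL: "E \<in> L" "T \<in> L" "E <= T" using E by (auto simp: essential_in_def)
 have "A \<inter> h E ~= z'" if A: "A \<in> L'" "A <= h T" "A ~= z'" for A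
 proof -
  obtain X where X: "X \<in> L" "A = h X" using lat_iso_surj[OF h A(1)] by auto
  have "X <= T" "X ~= z" using that X EL lat_iso_le[OF h] lat_iso_bot[OF m h] by auto
  then have "X \<inter> E ~= z" using E X by (auto simp: essential_in_def)
  then show ?thesis
   using X EL lat_iso_Int[OF m h X(1) EL(1)] lat_iso_eq[OF h, of "X \<inter> E" z] lat_iso_bot[OF m h] by simp
 qed
 then show ?thesis using lat_iso_in[OF h] lat_iso_le[OF h] EL by (simp add: essential_in_def)
qed

lemma lat_iso_uniform_sum:
 assumes m: "modular_sets L sp z" "modular_sets L' sp' z'" and h: "lat_iso L L' h"
 shows "uniform_sum L sp z n X ==> uniform_sum L' sp' z' n (h X)"
proof (induction rule: uniform_sum.induct)
 case uniform_sum_0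
 show ?case unfolding lat_iso_bot[OF m h] by (rule uniform_sum.uniform_sum_0)
next
 case (uniform_sum_Suc n X U)
 interpret L: modular_sets L sp z by fact
 have L: "X \<in> L" "U \<in> L"
  using L.uniform_sum_mem uniform_sum_Suc.hyps by (auto simp: uniform_in_def)
 have "h X \<inter> h U = z'"
  using uniform_sum_Suc.hyps lat_iso_Int[OF m h L] lat_iso_bot[OF m h] by simp
 then have "uniform_sum L' sp' z' (Suc n) (sp' (h X) (h U))"
  by (intro uniform_sum.uniform_sum_Suc uniform_sum_Suc.IH lat_iso_uniform[OF m h] uniform_sum_Suc.hyps)
 then show ?case by (simp add: lat_iso_sup[OF m h L])
qed

lemma lat_iso_acc:
 assumes h: "lat_iso L L' h" and L: "A \<in> L" "B \<in> L" and acc: "acc_between L A B"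
 shows "acc_between L' (h A) (h B)"
proof -
 note i = lat_iso_inverse[OF h]
 have 1: "inv_into L h (h X) = X" if "X \<in> L" for X
  using that lat_iso_eq[OF h] by (intro inv_into_f_f) (auto intro: inj_onI)
 have hL: "h A \<in> L'" "h B \<in> L'" using lat_iso_in[OF h] L by auto
 show ?thesis
 proof (rule acc_between_strict_embed[OF acc, where h = "inv_into L h"])
  fix X assume X: "X \<in> L'" "h A <= X" "X <= h B"
  show "inv_into L h X \<in> L \<and> A <= inv_into L h X \<and> inv_into L h X <= B"
   using lat_iso_in[OF i X(1)] lat_iso_le[OF i hL(1) X(1)] lat_iso_le[OF i X(1) hL(2)] X 1 L by simp
 next
  fix X Y assume X: "X \<in> L'" "Y \<in> L'" "X <= Y"
  then show "inv_into L h X <= inv_into L h Y" using lat_iso_le[OF i] by simp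
 next
  fix X Y assume X: "X \<in> L'" "Y \<in> L'" "inv_into L h X = inv_into L h Y"
  then show "X = Y" using lat_iso_eq[OF i] by simp
 qed
qed

section \<open>Homomorphisms and submodule lattices\<close>

text \<open>The correspondence theorem for an arbitrary homomorphism: a submodule above the kernel
  is the full preimage of its image (\<open>vim\<close>), and a submodule below the image is the
  image of its preimage.\<close>

lemma hom_lat_iso:
 assumes M: "right_module R M" and N: "right_module R N" and f: "f \<in> rhom R M N"
 shows "lat_iso {X \<in> submods R M. hker M N f <= X} {Y \<in> submods R N. Y <= f ` carrier M} ((`) f)"
proof -
 interpret M: right_module R M by fact
 interpret N: right_module R N by fact
 have vim: "{x \<in> carrier M. f x \<in> f ` X} = X" if X: "submodule X R M" "hker M N f <= X" for X
 proof -
  note X' = M.submoduleD[OF X(1)]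
  have "x \<in> X" if x: "x \<in> carrier M" "y \<in> X" "f x = f y" for x y
  proof -
   have y: "y \<in> carrier M" using x X' by auto
   have "f (x \<ominus>\<^bsub>M\<^esub> y) = \<zero>\<^bsub>N\<^esub>"
    using rhom_minus[OF M N f x(1) y] x(3) rhom_closed[OF f y] by (simp add: N.M.minus_eq N.M.r_neg)
   then have "x \<ominus>\<^bsub>M\<^esub> y \<in> X" using X(2) x y by auto
   then have "x \<ominus>\<^bsub>M\<^esub> y \<oplus>\<^bsub>M\<^esub> y \<in> X" using X'(3) x by auto
   then show ?thesis using x(1) y by (simp add: M.M.minus_eq M.M.a_assoc M.M.l_neg)
  qed
  then show ?thesis using X'(1) by auto
 qed
 show ?thesis
  unfolding lat_iso_def
 proof (intro conjI ballI)
  show "(`) f ` {X \<in> submods R M. hker M N f <= X} = {Y \<in> submods R N. Y <= f ` carrier M}"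
  proof (intro equalityI subsetI)
   fix Y assume "Y \<in> (`) f ` {X \<in> submods R M. hker M N f <= X}"
   then obtain X where X: "Y = f ` X" "submodule X R M" by auto
   then show "Y \<in> {Y \<in> submods R N. Y <= f ` carrier M}"
    using submodule_image[OF M N f X(2)] M.submoduleD(1)[OF X(2)] by auto
  next
   fix Y assume "Y \<in> {Y \<in> submods R N. Y <= f ` carrier M}"
   then have Y: "submodule Y R N" "Y <= f ` carrier M" by auto
   let ?X = "{x \<in> carrier M. f x \<in> Y}"
   have "submodule ?X R M" by (rule submodule_vimage[OF M N f Y(1)])
   moreover have "hker M N f <= ?X" using N.submoduleD(2)[OF Y(1)] by auto
   moreover have "f ` ?X = Y" using Y(2) by auto
   ultimately show "Y \<in> (`) f ` {X \<in> submods R M. hker M N f <= X}" by (auto intro!: image_eqI[of _ _ ?X])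
  qed
 next
  fix A B assume "A \<in> {X \<in> submods R M. hker M N f <= X}" "B \<in> {X \<in> submods R M. hker M N f <= X}"
  then have A: "submodule A R M" "hker M N f <= A" and B: "submodule B R M" "hker M N f <= B" by auto
  have "A <= B" if "f ` A <= f ` B"
  proof -
   have "A <= {x \<in> carrier M. f x \<in> f ` B}" using that M.submoduleD(1)[OF A(1)] by auto
   then show ?thesis using vim[OF B] by simp
  qed
  then show "(f ` A <= f ` B) = (A <= B)" by blast
 qed
qed

lemma riso_lat_iso:
 assumes M: "right_module R M" and N: "right_module R N" and f: "f \<in> riso R M N"
 shows "lat_iso (submods R M) (submods R N) ((`) f)"
proof -
 interpret M: right_module R M by fact
 interpret N: right_module R N by fact
 have f': "f \<in> rhom R M N" "inj_on f (carrier M)" "f ` carrier M = carrier N"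
  using f by (auto simp: riso_def bij_betw_def)
 have "hker M N f = nul M" using rhom_inj_iff[OF M N f'(1)] f'(2) by simp
 then have 1: "{X \<in> submods R M. hker M N f <= X} = submods R M" using M.submoduleD(2) by auto
 have 2: "{Y \<in> submods R N. Y <= f ` carrier M} = submods R N" using N.submoduleD(1) f'(3) by auto
 show ?thesis using hom_lat_iso[OF M N f'(1)] unfolding 1 2 .
qed

section \<open>Quotient modules\<close>

context right_module
begin

lemma abelian_subgroup_submodule: "submodule N R M ==> abelian_subgroup N M"
 by (intro abelian_subgroupI3 additive_subgroup.intro submodule.axioms(1) M.abelian_group_axioms)

text \<open>\<open>quot_module\<close> defines the action by a union over all elements of a coset,
  which avoids choosing a representative. The union collapses to one coset because \<open>N\<close>
  is closed under the action.\<close>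

lemma quot_smult:
 assumes N: "submodule N R M" and a: "a \<in> carrier R" "x \<in> carrier M"
 shows "a \<odot>\<^bsub>quot_module M N\<^esub> (N +>\<^bsub>M\<^esub> x) = N +>\<^bsub>M\<^esub> (a \<odot>\<^bsub>M\<^esub> x)"
proof -
 interpret N: abelian_subgroup N M by (rule abelian_subgroup_submodule[OF N])
 note N' = submoduleD[OF N]
 have "N +>\<^bsub>M\<^esub> (a \<odot>\<^bsub>M\<^esub> y) = N +>\<^bsub>M\<^esub> (a \<odot>\<^bsub>M\<^esub> x)" if "y \<in> N +>\<^bsub>M\<^esub> x" for y
 proof -
  obtain n where n: "n \<in> N" "y = n \<oplus>\<^bsub>M\<^esub> x" using \<open>y \<in> N +>\<^bsub>M\<^esub> x\<close> by (auto simp: a_r_coset_def')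
  have "a \<odot>\<^bsub>M\<^esub> y = a \<odot>\<^bsub>M\<^esub> n \<oplus>\<^bsub>M\<^esub> a \<odot>\<^bsub>M\<^esub> x" using n a N' by (simp add: smult_r_distr subset_eq)
  then have "a \<odot>\<^bsub>M\<^esub> y \<in> N +>\<^bsub>M\<^esub> (a \<odot>\<^bsub>M\<^esub> x)" using n a N'(4) by (auto simp: a_r_coset_def')
  then show ?thesis using N.a_repr_independence'[of "a \<odot>\<^bsub>M\<^esub> y" "a \<odot>\<^bsub>M\<^esub> x"] a by simp
 qed
 moreover have "x \<in> N +>\<^bsub>M\<^esub> x" using N.a_rcos_self a by simp
 ultimately have "(\<Union>y\<in>N +>\<^bsub>M\<^esub> x. N +>\<^bsub>M\<^esub> (a \<odot>\<^bsub>M\<^esub> y)) = N +>\<^bsub>M\<^esub> (a \<odot>\<^bsub>M\<^esub> x)" by blast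
 then show ?thesis by (simp add: quot_module_def)
qed

lemma quot_carrier: "carrier (quot_module M N) = (\<lambda>x. N +>\<^bsub>M\<^esub> x) ` carrier M"
 by (auto simp: quot_module_def A_RCOSETS_def')

lemma quot_add:
 assumes N: "submodule N R M" and "x \<in> carrier M" "y \<in> carrier M"
 shows "(N +>\<^bsub>M\<^esub> x) \<oplus>\<^bsub>quot_module M N\<^esub> (N +>\<^bsub>M\<^esub> y) = N +>\<^bsub>M\<^esub> (x \<oplus>\<^bsub>M\<^esub> y)"
proof -
 interpret N: abelian_subgroup N M by (rule abelian_subgroup_submodule[OF N])
 show ?thesis using N.a_rcos_sum assms by (simp add: quot_module_def)
qed

lemma right_module_quot:
 assumes N: "submodule N R M"
 shows "right_module R (quot_module M N)"
proof -
 interpret N: abelian_subgroup N M by (rule abelian_subgroup_submodule[OF N])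
 interpret Q: comm_group "M A_Mod N" by (rule N.a_factorgroup_is_comm_group)
 have Q: "carrier (M A_Mod N) = carrier (quot_module M N)" "mult (M A_Mod N) = add (quot_module M N)"
  "\<one>\<^bsub>M A_Mod N\<^esub> = \<zero>\<^bsub>quot_module M N\<^esub>"
  by (simp_all add: quot_module_def A_FactGroup_def')
 have "abelian_group (quot_module M N)"
  by (rule abelian_groupI)
   (use Q.m_closed Q.one_closed Q.m_assoc Q.m_comm Q.l_one Q.l_inv_ex in "unfold Q, simp_all")
 moreover have "right_module_axioms R (quot_module M N)"
  by (rule right_module_axioms.intro)
   (auto simp: quot_carrier quot_smult[OF N] quot_add[OF N] smult_l_distr smult_r_distr smult_assoc)
 ultimately show ?thesis by (intro right_module.intro R.ring_axioms)
qed

definition "quot_map N = (\<lambda>x\<in>carrier M. N +>\<^bsub>M\<^esub> x)"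

lemma quot_map:
 assumes N: "submodule N R M"
 shows "quot_map N \<in> rhom R M (quot_module M N)"
  "quot_map N ` carrier M = carrier (quot_module M N)"
  "hker M (quot_module M N) (quot_map N) = N"
proof -
 interpret N: abelian_subgroup N M by (rule abelian_subgroup_submodule[OF N])
 show "quot_map N \<in> rhom R M (quot_module M N)"
  unfolding quot_map_def
  by (rule rhom_restrictI[OF right_module_axioms]) (auto simp: quot_carrier quot_smult[OF N] quot_add[OF N])
 show "quot_map N ` carrier M = carrier (quot_module M N)"
  by (simp add: quot_map_def quot_carrier)
 have "N +>\<^bsub>M\<^esub> x = N \<longleftrightarrow> x \<in> N" if "x \<in> carrier M" for x
  using that N.a_rcos_self[of x] N.a_rcos_const[of x] by auto
 then show "hker M (quot_module M N) (quot_map N) = N"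
  using submoduleD(1)[OF N] by (auto simp: quot_map_def quot_module_def)
qed

lemma simple_iff: "simple_module R M \<longleftrightarrow> covers (submods R M) (nul M) (carrier M)"
 using right_module_axioms submoduleD(1,2)
 unfolding simple_module_def covers_def by auto

lemma surj_simple_iff:
 assumes N: "right_module R N" and f: "f \<in> rhom R M N" "f ` carrier M = carrier N"
 shows "simple_module R N \<longleftrightarrow> covers (submods R M) (hker M N f) (carrier M)"
proof -
 interpret N: right_module R N by fact
 let ?L = "{X \<in> submods R M. hker M N f <= X}"
 have iso: "lat_iso ?L (submods R N) ((`) f)"
  using hom_lat_iso[OF right_module_axioms N f(1)] f(2) N.submoduleD(1) by (simp add: Collect_conj_eq Int_absorb2 subset_eq)
 have k: "submodule (hker M N f) R M" by (rule submodule_ker[OF right_module_axioms N f(1)])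
 have "f ` hker M N f = nul N" using rhom_zero[OF right_module_axioms N f(1)] by force
 then have "simple_module R N \<longleftrightarrow> covers (submods R N) (f ` hker M N f) (f ` carrier M)"
  using N.simple_iff f(2) by simp
 also have "\<dots> \<longleftrightarrow> covers ?L (hker M N f) (carrier M)"
  by (rule lat_iso_covers[OF iso]) (use k in auto)
 also have "?L = {X \<in> submods R M. hker M N f <= X \<and> X <= carrier M}" using submoduleD(1) by auto
 also have "covers \<dots> (hker M N f) (carrier M) \<longleftrightarrow> covers (submods R M) (hker M N f) (carrier M)"
  using covers_restrict[of "hker M N f" "hker M N f" "submods R M" "carrier M" "carrier M"] by simp
 finally show ?thesis .
qed

lemma simple_quot_iff:
 assumes A: "submodule A R M" and B: "submodule B R M" and AB: "A <= B"
 shows "simple_module R (quot_module (sub_mod M B) A) \<longleftrightarrow> covers (submods R M) A B"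
proof -
 interpret B: right_module R "sub_mod M B" by (rule right_module_sub[OF B])
 have A': "submodule A R (sub_mod M B)" using submodule_sub_iff[OF B] A AB by simp
 have L: "submods R (sub_mod M B) = {X \<in> submods R M. nul M <= X \<and> X <= B}"
  using submodule_sub_iff[OF B] submoduleD(2) by auto
 have "simple_module R (quot_module (sub_mod M B) A) \<longleftrightarrow> covers (submods R (sub_mod M B)) A B"
  using B.surj_simple_iff[OF B.right_module_quot[OF A'] B.quot_map(1,2)[OF A']] B.quot_map(3)[OF A'] by simp
 then show ?thesis unfolding L using covers_restrict[of "nul M" A "submods R M" B B] submoduleD(2)[OF A] by simp
qed

text \<open>A list of \<open>Suc n\<close> submodules has \<open>n\<close> factors, and a factor is
  simple exactly when its two ends form a cover. This hands lengths over to the lattice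
  results.\<close>

lemma comp_series_iff:
 "(\<exists>Ns. comp_series R M Ns \<and> length Ns = Suc n) \<longleftrightarrow> chain R M n (nul M) (carrier M)"
proof
 assume "\<exists>Ns. comp_series R M Ns \<and> length Ns = Suc n"
 then obtain Ns where Ns: "comp_series R M Ns" "length Ns = Suc n" by blast
 have "Ns ! 0 = nul M" "Ns ! n = carrier M"
  using Ns by (auto simp: comp_series_def hd_conv_nth last_conv_nth)
 moreover have "covers (submods R M) (Ns ! i) (Ns ! Suc i)" if "i < n" for i
 proof -
  have "submodule (Ns ! i) R M" "submodule (Ns ! Suc i) R M" "Ns ! i <= Ns ! Suc i"
   "simple_module R (quot_module (sub_mod M (Ns ! Suc i)) (Ns ! i))"
   using Ns that by (auto simp: comp_series_def)
  then show ?thesis using simple_quot_iff by blast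
 qed
 ultimately show "chain R M n (nul M) (carrier M)"
  unfolding relpowp_fun_conv by blast
next
 assume "chain R M n (nul M) (carrier M)"
 then obtain f where f: "f 0 = nul M" "f n = carrier M" "!!i. i < n ==> covers (submods R M) (f i) (f (Suc i))"
  unfolding relpowp_fun_conv by blast
 have sub: "submodule (f i) R M" if "i \<le> n" for i
  using that f(1) f(3)[of "i - 1"] by (cases i) (auto simp: covers_def)
 let ?Ns = "map f [0..<Suc n]"
 have "comp_series R M ?Ns"
  unfolding comp_series_def
 proof (intro conjI allI impI ballI)
  fix i assume i: "Suc i < length ?Ns"
  then have *: "?Ns ! i = f i" "?Ns ! Suc i = f (Suc i)" "i < n" by (auto simp del: upt_Suc)
  show "?Ns ! i <= ?Ns ! Suc i" using f(3)[OF *(3)] unfolding * by (auto simp: covers_def)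
  show "simple_module R (quot_module (sub_mod M (?Ns ! Suc i)) (?Ns ! i))"
   using f(3)[OF *(3)] simple_quot_iff[of "f i" "f (Suc i)"] unfolding *(1,2) by (auto simp: covers_def)
 qed (use f sub in "auto simp: hd_map last_map simp del: upt_Suc")
 then show "\<exists>Ns. comp_series R M Ns \<and> length Ns = Suc n" by (intro exI[of _ ?Ns]) auto
qed

lemma surj_covers_chain_iff:
 assumes N: "right_module R N" and f: "f \<in> rhom R M N" "f ` carrier M = carrier N"
  and A: "submodule A R N" and X: "X = {x \<in> carrier M. f x \<in> A}"
 shows "chain R N n A (carrier N) \<longleftrightarrow> chain R M n X (carrier M)"
proof -
 interpret N: right_module R N by fact
 let ?L = "{X \<in> submods R M. hker M N f <= X}"
 have iso: "lat_iso ?L (submods R N) ((`) f)"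
  using hom_lat_iso[OF right_module_axioms N f(1)] f(2) N.submoduleD(1) by (simp add: Collect_conj_eq Int_absorb2 subset_eq)
 have sX: "submodule X R M" unfolding X by (rule submodule_vimage[OF right_module_axioms N f(1) A])
 have kX: "hker M N f <= X" unfolding X using N.submoduleD(2)[OF A] by auto
 have fX: "f ` X = A" unfolding X using f(2) N.submoduleD(1)[OF A] by (auto simp: image_iff)
 have "chain R N n A (carrier N) \<longleftrightarrow> chain R N n (f ` X) (f ` carrier M)"
  using fX f(2) by simp
 also have "\<dots> \<longleftrightarrow> (covers ?L ^^ n) X (carrier M)"
  by (rule lat_iso_covers_chain[OF iso]) (use sX kX submoduleD(1) in auto)
 also have "?L = {X \<in> submods R M. hker M N f <= X \<and> X <= carrier M}" using submoduleD(1) by auto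
 also have "(covers \<dots> ^^ n) X (carrier M) \<longleftrightarrow> chain R M n X (carrier M)"
  using covers_chain_restrict[OF modular_submods kX, of "carrier M"] sX submoduleD(1)[OF sX] by simp
 finally show ?thesis .
qed

lemma quot_covers_chain_iff:
 assumes N: "submodule N R M"
 shows "chain R (quot_module M N) n (nul (quot_module M N)) (carrier (quot_module M N)) \<longleftrightarrow>
  chain R M n N (carrier M)"
 using surj_covers_chain_iff[OF right_module_quot[OF N] quot_map(1,2)[OF N]
   right_module.submodule_zero[OF right_module_quot[OF N]], of N n] quot_map(3)[OF N] by simp

lemma mod_length_quot:
 assumes N: "submodule N R M"
 shows "mod_length R (quot_module M N) = (THE n. chain R M n N (carrier M))"
 unfolding mod_length_def right_module.comp_series_iff[OF right_module_quot[OF N]] quot_covers_chain_iff[OF N] ..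

end

lemma finite_length_iff:
 "finite_length R M \<longleftrightarrow> right_module R M \<and> (\<exists>n. chain R M n (nul M) (carrier M))"
proof -
 have "(\<exists>Ns. comp_series R M Ns) \<longleftrightarrow> (\<exists>n Ns. comp_series R M Ns \<and> length Ns = Suc n)"
  by (metis comp_series_def length_0_conv not0_implies_Suc)
 then show ?thesis unfolding finite_length_def using right_module.comp_series_iff by metis
qed

section \<open>Uniform dimension: indexed families against inductive direct sums\<close>

section \<open>Uniform dimension of modules\<close>

context right_module
begin

lemma uniform_submodule_iff: "uniform_submodule R M U \<longleftrightarrow> uniform_in (submods R M) (nul M) U"
 by (auto simp: uniform_submodule_def uniform_in_def)

lemma essential_submodule_iff: "essential_submodule R M E \<longleftrightarrow> ess_in R M E (carrier M)"
 using submoduleD(1) by (auto simp: essential_submodule_def essential_in_def)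

lemma sum_family_Suc:
 assumes "!!i. i < Suc n ==> U i <= carrier M"
 shows "(\<lambda>x. finsum M x {..<Suc n}) ` (\<Pi> i\<in>{..<Suc n}. U i) =
  (\<lambda>x. finsum M x {..<n}) ` (\<Pi> i\<in>{..<n}. U i) <+>\<^bsub>M\<^esub> U n"
proof (intro equalityI subsetI)
 fix y assume "y \<in> (\<lambda>x. finsum M x {..<Suc n}) ` (\<Pi> i\<in>{..<Suc n}. U i)"
 then obtain x where x: "x \<in> (\<Pi> i\<in>{..<Suc n}. U i)" "y = finsum M x {..<Suc n}" by auto
 have "x i \<in> carrier M" if "i < Suc n" for i using x(1) assms[OF that] that by (auto simp: Pi_iff)
 then have "x \<in> {..<n} \<rightarrow> carrier M" "x n \<in> carrier M" by auto
 then have "y = finsum M x {..<n} \<oplus>\<^bsub>M\<^esub> x n"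
  using x by (simp add: lessThan_Suc M.finsum_insert M.a_comm)
 then show "y \<in> (\<lambda>x. finsum M x {..<n}) ` (\<Pi> i\<in>{..<n}. U i) <+>\<^bsub>M\<^esub> U n"
 proof -
  have "x \<in> (\<Pi> i\<in>{..<n}. U i)" "x n \<in> U n" using x(1) by auto
  note imageI[OF this(1), of "\<lambda>x. finsum M x {..<n}"] this(2)
  then show ?thesis using \<open>y = _ \<oplus>\<^bsub>M\<^esub> _\<close> unfolding set_add_iff by blast
 qed
next
 fix y assume "y \<in> (\<lambda>x. finsum M x {..<n}) ` (\<Pi> i\<in>{..<n}. U i) <+>\<^bsub>M\<^esub> U n"
 then obtain x u where x: "x \<in> (\<Pi> i\<in>{..<n}. U i)" "u \<in> U n" "y = finsum M x {..<n} \<oplus>\<^bsub>M\<^esub> u"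
  unfolding set_add_iff by auto
 let ?x = "x(n := u)"
 have "x i \<in> carrier M" if "i < n" for i using x(1) assms[of i] that by (auto simp: Pi_iff)
 then have c: "x \<in> {..<n} \<rightarrow> carrier M" "u \<in> carrier M" using x(2) assms[of n] by auto
 have "finsum M ?x {..<n} = finsum M x {..<n}" using c by (intro M.finsum_cong') auto
 moreover have "finsum M ?x {..<Suc n} = ?x n \<oplus>\<^bsub>M\<^esub> finsum M ?x {..<n}"
  unfolding lessThan_Suc using c by (intro M.finsum_insert) auto
 ultimately have "finsum M ?x {..<Suc n} = y" using x c by (simp add: M.a_comm)
 moreover have "?x \<in> (\<Pi> i\<in>{..<Suc n}. U i)" using x by (auto simp: Pi_iff less_Suc_eq)
 ultimately show "y \<in> (\<lambda>x. finsum M x {..<Suc n}) ` (\<Pi> i\<in>{..<Suc n}. U i)" by (metis image_eqI)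
qed

definition independent_uniform :: "nat => (nat => 'm set) => bool" where
 "independent_uniform n U \<longleftrightarrow> (\<forall>i<n. uniform_submodule R M (U i)) \<and>
  (\<forall>x \<in> (\<Pi> i\<in>{..<n}. U i). finsum M x {..<n} = \<zero>\<^bsub>M\<^esub> --> (\<forall>i<n. x i = \<zero>\<^bsub>M\<^esub>))"

lemma uniform_subset: "uniform_submodule R M U ==> U <= carrier M"
 using submoduleD(1) by (auto simp: uniform_submodule_def)

lemma independent_uniform_Suc:
 assumes U: "!!i. i < Suc n ==> uniform_submodule R M (U i)"
  and sub: "submodule ((\<lambda>x. finsum M x {..<n}) ` (\<Pi> i\<in>{..<n}. U i)) R M"
 shows "independent_uniform (Suc n) U \<longleftrightarrow> independent_uniform n U \<and>
  (\<lambda>x. finsum M x {..<n}) ` (\<Pi> i\<in>{..<n}. U i) \<inter> U n = nul M" (is "_ \<longleftrightarrow> _ \<and> ?S \<inter> _ = _")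
proof -
 have Uc: "U i <= carrier M" if "i < Suc n" for i using uniform_subset U that by simp
 have Un: "submodule (U n) R M" using U by (auto simp: uniform_submodule_def)
 have fs: "finsum M x {..<Suc n} = x n \<oplus>\<^bsub>M\<^esub> finsum M x {..<n}" if "x \<in> (\<Pi> i\<in>{..<n}. U i)" "x n \<in> U n" for x
 proof -
  have "x i \<in> carrier M" if "i < Suc n" for i
   using \<open>x \<in> _\<close> \<open>x n \<in> _\<close> Uc[OF that] that by (cases "i = n") (auto simp: Pi_iff)
  then show ?thesis unfolding lessThan_Suc by (intro M.finsum_insert) auto
 qed
 have cl: "finsum M x {..<n} \<in> carrier M" if "x \<in> (\<Pi> i\<in>{..<n}. U i)" for x
 proof -
  have "x i \<in> carrier M" if "i < n" for i
   using \<open>x \<in> _\<close> Uc[of i] that by (auto simp: Pi_iff)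
  then show ?thesis by (intro M.finsum_closed) auto
 qed
 show ?thesis
 proof
  assume ind: "independent_uniform (Suc n) U"
  have ind': "\<forall>i<Suc n. x i = \<zero>\<^bsub>M\<^esub>" if "x \<in> (\<Pi> i\<in>{..<Suc n}. U i)" "finsum M x {..<Suc n} = \<zero>\<^bsub>M\<^esub>" for x
   using ind that unfolding independent_uniform_def by blast
  have upd: "x(n := v) \<in> (\<Pi> i\<in>{..<Suc n}. U i)" "finsum M (x(n := v)) {..<Suc n} = v \<oplus>\<^bsub>M\<^esub> finsum M x {..<n}"
   if "x \<in> (\<Pi> i\<in>{..<n}. U i)" "v \<in> U n" for x v
  proof -
   show "x(n := v) \<in> (\<Pi> i\<in>{..<Suc n}. U i)" using that by (auto simp: Pi_iff less_Suc_eq)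
   have "finsum M (x(n := v)) {..<n} = finsum M x {..<n}"
   proof -
    have "x i \<in> carrier M" if "i < n" for i
     using \<open>x \<in> _\<close> Uc[of i] that by (auto simp: Pi_iff)
    then show ?thesis by (intro M.finsum_cong') auto
   qed
   moreover have "x(n := v) \<in> (\<Pi> i\<in>{..<n}. U i)" using that by (auto simp: Pi_iff)
   ultimately show "finsum M (x(n := v)) {..<Suc n} = v \<oplus>\<^bsub>M\<^esub> finsum M x {..<n}"
    using fs[of "x(n := v)"] that by simp
  qed
  have "\<forall>i<n. x i = \<zero>\<^bsub>M\<^esub>" if x: "x \<in> (\<Pi> i\<in>{..<n}. U i)" "finsum M x {..<n} = \<zero>\<^bsub>M\<^esub>" for x
  proof -
   have "\<zero>\<^bsub>M\<^esub> \<in> U n" using submoduleD(2)[OF Un] .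
   from ind'[OF upd(1)[OF x(1) this]] upd(2)[OF x(1) this] x(2)
   have "\<forall>i<Suc n. (x(n := \<zero>\<^bsub>M\<^esub>)) i = \<zero>\<^bsub>M\<^esub>" by simp
   then show ?thesis by (auto simp: less_Suc_eq split: if_splits)
  qed
  then have 1: "independent_uniform n U" using U by (auto simp: independent_uniform_def)
  have "y = \<zero>\<^bsub>M\<^esub>" if "y \<in> ?S" "y \<in> U n" for y
  proof -
   obtain x where x: "x \<in> (\<Pi> i\<in>{..<n}. U i)" "y = finsum M x {..<n}" using \<open>y \<in> ?S\<close> by auto
   \<comment> \<open>Completing \<open>x\<close> by -y at index \<open>n\<close> gives a family with
     sum zero, so independence makes y vanish.\<close>
   have y: "y \<in> carrier M" "\<ominus>\<^bsub>M\<^esub> y \<in> U n" using submoduleD(1,5)[OF Un] that by auto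
   from ind'[OF upd(1)[OF x(1) y(2)]] upd(2)[OF x(1) y(2)] x(2) y(1)
   have "\<forall>i<Suc n. (x(n := \<ominus>\<^bsub>M\<^esub> y)) i = \<zero>\<^bsub>M\<^esub>" by (simp add: M.l_neg)
   then have "\<ominus>\<^bsub>M\<^esub> y = \<zero>\<^bsub>M\<^esub>" by auto
   then show ?thesis using y by (metis M.r_neg M.r_zero)
  qed
  then have "?S \<inter> U n = nul M" using submoduleD(2)[OF Un] submoduleD(2)[OF sub] by blast
  then show "independent_uniform n U \<and> ?S \<inter> U n = nul M" using 1 by simp
 next
  assume a: "independent_uniform n U \<and> ?S \<inter> U n = nul M"
  have "\<forall>i<Suc n. x i = \<zero>\<^bsub>M\<^esub>" if x: "x \<in> (\<Pi> i\<in>{..<Suc n}. U i)" "finsum M x {..<Suc n} = \<zero>\<^bsub>M\<^esub>" for x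
  proof -
   have xn: "x \<in> (\<Pi> i\<in>{..<n}. U i)" "x n \<in> U n" using x by auto
   have c: "x n \<in> carrier M" using xn Uc by auto
   have e: "x n \<oplus>\<^bsub>M\<^esub> finsum M x {..<n} = \<zero>\<^bsub>M\<^esub>" using x(2) fs[OF xn] by simp
   then have "finsum M x {..<n} = \<ominus>\<^bsub>M\<^esub> x n"
    using c cl[OF xn(1)] by (metis M.a_comm M.minus_equality)
   then have "finsum M x {..<n} \<in> ?S \<inter> U n"
    using imageI[OF xn(1), of "\<lambda>x. finsum M x {..<n}"] submoduleD(5)[OF Un xn(2)] by simp
   then have 0: "finsum M x {..<n} = \<zero>\<^bsub>M\<^esub>" using a by auto
   then have "x n = \<zero>\<^bsub>M\<^esub>" using e c by simp
   moreover have "\<forall>i<n. x i = \<zero>\<^bsub>M\<^esub>" using a xn 0 by (auto simp: independent_uniform_def)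
   ultimately show ?thesis by (simp add: less_Suc_eq)
  qed
  then show "independent_uniform (Suc n) U" using U by (simp add: independent_uniform_def)
 qed
qed

text \<open>The bridge from \<open>udim\<close>, which is phrased with indexed families and
  vanishing sums, to the inductive sums for which the exchange argument was carried out.\<close>

lemma uniform_sum_iff:
 "unisum R M n X \<longleftrightarrow>
  (\<exists>U. independent_uniform n U \<and> X = (\<lambda>x. finsum M x {..<n}) ` (\<Pi> i\<in>{..<n}. U i))"
proof (induction n arbitrary: X)
 case 0
 have "unisum R M 0 X \<longleftrightarrow> X = nul M"
  by (subst uniform_sum.simps) auto
 then show ?case by (auto simp: independent_uniform_def)
next
 case (Suc n)
 interpret L: modular_sets "submods R M" "set_add M" "nul M" by (rule modular_submods)
 show ?case
 proof
  assume "unisum R M (Suc n) X"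
  then obtain X' V where V: "unisum R M n X'" "uniform_in (submods R M) (nul M) V"
   "X' \<inter> V = nul M" "X = X' <+>\<^bsub>M\<^esub> V" by (auto elim: uniform_sum.cases)
  then obtain U where U: "independent_uniform n U" "X' = (\<lambda>x. finsum M x {..<n}) ` (\<Pi> i\<in>{..<n}. U i)"
   using Suc by blast
  let ?U = "U(n := V)"
  have Pi: "(\<Pi> i\<in>{..<n}. ?U i) = (\<Pi> i\<in>{..<n}. U i)" by (auto simp: Pi_iff)
  have un: "uniform_submodule R M (?U i)" if "i < Suc n" for i
   using U(1) V(2) that by (auto simp: independent_uniform_def uniform_submodule_iff less_Suc_eq)
  have X': "submodule X' R M" using L.uniform_sum_mem[OF V(1)] by simp
  have "independent_uniform n ?U" using U(1) un Pi by (auto simp: independent_uniform_def)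
  then have "independent_uniform (Suc n) ?U"
   using independent_uniform_Suc[of n ?U] un X' U(2) V(3) Pi by simp
  moreover have "X = (\<lambda>x. finsum M x {..<Suc n}) ` (\<Pi> i\<in>{..<Suc n}. ?U i)"
   using sum_family_Suc[of n ?U] un uniform_subset V(4) U(2) Pi by simp
  ultimately show "\<exists>U. independent_uniform (Suc n) U \<and> X = (\<lambda>x. finsum M x {..<Suc n}) ` (\<Pi> i\<in>{..<Suc n}. U i)"
   by blast
 next
  assume "\<exists>U. independent_uniform (Suc n) U \<and> X = (\<lambda>x. finsum M x {..<Suc n}) ` (\<Pi> i\<in>{..<Suc n}. U i)"
  then obtain U where U: "independent_uniform (Suc n) U" "X = (\<lambda>x. finsum M x {..<Suc n}) ` (\<Pi> i\<in>{..<Suc n}. U i)"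
   by blast
  have un: "uniform_submodule R M (U i)" if "i < Suc n" for i using U(1) that by (auto simp: independent_uniform_def)
  let ?S = "(\<lambda>x. finsum M x {..<n}) ` (\<Pi> i\<in>{..<n}. U i)"
  have sub: "submodule ?S R M"
  proof -
   have "m \<le> n ==> submodule ((\<lambda>x. finsum M x {..<m}) ` (\<Pi> i\<in>{..<m}. U i)) R M" for m
   proof (induction m)
    case (Suc m)
    have "submodule (U m) R M" using un[of m] Suc by (auto simp: uniform_submodule_def)
    then show ?case
     using Suc un uniform_subset submodule_set_add by (subst sum_family_Suc) auto
   qed auto
   then show ?thesis by simp
  qed
  have ind: "independent_uniform n U" "?S \<inter> U n = nul M"
   using independent_uniform_Suc[OF un sub] U(1) by auto
  have "unisum R M n ?S" using Suc ind by blast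
  then have "unisum R M (Suc n) (?S <+>\<^bsub>M\<^esub> U n)"
   using ind un[of n] by (intro uniform_sum.uniform_sum_Suc) (auto simp: uniform_submodule_iff)
  then show "unisum R M (Suc n) X"
   using sum_family_Suc[of n U] un uniform_subset U(2) by simp
 qed
qed

lemma udim_eq:
 "udim R M = (THE n. \<exists>X. unisum R M n X \<and>
  ess_in R M X (carrier M))"
 unfolding udim_def uniform_sum_iff independent_uniform_def essential_submodule_iff[symmetric]
 by (rule arg_cong[where f = The], rule ext) blast

lemma udim_uniform_sum:
 assumes "unisum R M n X" "ess_in R M X (carrier M)"
 shows "udim R M = n"
 unfolding udim_eq
proof (rule the_equality)
 fix m assume "\<exists>X. unisum R M m X \<and> ess_in R M X (carrier M)"
 then obtain Y where Y: "unisum R M m Y" "ess_in R M Y (carrier M)"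
  by auto
 show "m = n" by (rule modular_sets.uniform_sum_unique[OF modular_submods Y(1) assms Y(2)])
qed (use assms in blast)

end

section \<open>Chain conditions for finitely generated modules\<close>

section \<open>Finitely generated and projective modules\<close>

text \<open>The union of an ascending chain is finitely generated, and finitely many generators
  already lie in one member of the chain.\<close>

lemma acc_from_fin_gen:
 assumes M: "right_module R M" and fg: "!!N. submodule N R M ==> fin_gen R (sub_mod M N)"
 shows "noeth R M"
 unfolding acc_between_def
proof (intro allI impI)
 interpret M: right_module R M by fact
 fix f :: "nat => _ set"
 assume "\<forall>n. f n \<in> submods R M \<and> nul M <= f n \<and> f n <= carrier M \<and> f n <= f (Suc n)"
 then have sub: "!!n. submodule (f n) R M" and inc: "!!n. f n <= f (Suc n)" by auto
 have mono: "m \<le> n ==> f m <= f n" for m n using inc lift_Suc_mono_le[of f m n] by blast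
 let ?U = "\<Union>n. f n"
 have U: "submodule ?U R M"
 proof (rule M.submoduleI)
  fix x y assume "x \<in> ?U" "y \<in> ?U"
  then obtain m n where "x \<in> f m" "y \<in> f n" by auto
  then have "x \<in> f (max m n)" "y \<in> f (max m n)" using mono[of m "max m n"] mono[of n "max m n"] by auto
  then show "x \<oplus>\<^bsub>M\<^esub> y \<in> ?U" using M.submoduleD(3)[OF sub, of x "max m n" y] by blast
 next
  show "?U <= carrier M" using M.submoduleD(1)[OF sub] by blast
  show "\<zero>\<^bsub>M\<^esub> \<in> ?U" using M.submoduleD(2)[OF sub] by blast
  show "a \<odot>\<^bsub>M\<^esub> x \<in> ?U" if "a \<in> carrier R" "x \<in> ?U" for a x
   using M.submoduleD(4)[OF sub] that by blast
 qed
 obtain A where A: "finite A" "A <= ?U" "rspan R (sub_mod M ?U) A = ?U"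
  using fg[OF U] by (auto simp: fin_gen_def)
 have "\<exists>n. A <= f n"
  using A(1,2)
 proof (induction A)
  case (insert a A)
  then obtain n m where "A <= f n" "a \<in> f m" by auto
  then have "insert a A <= f (max m n)" using mono[of m "max m n"] mono[of n "max m n"] by auto
  then show ?case by blast
 qed auto
 then obtain n where n: "A <= f n" by blast
 have "submodule (f n) R (sub_mod M ?U)" using M.submodule_sub_iff[OF U] sub by auto
 then have "?U <= f n" using A(3) n unfolding rspan_def by blast
 then have "f m = f n" if "m \<ge> n" for m using mono[OF that] by blast
 then show "\<exists>n. \<forall>m\<ge>n. f m = f n" by blast
qed

lemma fin_gen_from_acc:
 assumes M: "right_module R M" and acc: "noeth R M"
 shows "fin_gen R M"
proof -
 interpret M: right_module R M by fact
 define P where "P N = (\<exists>A. finite A \<and> A <= carrier M \<and> N = rspan R M A)" for N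
 have "rspan R M {} = nul M"
  using M.rspan_least[of "nul M" "{}"] M.submoduleD(2)[OF M.submodule_rspan[of "{}"]] by auto
 then have "P (nul M)" unfolding P_def by (intro exI[of _ "{}"]) auto
 from acc_between_maximal[of "submods R M" "nul M" "carrier M" "nul M" P, OF acc _ order_refl _ this]
 obtain N where N: "P N" and max: "!!Z. [|submodule Z R M; Z <= carrier M; P Z; N <= Z|] ==> Z = N"
  using M.submodule_zero by auto
 from N obtain A where A: "finite A" "A <= carrier M" "N = rspan R M A" unfolding P_def by blast
 have "x \<in> N" if x: "x \<in> carrier M" for x
 proof -
  let ?Z = "rspan R M (insert x A)"
  have Ax: "insert x A <= carrier M" using A x by auto
  have Z: "submodule ?Z R M" by (rule M.submodule_rspan[OF Ax])
  have "P ?Z" unfolding P_def using A(1) Ax by (intro exI[of _ "insert x A"]) auto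
  moreover have "N <= ?Z" unfolding A(3) using M.rspan_incl[of "insert x A"] by (intro M.rspan_least Z) auto
  ultimately have "?Z = N" using max Z M.submoduleD(1)[OF Z] by blast
  then show ?thesis using M.rspan_incl[of "insert x A"] by auto
 qed
 then have "rspan R M A = carrier M" using A M.submoduleD(1)[OF M.submodule_rspan[OF A(2)]] by auto
 then show ?thesis using A unfolding fin_gen_def by blast
qed

context right_module
begin

lemma rspan_insert:
 assumes "A <= carrier M" "p \<in> carrier M" "x \<in> rspan R M (insert p A)"
 obtains s r where "s \<in> rspan R M A" "r \<in> carrier R" "x = s \<oplus>\<^bsub>M\<^esub> r \<odot>\<^bsub>M\<^esub> p"
proof -
 let ?C = "{r \<odot>\<^bsub>M\<^esub> p | r. r \<in> carrier R}"
 have C: "submodule ?C R M"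
 proof (rule submoduleI)
  show "\<zero>\<^bsub>M\<^esub> \<in> ?C" using assms(2) by (auto intro!: exI[of _ "\<zero>\<^bsub>R\<^esub>"])
  fix x y assume "x \<in> ?C" "y \<in> ?C"
  then obtain r s where "x = r \<odot>\<^bsub>M\<^esub> p" "y = s \<odot>\<^bsub>M\<^esub> p" "r \<in> carrier R" "s \<in> carrier R" by blast
  then show "x \<oplus>\<^bsub>M\<^esub> y \<in> ?C" using assms(2) smult_l_distr[of r s p] by (auto intro!: exI[of _ "r \<oplus>\<^bsub>R\<^esub> s"])
 next
  fix a x assume a: "a \<in> carrier R" "x \<in> ?C"
  then obtain r where "x = r \<odot>\<^bsub>M\<^esub> p" "r \<in> carrier R" by blast
  then show "a \<odot>\<^bsub>M\<^esub> x \<in> ?C" using a assms(2) smult_assoc[of r a p] by (auto intro!: exI[of _ "r \<otimes>\<^bsub>R\<^esub> a"])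
 qed (use assms(2) in auto)
 interpret L: modular_sets "submods R M" "set_add M" "nul M" by (rule modular_submods)
 have A: "submodule (rspan R M A) R M" by (rule submodule_rspan[OF assms(1)])
 have "p \<in> ?C" using assms(2) by (auto intro!: exI[of _ "\<one>\<^bsub>R\<^esub>"])
 then have "insert p A <= rspan R M A <+>\<^bsub>M\<^esub> ?C"
  using L.sup_upper1[of "rspan R M A" ?C] L.sup_upper2[of "rspan R M A" ?C] A C rspan_incl[of A] by auto
 then have "x \<in> rspan R M A <+>\<^bsub>M\<^esub> ?C"
  using rspan_least[OF submodule_set_add[OF A C]] assms(3) by blast
 then show thesis using that unfolding set_add_iff by blast
qed

text \<open>A submodule between the spans of \<open>X\<close> and of \<open>insert p X\<close> is
  recovered from the right ideal of those r that send \<open>p\<close> into it, since its elements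
  have the form s + p r with s already in the smaller span. The three conclusions are shaped as the
  premises of the strict embedding lemmas, so chain conditions above \<open>I\<close> pass to this
  interval.\<close>

lemma rspan_insert_embed:
 fixes X :: "'m set" and p :: 'm
 assumes X: "X <= carrier M" "p \<in> carrier M" and I: "!!r. r \<in> I ==> r \<odot>\<^bsub>M\<^esub> p \<in> rspan R M X"
  and I': "I <= carrier R"
 defines "h \<equiv> \<lambda>Y. {r \<in> carrier R. r \<odot>\<^bsub>M\<^esub> p \<in> Y}"
 shows "!!Y. [|Y \<in> submods R M; rspan R M X <= Y; Y <= rspan R M (insert p X)|] ==>
   h Y \<in> rideals R \<and> I <= h Y \<and> h Y <= carrier R"
  and "!!Y Z. [|Y \<in> submods R M; Z \<in> submods R M; rspan R M X <= Y; Y <= Z; Z <= rspan R M (insert p X)|]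
   ==> h Y <= h Z"
  and "!!Y Z. [|Y \<in> submods R M; Z \<in> submods R M; rspan R M X <= Y; Y <= Z; Z <= rspan R M (insert p X); h Y = h Z|]
   ==> Y = Z"
proof -
 interpret reg: right_module R "reg_module R" by (rule right_module_reg[OF R.ring_axioms])
 fix Y assume Y: "Y \<in> submods R M" "rspan R M X <= Y" "Y <= rspan R M (insert p X)"
 then have Y': "submodule Y R M" by simp
 have "submodule (h Y) R (reg_module R)"
  unfolding h_def
  using X(2) submoduleD[OF Y'] by (intro reg.submoduleI) (auto simp: smult_l_distr smult_assoc)
 moreover have "I <= h Y" unfolding h_def using I I' Y(2) by blast
 ultimately show "h Y \<in> rideals R \<and> I <= h Y \<and> h Y <= carrier R" by (auto simp: h_def)
next
 fix Y Z :: "'m set" assume "Y <= Z" then show "h Y <= h Z" by (auto simp: h_def)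
next
 fix Y Z assume YZ: "Y \<in> submods R M" "Z \<in> submods R M" "rspan R M X <= Y" "Y <= Z" "Z <= rspan R M (insert p X)" "h Y = h Z"
 then have Z: "submodule Z R M" and Y: "submodule Y R M" by auto
 have "z \<in> Y" if z: "z \<in> Z" for z
 proof -
  obtain s r where sr: "s \<in> rspan R M X" "r \<in> carrier R" "z = s \<oplus>\<^bsub>M\<^esub> r \<odot>\<^bsub>M\<^esub> p"
   using rspan_insert[OF X] z YZ(5) by blast
  have s: "s \<in> carrier M" "s \<in> Y" "s \<in> Z" using sr YZ submoduleD(1)[OF Z] by auto
  have "r \<odot>\<^bsub>M\<^esub> p = \<ominus>\<^bsub>M\<^esub> s \<oplus>\<^bsub>M\<^esub> z" using s sr X by (simp add: M.r_neg1)
  then have "r \<odot>\<^bsub>M\<^esub> p \<in> Z" using submoduleD(3,5)[OF Z] s z by simp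
  then have "r \<in> h Y" using YZ(6) sr by (auto simp: h_def)
  then show ?thesis using submoduleD(3)[OF Y] s sr by (auto simp: h_def)
 qed
 then show "Y = Z" using YZ by auto
qed

lemma rspan_mono: "A <= B ==> rspan R M A <= rspan R M B"
 unfolding rspan_def by auto

lemma acc_rspan:
 assumes acc: "right_acc R"
 shows "[|finite A; A <= carrier M|] ==> acc_between (submods R M) (nul M) (rspan R M A)"
proof (induction A rule: finite_induct)
 case empty
 have "rspan R M {} = nul M"
  using rspan_least[of "nul M" "{}"] submoduleD(2)[OF submodule_rspan[of "{}"]] by auto
 then show ?case by (simp add: acc_between_def) blast
next
 case (insert p A)
 interpret L: modular_sets "submods R M" "set_add M" "nul M" by (rule modular_submods)
 have A: "A <= carrier M" "p \<in> carrier M" using insert by auto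
 have s: "submodule (rspan R M A) R M" "submodule (rspan R M (insert p A)) R M"
  using submodule_rspan insert.prems A by auto
 have "acc_between (submods R M) (rspan R M A) (rspan R M (insert p A))"
  by (rule acc_between_strict_embed[OF acc rspan_insert_embed[OF A]])
   (use submoduleD(2)[OF s(1)] A in auto)
 then show ?case
  using L.acc_between_trans[of "nul M" "rspan R M A" "rspan R M (insert p A)"] insert A s
   submoduleD(2)[OF s(1)] rspan_mono[of A "insert p A"] by auto
qed

lemma acc_fin_gen:
 assumes "right_acc R" "fin_gen R M"
 shows "noeth R M"
 using assms acc_rspan unfolding fin_gen_def by metis

text \<open>As \<open>I\<close> carries \<open>M\<close> into \<open>N\<close>, each new generator
  contributes a section governed by the right ideals above \<open>I\<close>, and both chain
  conditions there make this section of finite length.\<close>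

lemma covers_chain_rspan:
 assumes acc: "acc_between (rideals R) I (carrier R)"
  and dcc: "dcc_between (rideals R) I (carrier R)"
  and I: "I <= carrier R" and N: "submodule N R M" "!!r x. [|r \<in> I; x \<in> carrier M|] ==> r \<odot>\<^bsub>M\<^esub> x \<in> N"
 shows "[|finite A; A <= carrier M|] ==> \<exists>n. chain R M n N (rspan R M (N \<union> A))"
proof (induction A rule: finite_induct)
 case empty
 have "rspan R M (N \<union> {}) = N" using rspan_least[OF N(1), of N] rspan_incl[of N] by auto
 then show ?case using relpowp_0_I by metis
next
 case (insert p A)
 note N' = submoduleD(1)[OF N(1)]
 have A: "N \<union> A <= carrier M" "p \<in> carrier M" using insert N' by auto
 have i: "N \<union> insert p A = insert p (N \<union> A)" by auto
 have s: "submodule (rspan R M (N \<union> A)) R M" "submodule (rspan R M (insert p (N \<union> A))) R M"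
  using submodule_rspan A by auto
 have Ip: "r \<odot>\<^bsub>M\<^esub> p \<in> rspan R M (N \<union> A)" if "r \<in> I" for r
  using N(2)[OF that A(2)] rspan_incl[of "N \<union> A"] by auto
 obtain n where n: "chain R M n N (rspan R M (N \<union> A))" using insert by auto
 have "acc_between (submods R M) (rspan R M (N \<union> A)) (rspan R M (insert p (N \<union> A)))"
  by (rule acc_between_strict_embed[OF acc rspan_insert_embed[OF A Ip I]])
 moreover have "dcc_between (submods R M) (rspan R M (N \<union> A)) (rspan R M (insert p (N \<union> A)))"
  by (rule dcc_between_strict_embed[OF dcc rspan_insert_embed[OF A Ip I]])
 ultimately obtain m where "chain R M m (rspan R M (N \<union> A)) (rspan R M (insert p (N \<union> A)))"
  using finite_length_between[of "submods R M"] s rspan_mono[of "N \<union> A" "insert p (N \<union> A)"] by blast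
 then have "chain R M (n + m) N (rspan R M (N \<union> insert p A))"
  unfolding i relpowp_add using n by auto
 then show ?case by blast
qed

end

section \<open>Free modules\<close>

lemma right_module_free:
 assumes "ring R" shows "right_module R (free_on R V)"
proof -
 interpret R: ring R by fact
 have fin: "finite {v. a v \<oplus>\<^bsub>R\<^esub> b v ~= \<zero>\<^bsub>R\<^esub>}"
  if "finite {v. a v ~= \<zero>\<^bsub>R\<^esub>}" "finite {v. b v ~= \<zero>\<^bsub>R\<^esub>}" for a b :: "'c => 'a"
  by (rule finite_subset[OF _ finite_UnI[OF that]]) auto
 have finm: "finite {v. a v \<otimes>\<^bsub>R\<^esub> r ~= \<zero>\<^bsub>R\<^esub>}"
  if "finite {v. a v ~= \<zero>\<^bsub>R\<^esub>}" "r \<in> carrier R" for a :: "'c => 'a" and r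
  by (rule finite_subset[OF _ that(1)]) (use that(2) in auto)
 have fineg: "finite {v. \<ominus>\<^bsub>R\<^esub> a v ~= \<zero>\<^bsub>R\<^esub>}"
  if "finite {v. a v ~= \<zero>\<^bsub>R\<^esub>}" for a :: "'c => 'a"
  by (rule finite_subset[OF _ that(1)]) auto
 have "abelian_group (free_on R V)"
 proof (rule abelian_groupI)
  fix a assume a: "a \<in> carrier (free_on R V)"
  have "(\<lambda>v. \<ominus>\<^bsub>R\<^esub> a v) \<in> carrier (free_on R V)"
   using a fineg by (simp add: free_on_def)
  moreover have "(\<lambda>v. \<ominus>\<^bsub>R\<^esub> a v) \<oplus>\<^bsub>free_on R V\<^esub> a = \<zero>\<^bsub>free_on R V\<^esub>"
   using a by (simp add: free_on_def R.l_neg)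
  ultimately show "\<exists>b\<in>carrier (free_on R V). b \<oplus>\<^bsub>free_on R V\<^esub> a = \<zero>\<^bsub>free_on R V\<^esub>" by blast
 qed (auto simp: free_on_def R.a_assoc fin intro: R.a_comm)
 moreover have "right_module_axioms R (free_on R V)"
  by (rule right_module_axioms.intro) (auto simp: free_on_def R.r_distr R.l_distr R.m_assoc finm)
 ultimately show ?thesis by (intro right_module.intro assms)
qed

text \<open>The linear map from a free module that sends the basis vector \<open>v\<close> to
  \<open>q v\<close>. The sum runs over the support, which is finite for elements of
  \<open>free_on\<close>.\<close>

definition lin :: "('r, 'k) ring_scheme => ('r, 'm) module => ('v => 'm) => ('v => 'r) => 'm" where
 "lin R M q a = finsum M (\<lambda>v. a v \<odot>\<^bsub>M\<^esub> q v) {v. a v ~= \<zero>\<^bsub>R\<^esub>}"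

lemma free_eval_lin: "free_eval R V = lin R V (\<lambda>v. v)"
 by (simp add: free_eval_def lin_def fun_eq_iff)

lemma free_onD:
 assumes "a \<in> carrier (free_on R V)"
 shows "!!v. a v \<in> carrier R" "!!v. v \<notin> carrier V ==> a v = \<zero>\<^bsub>R\<^esub>" "finite {v. a v ~= \<zero>\<^bsub>R\<^esub>}"
  "{v. a v ~= \<zero>\<^bsub>R\<^esub>} <= carrier V"
 using assms by (auto simp: free_on_def)

context right_module
begin

lemma lin_eq:
 assumes q: "!!v. v \<in> S ==> q v \<in> carrier M" and S: "finite S" "{v. a v ~= \<zero>\<^bsub>R\<^esub>} <= S" "!!v. a v \<in> carrier R"
 shows "lin R M q a = finsum M (\<lambda>v. a v \<odot>\<^bsub>M\<^esub> q v) S"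
 unfolding lin_def
 by (rule M.add.finprod_mono_neutral_cong_left) (use assms in auto)

lemma lin_rhom:
 assumes q: "!!v. v \<in> carrier V ==> q v \<in> carrier M"
 shows "restrict (lin R M q) (carrier (free_on R V)) \<in> rhom R (free_on R V) M"
proof (rule rhom_restrictI[OF right_module_free[OF R.ring_axioms]])
 fix a assume "a \<in> carrier (free_on R V)"
 note a = free_onD[OF this]
 show "lin R M q a \<in> carrier M"
  unfolding lin_def using a q by (intro M.finsum_closed) auto
 fix b assume b': "b \<in> carrier (free_on R V)"
 note b = free_onD[OF b']
 let ?S = "{v. a v ~= \<zero>\<^bsub>R\<^esub>} \<union> {v. b v ~= \<zero>\<^bsub>R\<^esub>}"
 have S: "finite ?S" "!!v. v \<in> ?S ==> q v \<in> carrier M" using a b q by auto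
 have "{v. a v \<oplus>\<^bsub>R\<^esub> b v ~= \<zero>\<^bsub>R\<^esub>} <= ?S" by auto
 then have "lin R M q (\<lambda>v. a v \<oplus>\<^bsub>R\<^esub> b v) = finsum M (\<lambda>v. (a v \<oplus>\<^bsub>R\<^esub> b v) \<odot>\<^bsub>M\<^esub> q v) ?S"
  using lin_eq[of ?S q "\<lambda>v. a v \<oplus>\<^bsub>R\<^esub> b v"] a(1) b(1) S by simp
 then have "lin R M q (a \<oplus>\<^bsub>free_on R V\<^esub> b) = finsum M (\<lambda>v. (a v \<oplus>\<^bsub>R\<^esub> b v) \<odot>\<^bsub>M\<^esub> q v) ?S"
  by (simp add: free_on_def)
 also have "\<dots> = finsum M (\<lambda>v. a v \<odot>\<^bsub>M\<^esub> q v \<oplus>\<^bsub>M\<^esub> b v \<odot>\<^bsub>M\<^esub> q v) ?S"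
  by (rule M.finsum_cong') (use a b S in "auto simp: smult_l_distr")
 also have "\<dots> = finsum M (\<lambda>v. a v \<odot>\<^bsub>M\<^esub> q v) ?S \<oplus>\<^bsub>M\<^esub> finsum M (\<lambda>v. b v \<odot>\<^bsub>M\<^esub> q v) ?S"
  by (rule M.finsum_addf) (use a b S in auto)
 also have "\<dots> = lin R M q a \<oplus>\<^bsub>M\<^esub> lin R M q b"
  using lin_eq[of ?S q a] lin_eq[of ?S q b] a b S by auto
 finally show "lin R M q (a \<oplus>\<^bsub>free_on R V\<^esub> b) = lin R M q a \<oplus>\<^bsub>M\<^esub> lin R M q b" .
next
 fix r a assume r: "r \<in> carrier R" and "a \<in> carrier (free_on R V)"
 note a = free_onD[OF this(2)]
 let ?S = "{v. a v ~= \<zero>\<^bsub>R\<^esub>}"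
 have S: "finite ?S" "!!v. v \<in> ?S ==> q v \<in> carrier M" using a q by auto
 have hom: "finsum M (\<lambda>v. r \<odot>\<^bsub>M\<^esub> g v) T = r \<odot>\<^bsub>M\<^esub> finsum M g T" if "finite T" "!!v. v \<in> T ==> g v \<in> carrier M" for T and g :: "_ => 'm"
  using that
 proof (induction T rule: finite_induct)
  case (insert x T)
  have "finsum M (\<lambda>v. r \<odot>\<^bsub>M\<^esub> g v) (insert x T) = r \<odot>\<^bsub>M\<^esub> g x \<oplus>\<^bsub>M\<^esub> finsum M (\<lambda>v. r \<odot>\<^bsub>M\<^esub> g v) T"
   using insert r by (intro M.finsum_insert) auto
  moreover have "finsum M g (insert x T) = g x \<oplus>\<^bsub>M\<^esub> finsum M g T"
   using insert by (intro M.finsum_insert) auto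
  moreover have "finsum M g T \<in> carrier M" using insert by (intro M.finsum_closed) auto
  ultimately show ?case using insert r by (simp add: smult_r_distr)
 qed (use r in simp)
 have "{v. a v \<otimes>\<^bsub>R\<^esub> r ~= \<zero>\<^bsub>R\<^esub>} <= ?S" using r by auto
 then have "lin R M q (\<lambda>v. a v \<otimes>\<^bsub>R\<^esub> r) = finsum M (\<lambda>v. (a v \<otimes>\<^bsub>R\<^esub> r) \<odot>\<^bsub>M\<^esub> q v) ?S"
  using lin_eq[of ?S q "\<lambda>v. a v \<otimes>\<^bsub>R\<^esub> r"] a(1) r S by simp
 then have "lin R M q (r \<odot>\<^bsub>free_on R V\<^esub> a) = finsum M (\<lambda>v. (a v \<otimes>\<^bsub>R\<^esub> r) \<odot>\<^bsub>M\<^esub> q v) ?S"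
  by (simp add: free_on_def)
 also have "\<dots> = finsum M (\<lambda>v. r \<odot>\<^bsub>M\<^esub> (a v \<odot>\<^bsub>M\<^esub> q v)) ?S"
  by (rule M.finsum_cong') (use a r S in "auto simp: smult_assoc")
 also have "\<dots> = r \<odot>\<^bsub>M\<^esub> lin R M q a"
  unfolding lin_def using a S by (intro hom) auto
 finally show "lin R M q (r \<odot>\<^bsub>free_on R V\<^esub> a) = r \<odot>\<^bsub>M\<^esub> lin R M q a" .
qed

definition "unit_vec v = (\<lambda>w. if w = v then \<one>\<^bsub>R\<^esub> else \<zero>\<^bsub>R\<^esub>)"

lemma unit_vec_closed: "v \<in> carrier V ==> unit_vec v \<in> carrier (free_on R V)"
 by (auto simp: unit_vec_def free_on_def)

lemma lin_unit_vec: "q v \<in> carrier M ==> lin R M q (unit_vec v) = q v"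
proof -
 assume q: "q v \<in> carrier M"
 have "{w. unit_vec v w ~= \<zero>\<^bsub>R\<^esub>} <= {v}" "!!w. unit_vec v w \<in> carrier R" "unit_vec v v = \<one>\<^bsub>R\<^esub>"
  by (auto simp: unit_vec_def)
 then show ?thesis using lin_eq[of "{v}" q "unit_vec v"] q by simp
qed

lemma lin_natural:
 assumes N: "right_module R N" and g: "g \<in> rhom R M N"
  and q: "!!v. v \<in> carrier V ==> q v \<in> carrier M" and a: "a \<in> carrier (free_on R V)"
 shows "g (lin R M q a) = lin R N (\<lambda>v. g (q v)) a"
proof -
 interpret N: right_module R N by fact
 note a' = free_onD[OF a]
 have hom: "g (finsum M h T) = finsum N (\<lambda>v. g (h v)) T" if "finite T" "!!v. v \<in> T ==> h v \<in> carrier M" for T and h :: "'d => 'm"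
  using that
 proof (induction T rule: finite_induct)
  case (insert x T)
  have "finsum M h (insert x T) = h x \<oplus>\<^bsub>M\<^esub> finsum M h T"
   using insert by (intro M.finsum_insert) auto
  moreover have "finsum N (\<lambda>v. g (h v)) (insert x T) = g (h x) \<oplus>\<^bsub>N\<^esub> finsum N (\<lambda>v. g (h v)) T"
   using insert rhom_closed[OF g] by (intro N.M.finsum_insert) auto
  moreover have "finsum M h T \<in> carrier M" using insert by (intro M.finsum_closed) auto
  ultimately show ?case using insert by (simp add: rhom_add[OF g])
 qed (use rhom_zero[OF right_module_axioms N g] in simp)
 have "g (lin R M q a) = finsum N (\<lambda>v. g (a v \<odot>\<^bsub>M\<^esub> q v)) {v. a v ~= \<zero>\<^bsub>R\<^esub>}"
  unfolding lin_def using a' q by (intro hom) auto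
 also have "\<dots> = lin R N (\<lambda>v. g (q v)) a"
  unfolding lin_def
  by (rule N.M.finsum_cong') (use a' q rhom_closed[OF g] in "auto simp: rhom_smult[OF g]")
 finally show ?thesis .
qed

end

section \<open>Finitely generated projective modules through dual bases\<close>

section \<open>Dual bases\<close>

text \<open>A list of pairs (p, f) encodes the map x -> sum of p f(x). Lists make extensions a
  matter of concatenation. The module \<open>M\<close> containing the p may differ from the source
  of the f, so that the p can be moved along a homomorphism.\<close>

primrec dbsum :: "('r, 'm) module => ('m \<times> ('p => 'r)) list => 'p => 'm" where
 "dbsum M [] x = \<zero>\<^bsub>M\<^esub>"
| "dbsum M (pf # l) x = snd pf x \<odot>\<^bsub>M\<^esub> fst pf \<oplus>\<^bsub>M\<^esub> dbsum M l x"

definition coords :: "('r, 'k) ring_scheme => ('r, 'p) module => ('r, 'm) module => ('m \<times> ('p => 'r)) list => bool" where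
 "coords R P M l \<longleftrightarrow> (\<forall>pf\<in>set l. fst pf \<in> carrier M \<and> snd pf \<in> rhom R P (reg_module R))"

definition dual_basis :: "('r, 'k) ring_scheme => ('r, 'p) module => ('p \<times> ('p => 'r)) list => bool" where
 "dual_basis R P l \<longleftrightarrow> coords R P P l \<and> (\<forall>x\<in>carrier P. dbsum P l x = x)"

text \<open>The dual basis lemma turned into a definition of finitely generated projective. Unlike
  \<open>proj_module\<close> it quantifies over no test modules, so it means the same on every
  carrier type.\<close>

definition has_db :: "('r, 'k) ring_scheme => ('r, 'p) module => bool" where
 "has_db R P \<longleftrightarrow> right_module R P \<and> (\<exists>l. dual_basis R P l)"

lemma has_db_module: "has_db R P ==> right_module R P"
 by (simp add: has_db_def)

lemma coords_Cons [simp]: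
 "coords R P M (pf # l) \<longleftrightarrow> fst pf \<in> carrier M \<and> snd pf \<in> rhom R P (reg_module R) \<and> coords R P M l"
 by (auto simp: coords_def)

lemma coords_Nil [simp]: "coords R P M []"
 by (simp add: coords_def)

lemma coords_append [simp]: "coords R P M (l @ l') \<longleftrightarrow> coords R P M l \<and> coords R P M l'"
 by (auto simp: coords_def)

lemma dbsum_rhom:
 assumes P: "right_module R P" and M: "right_module R M"
 shows "coords R P M l ==> (\<lambda>x\<in>carrier P. dbsum M l x) \<in> rhom R P M"
proof (induction l)
 case Nil
 have "(\<lambda>x\<in>carrier P. dbsum M [] x) = (\<lambda>x\<in>carrier P. \<zero>\<^bsub>M\<^esub>)" by (rule restrict_ext) simp
 then show ?case using rhom_const_zero[OF P M] by (simp only:)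
next
 case (Cons pf l)
 interpret P: right_module R P by fact
 interpret M: right_module R M by fact
 have pf: "fst pf \<in> carrier M" "snd pf \<in> rhom R P (reg_module R)" using Cons.prems by auto
 have cl: "snd pf x \<in> carrier R" if "x \<in> carrier P" for x using rhom_closed[OF pf(2) that] by simp
 have "(\<lambda>x\<in>carrier P. snd pf x \<odot>\<^bsub>M\<^esub> fst pf) \<in> rhom R P M"
  using pf cl by (intro rhom_restrictI[OF P])
   (auto simp: rhom_add[OF pf(2)] rhom_smult[OF pf(2)] M.smult_l_distr M.smult_assoc)
 note rhom_plus[OF P M this, of "\<lambda>x\<in>carrier P. dbsum M l x"]
 then have "(\<lambda>x\<in>carrier P. (\<lambda>x\<in>carrier P. snd pf x \<odot>\<^bsub>M\<^esub> fst pf) x \<oplus>\<^bsub>M\<^esub> (\<lambda>x\<in>carrier P. dbsum M l x) x) \<in> rhom R P M"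
  using Cons.IH Cons.prems unfolding coords_Cons by blast
 moreover have "(\<lambda>x\<in>carrier P. (\<lambda>x\<in>carrier P. snd pf x \<odot>\<^bsub>M\<^esub> fst pf) x \<oplus>\<^bsub>M\<^esub> (\<lambda>x\<in>carrier P. dbsum M l x) x) = (\<lambda>x\<in>carrier P. dbsum M (pf # l) x)"
  by (rule restrict_ext) simp
 ultimately show ?case by (simp only:)
qed

lemma dbsum_closed:
 "[|right_module R P; right_module R M; coords R P M l; x \<in> carrier P|] ==> dbsum M l x \<in> carrier M"
 using rhom_closed[OF dbsum_rhom[of R P M l]] by simp

lemma dbsum_natural:
 assumes P: "right_module R P" and M: "right_module R M" and N: "right_module R N"
  and g: "g \<in> rhom R M N" and x: "x \<in> carrier P"
 shows "coords R P M l ==> g (dbsum M l x) = dbsum N (map (\<lambda>pf. (g (fst pf), snd pf)) l) x"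
proof (induction l)
 case Nil
 then show ?case using rhom_zero[OF M N g] by simp
next
 case (Cons pf l)
 interpret M: right_module R M by fact
 have "snd pf x \<in> carrier R" using Cons.prems rhom_closed[of "snd pf" R P "reg_module R" x] x by simp
 then show ?case
  using Cons dbsum_closed[OF P M _ x, of l] by (simp add: rhom_add[OF g] rhom_smult[OF g])
qed

lemma coords_natural: "[|g \<in> rhom R M N; coords R P M l|] ==> coords R P N (map (\<lambda>pf. (g (fst pf), snd pf)) l)"
 by (auto simp: coords_def rhom_closed)

lemma dbsum_precompose:
 assumes "x \<in> carrier Q"
 shows "dbsum M (map (\<lambda>pf. (fst pf, compose (carrier Q) (snd pf) t)) l) x = dbsum M l (t x)"
 using assms by (induction l) (auto simp: compose_def)

lemma coords_precompose:
 "[|right_module R Q; t \<in> rhom R Q P; coords R P M l|] ==> coords R Q M (map (\<lambda>pf. (fst pf, compose (carrier Q) (snd pf) t)) l)"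
 by (auto simp: coords_def intro: rhom_compose)

lemma dbsum_append:
 assumes P: "right_module R P" and M: "right_module R M" and x: "x \<in> carrier P" and l': "coords R P M l'"
 shows "coords R P M l ==> dbsum M (l @ l') x = dbsum M l x \<oplus>\<^bsub>M\<^esub> dbsum M l' x"
proof (induction l)
 case Nil
 interpret M: right_module R M by fact
 show ?case using dbsum_closed[OF P M l' x] by simp
next
 case (Cons pf l)
 interpret M: right_module R M by fact
 have "snd pf x \<in> carrier R" using Cons.prems rhom_closed[of "snd pf" R P "reg_module R" x] x by simp
 then show ?case
  using Cons dbsum_closed[OF P M l' x] dbsum_closed[OF P M _ x, of l] by (simp add: M.M.a_assoc)
qed

text \<open>Only the finitely many values of \<open>h\<close> on the dual basis are lifted, and
  these arbitrarily; combining the lifts with the old coordinate functions is automatically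
  linear.\<close>

theorem has_db_lift:
 assumes P: "has_db R P" and M: "right_module R M" and N: "right_module R N"
  and g: "g \<in> rhom R M N" "g ` carrier M = carrier N" and h: "h \<in> rhom R P N"
 obtains k where "k \<in> rhom R P M" "!!x. x \<in> carrier P ==> g (k x) = h x"
proof -
 have Pm: "right_module R P" using P by (simp add: has_db_def)
 obtain l where l: "coords R P P l" "!!x. x \<in> carrier P ==> dbsum P l x = x"
  using P by (auto simp: has_db_def dual_basis_def)
 define q where "q y = inv_into (carrier M) g y" for y
 have q: "q y \<in> carrier M" "g (q y) = y" if "y \<in> carrier N" for y
  using that g(2) inv_into_into[of y g "carrier M"] f_inv_into_f[of y g "carrier M"] by (simp_all add: q_def)
 let ?l = "map (\<lambda>pf. (q (h (fst pf)), snd pf)) l"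
 have c: "coords R P M ?l" using l(1) q rhom_closed[OF h] by (auto simp: coords_def)
 have "map (\<lambda>pf. (g (fst pf), snd pf)) ?l = map (\<lambda>pf. (h (fst pf), snd pf)) l"
  using l(1) q rhom_closed[OF h] by (auto simp: coords_def)
 note eq = this
 have "g (dbsum M ?l x) = h x" if "x \<in> carrier P" for x
  using dbsum_natural[OF Pm M N g(1) that c] dbsum_natural[OF Pm Pm N h that l(1)] l(2)[OF that]
  unfolding eq by simp
 then show thesis
  using that[of "\<lambda>x\<in>carrier P. dbsum M ?l x"] dbsum_rhom[OF Pm M c] by simp
qed

lemma has_db_proj: "has_db R P ==> proj_module R P"
 unfolding proj_module_def using has_db_lift[of R P] has_db_module[of R P] by metis

lemma has_db_fin_gen:
 assumes "has_db R P" shows "fin_gen R P"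
proof -
 have P: "right_module R P" using assms by (simp add: has_db_def)
 interpret right_module R P by (rule P)
 obtain l where l: "coords R P P l" "!!x. x \<in> carrier P ==> dbsum P l x = x"
  using assms by (auto simp: has_db_def dual_basis_def)
 let ?A = "fst ` set l"
 have A: "?A <= carrier P" using l(1) by (auto simp: coords_def)
 have s: "submodule (rspan R P ?A) R P" by (rule submodule_rspan[OF A])
 have "dbsum P l' x \<in> rspan R P ?A" if "x \<in> carrier P" "set l' <= set l" for l' x
  using that(2)
 proof (induction l')
  case (Cons pf l')
  have "snd pf x \<in> carrier R"
   using l(1) Cons.prems rhom_closed[of "snd pf" R P "reg_module R" x] that(1) by (auto simp: coords_def)
  moreover have "fst pf \<in> rspan R P ?A" using Cons.prems rspan_incl[of ?A] by auto
  ultimately show ?case using Cons submoduleD(3,4)[OF s] by simp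
 qed (use submoduleD(2)[OF s] in simp)
 from this[of _ l] have "rspan R P ?A = carrier P" using l(2) submoduleD(1)[OF s] by fastforce
 then show ?thesis unfolding fin_gen_def using A by (intro exI[of _ ?A]) auto
qed

lemma fin_gen_free_surj:
 assumes P: "right_module R P" and fg: "fin_gen R P"
 obtains A where "finite A" "A <= carrier P"
  "restrict (lin R P (\<lambda>v. v)) (carrier (free_on R (sub_mod P A))) \<in> rhom R (free_on R (sub_mod P A)) P"
  "restrict (lin R P (\<lambda>v. v)) (carrier (free_on R (sub_mod P A))) ` carrier (free_on R (sub_mod P A)) = carrier P"
proof -
 interpret P: right_module R P by (rule P)
 obtain A where A: "finite A" "A <= carrier P" "rspan R P A = carrier P" using fg by (auto simp: fin_gen_def)
 let ?F = "free_on R (sub_mod P A)"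
 have F: "right_module R ?F" by (rule right_module_free[OF P.R.ring_axioms])
 let ?g = "restrict (lin R P (\<lambda>v. v)) (carrier ?F)"
 have g: "?g \<in> rhom R ?F P" by (rule P.lin_rhom) (use A in auto)
 have s: "submodule (?g ` carrier ?F) R P"
  by (rule submodule_image[OF F P g right_module.submodule_carrier[OF F]])
 have "v \<in> ?g ` carrier ?F" if "v \<in> A" for v
 proof -
  have "P.unit_vec v \<in> carrier ?F" by (rule P.unit_vec_closed) (use that in auto)
  moreover have "?g (P.unit_vec v) = v" using calculation P.lin_unit_vec[of "\<lambda>v. v" v] that A by auto
  ultimately show ?thesis by (metis image_eqI)
 qed
 then have "A <= ?g ` carrier ?F" by blast
 then have "?g ` carrier ?F = carrier P"
  using P.rspan_least[OF s] A(3) P.submoduleD(1)[OF s] by blast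
 then show thesis using that A(1,2) g by blast
qed

text \<open>A splitting of a finite free cover gives the dual basis: the generators paired with the
  coordinates of the splitting. The free module on generators of \<open>P\<close> is carried by
  functions from the type of \<open>P\<close> to the ring, so it is among the test modules of
  \<open>proj_module\<close>.\<close>

theorem proj_has_db:
 assumes proj: "proj_module R P" and fg: "fin_gen R P"
 shows "has_db R P"
proof -
 have P: "right_module R P" using proj by (simp add: proj_module_def)
 interpret P: right_module R P by (rule P)
 obtain A where A: "finite A" "A <= carrier P"
  and g: "restrict (lin R P (\<lambda>v. v)) (carrier (free_on R (sub_mod P A))) \<in> rhom R (free_on R (sub_mod P A)) P"
  "restrict (lin R P (\<lambda>v. v)) (carrier (free_on R (sub_mod P A))) ` carrier (free_on R (sub_mod P A)) = carrier P"
  using fin_gen_free_surj[OF P fg] .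
 obtain vs where vs: "distinct vs" "set vs = A" using finite_distinct_list[OF A(1)] by blast
 let ?F = "free_on R (sub_mod P A)"
 have F: "right_module R ?F" by (rule right_module_free[OF P.R.ring_axioms])
 let ?g = "restrict (lin R P (\<lambda>v. v)) (carrier ?F)"
 have "\<exists>s \<in> rhom R P ?F. \<forall>x\<in>carrier P. ?g (s x) = (\<lambda>x\<in>carrier P. x) x"
  using proj[unfolded proj_module_def, THEN conjunct2, rule_format, of ?F P ?g "\<lambda>x\<in>carrier P. x"]
   g rhom_id[OF P] F P by blast
 then obtain s where s: "s \<in> rhom R P ?F" "!!x. x \<in> carrier P ==> ?g (s x) = (\<lambda>x\<in>carrier P. x) x" by auto
 let ?l = "map (\<lambda>v. (v, \<lambda>x\<in>carrier P. s x v)) vs"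
 have sF: "s x \<in> carrier ?F" if "x \<in> carrier P" for x using rhom_closed[OF s(1) that] .
 have "(\<lambda>x\<in>carrier P. s x v) \<in> rhom R P (reg_module R)" for v
  by (rule rhom_restrictI[OF P])
   (use sF in "auto simp: rhom_add[OF s(1)] rhom_smult[OF s(1)] free_on_def")
 then have c: "coords R P P ?l" using vs A by (auto simp: coords_def)
 have "dbsum P ?l x = x" if x: "x \<in> carrier P" for x
 proof -
  note sx = free_onD[OF sF[OF x]]
  have "dbsum P (map (\<lambda>v. (v, \<lambda>x\<in>carrier P. s x v)) ws) x = finsum P (\<lambda>v. s x v \<odot>\<^bsub>P\<^esub> v) (set ws)"
   if "distinct ws" "set ws <= carrier P" for ws
   using that
  proof (induction ws)
   case (Cons w ws)
   have "finsum P (\<lambda>v. s x v \<odot>\<^bsub>P\<^esub> v) (insert w (set ws)) = s x w \<odot>\<^bsub>P\<^esub> w \<oplus>\<^bsub>P\<^esub> finsum P (\<lambda>v. s x v \<odot>\<^bsub>P\<^esub> v) (set ws)"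
    by (rule P.M.finsum_insert) (use Cons.prems sx(1) in auto)
   then show ?case using Cons x by simp
  qed simp
  from this[OF vs(1)] have "dbsum P ?l x = finsum P (\<lambda>v. s x v \<odot>\<^bsub>P\<^esub> v) A" using vs A by simp
  also have "\<dots> = lin R P (\<lambda>v. v) (s x)"
   by (rule P.lin_eq[symmetric]) (use A sx in auto)
  finally show ?thesis using s(2)[OF x] sF[OF x] x by simp
 qed
 then show ?thesis using P c unfolding has_db_def dual_basis_def by blast
qed

lemma fgproj_iff: "P \<in> fgproj_modules R \<longleftrightarrow> has_db R P"
 unfolding fgproj_modules_def mem_Collect_eq
 using proj_has_db[of R P] has_db_proj[of R P] has_db_fin_gen[of R P] has_db_module[of R P] by blast

lemma has_db_free:
 assumes R: "ring R" and A: "finite (carrier V)"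
 shows "has_db R (free_on R V)"
proof -
 interpret F: right_module R "free_on R V" by (rule right_module_free[OF R])
 obtain vs where vs: "distinct vs" "set vs = carrier V" using finite_distinct_list[OF A] by blast
 let ?l = "\<lambda>vs. map (\<lambda>v. (F.unit_vec v, \<lambda>a\<in>carrier (free_on R V). a v)) vs"
 have "(\<lambda>a\<in>carrier (free_on R V). a v) \<in> rhom R (free_on R V) (reg_module R)" for v
  by (rule rhom_restrictI[OF F.right_module_axioms]) (auto simp: free_on_def)
 then have c: "coords R (free_on R V) (free_on R V) (?l vs)"
  using vs F.unit_vec_closed[of _ V] by (auto simp: coords_def)
 have "dbsum (free_on R V) (?l vs) a = a" if a: "a \<in> carrier (free_on R V)" for a
 proof -
  note a' = free_onD[OF a]
  have "dbsum (free_on R V) (?l ws) a = (\<lambda>w. if w \<in> set ws then a w else \<zero>\<^bsub>R\<^esub>)" if "distinct ws" for ws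
   using that
  proof (induction ws)
   case Nil
   then show ?case by (simp add: free_on_def)
  next
   case (Cons v ws)
   have "a w \<in> carrier R" for w using a' by simp
   with Cons a show ?case
    by (auto simp: fun_eq_iff) (auto simp: free_on_def F.unit_vec_def)
  qed
  from this[OF vs(1)] show ?thesis using vs a' by (auto simp: fun_eq_iff)
 qed
 then show ?thesis using F.right_module_axioms c unfolding has_db_def dual_basis_def by blast
qed

lemma has_db_reg:
 assumes "ring R" shows "has_db R (reg_module R)"
proof -
 interpret R: right_module R "reg_module R" by (rule right_module_reg[OF assms])
 let ?l = "[(\<one>\<^bsub>R\<^esub>, \<lambda>x\<in>carrier R. x)]"
 have "coords R (reg_module R) (reg_module R) ?l" using rhom_id[OF R.right_module_axioms] by simp
 moreover have "dbsum (reg_module R) ?l x = x" if "x \<in> carrier R" for x using that by simp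
 ultimately have "dual_basis R (reg_module R) ?l" unfolding dual_basis_def by simp
 then show ?thesis using R.right_module_axioms unfolding has_db_def by blast
qed

lemma has_db_retract:
 assumes P: "has_db R P" and Q: "right_module R Q" and s: "s \<in> rhom R Q P" and t: "t \<in> rhom R P Q"
  and ts: "!!x. x \<in> carrier Q ==> t (s x) = x"
 shows "has_db R Q"
proof -
 have Pm: "right_module R P" using P by (simp add: has_db_def)
 obtain l where l: "coords R P P l" "!!x. x \<in> carrier P ==> dbsum P l x = x"
  using P by (auto simp: has_db_def dual_basis_def)
 let ?l = "map (\<lambda>pf. (fst pf, compose (carrier Q) (snd pf) s)) (map (\<lambda>pf. (t (fst pf), snd pf)) l)"
 have "coords R Q Q ?l" by (rule coords_precompose[OF Q s coords_natural[OF t l(1)]])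
 moreover have "dbsum Q ?l x = x" if "x \<in> carrier Q" for x
  using dbsum_precompose[OF that, of Q s "map (\<lambda>pf. (t (fst pf), snd pf)) l"]
   dbsum_natural[OF Pm Pm Q t rhom_closed[OF s that] l(1)] l(2)[OF rhom_closed[OF s that]] ts[OF that] by simp
 ultimately show ?thesis using Q unfolding has_db_def dual_basis_def by blast
qed

lemma has_db_riso:
 assumes "has_db R P" "right_module R Q" "riso R P Q ~= {}"
 shows "has_db R Q"
proof -
 obtain f where f: "f \<in> riso R P Q" using assms by blast
 have fb: "f \<in> rhom R P Q" "bij_betw f (carrier P) (carrier Q)" using f by (auto simp: riso_def)
 have "restrict (inv_into (carrier P) f) (carrier Q) \<in> rhom R Q P"
  using riso_inv[OF has_db_module[OF assms(1)] assms(2) f] by (simp add: riso_def)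
 then show ?thesis
  by (rule has_db_retract[OF assms(1,2) _ fb(1)])
   (use fb(2) bij_betw_inv_into_right[of f "carrier P" "carrier Q"] in simp)
qed

lemma short_exact_split:
 assumes L: "right_module R L" and M: "right_module R M" and N: "has_db R N" and ex: "short_exact R L M N f g"
 obtains \<sigma> t where "\<sigma> \<in> rhom R N M" "t \<in> rhom R M L" "!!y. y \<in> carrier N ==> g (\<sigma> y) = y"
  "!!x. x \<in> carrier L ==> t (f x) = x" "!!x. x \<in> carrier M ==> f (t x) \<oplus>\<^bsub>M\<^esub> \<sigma> (g x) = x"
proof -
 have Nm: "right_module R N" using N by (simp add: has_db_def)
 interpret L: right_module R L by (rule L)
 interpret M: right_module R M by (rule M)
 interpret N: right_module R N by (rule Nm)
 have f: "f \<in> rhom R L M" "inj_on f (carrier L)" and g: "g \<in> rhom R M N" "g ` carrier M = carrier N"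
  and im: "f ` carrier L = hker M N g" using ex by (auto simp: short_exact_def)
 obtain \<sigma> where \<sigma>: "\<sigma> \<in> rhom R N M" "!!y. y \<in> carrier N ==> g (\<sigma> y) = y"
  using has_db_lift[OF N M Nm g rhom_id[OF Nm]] by auto
 define u where "u x = x \<ominus>\<^bsub>M\<^esub> \<sigma> (g x)" for x
 have uc: "u x \<in> carrier M" if "x \<in> carrier M" for x
  using that rhom_closed[OF \<sigma>(1)] rhom_closed[OF g(1)] by (simp add: u_def)
 have u: "u x \<in> f ` carrier L" if "x \<in> carrier M" for x
 proof -
  have gx: "g x \<in> carrier N" by (rule rhom_closed[OF g(1) that])
  have "g (u x) = g x \<ominus>\<^bsub>N\<^esub> g (\<sigma> (g x))"
   unfolding u_def by (rule rhom_minus[OF M Nm g(1) that rhom_closed[OF \<sigma>(1) gx]])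
  then have "g (u x) = \<zero>\<^bsub>N\<^esub>" using \<sigma>(2)[OF gx] gx by (simp add: N.M.minus_eq N.M.r_neg)
  then show ?thesis unfolding im using uc[OF that] by simp
 qed
 define t where "t = (\<lambda>x\<in>carrier M. inv_into (carrier L) f (u x))"
 have t: "t x \<in> carrier L" "f (t x) = u x" if "x \<in> carrier M" for x
  using u[OF that] that by (auto simp: t_def inv_into_into f_inv_into_f)
 have inj: "x = y" if "f x = f y" "x \<in> carrier L" "y \<in> carrier L" for x y using f(2) that by (auto simp: inj_on_def)
 have "t \<in> rhom R M L"
 proof (rule rhomI)
  fix x y assume xy: "x \<in> carrier M" "y \<in> carrier M"
  have c: "g x \<in> carrier N" "g y \<in> carrier N" "\<sigma> (g x) \<in> carrier M" "\<sigma> (g y) \<in> carrier M"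
   using rhom_closed[OF g(1)] rhom_closed[OF \<sigma>(1)] xy by auto
  have "u (x \<oplus>\<^bsub>M\<^esub> y) = u x \<oplus>\<^bsub>M\<^esub> u y"
   using xy c unfolding u_def
   by (simp add: rhom_add[OF g(1)] rhom_add[OF \<sigma>(1)] M.M.minus_eq M.M.minus_add M.M.add.m_ac)
  then show "t (x \<oplus>\<^bsub>M\<^esub> y) = t x \<oplus>\<^bsub>L\<^esub> t y"
   using xy t by (intro inj) (auto simp: rhom_add[OF f(1)])
 next
  fix a x assume ax: "a \<in> carrier R" "x \<in> carrier M"
  have c: "g x \<in> carrier N" "\<sigma> (g x) \<in> carrier M"
   using rhom_closed[OF g(1)] rhom_closed[OF \<sigma>(1)] ax by auto
  have "u (a \<odot>\<^bsub>M\<^esub> x) = a \<odot>\<^bsub>M\<^esub> u x"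
   using ax c unfolding u_def
   by (simp add: rhom_smult[OF g(1)] rhom_smult[OF \<sigma>(1)] M.M.minus_eq M.smult_r_distr M.smult_minus_right)
  then show "t (a \<odot>\<^bsub>M\<^esub> x) = a \<odot>\<^bsub>L\<^esub> t x"
   using ax t by (intro inj) (auto simp: rhom_smult[OF f(1)])
 qed (use t in "auto simp: t_def")
 moreover have "t (f x) = x" if x: "x \<in> carrier L" for x
 proof -
  have fx: "f x \<in> carrier M" by (rule rhom_closed[OF f(1) x])
  have "f x \<in> hker M N g" using im x by blast
  then have "u (f x) = f x" using fx rhom_zero[OF Nm M \<sigma>(1)] by (simp add: u_def M.M.minus_eq)
  then show ?thesis using t[OF fx] x by (intro inj) auto
 qed
 moreover have "f (t x) \<oplus>\<^bsub>M\<^esub> \<sigma> (g x) = x" if "x \<in> carrier M" for x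
  using t[OF that] that rhom_closed[OF \<sigma>(1) rhom_closed[OF g(1) that]]
  by (simp add: u_def M.M.minus_eq M.M.a_assoc M.M.l_neg)
 ultimately show thesis using that \<sigma> by blast
qed

text \<open>With the sequence split, the coordinates of \<open>L\<close> are pulled back along the
  retraction and those of \<open>N\<close> along \<open>g\<close>; the two lists concatenate to a
  dual basis of \<open>M\<close>.\<close>

theorem has_db_extension:
 assumes L: "has_db R L" and M: "right_module R M" and N: "has_db R N" and ex: "short_exact R L M N f g"
 shows "has_db R M"
proof -
 have Lm: "right_module R L" and Nm: "right_module R N" using L N by (auto simp: has_db_def)
 have f: "f \<in> rhom R L M" and g: "g \<in> rhom R M N" using ex by (auto simp: short_exact_def)
 obtain \<sigma> t where st: "\<sigma> \<in> rhom R N M" "t \<in> rhom R M L" "!!x. x \<in> carrier M ==> f (t x) \<oplus>\<^bsub>M\<^esub> \<sigma> (g x) = x"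
  using short_exact_split[OF Lm M N ex] by metis
 obtain l where l: "coords R L L l" "!!x. x \<in> carrier L ==> dbsum L l x = x"
  using L by (auto simp: has_db_def dual_basis_def)
 obtain n where n: "coords R N N n" "!!x. x \<in> carrier N ==> dbsum N n x = x"
  using N by (auto simp: has_db_def dual_basis_def)
 let ?l = "map (\<lambda>pf. (fst pf, compose (carrier M) (snd pf) t)) (map (\<lambda>pf. (f (fst pf), snd pf)) l)"
 let ?n = "map (\<lambda>pf. (fst pf, compose (carrier M) (snd pf) g)) (map (\<lambda>pf. (\<sigma> (fst pf), snd pf)) n)"
 have c: "coords R M M ?l" "coords R M M ?n"
  by (rule coords_precompose[OF M st(2) coords_natural[OF f l(1)]]
    coords_precompose[OF M g coords_natural[OF st(1) n(1)]])+
 have "dbsum M (?l @ ?n) x = x" if x: "x \<in> carrier M" for x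
 proof -
  have "dbsum M ?l x = f (t x)"
   using dbsum_precompose[OF x, of M t "map (\<lambda>pf. (f (fst pf), snd pf)) l"]
    dbsum_natural[OF Lm Lm M f rhom_closed[OF st(2) x] l(1)] l(2)[OF rhom_closed[OF st(2) x]] by simp
  moreover have "dbsum M ?n x = \<sigma> (g x)"
   using dbsum_precompose[OF x, of M g "map (\<lambda>pf. (\<sigma> (fst pf), snd pf)) n"]
    dbsum_natural[OF Nm Nm M st(1) rhom_closed[OF g x] n(1)] n(2)[OF rhom_closed[OF g x]] by simp
  ultimately show ?thesis using dbsum_append[OF M M x c(2,1)] st(3)[OF x] by simp
 qed
 then have "dual_basis R M (?l @ ?n)" using c unfolding dual_basis_def by simp
 then show ?thesis using M unfolding has_db_def by blast
qed

lemma short_exact_sub: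
 assumes M: "right_module R M" and N: "right_module R N" and g: "g \<in> rhom R M N"
 shows "short_exact R (sub_mod M (hker M N g)) M (sub_mod N (g ` carrier M)) (\<lambda>x\<in>hker M N g. x) g"
 using rhom_incl[OF M submodule_ker[OF M N g]] rhom_codomain[OF g, of "g ` carrier M"]
 unfolding short_exact_def by (auto simp: inj_on_def)

text \<open>Projectivity of submodules descends along a finite list of coordinate functions: the kernel of
 the first one is handled by induction, its image is a right ideal.\<close>

theorem has_db_submodule:
 assumes R: "ring R" and H: "!!I. right_ideal I R ==> has_db R (sub_mod (reg_module R) I)"
  and P: "has_db R P" and K: "submodule K R P"
 shows "has_db R (sub_mod P K)"
proof -
 have Pm: "right_module R P" using P by (simp add: has_db_def)
 interpret P: right_module R P by (rule Pm)
 interpret reg: right_module R "reg_module R" by (rule right_module_reg[OF R])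
 have main: "[|set fs <= rhom R P (reg_module R); submodule K R P; {x \<in> K. \<forall>f\<in>set fs. f x = \<zero>\<^bsub>R\<^esub>} = nul P|]
  ==> has_db R (sub_mod P K)" for fs K
 proof (induction fs arbitrary: K)
  case Nil
  then have "K = nul P" by auto
  then have "dual_basis R (sub_mod P K) []" by (simp add: dual_basis_def)
  then show ?case using P.right_module_sub[OF Nil(2)] unfolding has_db_def by blast
 next
  case (Cons f fs)
  have f: "f \<in> rhom R P (reg_module R)" using Cons.prems by simp
  let ?K = "sub_mod P K"
  have Km: "right_module R ?K" by (rule P.right_module_sub[OF Cons.prems(2)])
  let ?f = "restrict f K"
  have f': "?f \<in> rhom R ?K (reg_module R)" by (rule rhom_restrict[OF Pm f Cons.prems(2)])
  have im: "right_ideal (?f ` K) R"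
   using submodule_image[OF Km reg.right_module_axioms f' right_module.submodule_carrier[OF Km]] by simp
  let ?K' = "hker ?K (reg_module R) ?f"
  have sK': "submodule ?K' R P"
   using submodule_ker[OF Km reg.right_module_axioms f'] P.submodule_sub_iff[OF Cons.prems(2)] by blast
  have "{x \<in> ?K'. \<forall>f\<in>set fs. f x = \<zero>\<^bsub>R\<^esub>} = {x \<in> K. \<forall>g\<in>set (f # fs). g x = \<zero>\<^bsub>R\<^esub>}" by auto
  then have "has_db R (sub_mod P ?K')" using Cons.IH[OF _ sK'] Cons.prems by simp
  moreover have "sub_mod P ?K' = sub_mod ?K ?K'" by simp
  ultimately have 1: "has_db R (sub_mod ?K ?K')" by simp
  have 2: "has_db R (sub_mod (reg_module R) (?f ` carrier ?K))" using H[OF im] by simp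
  show ?case
   by (rule has_db_extension[OF 1 Km 2 short_exact_sub[OF Km reg.right_module_axioms f']])
 qed
 obtain l where l: "coords R P P l" "!!x. x \<in> carrier P ==> dbsum P l x = x"
  using P by (auto simp: has_db_def dual_basis_def)
 have zero: "dbsum P l' x = \<zero>\<^bsub>P\<^esub>" if "\<forall>f\<in>snd ` set l'. f x = \<zero>\<^bsub>R\<^esub>" "fst ` set l' <= carrier P" for l' x
  using that by (induction l') auto
 show ?thesis
 proof (rule main[of "map snd l", OF _ K])
  show "set (map snd l) <= rhom R P (reg_module R)" using l(1) by (auto simp: coords_def)
  have "x = \<zero>\<^bsub>P\<^esub>" if "x \<in> K" "\<forall>f\<in>set (map snd l). f x = \<zero>\<^bsub>R\<^esub>" for x
  proof -
   have "fst ` set l <= carrier P" using l(1) by (auto simp: coords_def)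
   then have "dbsum P l x = \<zero>\<^bsub>P\<^esub>" using zero[of l x] that(2) by simp
   then show ?thesis using l(2)[of x] that(1) P.submoduleD(1)[OF K] by auto
  qed
  moreover have "f \<zero>\<^bsub>P\<^esub> = \<zero>\<^bsub>R\<^esub>" if "f \<in> set (map snd l)" for f
   using that l(1) rhom_zero[OF Pm reg.right_module_axioms, of f] by (auto simp: coords_def)
  ultimately show "{x \<in> K. \<forall>f\<in>set (map snd l). f x = \<zero>\<^bsub>R\<^esub>} = nul P"
   using P.submoduleD(2)[OF K] by blast
 qed
qed

section \<open>Modules that fit into the universe type\<close>

section \<open>Small modules\<close>

definition small_mod :: "'u itself => ('r, 'm) module => bool" where
 "small_mod (_ :: 'u itself) M \<longleftrightarrow> (\<exists>e :: 'm => 'u. inj_on e (carrier M))"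

lemma small_copy:
 fixes M :: "('r, 'm) module"
 assumes "small_mod TYPE('u) M" "right_module R M"
 obtains M' :: "('r, 'u) module" where "right_module R M'" "riso R M M' ~= {}" "riso R M' M ~= {}"
proof -
 obtain e :: "'m => 'u" where e: "inj_on e (carrier M)" using assms(1) by (auto simp: small_mod_def)
 note c = copy_module[OF assms(2) e]
 show thesis
  using that[of "copy_module e M"] c riso_inv[OF assms(2) c] by blast
qed

lemma small_mod_self: "small_mod TYPE('u) (M :: ('r, 'u) module)"
 unfolding small_mod_def by (intro exI[of _ id]) simp

lemma small_reg: "universe_for TYPE('u) R ==> small_mod TYPE('u) (reg_module R)"
 by (auto simp: small_mod_def universe_for_def)

lemma small_sub: "[|small_mod TYPE('u) M; N <= carrier M|] ==> small_mod TYPE('u) (sub_mod M N)"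
 unfolding small_mod_def by (elim exE, rule exI, erule inj_on_subset) simp

lemma small_surj:
 assumes "small_mod TYPE('u) M" "f ` carrier M = carrier N"
 shows "small_mod TYPE('u) N"
proof -
 obtain e :: "_ => 'u" where e: "inj_on e (carrier M)" using assms(1) by (auto simp: small_mod_def)
 have c: "inv_into (carrier M) f y \<in> carrier M" if "y \<in> carrier N" for y
  using that assms(2) inv_into_into[of y f "carrier M"] by simp
 then have "inj_on (\<lambda>y. e (inv_into (carrier M) f y)) (carrier N)"
 proof (intro inj_onI)
  fix x y assume xy: "x \<in> carrier N" "y \<in> carrier N" "e (inv_into (carrier M) f x) = e (inv_into (carrier M) f y)"
  have "inv_into (carrier M) f x = inv_into (carrier M) f y"
   by (rule inj_onD[OF e xy(3)]) (use c xy in blast)+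
  then show "x = y" using xy assms(2) by (intro inv_into_injective[of "carrier M" f x y]) auto
 qed
 then show ?thesis unfolding small_mod_def by blast
qed

lemma pair_injection:
 assumes "infinite (UNIV :: 'u set)"
 obtains p :: "'u \<times> 'u => 'u" where "inj p"
proof -
 have "|(UNIV :: 'u set) \<times> (UNIV :: 'u set)| =o |UNIV :: 'u set|"
  by (rule card_of_Times_same_infinite[OF assms])
 then obtain f where "bij_betw f ((UNIV :: 'u set) \<times> (UNIV :: 'u set)) (UNIV :: 'u set)"
  using card_of_ordIso by blast
 then show thesis using that[of f] by (auto simp: bij_betw_def)
qed

lemma small_times:
 fixes A :: "'a set" and B :: "'b set" and e :: "'a => 'u" and e' :: "'b => 'u"
 assumes "infinite (UNIV :: 'u set)" "inj_on e A" "inj_on e' B"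
 shows "\<exists>k :: 'a \<times> 'b => 'u. inj_on k (A \<times> B)"
proof -
 obtain p :: "'u \<times> 'u => 'u" where p: "inj p" using pair_injection[OF assms(1)] .
 have "inj_on (\<lambda>(a, b). p (e a, e' b)) (A \<times> B)"
 proof (rule inj_onI, clarify)
  fix a b a' b' assume ab: "a \<in> A" "b \<in> B" "a' \<in> A" "b' \<in> B" and "p (e a, e' b) = p (e a', e' b')"
  then have "(e a, e' b) = (e a', e' b')" by (intro injD[OF p])
  then show "a = a' \<and> b = b'" using inj_onD[OF assms(2)] inj_onD[OF assms(3)] ab by auto
 qed
 then show ?thesis by blast
qed

text \<open>Induction on the number of basis elements: a function supported on one more point is a
  pair of its value there and the rest, and pairs embed because an infinite type absorbs its
  square.\<close>

lemma small_free:
 assumes R: "ring R" and u: "universe_for TYPE('u) R" and A: "finite (carrier V)"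
 shows "small_mod TYPE('u) (free_on R V)"
proof -
 interpret R: ring R by (rule R)
 have inf: "infinite (UNIV :: 'u set)" using u by (simp add: universe_for_def)
 obtain i :: "_ => 'u" where i: "inj_on i (carrier R)" using u by (auto simp: universe_for_def)
 have "\<exists>e :: _ => 'u. inj_on e {a. (\<forall>v. a v \<in> carrier R) \<and> (\<forall>v. v \<notin> A --> a v = \<zero>\<^bsub>R\<^esub>)}" if "finite A" for A
  using that
 proof (induction A)
  case empty
  have "inj_on (\<lambda>a. undefined) {a. (\<forall>v. a v \<in> carrier R) \<and> (\<forall>v. v \<notin> {} --> a v = \<zero>\<^bsub>R\<^esub>)}"
   by (auto simp: inj_on_def)
  then show ?case by blast
 next
  case (insert w A)
  let ?X = "\<lambda>A. {a. (\<forall>v. a v \<in> carrier R) \<and> (\<forall>v. v \<notin> A --> a v = \<zero>\<^bsub>R\<^esub>)}"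
  obtain e :: "_ => 'u" where e: "inj_on e (?X A)" using insert by blast
  obtain k :: "_ => 'u" where k: "inj_on k (carrier R \<times> ?X A)" using small_times[OF inf i e] by blast
  have "inj_on (\<lambda>a. k (a w, a(w := \<zero>\<^bsub>R\<^esub>))) (?X (insert w A))"
  proof (rule inj_onI)
   fix a b assume ab: "a \<in> ?X (insert w A)" "b \<in> ?X (insert w A)"
    "k (a w, a(w := \<zero>\<^bsub>R\<^esub>)) = k (b w, b(w := \<zero>\<^bsub>R\<^esub>))"
   have "a(w := \<zero>\<^bsub>R\<^esub>) \<in> ?X A" "b(w := \<zero>\<^bsub>R\<^esub>) \<in> ?X A" "a w \<in> carrier R" "b w \<in> carrier R"
    using ab by auto
   then have "(a w, a(w := \<zero>\<^bsub>R\<^esub>)) = (b w, b(w := \<zero>\<^bsub>R\<^esub>))"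
    using inj_onD[OF k ab(3)] by auto
   then have "a w = b w" "a(w := \<zero>\<^bsub>R\<^esub>) = b(w := \<zero>\<^bsub>R\<^esub>)" by auto
   then show "a = b" by (metis fun_upd_triv fun_upd_upd)
  qed
  then show ?case by blast
 qed
 from this[OF A] obtain e :: "_ => 'u" where
  "inj_on e {a. (\<forall>v. a v \<in> carrier R) \<and> (\<forall>v. v \<notin> carrier V --> a v = \<zero>\<^bsub>R\<^esub>)}" by blast
 then have "inj_on e (carrier (free_on R V))"
  by (rule inj_on_subset) (auto simp: free_on_def)
 then show ?thesis unfolding small_mod_def by blast
qed

section \<open>What a full, faithful and essentially surjective functor preserves\<close>

section \<open>Equivalences of module categories\<close>

lemma rhom_factor:
 assumes L: "right_module R L" and N: "right_module R N" and h: "h \<in> rhom R L M" and i: "i \<in> rhom R N M" "inj_on i (carrier N)"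
  and im: "h ` carrier L <= i ` carrier N"
 obtains k where "k \<in> rhom R L N" "h = compose (carrier L) i k"
proof -
 interpret L: right_module R L by (rule L)
 interpret N: right_module R N by (rule N)
 let ?k = "\<lambda>x\<in>carrier L. inv_into (carrier N) i (h x)"
 have k: "?k x \<in> carrier N" "i (?k x) = h x" if "x \<in> carrier L" for x
 proof -
  have "h x \<in> i ` carrier N" using im that by auto
  then show "?k x \<in> carrier N" "i (?k x) = h x"
   using that by (simp_all add: inv_into_into f_inv_into_f)
 qed
 have inj: "x = y" if "i x = i y" "x \<in> carrier N" "y \<in> carrier N" for x y using i(2) that by (auto simp: inj_on_def)
 have "?k \<in> rhom R L N"
 proof (rule rhomI)
  fix x y assume xy: "x \<in> carrier L" "y \<in> carrier L"
  show "?k (x \<oplus>\<^bsub>L\<^esub> y) = ?k x \<oplus>\<^bsub>N\<^esub> ?k y"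
  proof (rule inj)
   show "i (?k (x \<oplus>\<^bsub>L\<^esub> y)) = i (?k x \<oplus>\<^bsub>N\<^esub> ?k y)"
    using k[of "x \<oplus>\<^bsub>L\<^esub> y"] k[OF xy(1)] k[OF xy(2)] xy
    by (simp only: rhom_add[OF i(1)] rhom_add[OF h] L.M.a_closed)
   show "?k (x \<oplus>\<^bsub>L\<^esub> y) \<in> carrier N" using k(1)[of "x \<oplus>\<^bsub>L\<^esub> y"] xy by blast
   show "?k x \<oplus>\<^bsub>N\<^esub> ?k y \<in> carrier N" using k(1) xy by blast
  qed
 next
  fix a x assume ax: "a \<in> carrier R" "x \<in> carrier L"
  show "?k (a \<odot>\<^bsub>L\<^esub> x) = a \<odot>\<^bsub>N\<^esub> ?k x"
  proof (rule inj)
   show "i (?k (a \<odot>\<^bsub>L\<^esub> x)) = i (a \<odot>\<^bsub>N\<^esub> ?k x)"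
    using k[of "a \<odot>\<^bsub>L\<^esub> x"] k[OF ax(2)] ax
    by (simp only: rhom_smult[OF i(1)] rhom_smult[OF h] L.smult_closed)
   show "?k (a \<odot>\<^bsub>L\<^esub> x) \<in> carrier N" using k(1)[of "a \<odot>\<^bsub>L\<^esub> x"] ax by blast
   show "a \<odot>\<^bsub>N\<^esub> ?k x \<in> carrier N" using k(1) ax by blast
  qed
 qed (use k in auto)
 moreover have "h = compose (carrier L) i ?k"
 proof
  fix x show "h x = compose (carrier L) i ?k x"
   using k(2)[of x] rhom_ext[OF h, of x] by (cases "x \<in> carrier L") (simp_all add: compose_def)
 qed
 ultimately show thesis using that by blast
qed

lemma risoI:
 assumes f: "f \<in> rhom R M N" and g: "g \<in> rhom R N M"
  and gf: "compose (carrier M) g f = (\<lambda>x\<in>carrier M. x)" and fg: "compose (carrier N) f g = (\<lambda>x\<in>carrier N. x)"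
 shows "f \<in> riso R M N"
proof -
 have 1: "g (f x) = x" if "x \<in> carrier M" for x using fun_cong[OF gf, of x] that by (simp add: compose_def)
 have 2: "f (g x) = x" if "x \<in> carrier N" for x using fun_cong[OF fg, of x] that by (simp add: compose_def)
 have "bij_betw f (carrier M) (carrier N)"
  by (rule bij_betw_byWitness[of _ g]) (use 1 2 rhom_closed[OF f] rhom_closed[OF g] in auto)
 then show ?thesis using f by (simp add: riso_def)
qed

lemma riso_inverse:
 assumes "right_module R M" "right_module R N" "f \<in> riso R M N"
 obtains g where "g \<in> riso R N M" "compose (carrier M) g f = (\<lambda>x\<in>carrier M. x)" "compose (carrier N) f g = (\<lambda>x\<in>carrier N. x)"
proof
 let ?g = "restrict (inv_into (carrier M) f) (carrier N)"
 show "?g \<in> riso R N M" by (rule riso_inv[OF assms])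
 have b: "bij_betw f (carrier M) (carrier N)" using assms(3) by (simp add: riso_def)
 have "f x \<in> carrier N" if "x \<in> carrier M" for x using b that by (auto simp: bij_betw_def)
 then show "compose (carrier M) ?g f = (\<lambda>x\<in>carrier M. x)"
  using bij_betw_inv_into_left[OF b] by (auto simp: compose_def)
 show "compose (carrier N) f ?g = (\<lambda>x\<in>carrier N. x)"
  using bij_betw_inv_into_right[OF b] by (auto simp: compose_def)
qed

lemma riso_rhom: "f \<in> riso R M N ==> f \<in> rhom R M N"
 by (simp add: riso_def)

text \<open>Neither additivity nor exactness is among the axioms. Zero maps are recognised by
  factoring through a zero module, and kernels and images through the action on submodules,
  \<open>Phi\<close>.\<close>

locale module_equiv =
 fixes R :: "('r, 'k) ring_scheme" and S :: "('s, 'l) ring_scheme"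
  and Fo :: "('r, 'u) module => ('s, 'u) module"
  and Fm :: "('r, 'u) module => ('r, 'u) module => ('u => 'u) => ('u => 'u)"
 assumes ringR: "ring R" and ringS: "ring S"
  and fctr: "mod_functor R S Fo Fm"
  and faithful: "[|right_module R M; right_module R N; f \<in> rhom R M N; g \<in> rhom R M N; Fm M N f = Fm M N g|] ==> f = g"
  and full: "[|right_module R M; right_module R N; h \<in> rhom S (Fo M) (Fo N)|] ==> \<exists>f\<in>rhom R M N. Fm M N f = h"
  and esurj: "right_module S (N' :: ('s, 'u) module) ==> \<exists>M. right_module R M \<and> riso S (Fo M) N' ~= {}"
begin

lemma Fo_module [simp]: "right_module R M ==> right_module S (Fo M)"
 using fctr unfolding mod_functor_def by blast

lemma Fm_rhom: "[|right_module R M; right_module R N; f \<in> rhom R M N|] ==> Fm M N f \<in> rhom S (Fo M) (Fo N)"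
 using fctr unfolding mod_functor_def by blast

lemma Fm_id: "right_module R M ==> Fm M M (\<lambda>x\<in>carrier M. x) = (\<lambda>x\<in>carrier (Fo M). x)"
 using fctr unfolding mod_functor_def by blast

lemma Fm_compose:
 "[|right_module R L; right_module R M; right_module R N; f \<in> rhom R L M; g \<in> rhom R M N|] ==>
  Fm L N (compose (carrier L) g f) = compose (carrier (Fo L)) (Fm M N g) (Fm L M f)"
 using fctr unfolding mod_functor_def by blast

lemma Fm_riso:
 assumes M: "right_module R M" and N: "right_module R N" and f: "f \<in> riso R M N"
 shows "Fm M N f \<in> riso S (Fo M) (Fo N)"
proof -
 obtain g where g: "g \<in> riso R N M" "compose (carrier M) g f = (\<lambda>x\<in>carrier M. x)" "compose (carrier N) f g = (\<lambda>x\<in>carrier N. x)"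
  using riso_inverse[OF M N f] .
 note fh = riso_rhom[OF f] and gh = riso_rhom[OF g(1)]
 show ?thesis
  by (rule risoI[OF Fm_rhom[OF M N fh] Fm_rhom[OF N M gh]])
   (use Fm_compose[OF M N M fh gh] Fm_compose[OF N M N gh fh] Fm_id[OF M] Fm_id[OF N] g in simp_all)
qed

lemma Fo_iso: "[|right_module R M; right_module R N; riso R M N ~= {}|] ==> riso S (Fo M) (Fo N) ~= {}"
 using Fm_riso by blast

text \<open>A module is zero when its zero endomorphism is the identity. The zero endomorphism of
  \<open>Fo M\<close> lifts to \<open>M\<close> by fullness; as \<open>M\<close> has only one
  endomorphism, it is the image of the identity.\<close>

lemma Fo_zero:
 assumes M: "right_module R M" and z: "carrier M = nul M"
 shows "carrier (Fo M) = nul (Fo M)"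
proof -
 interpret M: right_module R M by (rule M)
 interpret FM: right_module S "Fo M" by (rule Fo_module[OF M])
 have eq: "f = g" if "f \<in> rhom R M M" "g \<in> rhom R M M" for f g
  by (rule rhom_eqI[OF that]) (use z rhom_zero[OF M M that(1)] rhom_zero[OF M M that(2)] in auto)
 obtain f where f: "f \<in> rhom R M M" "Fm M M f = (\<lambda>x\<in>carrier (Fo M). \<zero>\<^bsub>Fo M\<^esub>)"
  using full[OF M M rhom_const_zero[OF FM.right_module_axioms FM.right_module_axioms]] by blast
 have "(\<lambda>x\<in>carrier (Fo M). \<zero>\<^bsub>Fo M\<^esub>) = (\<lambda>x\<in>carrier (Fo M). x)"
  using f eq[OF f(1) rhom_id[OF M]] Fm_id[OF M] by simp
 then have "x = \<zero>\<^bsub>Fo M\<^esub>" if "x \<in> carrier (Fo M)" for x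
  using that by (metis restrict_apply')
 then show ?thesis by auto
qed

text \<open>The zero map factors through a zero module, a description that asks for no additivity of
  \<open>Fm\<close>.\<close>

lemma Fm_zero:
 assumes M: "right_module R M" and N: "right_module R N"
 shows "Fm M N (\<lambda>x\<in>carrier M. \<zero>\<^bsub>N\<^esub>) = (\<lambda>x\<in>carrier (Fo M). \<zero>\<^bsub>Fo N\<^esub>)"
proof -
 interpret N: right_module R N by (rule N)
 let ?Z = "sub_mod N (nul N)"
 have Z: "right_module R ?Z" by (rule N.right_module_sub) simp
 have f: "(\<lambda>x\<in>carrier M. \<zero>\<^bsub>N\<^esub>) \<in> rhom R M ?Z" by (rule rhom_codomain[OF rhom_const_zero[OF M N]]) simp
 have g: "(\<lambda>x\<in>nul N. x) \<in> rhom R ?Z N" by (rule rhom_incl[OF N]) simp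
 have FZ: "carrier (Fo ?Z) = nul (Fo ?Z)" by (rule Fo_zero[OF Z]) simp
 have "(\<lambda>x\<in>carrier M. \<zero>\<^bsub>N\<^esub>) = compose (carrier M) (\<lambda>x\<in>nul N. x) (\<lambda>x\<in>carrier M. \<zero>\<^bsub>N\<^esub>)"
  by (auto simp: compose_def)
 then have "Fm M N (\<lambda>x\<in>carrier M. \<zero>\<^bsub>N\<^esub>) =
   compose (carrier (Fo M)) (Fm ?Z N (\<lambda>x\<in>nul N. x)) (Fm M ?Z (\<lambda>x\<in>carrier M. \<zero>\<^bsub>N\<^esub>))"
  using Fm_compose[OF M Z N f g] by simp
 moreover have "Fm M ?Z (\<lambda>x\<in>carrier M. \<zero>\<^bsub>N\<^esub>) x = \<zero>\<^bsub>Fo ?Z\<^esub>" if "x \<in> carrier (Fo M)" for x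
  using rhom_closed[OF Fm_rhom[OF M Z f] that] FZ by simp
 moreover have "Fm ?Z N (\<lambda>x\<in>nul N. x) \<zero>\<^bsub>Fo ?Z\<^esub> = \<zero>\<^bsub>Fo N\<^esub>"
  by (rule rhom_zero[OF Fo_module[OF Z] Fo_module[OF N] Fm_rhom[OF Z N g]])
 ultimately show ?thesis by (auto simp: compose_def)
qed

lemma Fm_zero_iff:
 assumes M: "right_module R M" and N: "right_module R N" and f: "f \<in> rhom R M N"
 shows "(\<forall>x\<in>carrier (Fo M). Fm M N f x = \<zero>\<^bsub>Fo N\<^esub>) \<longleftrightarrow> (\<forall>x\<in>carrier M. f x = \<zero>\<^bsub>N\<^esub>)"
proof -
 note FM = Fo_module[OF M] and FN = Fo_module[OF N]
 have "(\<forall>x\<in>carrier M. f x = \<zero>\<^bsub>N\<^esub>) \<longleftrightarrow> f = (\<lambda>x\<in>carrier M. \<zero>\<^bsub>N\<^esub>)"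
  using rhom_eqI[OF f rhom_const_zero[OF M N]] by auto
 also have "\<dots> \<longleftrightarrow> Fm M N f = (\<lambda>x\<in>carrier (Fo M). \<zero>\<^bsub>Fo N\<^esub>)"
  using faithful[OF M N f rhom_const_zero[OF M N]] Fm_zero[OF M N] by auto
 also have "\<dots> \<longleftrightarrow> (\<forall>x\<in>carrier (Fo M). Fm M N f x = \<zero>\<^bsub>Fo N\<^esub>)"
  using rhom_eqI[OF Fm_rhom[OF M N f] rhom_const_zero[OF FM FN]] by auto
 finally show ?thesis ..
qed

text \<open>The kernel of \<open>Fm M N f\<close> is isomorphic to some \<open>Fo K'\<close>, and
  its inclusion lifts to a map \<open>k\<close> from \<open>K'\<close> to \<open>M\<close>. The
  composite of \<open>f\<close> and \<open>k\<close> is zero by faithfulness, so \<open>k\<close> is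
  zero, and then so is the inclusion of the kernel.\<close>

lemma Fm_inj:
 assumes M: "right_module R M" and N: "right_module R N" and f: "f \<in> rhom R M N" "inj_on f (carrier M)"
 shows "inj_on (Fm M N f) (carrier (Fo M))"
proof -
 note FM = Fo_module[OF M] and FN = Fo_module[OF N] and Ff = Fm_rhom[OF M N f(1)]
 interpret FM: right_module S "Fo M" by (rule FM)
 interpret M: right_module R M by (rule M)
 let ?K = "hker (Fo M) (Fo N) (Fm M N f)"
 have K: "submodule ?K S (Fo M)" by (rule submodule_ker[OF FM FN Ff])
 have Km: "right_module S (sub_mod (Fo M) ?K)" by (rule FM.right_module_sub[OF K])
 obtain K' \<theta> where K': "right_module R K'" "\<theta> \<in> riso S (Fo K') (sub_mod (Fo M) ?K)"
  using esurj[OF Km] by blast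
 have \<theta>: "\<theta> \<in> rhom S (Fo K') (Fo M)"
  by (rule rhom_codomain_sub[OF riso_rhom[OF K'(2)]]) auto
 have \<theta>im: "\<theta> ` carrier (Fo K') = ?K" using K'(2) by (simp add: riso_def bij_betw_def)
 obtain k where k: "k \<in> rhom R K' M" "Fm K' M k = \<theta>" using full[OF K'(1) M \<theta>] by blast
 have fk: "compose (carrier K') f k \<in> rhom R K' N" by (rule rhom_compose[OF k(1) f(1) K'(1)])
 have "Fm K' N (compose (carrier K') f k) x = \<zero>\<^bsub>Fo N\<^esub>" if "x \<in> carrier (Fo K')" for x
  using Fm_compose[OF K'(1) M N k(1) f(1)] that \<theta>im k(2) by (auto simp: compose_def)
 then have "f (k x) = \<zero>\<^bsub>N\<^esub>" if "x \<in> carrier K'" for x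
  using Fm_zero_iff[OF K'(1) N fk] that by (auto simp: compose_def)
 then have "k x = \<zero>\<^bsub>M\<^esub>" if "x \<in> carrier K'" for x
  using that rhom_inj_iff[OF M N f(1)] f(2) rhom_closed[OF k(1) that] by blast
 then have "\<theta> x = \<zero>\<^bsub>Fo M\<^esub>" if "x \<in> carrier (Fo K')" for x
  using Fm_zero_iff[OF K'(1) M k(1)] k(2) that by auto
 then have "?K <= nul (Fo M)" using \<theta>im by auto
 then have "?K = nul (Fo M)" using FM.submoduleD(2)[OF K] by auto
 then show ?thesis using rhom_inj_iff[OF FM FN Ff] by simp
qed

text \<open>\<open>Fo (sub_mod M N)\<close> is not a subset of \<open>Fo M\<close>, so the submodule
  corresponding to \<open>N\<close> has to be the image of the transported inclusion.\<close>

definition Phi :: "('r, 'u) module => 'u set => 'u set" where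
 "Phi M N = Fm (sub_mod M N) M (\<lambda>x\<in>N. x) ` carrier (Fo (sub_mod M N))"

lemma incl_facts:
 assumes M: "right_module R M" and N: "submodule N R M"
 shows "right_module R (sub_mod M N)" "(\<lambda>x\<in>N. x) \<in> rhom R (sub_mod M N) M"
  "inj_on (\<lambda>x\<in>N. x) (carrier (sub_mod M N))" "(\<lambda>x\<in>N. x) ` carrier (sub_mod M N) = N"
  "Fm (sub_mod M N) M (\<lambda>x\<in>N. x) \<in> rhom S (Fo (sub_mod M N)) (Fo M)"
  "inj_on (Fm (sub_mod M N) M (\<lambda>x\<in>N. x)) (carrier (Fo (sub_mod M N)))"
proof -
 interpret right_module R M by (rule M)
 show 1: "right_module R (sub_mod M N)" by (rule right_module_sub[OF N])
 show 2: "(\<lambda>x\<in>N. x) \<in> rhom R (sub_mod M N) M" by (rule rhom_incl[OF M N])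
 show 3: "inj_on (\<lambda>x\<in>N. x) (carrier (sub_mod M N))" by (auto simp: inj_on_def)
 show "(\<lambda>x\<in>N. x) ` carrier (sub_mod M N) = N" by auto
 show "Fm (sub_mod M N) M (\<lambda>x\<in>N. x) \<in> rhom S (Fo (sub_mod M N)) (Fo M)" by (rule Fm_rhom[OF 1 M 2])
 show "inj_on (Fm (sub_mod M N) M (\<lambda>x\<in>N. x)) (carrier (Fo (sub_mod M N)))" by (rule Fm_inj[OF 1 M 2 3])
qed

lemma Phi_submodule:
 assumes M: "right_module R M" and N: "submodule N R M"
 shows "submodule (Phi M N) S (Fo M)"
 unfolding Phi_def using incl_facts[OF M N] M
 by (intro submodule_image) (auto intro: right_module.submodule_carrier)

text \<open>Both sides say that a map factors through a subobject: through the inclusion of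
  \<open>N\<close>, or through its image under the functor. Fullness and functoriality carry such a
  factorisation across, faithfulness brings it back.\<close>

lemma image_Phi_iff:
 assumes L: "right_module R L" and M: "right_module R M" and N: "submodule N R M" and f: "f \<in> rhom R L M"
 shows "Fm L M f ` carrier (Fo L) <= Phi M N \<longleftrightarrow> f ` carrier L <= N"
proof
 note N' = incl_facts[OF M N]
 assume "f ` carrier L <= N"
 then obtain k where k: "k \<in> rhom R L (sub_mod M N)" "f = compose (carrier L) (\<lambda>x\<in>N. x) k"
  using rhom_factor[OF L N'(1) f N'(2,3)] N'(4) by auto
 have "Fm L M f = compose (carrier (Fo L)) (Fm (sub_mod M N) M (\<lambda>x\<in>N. x)) (Fm L (sub_mod M N) k)"
  using Fm_compose[OF L N'(1) M k(1) N'(2)] k(2) by simp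
 then show "Fm L M f ` carrier (Fo L) <= Phi M N"
  using rhom_closed[OF Fm_rhom[OF L N'(1) k(1)]] unfolding Phi_def by (auto simp: compose_def)
next
 note N' = incl_facts[OF M N]
 assume "Fm L M f ` carrier (Fo L) <= Phi M N"
 then obtain h where h: "h \<in> rhom S (Fo L) (Fo (sub_mod M N))"
  "Fm L M f = compose (carrier (Fo L)) (Fm (sub_mod M N) M (\<lambda>x\<in>N. x)) h"
  using rhom_factor[OF Fo_module[OF L] Fo_module[OF N'(1)] Fm_rhom[OF L M f] N'(5,6)] unfolding Phi_def by auto
 obtain k where k: "k \<in> rhom R L (sub_mod M N)" "Fm L (sub_mod M N) k = h" using full[OF L N'(1) h(1)] by blast
 have "Fm L M f = Fm L M (compose (carrier L) (\<lambda>x\<in>N. x) k)"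
  using Fm_compose[OF L N'(1) M k(1) N'(2)] h(2) k(2) by simp
 then have "f = compose (carrier L) (\<lambda>x\<in>N. x) k"
  by (intro faithful[OF L M f rhom_compose[OF k(1) N'(2) L]])
 then show "f ` carrier L <= N" using rhom_closed[OF k(1)] by (auto simp: compose_def)
qed

lemma Phi_lat_iso:
 assumes M: "right_module R M"
 shows "lat_iso (submods R M) (submods S (Fo M)) (Phi M)"
 unfolding lat_iso_def
proof (intro conjI ballI)
 interpret FM: right_module S "Fo M" by (rule Fo_module[OF M])
 fix A B assume "A \<in> submods R M" "B \<in> submods R M"
 then have A: "submodule A R M" and B: "submodule B R M" by auto
 note A' = incl_facts[OF M A]
 show "(Phi M A <= Phi M B) = (A <= B)"
  using image_Phi_iff[OF A'(1) M B A'(2)] A'(4) unfolding Phi_def by simp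
next
 interpret FM: right_module S "Fo M" by (rule Fo_module[OF M])
 show "Phi M ` submods R M = submods S (Fo M)"
 proof (intro equalityI subsetI)
  fix Y assume "Y \<in> Phi M ` submods R M"
  then show "Y \<in> submods S (Fo M)" using Phi_submodule[OF M] by auto
 next
  fix Y assume "Y \<in> submods S (Fo M)"
  then have Y: "submodule Y S (Fo M)" by simp
  note Ym = FM.right_module_sub[OF Y]
  obtain K \<theta> where K: "right_module R K" "\<theta> \<in> riso S (Fo K) (sub_mod (Fo M) Y)" using esurj[OF Ym] by blast
  have \<theta>: "\<theta> \<in> rhom S (Fo K) (Fo M)"
   by (rule rhom_codomain_sub[OF riso_rhom[OF K(2)] FM.submoduleD(1)[OF Y]])
  have \<theta>im: "\<theta> ` carrier (Fo K) = Y" "inj_on \<theta> (carrier (Fo K))" using K(2) by (simp_all add: riso_def bij_betw_def)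
  obtain k where k: "k \<in> rhom R K M" "Fm K M k = \<theta>" using full[OF K(1) M \<theta>] by blast
  \<comment> \<open>The submodule corresponding to \<open>Y\<close> is the image of the map
    \<open>k\<close> lifting the inclusion of \<open>Y\<close>. Injectivity of \<open>k\<close> is
    shown below so that the inclusion of this image factors back through \<open>K\<close>.\<close>
  let ?X = "k ` carrier K"
  have X: "submodule ?X R M" by (rule submodule_image[OF K(1) M k(1) right_module.submodule_carrier[OF K(1)]])
  note X' = incl_facts[OF M X]
  have "Y <= Phi M ?X" using image_Phi_iff[OF K(1) M X k(1)] k(2) \<theta>im by simp
  moreover have "Phi M ?X <= Y"
  proof -
   have "hker K M k = nul K"
   proof -
    interpret K: right_module R K by (rule K(1))
    let ?Z = "hker K M k"
    have Z: "submodule ?Z R K" by (rule submodule_ker[OF K(1) M k(1)])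
    note Z' = incl_facts[OF K(1) Z]
    have c: "compose ?Z k (\<lambda>x\<in>?Z. x) \<in> rhom R (sub_mod K ?Z) M"
     using rhom_compose[OF Z'(2) k(1) Z'(1)] by simp
    have "compose ?Z k (\<lambda>x\<in>?Z. x) x = \<zero>\<^bsub>M\<^esub>" if "x \<in> carrier (sub_mod K ?Z)" for x
     using that by (simp add: compose_def)
    then have "\<forall>x\<in>carrier (Fo (sub_mod K ?Z)). Fm (sub_mod K ?Z) M (compose ?Z k (\<lambda>x\<in>?Z. x)) x = \<zero>\<^bsub>Fo M\<^esub>"
     using Fm_zero_iff[OF Z'(1) M c] by blast
    moreover have "Fm (sub_mod K ?Z) M (compose ?Z k (\<lambda>x\<in>?Z. x)) =
     compose (carrier (Fo (sub_mod K ?Z))) \<theta> (Fm (sub_mod K ?Z) K (\<lambda>x\<in>?Z. x))"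
     using Fm_compose[OF Z'(1) K(1) M Z'(2) k(1)] k(2) by simp
    ultimately have "\<theta> (Fm (sub_mod K ?Z) K (\<lambda>x\<in>?Z. x) x) = \<zero>\<^bsub>Fo M\<^esub>" if "x \<in> carrier (Fo (sub_mod K ?Z))" for x
     using that by (simp add: compose_def)
    then have "Fm (sub_mod K ?Z) K (\<lambda>x\<in>?Z. x) x = \<zero>\<^bsub>Fo K\<^esub>" if "x \<in> carrier (Fo (sub_mod K ?Z))" for x
     using that rhom_inj_iff[OF Fo_module[OF K(1)] Fo_module[OF M] \<theta>] \<theta>im(2) rhom_closed[OF Z'(5) that] by blast
    then have "\<forall>x\<in>?Z. (\<lambda>x\<in>?Z. x) x = \<zero>\<^bsub>K\<^esub>"
     using Fm_zero_iff[OF Z'(1) K(1) Z'(2)] by simp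
    then show ?thesis using K.submoduleD(2)[OF Z] by auto
   qed
   then have inj: "inj_on k (carrier K)" using rhom_inj_iff[OF K(1) M k(1)] by simp
   obtain j where j: "j \<in> rhom R (sub_mod M ?X) K" "(\<lambda>x\<in>?X. x) = compose (carrier (sub_mod M ?X)) k j"
    using rhom_factor[OF X'(1) K(1) X'(2) k(1) inj] X'(4) by auto
   have "Fm (sub_mod M ?X) M (\<lambda>x\<in>?X. x) = compose (carrier (Fo (sub_mod M ?X))) \<theta> (Fm (sub_mod M ?X) K j)"
    using Fm_compose[OF X'(1) K(1) M j(1) k(1)] j(2) k(2) by simp
   then show ?thesis
    using rhom_closed[OF Fm_rhom[OF X'(1) K(1) j(1)]] \<theta>im unfolding Phi_def by (auto simp: compose_def)
  qed
  ultimately show "Y \<in> Phi M ` submods R M" using X by auto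
 qed
qed

lemma Phi_zero:
 assumes M: "right_module R M" shows "Phi M (nul M) = nul (Fo M)"
 by (rule lat_iso_bot[OF right_module.modular_submods[OF M] right_module.modular_submods[OF Fo_module[OF M]] Phi_lat_iso[OF M]])

lemma Phi_carrier:
 assumes M: "right_module R M" shows "Phi M (carrier M) = carrier (Fo M)"
proof -
 interpret M: right_module R M by (rule M)
 interpret FM: right_module S "Fo M" by (rule Fo_module[OF M])
 obtain X where X: "submodule X R M" "carrier (Fo M) = Phi M X"
  using lat_iso_surj[OF Phi_lat_iso[OF M], of "carrier (Fo M)"] by auto
 then have "Phi M X <= Phi M (carrier M)" using lat_iso_le[OF Phi_lat_iso[OF M]] M.submoduleD(1) by simp
 then show ?thesis using X FM.submoduleD(1)[OF Phi_submodule[OF M M.submodule_carrier]] by auto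
qed

text \<open>The kernel is the largest submodule whose inclusion is killed by the map, and the
  functor preserves and reflects the vanishing of such composites.\<close>

lemma Phi_ker:
 assumes M: "right_module R M" and N: "right_module R N" and f: "f \<in> rhom R M N"
 shows "hker (Fo M) (Fo N) (Fm M N f) = Phi M (hker M N f)"
proof -
 note iso = Phi_lat_iso[OF M]
 have K: "submodule (hker M N f) R M" by (rule submodule_ker[OF M N f])
 have FK: "submodule (hker (Fo M) (Fo N) (Fm M N f)) S (Fo M)"
  by (rule submodule_ker[OF Fo_module[OF M] Fo_module[OF N] Fm_rhom[OF M N f]])
 have key: "Phi M X <= hker (Fo M) (Fo N) (Fm M N f) \<longleftrightarrow> X <= hker M N f" if X: "submodule X R M" for X
 proof -
  note X' = incl_facts[OF M X]
  have XM: "X <= carrier M" using right_module.submoduleD(1)[OF M X] .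
  have c: "compose X f (\<lambda>x\<in>X. x) \<in> rhom R (sub_mod M X) N" using rhom_compose[OF X'(2) f X'(1)] by simp
  have "Phi M X <= hker (Fo M) (Fo N) (Fm M N f) \<longleftrightarrow>
   (\<forall>x\<in>carrier (Fo (sub_mod M X)). Fm M N f (Fm (sub_mod M X) M (\<lambda>x\<in>X. x) x) = \<zero>\<^bsub>Fo N\<^esub>)"
   unfolding Phi_def using rhom_closed[OF X'(5)] by auto
  also have "\<dots> \<longleftrightarrow> (\<forall>x\<in>carrier (Fo (sub_mod M X)). Fm (sub_mod M X) N (compose X f (\<lambda>x\<in>X. x)) x = \<zero>\<^bsub>Fo N\<^esub>)"
   using Fm_compose[OF X'(1) M N X'(2) f] by (simp add: compose_def)
  also have "\<dots> \<longleftrightarrow> (\<forall>x\<in>carrier (sub_mod M X). compose X f (\<lambda>x\<in>X. x) x = \<zero>\<^bsub>N\<^esub>)"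
   by (rule Fm_zero_iff[OF X'(1) N c])
  also have "\<dots> \<longleftrightarrow> X <= hker M N f" using XM by (auto simp: compose_def)
  finally show ?thesis .
 qed
 obtain Y where Y: "submodule Y R M" "hker (Fo M) (Fo N) (Fm M N f) = Phi M Y"
  using lat_iso_surj[OF iso, of "hker (Fo M) (Fo N) (Fm M N f)"] FK by auto
 have "Y <= hker M N f" using key[OF Y(1)] Y(2) by simp
 moreover have "hker M N f <= Y" using key[OF K] Y(2) lat_iso_le[OF iso, of "hker M N f" Y] K Y(1) by simp
 ultimately show ?thesis using Y(2) by simp
qed

lemma Phi_image:
 assumes M: "right_module R M" and N: "right_module R N" and f: "f \<in> rhom R M N"
 shows "Fm M N f ` carrier (Fo M) = Phi N (f ` carrier M)"
proof -
 note iso = Phi_lat_iso[OF N]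
 have I: "submodule (f ` carrier M) R N"
  by (rule submodule_image[OF M N f right_module.submodule_carrier[OF M]])
 have FI: "submodule (Fm M N f ` carrier (Fo M)) S (Fo N)"
  by (rule submodule_image[OF Fo_module[OF M] Fo_module[OF N] Fm_rhom[OF M N f] right_module.submodule_carrier[OF Fo_module[OF M]]])
 obtain Y where Y: "submodule Y R N" "Fm M N f ` carrier (Fo M) = Phi N Y"
  using lat_iso_surj[OF iso, of "Fm M N f ` carrier (Fo M)"] FI by auto
 have "f ` carrier M <= Y" using image_Phi_iff[OF M N Y(1) f] Y(2) by simp
 moreover have "Y <= f ` carrier M"
  using image_Phi_iff[OF M N I f] Y(2) lat_iso_le[OF iso, of Y "f ` carrier M"] Y(1) I by simp
 ultimately show ?thesis using Y(2) by simp
qed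

lemma Fm_surj_iff:
 assumes M: "right_module R M" and N: "right_module R N" and f: "f \<in> rhom R M N"
 shows "Fm M N f ` carrier (Fo M) = carrier (Fo N) \<longleftrightarrow> f ` carrier M = carrier N"
proof -
 interpret N: right_module R N by (rule N)
 have I: "submodule (f ` carrier M) R N"
  by (rule submodule_image[OF M N f right_module.submodule_carrier[OF M]])
 show ?thesis
  unfolding Phi_image[OF M N f] Phi_carrier[OF N, symmetric]
  using lat_iso_eq[OF Phi_lat_iso[OF N], of "f ` carrier M" "carrier N"] I by simp
qed

lemma Fm_short_exact:
 assumes L: "right_module R L" and M: "right_module R M" and N: "right_module R N" and ex: "short_exact R L M N f g"
 shows "short_exact S (Fo L) (Fo M) (Fo N) (Fm L M f) (Fm M N g)"
proof -
 have f: "f \<in> rhom R L M" "inj_on f (carrier L)" and g: "g \<in> rhom R M N" "g ` carrier M = carrier N"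
  and im: "f ` carrier L = hker M N g" using ex by (auto simp: short_exact_def)
 have "Fm L M f ` carrier (Fo L) = hker (Fo M) (Fo N) (Fm M N g)"
  unfolding Phi_image[OF L M f(1)] Phi_ker[OF M N g(1)] im ..
 then show ?thesis
  using Fm_rhom[OF L M f(1)] Fm_rhom[OF M N g(1)] Fm_inj[OF L M f] Fm_surj_iff[OF M N g(1)] g(2)
  unfolding short_exact_def by blast
qed

lemma Fo_simple:
 assumes M: "right_module R M"
 shows "simple_module S (Fo M) \<longleftrightarrow> simple_module R M"
 unfolding right_module.simple_iff[OF M] right_module.simple_iff[OF Fo_module[OF M]]
  Phi_zero[OF M, symmetric] Phi_carrier[OF M, symmetric]
 by (rule lat_iso_covers[OF Phi_lat_iso[OF M]]) (use M in "auto intro: right_module.submodule_zero right_module.submodule_carrier")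

text \<open>\<open>Fo P\<close> is finitely generated because its submodule lattice is Noetherian. A
  finite free cover of it is of the form \<open>Fo X\<close> up to isomorphism; the cover lifts to a
  surjection from \<open>X\<close> to \<open>P\<close>, which splits, and the image of the splitting
  makes \<open>Fo P\<close> a retract of a free module.\<close>

lemma Fo_has_db:
 assumes accR: "right_acc R" and u: "universe_for TYPE('u) S"
  and P: "has_db R P"
 shows "has_db S (Fo P)"
proof -
 have Pm: "right_module R P" by (rule has_db_module[OF P])
 interpret P: right_module R P by (rule Pm)
 interpret FP: right_module S "Fo P" by (rule Fo_module[OF Pm])
 have "noeth R P"
  by (rule P.acc_fin_gen[OF accR has_db_fin_gen[OF P]])
 from lat_iso_acc[OF Phi_lat_iso[OF Pm] _ _ this]
 have "acc_between (submods S (Fo P)) (nul (Fo P)) (carrier (Fo P))"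
  by (simp add: Phi_zero[OF Pm] Phi_carrier[OF Pm])
 then have "fin_gen S (Fo P)" by (rule fin_gen_from_acc[OF FP.right_module_axioms])
 then obtain A g where A: "finite A" "A <= carrier (Fo P)"
  and g: "g \<in> rhom S (free_on S (sub_mod (Fo P) A)) (Fo P)"
  "g ` carrier (free_on S (sub_mod (Fo P) A)) = carrier (Fo P)"
  using fin_gen_free_surj[OF FP.right_module_axioms] by metis
 let ?A = "free_on S (sub_mod (Fo P) A)"
 have Am: "right_module S ?A" by (rule right_module_free[OF ringS])
 have Adb: "has_db S ?A" by (rule has_db_free[OF ringS]) (use A in simp)
 have "small_mod TYPE('u) ?A" by (rule small_free[OF ringS u]) (use A in simp)
 then obtain A' :: "('s, 'u) module" where A': "right_module S A'" "riso S ?A A' ~= {}" "riso S A' ?A ~= {}"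
  using small_copy Am by blast
 have A'db: "has_db S A'" by (rule has_db_riso[OF Adb A'(1,2)])
 obtain X where X: "right_module R X" "riso S (Fo X) A' ~= {}" using esurj[OF A'(1)] by blast
 have Xdb: "has_db S (Fo X)"
  by (rule has_db_riso[OF A'db Fo_module[OF X(1)] riso_nonempty_sym[OF Fo_module[OF X(1)] A'(1) X(2)]])
 have "riso S (Fo X) ?A ~= {}" by (rule riso_nonempty_trans[OF Fo_module[OF X(1)] X(2) A'(3)])
 then obtain \<theta> where \<theta>: "\<theta> \<in> riso S (Fo X) ?A" by blast
 have \<theta>': "\<theta> \<in> rhom S (Fo X) ?A" "\<theta> ` carrier (Fo X) = carrier ?A" using \<theta> by (auto simp: riso_def bij_betw_def)
 let ?h = "compose (carrier (Fo X)) g \<theta>"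
 have h: "?h \<in> rhom S (Fo X) (Fo P)" by (rule rhom_compose[OF \<theta>'(1) g(1) Fo_module[OF X(1)]])
 have "?h ` carrier (Fo X) = g ` (\<theta> ` carrier (Fo X))" by (auto simp: compose_def)
 then have hs: "?h ` carrier (Fo X) = carrier (Fo P)" using \<theta>'(2) g(2) by simp
 obtain k where k: "k \<in> rhom R X P" "Fm X P k = ?h" using full[OF X(1) Pm h] by blast
 have ks: "k ` carrier X = carrier P" using Fm_surj_iff[OF X(1) Pm k(1)] k(2) hs by simp
 obtain s where s: "s \<in> rhom R P X" "!!x. x \<in> carrier P ==> k (s x) = (\<lambda>x\<in>carrier P. x) x"
  using has_db_lift[OF P X(1) Pm k(1) ks rhom_id[OF Pm]] by blast
 have "compose (carrier P) k s = (\<lambda>x\<in>carrier P. x)" using s(2) by (auto simp: compose_def)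
 then have "compose (carrier (Fo P)) ?h (Fm P X s) = (\<lambda>x\<in>carrier (Fo P). x)"
  using Fm_compose[OF Pm X(1) Pm s(1) k(1)] Fm_id[OF Pm] k(2) by simp
 then have "?h (Fm P X s x) = x" if "x \<in> carrier (Fo P)" for x
  using that by (metis compose_eq restrict_apply')
 then show ?thesis
  by (rule has_db_retract[OF Xdb FP.right_module_axioms Fm_rhom[OF Pm X(1) s(1)] h])
qed

end

section \<open>Grothendieck groups and their universal property\<close>

section \<open>Grothendieck groups\<close>

definition exact_gens :: "('r, 'k) ring_scheme => ('r, 'u) module set => (('r, 'u) module set \<Rightarrow>\<^sub>0 int) set" where
 "exact_gens R C = {frag_of (iso_class R M) - frag_of (iso_class R L) - frag_of (iso_class R N) | L M N.
    L \<in> C \<and> M \<in> C \<and> N \<in> C \<and> (\<exists>f g. short_exact R L M N f g)}"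

lemma exact_gens_closed: "exact_gens R C <= carrier (groth_free R C)"
proof
 fix x assume "x \<in> exact_gens R C"
 then obtain L M N where LMN: "L \<in> C" "M \<in> C" "N \<in> C"
  "x = frag_of (iso_class R M) - frag_of (iso_class R L) - frag_of (iso_class R N)"
  unfolding exact_gens_def by blast
 have k: "Poly_Mapping.keys (frag_of (iso_class R X)) <= iso_class R ` C" if "X \<in> C" for X
  using that by simp
 have "Poly_Mapping.keys x <= iso_class R ` C"
  unfolding LMN(4) using k[OF LMN(1)] k[OF LMN(2)] k[OF LMN(3)] keys_diff by (meson Un_least order_trans)
 then show "x \<in> carrier (groth_free R C)" by (simp add: groth_free_def)
qed

lemma groth_free_group: "comm_group (groth_free R C)"
 unfolding groth_free_def by (rule abelian_free_Abelian_group)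

lemma groth_rel_subgroup: "subgroup (groth_rel R C) (groth_free R C)"
 using group.generate_is_subgroup[OF comm_group.axioms(2)[OF groth_free_group] exact_gens_closed]
 unfolding groth_rel_def exact_gens_def .

lemma groth_rel_normal: "groth_rel R C \<lhd> groth_free R C"
 by (rule comm_group.subgroup_imp_normal[OF groth_free_group groth_rel_subgroup])

lemma groth_comm_group: "comm_group (groth R C)"
 unfolding groth_def by (rule comm_group.abelian_FactGroup[OF groth_free_group groth_rel_subgroup])

lemma groth_proj_hom: "(\<lambda>a. groth_rel R C #>\<^bsub>groth_free R C\<^esub> a) \<in> hom (groth_free R C) (groth R C)"
 unfolding groth_def by (rule normal.r_coset_hom_Mod[OF groth_rel_normal])

lemma frag_of_groth_free: "M \<in> C ==> frag_of (iso_class R M) \<in> carrier (groth_free R C)"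
 by (simp add: groth_free_def)

lemma groth_class_closed: "M \<in> C ==> groth_class R C (iso_class R M) \<in> carrier (groth R C)"
 unfolding groth_class_def using groth_proj_hom[of R C] frag_of_groth_free[of M C R] by (auto simp: hom_def Pi_iff)

lemma groth_class_exact:
 assumes "L \<in> C" "M \<in> C" "N \<in> C" "short_exact R L M N f g"
 shows "groth_class R C (iso_class R M) =
  groth_class R C (iso_class R L) \<otimes>\<^bsub>groth R C\<^esub> groth_class R C (iso_class R N)"
proof -
 interpret F: comm_group "groth_free R C" by (rule groth_free_group)
 let ?l = "frag_of (iso_class R L)" and ?m = "frag_of (iso_class R M)" and ?n = "frag_of (iso_class R N)"
 have c: "?l \<in> carrier (groth_free R C)" "?m \<in> carrier (groth_free R C)" "?n \<in> carrier (groth_free R C)"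
  using assms frag_of_groth_free by auto
 have "?m - ?l - ?n \<in> exact_gens R C" unfolding exact_gens_def using assms by blast
 then have r: "?m - ?l - ?n \<in> groth_rel R C"
  unfolding groth_rel_def exact_gens_def[symmetric] by (rule generate.incl)
 have lnc: "?l + ?n \<in> carrier (groth_free R C)"
  using F.m_closed[OF c(1,3)] by (simp add: groth_free_def)
 have "?m \<in> groth_rel R C #>\<^bsub>groth_free R C\<^esub> (?l + ?n)"
  unfolding r_coset_def using r by (auto simp: groth_free_def intro!: bexI[of _ "?m - ?l - ?n"])
 then have "groth_rel R C #>\<^bsub>groth_free R C\<^esub> ?m = groth_rel R C #>\<^bsub>groth_free R C\<^esub> (?l + ?n)"
  using F.repr_independence[OF _ lnc groth_rel_subgroup] by simp
 also have "\<dots> = (groth_rel R C #>\<^bsub>groth_free R C\<^esub> ?l) \<otimes>\<^bsub>groth R C\<^esub> (groth_rel R C #>\<^bsub>groth_free R C\<^esub> ?n)"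
  using hom_mult[OF groth_proj_hom c(1,3)] by (simp add: groth_free_def)
 finally show ?thesis unfolding groth_class_def .
qed

text \<open>The generators are isomorphism classes, so \<open>f\<close> has to be constant on them
  to descend through a chosen representative; the exact sequence relations then lie in the kernel of
  the induced map on the free group.\<close>

theorem groth_universal:
 fixes R :: "('r, 'k) ring_scheme" and C :: "('r, 'u) module set"
 assumes A: "comm_group A" and C: "!!M. M \<in> C ==> right_module R M"
  and f: "!!M. M \<in> C ==> f M \<in> carrier A"
  and iso: "!!M N. [|M \<in> C; N \<in> C; riso R M N ~= {}|] ==> f M = f N"
  and ex: "!!L M N i p. [|L \<in> C; M \<in> C; N \<in> C; short_exact R L M N i p|] ==> f M = f L \<otimes>\<^bsub>A\<^esub> f N"
 shows "\<exists>h\<in>hom (groth R C) A. \<forall>M\<in>C. h (groth_class R C (iso_class R M)) = f M"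
proof -
 interpret A: comm_group A by (rule A)
 interpret F: comm_group "groth_free R C" by (rule groth_free_group)
 define k where "k c = f (SOME M. M \<in> C \<and> iso_class R M = c)" for c :: "('r, 'u) module set"
 have k: "k (iso_class R M) = f M" if M: "M \<in> C" for M
 proof -
  let ?N = "SOME N. N \<in> C \<and> (iso_class R N :: ('r, 'u) module set) = iso_class R M"
  have N: "?N \<in> C \<and> (iso_class R ?N :: ('r, 'u) module set) = iso_class R M"
   by (rule someI[of _ M]) (use M in simp)
  then have "riso R ?N M ~= {}" using iso_class_eq_iff[of R ?N M] C M by blast
  then show ?thesis unfolding k_def using iso N M by blast
 qed
 have "k ` (iso_class R ` C) <= carrier A" using k f by auto
 then obtain h0 where h0: "h0 \<in> hom (groth_free R C) A" "!!c. c \<in> iso_class R ` C ==> h0 (frag_of c) = k c"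
  unfolding groth_free_def using A.free_Abelian_group_universal by metis
 interpret h0: group_hom "groth_free R C" A h0
  by (rule group_hom.intro) (auto intro: group_hom_axioms.intro h0 F.is_group A.is_group)
 have "exact_gens R C <= kernel (groth_free R C) A h0"
 proof
  fix x assume x: "x \<in> exact_gens R C"
  then obtain L M N i p where LMN: "L \<in> C" "M \<in> C" "N \<in> C" "short_exact R L M N i p"
   "x = frag_of (iso_class R M) - frag_of (iso_class R L) - frag_of (iso_class R N)"
   unfolding exact_gens_def by blast
  let ?l = "frag_of (iso_class R L)" and ?m = "frag_of (iso_class R M)" and ?n = "frag_of (iso_class R N)"
  have xc: "x \<in> carrier (groth_free R C)" using x exact_gens_closed by blast
  have c: "?l \<in> carrier (groth_free R C)" "?m \<in> carrier (groth_free R C)" "?n \<in> carrier (groth_free R C)"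
   using LMN frag_of_groth_free by auto
  have "x \<otimes>\<^bsub>groth_free R C\<^esub> (?l \<otimes>\<^bsub>groth_free R C\<^esub> ?n) = ?m" using LMN(5) by (simp add: groth_free_def)
  then have "h0 x \<otimes>\<^bsub>A\<^esub> (h0 ?l \<otimes>\<^bsub>A\<^esub> h0 ?n) = h0 ?m"
   using xc c by (metis F.m_closed h0.hom_mult)
  moreover have "h0 ?l = f L" "h0 ?m = f M" "h0 ?n = f N" using h0(2) k LMN(1-3) by auto
  ultimately have "h0 x \<otimes>\<^bsub>A\<^esub> (f L \<otimes>\<^bsub>A\<^esub> f N) = f L \<otimes>\<^bsub>A\<^esub> f N" using ex[OF LMN(1-4)] by simp
  then have "h0 x = \<one>\<^bsub>A\<^esub>" using f LMN(1-3) h0.hom_closed[OF xc] A.r_cancel_one' by (metis A.m_closed A.l_cancel_one')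
  then show "x \<in> kernel (groth_free R C) A h0" using xc by (simp add: kernel_def)
 qed
 then have "groth_rel R C <= kernel (groth_free R C) A h0"
  unfolding groth_rel_def exact_gens_def[symmetric]
  by (rule F.generate_subgroup_incl[OF _ h0.subgroup_kernel])
 then obtain h where h: "h \<in> hom (groth_free R C Mod groth_rel R C) A"
  "!!x. x \<in> carrier (groth_free R C) ==> h (groth_rel R C #>\<^bsub>groth_free R C\<^esub> x) = h0 x"
  using h0.FactGroup_universal_kernel[OF groth_rel_normal] by metis
 have "h (groth_class R C (iso_class R M)) = f M" if "M \<in> C" for M
  unfolding groth_class_def using h(2)[OF frag_of_groth_free[OF that]] h0(2) k that by auto
 then show ?thesis using h(1) unfolding groth_def by blast
qed

theorem groth_hom_eq:
 assumes A: "group A" and h: "h \<in> hom (groth R C) A" and h': "h' \<in> hom (groth R C) A"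
  and eq: "!!M. M \<in> C ==> h (groth_class R C (iso_class R M)) = h' (groth_class R C (iso_class R M))"
  and x: "x \<in> carrier (groth R C)"
 shows "h x = h' x"
proof -
 interpret A: group A by (rule A)
 interpret F: comm_group "groth_free R C" by (rule groth_free_group)
 let ?q = "\<lambda>a. groth_rel R C #>\<^bsub>groth_free R C\<^esub> a"
 have H: "group_hom (groth_free R C) A (\<lambda>a. g (?q a))" if "g \<in> hom (groth R C) A" for g
  by (rule group_hom.intro) (use hom_compose[OF groth_proj_hom that] in
   \<open>auto intro: group_hom_axioms.intro F.is_group A.is_group simp: comp_def\<close>)
 interpret h: group_hom "groth_free R C" A "\<lambda>a. h (?q a)" by (rule H[OF h])
 interpret h': group_hom "groth_free R C" A "\<lambda>a. h' (?q a)" by (rule H[OF h'])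
 obtain a where a: "a \<in> carrier (groth_free R C)" "x = ?q a"
  using x unfolding groth_def FactGroup_def RCOSETS_def by auto
 have "Poly_Mapping.keys a <= iso_class R ` C" using a(1) by (simp add: groth_free_def)
 then have "a \<in> carrier (groth_free R C) \<and> h (?q a) = h' (?q a)"
 proof (induction a rule: frag_induction)
  case zero
  then show ?case using h.hom_one h'.hom_one F.one_closed by (simp add: groth_free_def)
 next
  case (one c)
  then show ?case using eq unfolding groth_class_def groth_free_def by auto
 next
  case (diff a b)
  then have ab: "a \<in> carrier (groth_free R C)" "b \<in> carrier (groth_free R C)" by auto
  have "Poly_Mapping.keys b <= iso_class R ` C" using ab(2) by (simp add: groth_free_def)
  then have d: "a - b = a \<otimes>\<^bsub>groth_free R C\<^esub> inv\<^bsub>groth_free R C\<^esub> b" by (simp add: groth_free_def)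
  have "a - b \<in> carrier (groth_free R C)" unfolding d using ab by simp
  moreover have "h (?q (a - b)) = h' (?q (a - b))"
   unfolding d using ab diff h.hom_mult h'.hom_mult h.hom_inv h'.hom_inv by simp
  ultimately show ?case by blast
 qed
 then show ?thesis using a by simp
qed

section \<open>Exact sequences up to isomorphism, and fibre products\<close>

section \<open>Exact sequences and isomorphisms\<close>

lemma short_exact_riso:
 assumes m: "right_module R L" "right_module R M" "right_module R N"
   "right_module R L'" "right_module R M'" "right_module R N'"
  and a: "\<alpha> \<in> riso R L' L" and b: "\<beta> \<in> riso R M M'" and c: "\<gamma> \<in> riso R N N'"
  and ex: "short_exact R L M N f g"
 shows "\<exists>f' g'. short_exact R L' M' N' f' g'"
proof -
 have f: "f \<in> rhom R L M" "inj_on f (carrier L)" and g: "g \<in> rhom R M N" "g ` carrier M = carrier N"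
  and im: "f ` carrier L = hker M N g" using ex by (auto simp: short_exact_def)
 obtain \<beta>' where b': "\<beta>' \<in> riso R M' M" "compose (carrier M) \<beta>' \<beta> = (\<lambda>x\<in>carrier M. x)" "compose (carrier M') \<beta> \<beta>' = (\<lambda>x\<in>carrier M'. x)"
  using riso_inverse[OF m(2,5) b] .
 have bb: "\<beta>' (\<beta> x) = x" if "x \<in> carrier M" for x using fun_cong[OF b'(2), of x] that by (simp add: compose_def)
 have bb': "\<beta> (\<beta>' x) = x" if "x \<in> carrier M'" for x using fun_cong[OF b'(3), of x] that by (simp add: compose_def)
 note hom = riso_rhom[OF a] riso_rhom[OF b] riso_rhom[OF c] riso_rhom[OF b'(1)]
 have A: "\<alpha> ` carrier L' = carrier L" "inj_on \<alpha> (carrier L')" using a by (auto simp: riso_def bij_betw_def)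
 have B: "\<beta> ` carrier M = carrier M'" "inj_on \<beta> (carrier M)" using b by (auto simp: riso_def bij_betw_def)
 have B': "\<beta>' ` carrier M' = carrier M" using b'(1) by (auto simp: riso_def bij_betw_def)
 have C: "\<gamma> ` carrier N = carrier N'" "inj_on \<gamma> (carrier N)" using c by (auto simp: riso_def bij_betw_def)
 let ?f = "compose (carrier L') \<beta> (compose (carrier L') f \<alpha>)"
 let ?g = "compose (carrier M') \<gamma> (compose (carrier M') g \<beta>')"
 have "?f \<in> rhom R L' M'" by (rule rhom_compose[OF rhom_compose[OF hom(1) f(1) m(4)] hom(2) m(4)])
 moreover have "?g \<in> rhom R M' N'" by (rule rhom_compose[OF rhom_compose[OF hom(4) g(1) m(5)] hom(3) m(5)])
 moreover have fx: "?f x = \<beta> (f (\<alpha> x))" if "x \<in> carrier L'" for x using that by (simp add: compose_def)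
 moreover have gx: "?g x = \<gamma> (g (\<beta>' x))" if "x \<in> carrier M'" for x using that by (simp add: compose_def)
 moreover have "inj_on ?f (carrier L')"
 proof (rule inj_onI)
  fix x y assume xy: "x \<in> carrier L'" "y \<in> carrier L'" "?f x = ?f y"
  have ax: "\<alpha> x \<in> carrier L" "\<alpha> y \<in> carrier L" using rhom_closed[OF hom(1)] xy by auto
  have "f (\<alpha> x) = f (\<alpha> y)"
   using inj_onD[OF B(2)] xy fx rhom_closed[OF f(1)] ax by auto
  then show "x = y" using inj_onD[OF f(2)] inj_onD[OF A(2)] ax xy by auto
 qed
 moreover have "?g ` carrier M' = carrier N'"
 proof -
  have "?g ` carrier M' = \<gamma> ` (g ` (\<beta>' ` carrier M'))" unfolding image_image by (rule image_cong) (auto simp: gx)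
  then show ?thesis using B' g(2) C(1) by simp
 qed
 moreover have "?f ` carrier L' = hker M' N' ?g"
 proof -
  have "?f ` carrier L' = \<beta> ` (f ` (\<alpha> ` carrier L'))" unfolding image_image by (rule image_cong) (auto simp: fx)
  also have "\<dots> = \<beta> ` hker M N g" using A(1) im by simp
  also have "\<dots> = hker M' N' ?g"
  proof (intro equalityI subsetI)
   fix y assume "y \<in> \<beta> ` hker M N g"
   then obtain x where x: "x \<in> carrier M" "g x = \<zero>\<^bsub>N\<^esub>" "y = \<beta> x" by auto
   then show "y \<in> hker M' N' ?g"
    using bb[OF x(1)] rhom_closed[OF hom(2) x(1)] rhom_zero[OF m(3,6) hom(3)] gx by simp
  next
   fix y assume "y \<in> hker M' N' ?g"
   then have y: "y \<in> carrier M'" "\<gamma> (g (\<beta>' y)) = \<zero>\<^bsub>N'\<^esub>" using gx by auto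
   have by': "\<beta>' y \<in> carrier M" by (rule rhom_closed[OF hom(4) y(1)])
   have "g (\<beta>' y) = \<zero>\<^bsub>N\<^esub>"
   proof (rule inj_onD[OF C(2)])
    show "\<gamma> (g (\<beta>' y)) = \<gamma> \<zero>\<^bsub>N\<^esub>" using y(2) rhom_zero[OF m(3,6) hom(3)] by simp
    show "g (\<beta>' y) \<in> carrier N" by (rule rhom_closed[OF g(1) by'])
    show "\<zero>\<^bsub>N\<^esub> \<in> carrier N" using right_module.submoduleD(2)[OF m(3) right_module.submodule_carrier[OF m(3)]] .
   qed
   then have "\<beta>' y \<in> hker M N g" using by' by simp
   then show "y \<in> \<beta> ` hker M N g" using imageI[of "\<beta>' y" "hker M N g" \<beta>] bb'[OF y(1)] by simp
  qed
  finally show ?thesis .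
 qed
 ultimately have "short_exact R L' M' N' ?f ?g" unfolding short_exact_def by blast
 then show ?thesis by blast
qed

definition prod_mod :: "('r, 'm) module => ('r, 'n) module => ('r, 'm \<times> 'n) module" where
 "prod_mod M N = \<lparr>carrier = carrier M \<times> carrier N, mult = (\<lambda>x y. x), one = (\<zero>\<^bsub>M\<^esub>, \<zero>\<^bsub>N\<^esub>), ring.zero = (\<zero>\<^bsub>M\<^esub>, \<zero>\<^bsub>N\<^esub>),
  add = (\<lambda>x y. (fst x \<oplus>\<^bsub>M\<^esub> fst y, snd x \<oplus>\<^bsub>N\<^esub> snd y)), smult = (\<lambda>a x. (a \<odot>\<^bsub>M\<^esub> fst x, a \<odot>\<^bsub>N\<^esub> snd x))\<rparr>"

lemma right_module_prod:
 assumes "right_module R M" "right_module R N"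
 shows "right_module R (prod_mod M N)"
proof -
 interpret M: right_module R M by fact
 interpret N: right_module R N by fact
 have "abelian_group (prod_mod M N)"
 proof (rule abelian_groupI)
  fix x assume x: "x \<in> carrier (prod_mod M N)"
  show "\<exists>y\<in>carrier (prod_mod M N). y \<oplus>\<^bsub>prod_mod M N\<^esub> x = \<zero>\<^bsub>prod_mod M N\<^esub>"
   by (rule bexI[of _ "(\<ominus>\<^bsub>M\<^esub> fst x, \<ominus>\<^bsub>N\<^esub> snd x)"]) (use x in "auto simp: prod_mod_def M.M.l_neg N.M.l_neg")
 qed (auto simp: prod_mod_def M.M.a_assoc N.M.a_assoc intro: M.M.a_comm N.M.a_comm)
 moreover have "right_module_axioms R (prod_mod M N)"
  by (rule right_module_axioms.intro)
   (auto simp: prod_mod_def M.smult_l_distr N.smult_l_distr M.smult_r_distr N.smult_r_distr M.smult_assoc N.smult_assoc)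
 ultimately show ?thesis by (intro right_module.intro M.R.ring_axioms)
qed

text \<open>\<open>X\<close> is the fibre product of \<open>p1\<close> and \<open>p2\<close>. Its
  projection to \<open>P1\<close> is onto because \<open>p2\<close> is, with kernel a copy of
  \<open>K2\<close>. The last claim repeats this with the two factors swapped, so that one fibre
  product can be read from both sides.\<close>

lemma pullback_exact:
 assumes m: "right_module R K2" "right_module R P1" "right_module R P2" "right_module R M"
  and p1: "p1 \<in> rhom R P1 M" and ex: "short_exact R K2 P2 M i2 p2"
  and X: "X = {x \<in> carrier (prod_mod P1 P2). p1 (fst x) = p2 (snd x)}"
 shows "right_module R (sub_mod (prod_mod P1 P2) X)"
  "\<exists>f g. short_exact R K2 (sub_mod (prod_mod P1 P2) X) P1 f g"
  "\<exists>f g. short_exact R K2 (sub_mod (prod_mod P2 P1) ((\<lambda>x. (snd x, fst x)) ` X)) P1 f g"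
proof -
 interpret P1: right_module R P1 by (rule m(2))
 interpret P2: right_module R P2 by (rule m(3))
 interpret M: right_module R M by (rule m(4))
 have i2: "i2 \<in> rhom R K2 P2" "inj_on i2 (carrier K2)" and p2: "p2 \<in> rhom R P2 M" "p2 ` carrier P2 = carrier M"
  and im: "i2 ` carrier K2 = hker P2 M p2" using ex by (auto simp: short_exact_def)
 have i2k: "p2 (i2 x) = \<zero>\<^bsub>M\<^esub>" if "x \<in> carrier K2" for x using im that by blast
 interpret PP: right_module R "prod_mod P1 P2" by (rule right_module_prod[OF m(2,3)])
 interpret PP': right_module R "prod_mod P2 P1" by (rule right_module_prod[OF m(3,2)])
 have pz: "p1 \<zero>\<^bsub>P1\<^esub> = \<zero>\<^bsub>M\<^esub>" "p2 \<zero>\<^bsub>P2\<^esub> = \<zero>\<^bsub>M\<^esub>" using rhom_zero[OF m(2,4) p1] rhom_zero[OF m(3,4) p2(1)] .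
 have sX: "submodule X R (prod_mod P1 P2)"
  unfolding X
  by (rule PP.submoduleI)
   (auto simp: prod_mod_def rhom_add[OF p1] rhom_add[OF p2(1)] rhom_smult[OF p1] rhom_smult[OF p2(1)] pz)
 have sX': "submodule ((\<lambda>x. (snd x, fst x)) ` X) R (prod_mod P2 P1)"
 proof -
  have "(\<lambda>x. (snd x, fst x)) ` X = {x \<in> carrier (prod_mod P2 P1). p1 (snd x) = p2 (fst x)}"
   unfolding X by (force simp: prod_mod_def image_iff)
  then show ?thesis
   by (simp, intro PP'.submoduleI)
    (auto simp: prod_mod_def rhom_add[OF p1] rhom_add[OF p2(1)] rhom_smult[OF p1] rhom_smult[OF p2(1)] pz)
 qed
 show Xm: "right_module R (sub_mod (prod_mod P1 P2) X)" by (rule PP.right_module_sub[OF sX])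
 have Xm': "right_module R (sub_mod (prod_mod P2 P1) ((\<lambda>x. (snd x, fst x)) ` X))" by (rule PP'.right_module_sub[OF sX'])
 let ?X = "sub_mod (prod_mod P1 P2) X"
 let ?f = "\<lambda>x\<in>carrier K2. (\<zero>\<^bsub>P1\<^esub>, i2 x)" and ?g = "\<lambda>x\<in>X. fst x"
 have f: "?f \<in> rhom R K2 ?X"
  by (rule rhom_restrictI[OF m(1)])
   (use i2k rhom_closed[OF i2(1)] in "auto simp: X prod_mod_def pz rhom_add[OF i2(1)] rhom_smult[OF i2(1)]")
 have g: "?g \<in> rhom R ?X P1"
  using rhom_restrictI[OF Xm, of fst P1] by (auto simp: X prod_mod_def)
 have fi: "inj_on ?f (carrier K2)" using i2(2) by (auto simp: inj_on_def)
 have gs: "?g ` X = carrier P1"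
 proof (intro equalityI subsetI)
  fix x assume x: "x \<in> carrier P1"
  then have "p1 x \<in> p2 ` carrier P2" unfolding p2(2) by (rule rhom_closed[OF p1])
  then obtain y where y: "y \<in> carrier P2" "p1 x = p2 y" by auto
  then have "(x, y) \<in> X" using x by (simp add: X prod_mod_def)
  then have "?g (x, y) \<in> ?g ` X" by (rule imageI)
  then show "x \<in> ?g ` X" using \<open>(x, y) \<in> X\<close> by simp
 qed (auto simp: X prod_mod_def)
 have fg: "?f ` carrier K2 = {x \<in> X. ?g x = \<zero>\<^bsub>P1\<^esub>}"
 proof (intro equalityI subsetI)
  fix x assume "x \<in> ?f ` carrier K2"
  then obtain y where y: "y \<in> carrier K2" "x = (\<zero>\<^bsub>P1\<^esub>, i2 y)" by auto
  then show "x \<in> {x \<in> X. ?g x = \<zero>\<^bsub>P1\<^esub>}" using rhom_closed[OF f y(1)] by auto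
 next
  fix x assume x: "x \<in> {x \<in> X. ?g x = \<zero>\<^bsub>P1\<^esub>}"
  then have "fst x = \<zero>\<^bsub>P1\<^esub>" "snd x \<in> hker P2 M p2" using pz by (auto simp: X prod_mod_def)
  then obtain y where "y \<in> carrier K2" "snd x = i2 y" using im by blast
  then show "x \<in> ?f ` carrier K2" using \<open>fst x = _\<close> by (intro image_eqI[of _ _ y]) (auto simp: prod_eq_iff)
 qed
 have se: "short_exact R K2 ?X P1 ?f ?g"
  unfolding short_exact_def using f g fi gs fg by simp
 then show "\<exists>f g. short_exact R K2 ?X P1 f g" by blast
 have "(\<lambda>x\<in>X. (snd x, fst x)) \<in> rhom R ?X (sub_mod (prod_mod P2 P1) ((\<lambda>x. (snd x, fst x)) ` X))"
  using rhom_restrictI[OF Xm, of "\<lambda>x. (snd x, fst x)" "sub_mod (prod_mod P2 P1) ((\<lambda>x. (snd x, fst x)) ` X)"]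
  by (auto simp: prod_mod_def)
 then have sw: "(\<lambda>x\<in>X. (snd x, fst x)) \<in> riso R ?X (sub_mod (prod_mod P2 P1) ((\<lambda>x. (snd x, fst x)) ` X))"
  by (auto simp: riso_def bij_betw_def inj_on_def prod_eq_iff)
 show "\<exists>f g. short_exact R K2 (sub_mod (prod_mod P2 P1) ((\<lambda>x. (snd x, fst x)) ` X)) P1 f g"
  by (rule short_exact_riso[OF m(1) Xm m(2) m(1) Xm' m(2) riso_id[OF m(1)] sw riso_id[OF m(2)] se])
qed

section \<open>Schanuel's lemma and Euler characteristics\<close>

section \<open>The class group of finitely generated projective modules\<close>

lemma (in comm_group) cross_quotient:
 assumes c: "a \<in> carrier G" "b \<in> carrier G" "c \<in> carrier G" "d \<in> carrier G" and e: "d \<otimes> a = c \<otimes> b"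
 shows "a \<otimes> inv c = b \<otimes> inv d"
proof -
 have "a \<otimes> inv c = inv d \<otimes> (d \<otimes> a) \<otimes> inv c" using c by (simp add: m_assoc[symmetric])
 also have "\<dots> = b \<otimes> inv d \<otimes> (c \<otimes> inv c)" 
  unfolding e using c m_comm[of "inv d" "c \<otimes> b"] m_comm[of c b] by (simp add: m_assoc m_comm[of "inv d" "c \<otimes> inv c"] m_lcomm[of c "inv d"])
 finally show ?thesis using c by simp
qed

locale hereditary_universe =
 fixes R :: "('r, 'k) ring_scheme" and U :: "'u itself"
 assumes ringR: "ring R" and univ: "universe_for U R"
  and hereditary: "!!I. right_ideal I R ==> has_db R (sub_mod (reg_module R) I)"
begin

lemma univ': "universe_for TYPE('u) R"
 using univ by (simp add: universe_for_def)

abbreviation K :: "('r, 'u) groth_elem monoid" where "K \<equiv> K0 R"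

abbreviation kcl :: "('r, 'm) module => ('r, 'u) groth_elem" where "kcl P \<equiv> K0_class R P"

lemma K_comm_group: "comm_group K"
 unfolding K0_def by (rule groth_comm_group)

lemma acc_ring: "right_acc R"
 using acc_from_fin_gen[OF right_module_reg[OF ringR]] has_db_fin_gen[OF hereditary] by simp

lemma small_db_copy:
 assumes "has_db R (P :: ('r, 'm) module)" "small_mod TYPE('u) P"
 obtains P' :: "('r, 'u) module" where "P' \<in> fgproj_modules R" "right_module R P'" "riso R P P' ~= {}" "riso R P' P ~= {}"
  "kcl P = kcl P'"
proof -
 have Pm: "right_module R P" by (rule has_db_module[OF assms(1)])
 obtain P' :: "('r, 'u) module" where P': "right_module R P'" "riso R P P' ~= {}" "riso R P' P ~= {}"
  using small_copy[OF assms(2) Pm] .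
 have "P' \<in> fgproj_modules R" unfolding fgproj_iff by (rule has_db_riso[OF assms(1) P'(1,2)])
 moreover have "kcl P = kcl P'"
  unfolding K0_class_def using iso_class_cong[OF Pm P'(1,2)] by metis
 ultimately show thesis using that P' by blast
qed

lemma kcl_closed:
 assumes "has_db R (P :: ('r, 'm) module)" "small_mod TYPE('u) P"
 shows "kcl P \<in> carrier K"
proof -
 obtain P' :: "('r, 'u) module" where "P' \<in> fgproj_modules R" "kcl P = kcl P'" using small_db_copy[OF assms] .
 then show ?thesis unfolding K0_def K0_class_def using groth_class_closed by metis
qed

lemma kcl_exact:
 fixes L :: "('r, 'l) module" and M :: "('r, 'm) module" and N :: "('r, 'n) module"
 assumes L: "has_db R L" "small_mod TYPE('u) L" and M: "right_module R M" "small_mod TYPE('u) M"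
  and N: "has_db R N" "small_mod TYPE('u) N" and ex: "short_exact R L M N f g"
 shows "kcl M = kcl L \<otimes>\<^bsub>K\<^esub> kcl N"
proof -
 have Mdb: "has_db R M" by (rule has_db_extension[OF L(1) M(1) N(1) ex])
 obtain L' :: "('r, 'u) module" where L': "L' \<in> fgproj_modules R" "right_module R L'" "riso R L L' ~= {}" "riso R L' L ~= {}" "kcl L = kcl L'"
  using small_db_copy[OF L] .
 obtain M' :: "('r, 'u) module" where M': "M' \<in> fgproj_modules R" "right_module R M'" "riso R M M' ~= {}" "riso R M' M ~= {}" "kcl M = kcl M'"
  using small_db_copy[OF Mdb M(2)] .
 obtain N' :: "('r, 'u) module" where N': "N' \<in> fgproj_modules R" "right_module R N'" "riso R N N' ~= {}" "riso R N' N ~= {}" "kcl N = kcl N'"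
  using small_db_copy[OF N] .
 obtain \<alpha> \<beta> \<gamma> where abc: "\<alpha> \<in> riso R L' L" "\<beta> \<in> riso R M M'" "\<gamma> \<in> riso R N N'" using L' M' N' by blast
 obtain f' g' where "short_exact R L' M' N' f' g'"
  using short_exact_riso[OF has_db_module[OF L(1)] M(1) has_db_module[OF N(1)] L'(2) M'(2) N'(2) abc ex] by blast
 from groth_class_exact[OF L'(1) M'(1) N'(1) this] show ?thesis
  unfolding L'(5) M'(5) N'(5) unfolding K0_class_def K0_def .
qed

lemma has_db_sub: "[|has_db R P; submodule N R P|] ==> has_db R (sub_mod P N)"
 by (rule has_db_submodule[OF ringR hereditary])

text \<open>The fibre product of the two presentations is an extension of \<open>P1\<close> by
  \<open>K2\<close> and also of \<open>P2\<close> by \<open>K1\<close>; equate the two expressions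
  for its class.\<close>

theorem schanuel:
 fixes P1 :: "('r, 'a) module" and P2 :: "('r, 'b) module" and K1 :: "('r, 'c) module" and K2 :: "('r, 'd) module"
 assumes db: "has_db R P1" "has_db R P2" "has_db R K1" "has_db R K2"
  and small: "small_mod TYPE('u) P1" "small_mod TYPE('u) P2" "small_mod TYPE('u) K1" "small_mod TYPE('u) K2"
  and M: "right_module R M" and ex1: "short_exact R K1 P1 M i1 p1" and ex2: "short_exact R K2 P2 M i2 p2"
 shows "kcl P1 \<otimes>\<^bsub>K\<^esub> inv\<^bsub>K\<^esub> kcl K1 = kcl P2 \<otimes>\<^bsub>K\<^esub> inv\<^bsub>K\<^esub> kcl K2"
proof -
 interpret K: comm_group K by (rule K_comm_group)
 note m = has_db_module[OF db(1)] has_db_module[OF db(2)] has_db_module[OF db(3)] has_db_module[OF db(4)]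
 have p1: "p1 \<in> rhom R P1 M" and p2: "p2 \<in> rhom R P2 M" using ex1 ex2 by (auto simp: short_exact_def)
 let ?X = "{x \<in> carrier (prod_mod P1 P2). p1 (fst x) = p2 (snd x)}"
 let ?Y = "{x \<in> carrier (prod_mod P2 P1). p2 (fst x) = p1 (snd x)}"
 have XY: "?X = (\<lambda>x. (snd x, fst x)) ` ?Y" by (force simp: prod_mod_def image_iff)
 obtain f g where fg: "short_exact R K2 (sub_mod (prod_mod P1 P2) ?X) P1 f g"
  using pullback_exact(2)[OF m(4,1,2) M p1 ex2 refl] by blast
 obtain f' g' where fg': "short_exact R K1 (sub_mod (prod_mod P1 P2) ?X) P2 f' g'"
  using pullback_exact(3)[OF m(3,2,1) M p2 ex1 refl] unfolding XY by blast
 have Xm: "right_module R (sub_mod (prod_mod P1 P2) ?X)"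
  by (rule pullback_exact(1)[OF m(4,1,2) M p1 ex2 refl])
 have "small_mod TYPE('u) (prod_mod P1 P2)"
  using small(1,2) small_times[of _ "carrier P1" _ "carrier P2"] univ'
  unfolding small_mod_def universe_for_def prod_mod_def by auto
 then have Xs: "small_mod TYPE('u) (sub_mod (prod_mod P1 P2) ?X)" by (rule small_sub) auto
 have "kcl K2 \<otimes>\<^bsub>K\<^esub> kcl P1 = kcl K1 \<otimes>\<^bsub>K\<^esub> kcl P2"
  by (rule trans[OF sym[OF kcl_exact[OF db(4) small(4) Xm Xs db(1) small(1) fg]] kcl_exact[OF db(3) small(3) Xm Xs db(2) small(2) fg']])
 moreover note c = kcl_closed[OF db(1) small(1)] kcl_closed[OF db(2) small(2)] kcl_closed[OF db(3) small(3)] kcl_closed[OF db(4) small(4)]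
 ultimately show ?thesis by (intro K.cross_quotient) 
qed

subsection \<open>Euler characteristics\<close>

text \<open>A relation rather than a function, because a presentation involves choices;
  \<open>euler_unique\<close> makes it functional. \<open>M\<close> may live on any type, while
  \<open>P\<close> and \<open>Q\<close> stay in the universe so that the quantifiers range over a
  fixed type.\<close>

definition euler :: "('r, 'm) module => ('r, 'u) groth_elem => bool" where
 "euler M x \<longleftrightarrow> (\<exists>(P :: ('r, 'u) module) (Q :: ('r, 'u) module) i p.
  P \<in> fgproj_modules R \<and> Q \<in> fgproj_modules R \<and> short_exact R Q P M i p \<and> x = kcl P \<otimes>\<^bsub>K\<^esub> inv\<^bsub>K\<^esub> kcl Q)"

lemma euler_unique: "[|right_module R M; euler M x; euler M y|] ==> x = y"
 unfolding euler_def fgproj_iff using schanuel small_mod_self by blast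

lemma eulerI:
 fixes P :: "('r, 'a) module" and Q :: "('r, 'b) module" and M :: "('r, 'm) module"
 assumes P: "has_db R P" "small_mod TYPE('u) P" and Q: "has_db R Q" "small_mod TYPE('u) Q"
  and M: "right_module R M" and ex: "short_exact R Q P M i p"
 shows "euler M (kcl P \<otimes>\<^bsub>K\<^esub> inv\<^bsub>K\<^esub> kcl Q)"
proof -
 obtain P' :: "('r, 'u) module" where P': "P' \<in> fgproj_modules R" "right_module R P'" "riso R P P' ~= {}" "riso R P' P ~= {}" "kcl P = kcl P'"
  using small_db_copy[OF P] .
 obtain Q' :: "('r, 'u) module" where Q': "Q' \<in> fgproj_modules R" "right_module R Q'" "riso R Q Q' ~= {}" "riso R Q' Q ~= {}" "kcl Q = kcl Q'"
  using small_db_copy[OF Q] .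
 obtain \<alpha> \<beta> where ab: "\<alpha> \<in> riso R Q' Q" "\<beta> \<in> riso R P P'" using P' Q' by blast
 obtain i' p' where "short_exact R Q' P' M i' p'"
  using short_exact_riso[OF has_db_module[OF Q(1)] has_db_module[OF P(1)] M Q'(2) P'(2) M ab riso_id[OF M] ex] by blast
 then show ?thesis unfolding euler_def using P' Q' by metis
qed

lemma euler_iso:
 fixes M :: "('r, 'm) module" and N :: "('r, 'n) module"
 assumes "right_module R M" "right_module R N" "riso R M N ~= {}" "euler M x"
 shows "euler N x"
proof -
 obtain P :: "('r, 'u) module" and Q :: "('r, 'u) module" and i p where
  PQ: "P \<in> fgproj_modules R" "Q \<in> fgproj_modules R" "short_exact R Q P M i p" "x = kcl P \<otimes>\<^bsub>K\<^esub> inv\<^bsub>K\<^esub> kcl Q"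
  using assms(4) unfolding euler_def by blast
 have m: "right_module R P" "right_module R Q" using PQ by (auto simp: fgproj_modules_def)
 obtain \<gamma> where "\<gamma> \<in> riso R M N" using assms(3) by blast
 then obtain i' p' where "short_exact R Q P N i' p'"
  using short_exact_riso[OF m(2,1) assms(1) m(2,1) assms(2) riso_id[OF m(2)] riso_id[OF m(1)] _ PQ(3)] by blast
 then show ?thesis unfolding euler_def using PQ by blast
qed

text \<open>Hereditariness enters here: the kernel of a finite free cover is again finitely
  generated projective.\<close>

lemma euler_exists:
 assumes M: "right_module R M" and fg: "fin_gen R M"
 shows "\<exists>x. euler M x"
proof -
 obtain A g where A: "finite A" "A <= carrier M"
  and g: "g \<in> rhom R (free_on R (sub_mod M A)) M" "g ` carrier (free_on R (sub_mod M A)) = carrier M"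
  using fin_gen_free_surj[OF M fg] by metis
 let ?F = "free_on R (sub_mod M A)"
 have F: "has_db R ?F" by (rule has_db_free[OF ringR]) (use A in simp)
 have Fs: "small_mod TYPE('u) ?F" by (rule small_free[OF ringR]) (use A univ' in simp_all)
 note Fm = has_db_module[OF F]
 have k: "submodule (hker ?F M g) R ?F" by (rule submodule_ker[OF Fm M g(1)])
 have ks: "small_mod TYPE('u) (sub_mod ?F (hker ?F M g))" by (rule small_sub[OF Fs]) auto
 have "short_exact R (sub_mod ?F (hker ?F M g)) ?F (sub_mod M (g ` carrier ?F)) (\<lambda>x\<in>hker ?F M g. x) g"
  by (rule short_exact_sub[OF Fm M g(1)])
 then have "short_exact R (sub_mod ?F (hker ?F M g)) ?F M (\<lambda>x\<in>hker ?F M g. x) g"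
  unfolding g(2) by simp
 from eulerI[OF F Fs has_db_sub[OF F k] ks M this] show ?thesis by blast
qed

lemma euler_closed:
 assumes "euler M x" shows "x \<in> carrier K"
proof -
 interpret K: comm_group K by (rule K_comm_group)
 show ?thesis
  using assms kcl_closed[OF _ small_mod_self] unfolding euler_def fgproj_iff by blast
qed

text \<open>Compose the presentation of \<open>M\<close> with \<open>g\<close> and let T be the
  kernel of the composite. Then P/T is \<open>N\<close> and T/Q is \<open>L\<close>, so the class of
  T cancels when the two characteristics are added.\<close>

lemma euler_exact:
 fixes L :: "('r, 'a) module" and M :: "('r, 'b) module" and N :: "('r, 'c) module"
 assumes m: "right_module R L" "right_module R M" "right_module R N" and ex: "short_exact R L M N f g"
  and e: "euler M x" "euler L y" "euler N z"
 shows "x = y \<otimes>\<^bsub>K\<^esub> z"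
proof -
 interpret K: comm_group K by (rule K_comm_group)
 interpret M: right_module R M by (rule m(2))
 have f: "f \<in> rhom R L M" "inj_on f (carrier L)" and g: "g \<in> rhom R M N" "g ` carrier M = carrier N"
  and im: "f ` carrier L = hker M N g" using ex by (auto simp: short_exact_def)
 obtain P :: "('r, 'u) module" and Q :: "('r, 'u) module" and i p where PQ: "P \<in> fgproj_modules R" "Q \<in> fgproj_modules R" "short_exact R Q P M i p"
  "x = kcl P \<otimes>\<^bsub>K\<^esub> inv\<^bsub>K\<^esub> kcl Q"
  using e(1) unfolding euler_def by blast
 have P: "has_db R P" and Q: "has_db R Q" using PQ fgproj_iff by auto
 note Pm = has_db_module[OF P] and Qm = has_db_module[OF Q]
 interpret P: right_module R P by (rule Pm)
 have i: "i \<in> rhom R Q P" "inj_on i (carrier Q)" and p: "p \<in> rhom R P M" "p ` carrier P = carrier M"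
  and imi: "i ` carrier Q = hker P M p" using PQ(3) by (auto simp: short_exact_def)
 let ?gp = "compose (carrier P) g p"
 have gp: "?gp \<in> rhom R P N" by (rule rhom_compose[OF p(1) g(1) Pm])
 have gps: "?gp ` carrier P = carrier N"
 proof -
  have "?gp ` carrier P = g ` (p ` carrier P)" unfolding image_image by (rule image_cong) (auto simp: compose_def)
  then show ?thesis using p g by simp
 qed
 let ?T = "hker P N ?gp"
 let ?TT = "sub_mod P ?T"
 have T: "submodule ?T R P" by (rule submodule_ker[OF Pm m(3) gp])
 have Tdb: "has_db R ?TT" by (rule has_db_sub[OF P T])
 have Tm: "right_module R ?TT" by (rule has_db_module[OF Tdb])
 have e1: "short_exact R ?TT P N (\<lambda>x\<in>?T. x) ?gp"
  using short_exact_sub[OF Pm m(3) gp] unfolding gps by simp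
 have z: "z = kcl P \<otimes>\<^bsub>K\<^esub> inv\<^bsub>K\<^esub> kcl ?TT"
  by (rule euler_unique[OF m(3) e(3) eulerI[OF P small_mod_self Tdb small_mod_self m(3) e1]])
 let ?pT = "restrict p ?T"
 have pT: "?pT \<in> rhom R ?TT M" by (rule rhom_restrict[OF Pm p(1) T])
 have pTim: "?pT ` carrier ?TT = f ` carrier L"
 proof -
  have "y \<in> ?pT ` ?T" if "y \<in> hker M N g" for y
  proof -
   have "y \<in> p ` carrier P" using that p(2) by simp
   then obtain a where a: "a \<in> carrier P" "y = p a" by auto
   then have "a \<in> ?T" using that by (simp add: compose_def)
   then show ?thesis using imageI[of a ?T ?pT] a by simp
  qed
  moreover have "?pT ` ?T <= hker M N g" using rhom_closed[OF p(1)] by (auto simp: compose_def)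
  ultimately show ?thesis unfolding im by auto
 qed
 obtain k where k: "k \<in> rhom R ?TT L" "?pT = compose (carrier ?TT) f k"
  using rhom_factor[OF Tm m(1) pT f] pTim by blast
 have kf: "f (k x) = p x" if x: "x \<in> ?T" for x
 proof -
  have "?pT x = p x" "compose (carrier ?TT) f k x = f (k x)" using x by (simp_all add: compose_eq)
  then show ?thesis using fun_cong[OF k(2), of x] by simp
 qed
 have ks: "k ` ?T = carrier L"
 proof (intro equalityI subsetI)
  fix y assume y: "y \<in> carrier L"
  then have "f y \<in> ?pT ` carrier ?TT" using pTim by blast
  then obtain a where a: "a \<in> ?T" "f y = p a" by auto
  then have "f (k a) = f y" using kf by simp
  then have "k a = y" using inj_onD[OF f(2)] rhom_closed[OF k(1), of a] a y by simp
  then show "y \<in> k ` ?T" using a by blast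
 next
  fix y assume "y \<in> k ` ?T"
  then show "y \<in> carrier L" using rhom_closed[OF k(1)] by auto
 qed
 have kk: "hker ?TT L k = hker P M p"
 proof -
  have "k a = \<zero>\<^bsub>L\<^esub> \<longleftrightarrow> p a = \<zero>\<^bsub>M\<^esub>" if "a \<in> ?T" for a
  proof -
   have "k a \<in> carrier L" using rhom_closed[OF k(1)] that by simp
   then have "k a = \<zero>\<^bsub>L\<^esub> \<longleftrightarrow> f (k a) = \<zero>\<^bsub>M\<^esub>"
    using rhom_inj_iff[OF m(1,2) f(1)] f(2) rhom_zero[OF m(1,2) f(1)] by auto
   then show ?thesis using kf that by simp
  qed
  moreover have "hker P M p <= ?T" using rhom_zero[OF m(2,3) g(1)] by (auto simp: compose_def)
  ultimately show ?thesis by auto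
 qed
 have iT: "i \<in> rhom R Q ?TT"
  by (rule rhom_codomain[OF i(1)]) (use imi kk in auto)
 have e2: "short_exact R Q ?TT L i k"
  unfolding short_exact_def using iT k(1) i(2) ks imi kk by simp
 have y: "y = kcl ?TT \<otimes>\<^bsub>K\<^esub> inv\<^bsub>K\<^esub> kcl Q"
  by (rule euler_unique[OF m(1) e(2) eulerI[OF Tdb small_mod_self Q small_mod_self m(1) e2]])
 have c: "kcl P \<in> carrier K" "kcl Q \<in> carrier K" "kcl ?TT \<in> carrier K"
  using kcl_closed[OF P small_mod_self] kcl_closed[OF Q small_mod_self] kcl_closed[OF Tdb small_mod_self] .
 have "y \<otimes>\<^bsub>K\<^esub> z = kcl ?TT \<otimes>\<^bsub>K\<^esub> (inv\<^bsub>K\<^esub> kcl Q \<otimes>\<^bsub>K\<^esub> (kcl P \<otimes>\<^bsub>K\<^esub> inv\<^bsub>K\<^esub> kcl ?TT))"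
  unfolding y z using c by (simp add: K.m_assoc)
 also have "\<dots> = kcl P \<otimes>\<^bsub>K\<^esub> inv\<^bsub>K\<^esub> kcl Q \<otimes>\<^bsub>K\<^esub> (kcl ?TT \<otimes>\<^bsub>K\<^esub> inv\<^bsub>K\<^esub> kcl ?TT)"
  using c by (simp add: K.m_ac del: K.r_inv K.l_inv)
 finally show ?thesis using c PQ(4) by simp
qed

lemma finite_length_fin_gen:
 assumes "finite_length R M" shows "fin_gen R M"
proof -
 have M: "right_module R M" using assms by (simp add: finite_length_iff)
 interpret M: right_module R M by (rule M)
 obtain n where "chain R M n (nul M) (carrier M)" using assms by (auto simp: finite_length_iff)
 moreover have "chain R M n (nul M) X ==> \<exists>A. finite A \<and> A <= carrier M \<and> rspan R M A = X" for n X
 proof (induction n arbitrary: X)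
  case 0
  have "rspan R M {} = nul M"
   using M.rspan_least[of "nul M" "{}"] M.submoduleD(2)[OF M.submodule_rspan[of "{}"]] by auto
  then show ?case using 0 by (intro exI[of _ "{}"]) simp
 next
  case (Suc n)
  then obtain Y where Y: "chain R M n (nul M) Y" "covers (submods R M) Y X" by auto
  then obtain A where A: "finite A" "A <= carrier M" "rspan R M A = Y" using Suc.IH by blast
  have X: "submodule X R M" "Y \<subset> X" and cov: "!!Z. [|submodule Z R M; Y <= Z; Z <= X|] ==> Z = Y \<or> Z = X"
   using Y(2) by (auto simp: covers_def)
  obtain x where x: "x \<in> X" "x \<notin> Y" using X(2) by blast
  have Ax: "insert x A <= carrier M" using A x M.submoduleD(1)[OF X(1)] by auto
  have s: "submodule (rspan R M (insert x A)) R M" by (rule M.submodule_rspan[OF Ax])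
  have "Y <= rspan R M (insert x A)" using A(3) M.rspan_mono[of A "insert x A"] by auto
  moreover have "rspan R M (insert x A) <= X"
   by (rule M.rspan_least[OF X(1)]) (use A x X M.rspan_incl[of A] in auto)
  moreover have "x \<in> rspan R M (insert x A)" using M.rspan_incl[of "insert x A"] by auto
  ultimately have "rspan R M (insert x A) = X" using cov[OF s] x by blast
  then show ?case using A Ax by (intro exI[of _ "insert x A"]) auto
 qed
 ultimately show ?thesis unfolding fin_gen_def by blast
qed

lemma euler_hom:
 obtains \<chi> where "\<chi> \<in> hom (groth R (fl_modules R)) K"
  "!!M :: ('r, 'u) module. M \<in> fl_modules R ==> euler M (\<chi> (groth_class R (fl_modules R) (iso_class R M) :: ('r, 'u) groth_elem))"
proof -
 define e where "e M = (SOME x. euler M x)" for M :: "('r, 'u) module"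
 have fl: "right_module R M" if "M \<in> fl_modules R" for M :: "('r, 'u) module"
  using that by (simp add: fl_modules_def finite_length_iff)
 have e: "euler M (e M)" if "M \<in> fl_modules R" for M
  unfolding e_def by (rule someI_ex, rule euler_exists[OF fl[OF that]])
   (use that finite_length_fin_gen in "simp add: fl_modules_def")
 have "\<exists>\<chi>\<in>hom (groth R (fl_modules R)) K. \<forall>M\<in>fl_modules R. \<chi> (groth_class R (fl_modules R) (iso_class R M) :: ('r, 'u) groth_elem) = e M"
 proof (rule groth_universal[where A = K and C = "fl_modules R" and R = R and f = e, OF K_comm_group])
  fix M N :: "('r, 'u) module" assume MN: "M \<in> fl_modules R" "N \<in> fl_modules R" "riso R M N ~= {}"
  show "e M = e N"
   by (rule euler_unique[OF fl[OF MN(2)] euler_iso[OF fl[OF MN(1)] fl[OF MN(2)] MN(3) e[OF MN(1)]] e[OF MN(2)]])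
 next
  fix L M N :: "('r, 'u) module" and i p assume LMN: "L \<in> fl_modules R" "M \<in> fl_modules R" "N \<in> fl_modules R" "short_exact R L M N i p"
  show "e M = e L \<otimes>\<^bsub>K\<^esub> e N"
   by (rule euler_exact[OF fl[OF LMN(1)] fl[OF LMN(2)] fl[OF LMN(3)] LMN(4) e[OF LMN(2)] e[OF LMN(1)] e[OF LMN(3)]])
 qed (use fl e euler_closed in blast)+
 then show thesis using that e by metis
qed

end

section \<open>Elementwise primeness, and the descending chain condition above a nonzero
  ideal\<close>

section \<open>Hereditary Noetherian prime rings\<close>

lemma opp_ring_simps [simp]:
 "carrier (opp_ring R) = carrier R" "\<zero>\<^bsub>opp_ring R\<^esub> = \<zero>\<^bsub>R\<^esub>" "\<one>\<^bsub>opp_ring R\<^esub> = \<one>\<^bsub>R\<^esub>"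
 "x \<oplus>\<^bsub>opp_ring R\<^esub> y = x \<oplus>\<^bsub>R\<^esub> y" "x \<otimes>\<^bsub>opp_ring R\<^esub> y = y \<otimes>\<^bsub>R\<^esub> x" "opp_ring (opp_ring R) = R"
 by (simp_all add: opp_ring_def)

lemma ring_opp_ring:
 assumes "ring R" shows "ring (opp_ring R)"
proof -
 interpret R: ring R by fact
 show ?thesis
 proof (rule ringI)
  show "abelian_group (opp_ring R)"
   by (rule abelian_groupI) (auto simp: R.a_assoc intro: R.a_comm R.add.l_inv_ex)
  show "monoid (opp_ring R)"
   by (rule monoidI) (auto simp: R.m_assoc)
 qed (auto simp: R.l_distr R.r_distr)
qed

locale prime_element_ring = ring R for R (structure) +
 assumes prime_elem: "[|a \<in> carrier R; b \<in> carrier R; !!r. r \<in> carrier R ==> a \<otimes> r \<otimes> b = \<zero>|] ==> a = \<zero> \<or> b = \<zero>"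

text \<open>From a R b = 0 one passes to ideals: the x with x R b = 0, and the right annihilator of
  the set of these. Their product is zero, the first contains a and the second contains b.\<close>

lemma prime_element_ringI:
 assumes "ring R" and prime: "prime_ring R"
 shows "prime_element_ring R"
proof -
 interpret ring R by fact
 have pe: "a = \<zero>\<^bsub>R\<^esub> \<or> b = \<zero>\<^bsub>R\<^esub>"
  if ab: "a \<in> carrier R" "b \<in> carrier R" "!!r. r \<in> carrier R ==> a \<otimes>\<^bsub>R\<^esub> r \<otimes>\<^bsub>R\<^esub> b = \<zero>\<^bsub>R\<^esub>" for a b
 proof -
  let ?I = "{x \<in> carrier R. \<forall>r\<in>carrier R. x \<otimes>\<^bsub>R\<^esub> r \<otimes>\<^bsub>R\<^esub> b = \<zero>\<^bsub>R\<^esub>}"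
  let ?J = "{y \<in> carrier R. \<forall>x\<in>?I. x \<otimes>\<^bsub>R\<^esub> y = \<zero>\<^bsub>R\<^esub>}"
  have I: "ideal ?I R"
  proof (rule idealI[OF assms(1)])
   show "subgroup ?I (add_monoid R)"
    by (rule add.subgroupI) (use ab in "auto simp: l_distr l_minus simp flip: a_inv_def")
   fix x r assume x: "x \<in> ?I" "r \<in> carrier R"
   show "r \<otimes>\<^bsub>R\<^esub> x \<in> ?I" using x ab by (auto simp: m_assoc)
   have "x \<otimes>\<^bsub>R\<^esub> r \<otimes>\<^bsub>R\<^esub> s \<otimes>\<^bsub>R\<^esub> b = \<zero>\<^bsub>R\<^esub>" if s: "s \<in> carrier R" for s
   proof -
    have "x \<otimes>\<^bsub>R\<^esub> (r \<otimes>\<^bsub>R\<^esub> s) \<otimes>\<^bsub>R\<^esub> b = \<zero>\<^bsub>R\<^esub>" using x s by blast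
    then show ?thesis using x s ab by (simp add: m_assoc)
   qed
   then show "x \<otimes>\<^bsub>R\<^esub> r \<in> ?I" using x by blast
  qed
  have J: "ideal ?J R"
  proof (rule idealI[OF assms(1)])
   show "subgroup ?J (add_monoid R)"
    by (rule add.subgroupI) (use ab in "auto simp: r_distr r_minus simp flip: a_inv_def")
   fix y r assume y: "y \<in> ?J" "r \<in> carrier R"
   have "x \<otimes>\<^bsub>R\<^esub> (y \<otimes>\<^bsub>R\<^esub> r) = \<zero>\<^bsub>R\<^esub>" if "x \<in> ?I" for x
    using y that by (simp add: m_assoc[symmetric])
   then show "y \<otimes>\<^bsub>R\<^esub> r \<in> ?J" using y by blast
   have "x \<otimes>\<^bsub>R\<^esub> (r \<otimes>\<^bsub>R\<^esub> y) = \<zero>\<^bsub>R\<^esub>" if "x \<in> ?I" for x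
   proof -
    have "x \<otimes>\<^bsub>R\<^esub> r \<in> ?I" by (rule ideal.I_r_closed[OF I that y(2)])
    then have "x \<otimes>\<^bsub>R\<^esub> r \<otimes>\<^bsub>R\<^esub> y = \<zero>\<^bsub>R\<^esub>" using y by blast
    moreover have "x \<in> carrier R" "y \<in> carrier R" using that y(1) by blast+
    ultimately show ?thesis using y(2) m_assoc[of x r y] by simp
   qed
   then show "r \<otimes>\<^bsub>R\<^esub> y \<in> ?J" using y by blast
  qed
  have "\<forall>x\<in>?I. \<forall>y\<in>?J. x \<otimes>\<^bsub>R\<^esub> y = \<zero>\<^bsub>R\<^esub>" by blast
  with prime I J have "?I = nul R \<or> ?J = nul R" unfolding prime_ring_def by blast
  moreover have "a \<in> ?I" using ab by blast
  moreover have "b \<in> ?J"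
  proof -
   have "x \<otimes>\<^bsub>R\<^esub> b = \<zero>\<^bsub>R\<^esub>" if "x \<in> ?I" for x
   proof -
    have "x \<otimes>\<^bsub>R\<^esub> \<one>\<^bsub>R\<^esub> \<otimes>\<^bsub>R\<^esub> b = \<zero>\<^bsub>R\<^esub>" using that one_closed by blast
    then show ?thesis using that by simp
   qed
   then show ?thesis using ab by blast
  qed
  ultimately show ?thesis by blast
 qed
 show ?thesis by (intro prime_element_ring.intro prime_element_ring_axioms.intro assms(1)) (rule pe)
qed

lemma hnp_opp_ring:
 assumes "hnp_ring R" shows "hnp_ring (opp_ring R)"
proof -
 have R: "ring R" and p: "prime_ring R" using assms by (auto simp: hnp_ring_def)
 interpret R: ring R by (rule R)
 have id: "ideal I R" if "ideal I (opp_ring R)" for I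
 proof -
  interpret I: ideal I "opp_ring R" by (rule that)
  have am: "add_monoid (opp_ring R) = add_monoid R" by (simp add: opp_ring_def)
  have "subgroup I (add_monoid R)"
   using additive_subgroup.a_subgroup[OF ideal.axioms(1)[OF that]] unfolding am .
  then show ?thesis
   by (rule idealI[OF R]) (use I.I_l_closed I.I_r_closed in auto)
 qed
 have "prime_ring (opp_ring R)"
  unfolding prime_ring_def
 proof (intro conjI allI impI)
  show "\<one>\<^bsub>opp_ring R\<^esub> ~= \<zero>\<^bsub>opp_ring R\<^esub>" using p by (simp add: prime_ring_def)
  fix I J assume IJ: "ideal I (opp_ring R) \<and> ideal J (opp_ring R) \<and> (\<forall>a\<in>I. \<forall>b\<in>J. a \<otimes>\<^bsub>opp_ring R\<^esub> b = \<zero>\<^bsub>opp_ring R\<^esub>)"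
  then have "\<forall>b\<in>J. \<forall>a\<in>I. b \<otimes>\<^bsub>R\<^esub> a = \<zero>\<^bsub>R\<^esub>" by simp
  then have "J = nul R \<or> I = nul R" using p id IJ unfolding prime_ring_def by blast
  then show "I = nul (opp_ring R) \<or> J = nul (opp_ring R)" by auto
 qed
 then show ?thesis using assms ring_opp_ring[OF R] unfolding hnp_ring_def by simp
qed

lemma hnp_ideal_has_db:
 assumes "hnp_ring R" "right_ideal I R"
 shows "has_db R (sub_mod (reg_module R) I)"
 using assms unfolding hnp_ring_def right_hereditary_def right_noetherian_def by (blast intro: proj_has_db)

lemma hnp_acc:
 assumes "hnp_ring R"
 shows "right_acc R"
proof -
 have R: "ring R" using assms by (simp add: hnp_ring_def)
 show ?thesis
  using acc_from_fin_gen[OF right_module_reg[OF R]] has_db_fin_gen[OF hnp_ideal_has_db[OF assms]] by simp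
qed

locale hnp =
 fixes R :: "('r, 'k) ring_scheme" (structure)
 assumes hnp: "hnp_ring R"

sublocale hnp \<subseteq> prime_element_ring R
 using hnp prime_element_ringI by (auto simp: hnp_ring_def)

sublocale hnp \<subseteq> reg: right_module R "reg_module R"
 by (rule right_module_reg[OF ring_axioms])

context hnp
begin

lemma one_neq_zero: "\<one> ~= \<zero>"
 using hnp by (simp add: hnp_ring_def prime_ring_def)

lemma right_ideal_iff:
 "right_ideal I R \<longleftrightarrow> I <= carrier R \<and> \<zero> \<in> I \<and> (\<forall>x\<in>I. \<forall>y\<in>I. x \<oplus> y \<in> I) \<and> (\<forall>a\<in>carrier R. \<forall>x\<in>I. x \<otimes> a \<in> I)"
 unfolding reg.submodule_iff by simp

lemma ideal_right_ideal: "ideal I R ==> right_ideal I R"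
 unfolding right_ideal_iff
 by (auto simp: ideal.I_r_closed ideal.Icarr additive_subgroup.zero_closed additive_subgroup.a_closed ideal.axioms(1))

text \<open>For i in \<open>I\<close> and any r, the product x r i lies in \<open>I\<close>, so
  \<delta>(x) r i = \<delta>(x r i) = 0. Primeness with a nonzero i forces \<delta>(x) = 0.\<close>

lemma rhom_kills:
 assumes A: "right_ideal A R" and I: "ideal I R" "I ~= {\<zero>}" "I <= A"
  and \<delta>: "\<delta> \<in> rhom R (sub_mod (reg_module R) A) (reg_module R)" and k: "!!i. i \<in> I ==> \<delta> i = \<zero>" and x: "x \<in> A"
 shows "\<delta> x = \<zero>"
proof -
 interpret I: ideal I R by (rule I(1))
 obtain i where i: "i \<in> I" "i ~= \<zero>" using I(2) I.zero_closed by blast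
 have xR: "x \<in> carrier R" using A x by (auto simp: right_ideal_iff)
 have dx: "\<delta> x \<in> carrier R" using rhom_closed[OF \<delta>] x by simp
 have z: "\<delta> x \<otimes> r \<otimes> i = \<zero>" if r: "r \<in> carrier R" for r
 proof -
  have ri: "r \<otimes> i \<in> I" using I.I_l_closed i r by simp
  have "\<delta> (x \<otimes> (r \<otimes> i)) = \<delta> x \<otimes> (r \<otimes> i)"
   using rhom_smult[OF \<delta>, of "r \<otimes> i" x] x r i I.Icarr by simp
  moreover have "x \<otimes> (r \<otimes> i) \<in> I" using I.I_l_closed ri xR by simp
  ultimately show ?thesis using k dx r i I.Icarr by (simp add: m_assoc)
 qed
 show ?thesis using prime_elem[OF dx I.Icarr[OF i(1)] z] i(2) by blast
qed

text \<open>Restricting homomorphisms into \<open>R\<close> to generators of \<open>I\<close> turns a descending chain of right ideals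
 above \<open>I\<close> into an ascending chain of left submodules of a free left module of finite rank; since the
 right ideals are projective, no information is lost.\<close>

theorem dcc_above_ideal:
 assumes I: "ideal I R" "I ~= {\<zero>}"
 shows "dcc_between (rideals R) I (carrier R)"
 unfolding dcc_between_def
proof (intro allI impI)
 fix A :: "nat => 'r set"
 assume "\<forall>n. A n \<in> rideals R \<and> I <= A n \<and> A n <= carrier R \<and> A (Suc n) <= A n"
 then have A: "!!n. right_ideal (A n) R" "!!n. I <= A n" and dec: "!!n. A (Suc n) <= A n" by auto
 have Ir: "right_ideal I R" by (rule ideal_right_ideal[OF I(1)])
 let ?I = "sub_mod (reg_module R) I" and ?A = "\<lambda>n. sub_mod (reg_module R) (A n)"
 have Am: "right_module R (?A n)" for n by (rule reg.right_module_sub[OF A(1)])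
 obtain C where C: "finite C" "C <= I" "rspan R ?I C = I"
  using has_db_fin_gen[OF hnp_ideal_has_db[OF hnp Ir]] by (auto simp: fin_gen_def)
 \<comment> \<open>Left modules over \<open>R\<close> are right modules over the opposite ring.
   Homomorphisms from a right ideal into \<open>R\<close> form such a left module.\<close>
 let ?S = "opp_ring R"
 let ?V = "sub_mod (reg_module ?S) C"
 let ?L = "free_on ?S ?V"
 have S: "ring ?S" by (rule ring_opp_ring[OF ring_axioms])
 interpret L: right_module ?S ?L by (rule right_module_free[OF S])
 have "fin_gen ?S ?L" by (rule has_db_fin_gen[OF has_db_free[OF S]]) (use C in simp)
 then have acc: "noeth ?S ?L"
  using L.acc_fin_gen hnp_acc[OF hnp_opp_ring[OF hnp]] by simp
 \<comment> \<open>A homomorphism is recorded by its values on the finite generating set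
   \<open>C\<close> of \<open>I\<close>; the value zero outside \<open>C\<close> makes the record an
   element of \<open>free_on\<close>.\<close>
 define tup where "tup \<phi> = (\<lambda>v. if v \<in> C then \<phi> v else \<zero>)" for \<phi> :: "'r => 'r"
 define H where "H n = tup ` rhom R (?A n) (reg_module R)" for n
 have CA: "v \<in> A n" if "v \<in> C" for v n using that C A by blast
 have rc: "\<phi> v \<in> carrier R" if "\<phi> \<in> rhom R (?A n) (reg_module R)" "v \<in> A n" for \<phi> v n
  using rhom_closed[OF that(1)] that(2) by simp
 have Hsub: "submodule (H n) ?S ?L" for n
 proof (rule L.submoduleI)
  show "H n <= carrier ?L"
   unfolding H_def tup_def free_on_def using rc CA C(1) by auto
  have "tup (\<lambda>x\<in>A n. \<zero>) = \<zero>\<^bsub>?L\<^esub>" using CA by (auto simp: tup_def free_on_def)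
  then show "\<zero>\<^bsub>?L\<^esub> \<in> H n"
   unfolding H_def using imageI[OF rhom_const_zero[OF Am[of n] reg.right_module_axioms], of tup] by simp
  fix a b assume "a \<in> H n" "b \<in> H n"
  then obtain \<phi> \<psi> where p: "\<phi> \<in> rhom R (?A n) (reg_module R)" "\<psi> \<in> rhom R (?A n) (reg_module R)" "a = tup \<phi>" "b = tup \<psi>"
   unfolding H_def by blast
  have "a \<oplus>\<^bsub>?L\<^esub> b = tup (\<lambda>x\<in>A n. \<phi> x \<oplus> \<psi> x)"
   using p CA by (auto simp: tup_def free_on_def)
  then show "a \<oplus>\<^bsub>?L\<^esub> b \<in> H n"
   unfolding H_def using rhom_plus[OF Am reg.right_module_axioms p(1,2)] by auto
 next
  fix r a assume r: "r \<in> carrier ?S" and "a \<in> H n"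
  then obtain \<phi> where p: "\<phi> \<in> rhom R (?A n) (reg_module R)" "a = tup \<phi>" unfolding H_def by blast
  have "(\<lambda>x\<in>A n. r \<otimes> \<phi> x) \<in> rhom R (?A n) (reg_module R)"
   using rhom_restrictI[OF Am, of n "\<lambda>x. r \<otimes> \<phi> x" "reg_module R"] r rc[OF p(1)]
    rhom_add[OF p(1)] rhom_smult[OF p(1)] by (auto simp: r_distr m_assoc)
  moreover have "r \<odot>\<^bsub>?L\<^esub> a = tup (\<lambda>x\<in>A n. r \<otimes> \<phi> x)"
   using p CA r by (auto simp: tup_def free_on_def)
  ultimately show "r \<odot>\<^bsub>?L\<^esub> a \<in> H n" unfolding H_def by auto
 qed
 have restr: "restrict \<phi> (A m) \<in> rhom R (?A m) (reg_module R)"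
  if "\<phi> \<in> rhom R (?A n) (reg_module R)" "A m <= A n" for \<phi> m n
 proof -
  have "submodule (A m) R (?A n)" using reg.submodule_sub_iff[OF A(1)] A(1) that(2) by blast
  from rhom_restrict[OF Am that(1) this] show ?thesis by simp
 qed
 have Hinc: "H n <= H (Suc n)" for n
 proof
  fix a assume "a \<in> H n"
  then obtain \<phi> where p: "\<phi> \<in> rhom R (?A n) (reg_module R)" "a = tup \<phi>" unfolding H_def by blast
  have "a = tup (restrict \<phi> (A (Suc n)))" using p(2) CA by (auto simp: tup_def)
  then show "a \<in> H (Suc n)" unfolding H_def using restr[OF p(1) dec] by blast
 qed
 have "\<forall>n. H n \<in> submods ?S ?L \<and> nul ?L <= H n \<and> H n <= carrier ?L \<and> H n <= H (Suc n)"
  using Hsub Hinc L.submoduleD(1,2)[OF Hsub] by blast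
 then have "\<exists>n. \<forall>m\<ge>n. H m = H n"
  using acc[unfolded acc_between_def, rule_format, of H] by blast
 then obtain n where n: "!!m. m \<ge> n ==> H m = H n" by blast
 have "A m = A n" if m: "m \<ge> n" for m
 proof -
  have mn: "A m <= A n" using lift_Suc_antimono_le[of A, OF dec m] .
  obtain l where l: "coords R (?A m) (?A m) l" "!!x. x \<in> A m ==> dbsum (?A m) l x = x"
   using hnp_ideal_has_db[OF hnp A(1)[of m]] by (auto simp: has_db_def dual_basis_def)
  have "\<exists>\<psi>\<in>rhom R (?A n) (reg_module R). \<forall>v\<in>C. \<psi> v = \<phi> v" if p: "\<phi> \<in> rhom R (?A m) (reg_module R)" for \<phi>
  proof -
   have "tup \<phi> \<in> H n" using n[OF m] p unfolding H_def by blast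
   then obtain \<psi> where \<psi>: "\<psi> \<in> rhom R (?A n) (reg_module R)" "tup \<phi> = tup \<psi>" unfolding H_def by blast
   have "\<psi> v = \<phi> v" if "v \<in> C" for v
    using fun_cong[OF \<psi>(2), of v] that unfolding tup_def by simp
   then show ?thesis using \<psi>(1) by blast
  qed
  then obtain E where E: "!!\<phi>. \<phi> \<in> rhom R (?A m) (reg_module R) ==> E \<phi> \<in> rhom R (?A n) (reg_module R)"
   "!!\<phi> v. [|\<phi> \<in> rhom R (?A m) (reg_module R); v \<in> C|] ==> E \<phi> v = \<phi> v" by metis
  let ?l = "map (\<lambda>pf. (fst pf, E (snd pf))) l"
  have c: "coords R (?A n) (?A m) ?l" using l(1) E(1) by (auto simp: coords_def)
  \<comment> \<open>The dual basis of \<open>A m\<close>, with each coordinate replaced by a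
    homomorphism on \<open>A n\<close> taking the same values on \<open>C\<close>, yields a map from
    \<open>A n\<close> to \<open>A m\<close> that fixes \<open>C\<close>. Its difference from the
    inclusion vanishes on \<open>I\<close>, hence on all of \<open>A n\<close> by
    \<open>rhom_kills\<close>, so \<open>A n\<close> is contained in \<open>A m\<close>.\<close>
  let ?\<theta> = "\<lambda>x\<in>A n. dbsum (?A m) ?l x"
  have \<theta>: "?\<theta> \<in> rhom R (?A n) (?A m)" using dbsum_rhom[OF Am Am c] by simp
  have \<theta>': "?\<theta> \<in> rhom R (?A n) (reg_module R)"
   by (rule rhom_codomain_sub[OF \<theta>]) (use A(1)[of m] in "simp add: right_ideal_iff")
  have \<theta>C: "?\<theta> v = v" if v: "v \<in> C" for v
  proof -
   have "dbsum (?A m) (map (\<lambda>pf. (fst pf, E (snd pf))) l') v = dbsum (?A m) l' v" if "coords R (?A m) (?A m) l'" for l'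
    using that E(2) v by (induction l') auto
   then show ?thesis using l CA[OF v] v by simp
  qed
  have inc: "(\<lambda>x\<in>A n. x) \<in> rhom R (?A n) (reg_module R)" by (rule rhom_incl[OF reg.right_module_axioms A(1)])
  let ?\<delta> = "\<lambda>x\<in>A n. (\<lambda>x\<in>A n. x) x \<oplus> (\<lambda>x\<in>A n. \<ominus> ?\<theta> x) x"
  have \<delta>: "?\<delta> \<in> rhom R (?A n) (reg_module R)"
  proof -
   have "(\<lambda>x\<in>A n. \<ominus>\<^bsub>reg_module R\<^esub> ?\<theta> x) \<in> rhom R (?A n) (reg_module R)"
    using rhom_uminus[OF Am reg.right_module_axioms \<theta>'] by simp
   moreover have "\<ominus>\<^bsub>reg_module R\<^esub> x = \<ominus> x" for x by (simp add: a_inv_def m_inv_def reg_module_def)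
   ultimately show ?thesis using rhom_plus[OF Am reg.right_module_axioms inc, of "\<lambda>x\<in>A n. \<ominus> ?\<theta> x"] by simp
  qed
  have \<theta>R: "?\<theta> x \<in> carrier R" if "x \<in> A n" for x using rhom_closed[OF \<theta>'] that by simp
  have AR: "A n <= carrier R" using A(1)[of n] by (simp add: right_ideal_iff)
  have \<delta>C: "?\<delta> v = \<zero>" if v: "v \<in> C" for v
   using \<theta>C[OF v] CA[OF v, of n] AR by (auto simp: r_neg)
  have kI: "?\<delta> i = \<zero>" if i: "i \<in> I" for i
  proof -
   let ?k = "hker (?A n) (reg_module R) ?\<delta>"
   have "submodule ?k R (?A n)" by (rule submodule_ker[OF Am reg.right_module_axioms \<delta>])
   then have "submodule ?k R (reg_module R)" using reg.submodule_sub_iff[OF A(1)[of n]] by blast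
   then have "submodule (I \<inter> ?k) R ?I" using reg.submodule_sub_iff[OF Ir] reg.submodule_Int[OF Ir] by blast
   moreover have "C <= I \<inter> ?k" using C(2) \<delta>C CA[of _ n] by auto
   ultimately have "rspan R ?I C <= I \<inter> ?k" unfolding rspan_def by blast
   then have "i \<in> ?k" using C(3) i by blast
   then have "?\<delta> i = \<zero>\<^bsub>reg_module R\<^esub>" unfolding mem_Collect_eq by (rule conjunct2)
   then show ?thesis by (simp only: reg_module_simps)
  qed
  have "x \<in> A m" if x: "x \<in> A n" for x
  proof -
   have "?\<delta> x = \<zero>" by (rule rhom_kills[OF A(1)[of n] I A(2) \<delta> kI x])
   then have "x \<oplus> \<ominus> ?\<theta> x = \<zero>" using x by simp
   moreover have "a = b" if "a \<in> carrier R" "b \<in> carrier R" "a \<oplus> \<ominus> b = \<zero>" for a b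
   proof -
    have "a \<oplus> \<ominus> b \<oplus> b = b" using that by simp
    then show ?thesis using that(1,2) by (simp add: a_assoc l_neg)
   qed
   ultimately have "x = ?\<theta> x" using \<theta>R[OF x] x AR by blast
   then show ?thesis using rhom_closed[OF \<theta>, of x] x by simp
  qed
  then show ?thesis using mn by blast
 qed
 then show "\<exists>n. \<forall>m\<ge>n. A m = A n" by blast
qed

section \<open>Finiteness and additivity of the genus\<close>

section \<open>Rejects and the genus\<close>

lemma ann_ideal:
 assumes W: "right_module R W"
 shows "ideal (ann R W) R"
proof -
 interpret W: right_module R W by (rule W)
 have m: "(\<ominus> a) \<odot>\<^bsub>W\<^esub> x = \<zero>\<^bsub>W\<^esub>" if a: "a \<in> carrier R" "x \<in> carrier W" "a \<odot>\<^bsub>W\<^esub> x = \<zero>\<^bsub>W\<^esub>" for a x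
 proof -
  have "(\<ominus> a \<oplus> a) \<odot>\<^bsub>W\<^esub> x = (\<ominus> a) \<odot>\<^bsub>W\<^esub> x \<oplus>\<^bsub>W\<^esub> a \<odot>\<^bsub>W\<^esub> x" by (rule W.smult_l_distr) (use a in auto)
  then show ?thesis using a by (simp add: l_neg)
 qed
 show ?thesis
 proof (rule idealI[OF ring_axioms])
  show "subgroup (ann R W) (add_monoid R)"
   by (rule add.subgroupI) (use m in "auto simp: ann_def W.smult_l_distr simp flip: a_inv_def intro!: exI[of _ \<zero>]")
 qed (auto simp: ann_def W.smult_assoc)
qed

end

text \<open>Unlike the annihilator it mentions no ring element, so it is the form in which the genus
  and faithfulness can be followed through a functor.\<close>

definition reject :: "('r, 'k) ring_scheme => ('r, 'm) module => ('r, 'n) module => 'm set" where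
 "reject R P W = {x \<in> carrier P. \<forall>g\<in>rhom R P W. g x = \<zero>\<^bsub>W\<^esub>}"

lemma submodule_reject:
 assumes P: "right_module R P" and W: "right_module R W"
 shows "submodule (reject R P W) R P"
proof -
 interpret P: right_module R P by (rule P)
 interpret W: right_module R W by (rule W)
 show ?thesis
 proof (rule P.submoduleI)
  fix x y assume xy: "x \<in> reject R P W" "y \<in> reject R P W"
  have "g (x \<oplus>\<^bsub>P\<^esub> y) = \<zero>\<^bsub>W\<^esub>" if "g \<in> rhom R P W" for g
  proof -
   have "g x = \<zero>\<^bsub>W\<^esub>" "g y = \<zero>\<^bsub>W\<^esub>" using xy that by (simp_all add: reject_def)
   then show ?thesis using xy by (simp add: rhom_add[OF that] reject_def)
  qed
  then show "x \<oplus>\<^bsub>P\<^esub> y \<in> reject R P W" using xy by (simp add: reject_def)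
 next
  fix a x assume ax: "a \<in> carrier R" "x \<in> reject R P W"
  have "g (a \<odot>\<^bsub>P\<^esub> x) = \<zero>\<^bsub>W\<^esub>" if "g \<in> rhom R P W" for g
  proof -
   have "g x = \<zero>\<^bsub>W\<^esub>" using ax that by (simp add: reject_def)
   then show ?thesis using ax by (simp add: rhom_smult[OF that] reject_def)
  qed
  then show "a \<odot>\<^bsub>P\<^esub> x \<in> reject R P W" using ax by (simp add: reject_def)
 qed (auto simp: reject_def rhom_zero[OF P W])
qed

text \<open>For w in \<open>W\<close> and a coordinate function f, the map y -> w f(y) is a
  homomorphism from \<open>P\<close> to \<open>W\<close>. It kills an element x of the reject, so
  f(x) annihilates \<open>W\<close>, and the dual basis expansion writes x with coefficients in the
  annihilator.\<close>

theorem mod_mult_ann: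
 assumes P: "has_db R P" and W: "right_module R W"
 shows "mod_mult_ideal P (ann R W) = reject R P W"
proof -
 have Pm: "right_module R P" by (rule has_db_module[OF P])
 interpret P: right_module R P by (rule Pm)
 interpret W: right_module R W by (rule W)
 let ?X = "{a \<odot>\<^bsub>P\<^esub> x | a x. a \<in> ann R W \<and> x \<in> carrier P}"
 have rs: "submodule (reject R P W) R P" by (rule submodule_reject[OF Pm W])
 have "?X <= reject R P W"
  by (auto simp: reject_def ann_def rhom_smult rhom_closed)
 then have 1: "mod_mult_ideal P (ann R W) <= reject R P W"
  unfolding mod_mult_ideal_def
  by (rule P.M.add.generate_subgroup_incl[OF _ submodule.axioms(1)[OF rs]])
 obtain l where l: "coords R P P l" "!!x. x \<in> carrier P ==> dbsum P l x = x"
  using P by (auto simp: has_db_def dual_basis_def)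
 have "x \<in> mod_mult_ideal P (ann R W)" if x: "x \<in> reject R P W" for x
 proof -
  have xP: "x \<in> carrier P" using x by (simp add: reject_def)
  have an: "f x \<in> ann R W" if f: "f \<in> rhom R P (reg_module R)" for f
  proof -
   have fc: "f y \<in> carrier R" if "y \<in> carrier P" for y using rhom_closed[OF f that] by simp
   have "f x \<odot>\<^bsub>W\<^esub> w = \<zero>\<^bsub>W\<^esub>" if w: "w \<in> carrier W" for w
   proof -
    have "(\<lambda>y\<in>carrier P. f y \<odot>\<^bsub>W\<^esub> w) \<in> rhom R P W"
     by (rule rhom_restrictI[OF Pm])
      (use fc w in "auto simp: rhom_add[OF f] rhom_smult[OF f] W.smult_l_distr W.smult_assoc")
    then have "(\<lambda>y\<in>carrier P. f y \<odot>\<^bsub>W\<^esub> w) x = \<zero>\<^bsub>W\<^esub>" using x unfolding reject_def by blast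
    then show ?thesis using xP by simp
   qed
   then show ?thesis using fc[OF xP] by (simp add: ann_def)
  qed
  have "dbsum P l' x \<in> mod_mult_ideal P (ann R W)" if "coords R P P l'" for l'
   using that
  proof (induction l')
   case Nil
   then show ?case using generate.one[of "add_monoid P"] by (simp add: mod_mult_ideal_def)
  next
   case (Cons pf l')
   have "snd pf x \<odot>\<^bsub>P\<^esub> fst pf \<in> ?X" using an[of "snd pf"] Cons.prems by auto
   then have "snd pf x \<odot>\<^bsub>P\<^esub> fst pf \<in> mod_mult_ideal P (ann R W)"
    unfolding mod_mult_ideal_def by (rule generate.incl)
   then show ?case
    using Cons generate.eng[of _ "add_monoid P"] by (simp add: mod_mult_ideal_def)
  qed
  from this[OF l(1)] show ?thesis using l(2)[OF xP] by simp
 qed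
 then show ?thesis using 1 by blast
qed

lemma rho_reject:
 assumes P: "has_db R P" and W: "right_module R W"
 shows "rho R P W = (if carrier W = nul W then udim R P
  else (THE n. chain R P n (reject R P W) (carrier P)))"
 unfolding rho_def mod_mult_ann[OF P W]
 using right_module.mod_length_quot[OF has_db_module[OF P] submodule_reject[OF has_db_module[OF P] W]] by simp

lemma inj_lat_iso:
 assumes M: "right_module R M" and N: "right_module R N" and f: "f \<in> rhom R M N" "inj_on f (carrier M)"
 shows "lat_iso (submods R M) (submods R (sub_mod N (f ` carrier M))) ((`) f)"
proof -
 interpret M: right_module R M by (rule M)
 interpret N: right_module R N by (rule N)
 have k: "hker M N f = nul M" using rhom_inj_iff[OF M N f(1)] f(2) by simp
 have 1: "{X \<in> submods R M. hker M N f <= X} = submods R M" unfolding k using M.submoduleD(2) by auto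
 have im: "submodule (f ` carrier M) R N" by (rule submodule_image[OF M N f(1) M.submodule_carrier])
 have 2: "{Y \<in> submods R N. Y <= f ` carrier M} = submods R (sub_mod N (f ` carrier M))"
  using N.submodule_sub_iff[OF im] by auto
 show ?thesis using hom_lat_iso[OF M N f(1)] unfolding 1 2 .
qed

lemma sub_covers_chain:
 assumes N: "right_module R N" and T: "submodule T R N" and A: "submodule A R N" "A <= T"
 shows "chain R (sub_mod N T) n A B \<longleftrightarrow> chain R N n A B \<and> B <= T"
proof -
 interpret N: right_module R N by (rule N)
 have "submods R (sub_mod N T) = {X \<in> submods R N. nul N <= X \<and> X <= T}"
  using N.submodule_sub_iff[OF T] N.submoduleD(2) by auto
 then show ?thesis
  using covers_chain_restrict[OF N.modular_submods, of "nul N" A T n B] A N.submoduleD(2)[OF A(1)] by simp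
qed

lemma sub_uniform_in:
 assumes N: "right_module R N" and T: "submodule T R N" and U: "uniform_in (submods R (sub_mod N T)) z U"
 shows "uniform_in (submods R N) z U"
proof -
 interpret N: right_module R N by (rule N)
 have "U \<in> submods R N" "U ~= z" "U <= T"
  and u: "!!A B. [|submodule A R (sub_mod N T); submodule B R (sub_mod N T); A <= U; B <= U; A ~= z; B ~= z|] ==> A \<inter> B ~= z"
  using U unfolding uniform_in_def by (simp_all add: N.submodule_sub_iff[OF T])
 moreover from this have "submodule A R (sub_mod N T)" if "submodule A R N" "A <= U" for A
  using that N.submodule_sub_iff[OF T] by auto
 ultimately show ?thesis unfolding uniform_in_def by simp
qed

lemma set_add_sub_mod [simp]: "set_add (sub_mod M N) = set_add M"
 by (auto simp: set_add_def' fun_eq_iff)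

lemma sub_uniform_sum:
 assumes N: "right_module R N" and T: "submodule T R N"
 shows "uniform_sum (submods R (sub_mod N T)) (set_add (sub_mod N T)) z n X ==> uniform_sum (submods R N) (set_add N) z n X"
proof (induction rule: uniform_sum.induct)
 case uniform_sum_0
 show ?case by (rule uniform_sum.uniform_sum_0)
next
 case (uniform_sum_Suc n X U)
 then show ?case
  using uniform_sum.uniform_sum_Suc[OF uniform_sum_Suc.IH sub_uniform_in[OF N T uniform_sum_Suc.hyps(2)] uniform_sum_Suc.hyps(3)]
  by simp
qed

lemma sub_essential:
 assumes N: "right_module R N" and T: "submodule T R N" and E: "essential_in (submods R (sub_mod N T)) z E T"
 shows "essential_in (submods R N) z E T"
proof -
 interpret N: right_module R N by (rule N)
 show ?thesis using E unfolding essential_in_def by (auto simp: N.submodule_sub_iff[OF T])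
qed

lemma inj_uniform_sum:
 assumes M: "right_module R M" and N: "right_module R N" and f: "f \<in> rhom R M N" "inj_on f (carrier M)"
  and X: "unisum R M n X" "ess_in R M X (carrier M)"
 shows "unisum R N n (f ` X)"
  "ess_in R N (f ` X) (f ` carrier M)"
proof -
 interpret M: right_module R M by (rule M)
 interpret N: right_module R N by (rule N)
 have T: "submodule (f ` carrier M) R N" by (rule submodule_image[OF M N f(1) M.submodule_carrier])
 interpret T: right_module R "sub_mod N (f ` carrier M)" by (rule N.right_module_sub[OF T])
 note iso = inj_lat_iso[OF M N f] and m = M.modular_submods T.modular_submods
 show "unisum R N n (f ` X)"
  using sub_uniform_sum[OF N T lat_iso_uniform_sum[OF m iso X(1)]] by simp
 show "ess_in R N (f ` X) (f ` carrier M)"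
  using sub_essential[OF N T, of "nul N"] lat_iso_essential[OF m iso X(2)] by simp
qed

context hnp
begin

text \<open>The annihilator carries \<open>P\<close> into the reject, and the right ideals above it
  satisfy both chain conditions, the descending one because the annihilator is nonzero; finitely
  many generators of \<open>P\<close> then suffice.\<close>

lemma length_mod_reject:
 assumes P: "has_db R P" and W: "right_module R W" "ann R W ~= {\<zero>}"
 shows "\<exists>n. chain R P n (reject R P W) (carrier P)"
proof -
 have Pm: "right_module R P" by (rule has_db_module[OF P])
 interpret P: right_module R P by (rule Pm)
 let ?I = "ann R W"
 have I: "ideal ?I R" by (rule ann_ideal[OF W(1)])
 have Ir: "right_ideal ?I R" by (rule ideal_right_ideal[OF I])
 obtain A where A: "finite A" "A <= carrier P" "rspan R P A = carrier P"
  using has_db_fin_gen[OF P] by (auto simp: fin_gen_def)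
 have rej: "submodule (reject R P W) R P" by (rule submodule_reject[OF Pm W(1)])
 have acc: "acc_between (rideals R) ?I (carrier R)"
  by (rule acc_between_strict_embed[OF hnp_acc[OF hnp], where h = "\<lambda>X. X"])
   (use reg.submoduleD(2) in auto)
 have "\<exists>n. chain R P n (reject R P W) (rspan R P (reject R P W \<union> A))"
 proof (rule P.covers_chain_rspan[OF acc dcc_above_ideal[OF I W(2)] _ rej _ A(1,2)])
  show "?I <= carrier R" by (auto simp: ann_def)
  show "r \<odot>\<^bsub>P\<^esub> x \<in> reject R P W" if "r \<in> ?I" "x \<in> carrier P" for r x
   using that by (auto simp: reject_def ann_def rhom_smult rhom_closed)
 qed
 moreover have "rspan R P (reject R P W \<union> A) = carrier P"
  using P.rspan_mono[of A "reject R P W \<union> A"] A(3)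
   P.submoduleD(1)[OF P.submodule_rspan[of "reject R P W \<union> A"]] P.submoduleD(1)[OF rej] A(2) by auto
 ultimately show ?thesis by simp
qed

text \<open>The sequence splits. Ranks add because essential sums of uniform submodules of
  \<open>L\<close> and \<open>N\<close> combine to one in \<open>M\<close>. For lengths, the image
  of \<open>L\<close> together with the reject of \<open>M\<close> cuts the chain from the reject to
  \<open>M\<close> into two sections, which match those of \<open>L\<close> and
  \<open>N\<close>.\<close>

lemma rho_exact:
 assumes L: "has_db R L" and M: "has_db R M" and N: "has_db R N" and ex: "short_exact R L M N f g"
  and W: "right_module R W" "carrier W = nul W \<or> ann R W ~= {\<zero>}"
 shows "rho R M W = rho R L W + rho R N W"
proof -
 note m = has_db_module[OF L] has_db_module[OF M] has_db_module[OF N]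
 interpret L: right_module R L by (rule m(1))
 interpret M: right_module R M by (rule m(2))
 interpret N: right_module R N by (rule m(3))
 interpret LM: modular_sets "submods R M" "set_add M" "nul M" by (rule M.modular_submods)
 interpret LL: modular_sets "submods R L" "set_add L" "nul L" by (rule L.modular_submods)
 interpret LN: modular_sets "submods R N" "set_add N" "nul N" by (rule N.modular_submods)
 have f: "f \<in> rhom R L M" "inj_on f (carrier L)" and g: "g \<in> rhom R M N" "g ` carrier M = carrier N"
  and im: "f ` carrier L = hker M N g" using ex by (auto simp: short_exact_def)
 obtain \<sigma> t where st: "\<sigma> \<in> rhom R N M" "t \<in> rhom R M L" "!!y. y \<in> carrier N ==> g (\<sigma> y) = y"
  "!!x. x \<in> carrier L ==> t (f x) = x" "!!x. x \<in> carrier M ==> f (t x) \<oplus>\<^bsub>M\<^esub> \<sigma> (g x) = x"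
  using short_exact_split[OF m(1,2) N ex] by metis
 let ?T = "f ` carrier L"
 have T: "submodule ?T R M" by (rule submodule_image[OF m(1,2) f(1) L.submodule_carrier])
 show ?thesis
 proof (cases "carrier W = nul W")
  case True
  have accL: "noeth R L"
   by (rule L.acc_fin_gen[OF hnp_acc[OF hnp] has_db_fin_gen[OF L]])
  have accN: "noeth R N"
   by (rule N.acc_fin_gen[OF hnp_acc[OF hnp] has_db_fin_gen[OF N]])
  obtain a X where X: "unisum R L a X" "ess_in R L X (carrier L)"
   using LL.uniform_sum_exists[OF accL] by auto
  obtain b Y where Y: "unisum R N b Y" "ess_in R N Y (carrier N)"
   using LN.uniform_sum_exists[OF accN] by auto
  have \<sigma>i: "inj_on \<sigma> (carrier N)" using st(3) by (metis inj_onI)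
  let ?S = "\<sigma> ` carrier N"
  have S: "submodule ?S R M" by (rule submodule_image[OF m(3,2) st(1) N.submodule_carrier])
  note fX = inj_uniform_sum[OF m(1,2) f X] and sY = inj_uniform_sum[OF m(3,2) st(1) \<sigma>i Y]
  have TS: "?T \<inter> ?S = nul M"
  proof -
   have "x = \<zero>\<^bsub>M\<^esub>" if xT: "x \<in> ?T" and xS: "x \<in> ?S" for x
   proof -
    obtain y where y: "y \<in> carrier N" "x = \<sigma> y" using xS by (elim imageE)
    have "g x = \<zero>\<^bsub>N\<^esub>" using xT unfolding im by simp
    then have "y = \<zero>\<^bsub>N\<^esub>" using y st(3) by simp
    then show ?thesis using y rhom_zero[OF m(3,2) st(1)] by simp
   qed
   then show ?thesis using M.submoduleD(2)[OF T] M.submoduleD(2)[OF S] by blast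
  qed
  have top: "?T <+>\<^bsub>M\<^esub> ?S = carrier M"
  proof (intro equalityI subsetI)
   fix x assume "x \<in> carrier M"
   then show "x \<in> ?T <+>\<^bsub>M\<^esub> ?S"
    unfolding M.set_add_iff using st(5)[of x] rhom_closed[OF st(2)] rhom_closed[OF g(1)] by (metis image_eqI)
  next
   fix x assume "x \<in> ?T <+>\<^bsub>M\<^esub> ?S"
   then show "x \<in> carrier M" using M.submoduleD(1)[OF M.submodule_set_add[OF T S]] by blast
  qed
  have sub: "submodule (f ` X) R M" "submodule (\<sigma> ` Y) R M" using LM.uniform_sum_mem fX(1) sY(1) by auto
  have fXsY: "f ` X \<inter> \<sigma> ` Y = nul M"
  proof -
   have "f ` X <= ?T" "\<sigma> ` Y <= ?S" using fX(2) sY(2) by (auto simp: essential_in_def)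
   then show ?thesis using TS M.submoduleD(2)[OF sub(1)] M.submoduleD(2)[OF sub(2)] by blast
  qed
  have "unisum R M (a + b) (f ` X <+>\<^bsub>M\<^esub> \<sigma> ` Y)"
   by (rule LM.uniform_sum_append[OF fX(1) sY(1) fXsY])
  moreover have "ess_in R M (f ` X <+>\<^bsub>M\<^esub> \<sigma> ` Y) (carrier M)"
   using LM.essential_sup2[OF fX(2) sY(2) TS] top by simp
  ultimately have "udim R M = a + b" by (rule M.udim_uniform_sum)
  then show ?thesis using True L.udim_uniform_sum[OF X] N.udim_uniform_sum[OF Y] by (simp add: rho_def)
 next
  case False
  then have ann: "ann R W ~= {\<zero>}" using W(2) by blast
  obtain a where a: "chain R L a (reject R L W) (carrier L)" using length_mod_reject[OF L W(1) ann] by blast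
  obtain b where b: "chain R N b (reject R N W) (carrier N)" using length_mod_reject[OF N W(1) ann] by blast
  let ?r = "reject R M W"
  have r: "submodule ?r R M" by (rule submodule_reject[OF m(2) W(1)])
  have rL: "submodule (reject R L W) R L" by (rule submodule_reject[OF m(1) W(1)])
  have rN: "submodule (reject R N W) R N" by (rule submodule_reject[OF m(3) W(1)])
  \<comment> \<open>Homomorphisms from \<open>L\<close> extend to \<open>M\<close> along the
    retraction \<open>t\<close>, so the reject of \<open>L\<close> is exactly what the reject of
    \<open>M\<close> cuts out of the image of \<open>L\<close>.\<close>
  have fr: "f ` reject R L W = ?T \<inter> ?r"
  proof -
   have "f x \<in> ?r \<longleftrightarrow> x \<in> reject R L W" if x: "x \<in> carrier L" for x
   proof
    assume fx: "f x \<in> ?r"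
    have "h x = \<zero>\<^bsub>W\<^esub>" if h: "h \<in> rhom R L W" for h
    proof -
     have "compose (carrier M) h t (f x) = \<zero>\<^bsub>W\<^esub>"
      using fx rhom_compose[OF st(2) h m(2)] unfolding reject_def by blast
     then show ?thesis using x st(4) rhom_closed[OF f(1) x] by (simp add: compose_def)
    qed
    then show "x \<in> reject R L W" using x by (simp add: reject_def)
   next
    assume x': "x \<in> reject R L W"
    have "h (f x) = \<zero>\<^bsub>W\<^esub>" if h: "h \<in> rhom R M W" for h
    proof -
     have "compose (carrier L) h f x = \<zero>\<^bsub>W\<^esub>"
      using x' rhom_compose[OF f(1) h m(1)] unfolding reject_def by blast
     then show ?thesis using x by (simp add: compose_def)
    qed
    then show "f x \<in> ?r" using rhom_closed[OF f(1) x] by (simp add: reject_def)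
   qed
   then show ?thesis by (auto simp: reject_def)
  qed
  \<comment> \<open>If g x lies in the reject of \<open>N\<close>, the component \<sigma>(g x) of x
    lies in the reject of \<open>M\<close>, and the other component lies in the image of
    \<open>L\<close>.\<close>
  have gr: "{x \<in> carrier M. g x \<in> reject R N W} = ?T <+>\<^bsub>M\<^esub> ?r"
  proof (intro equalityI subsetI)
   fix x assume x: "x \<in> {x \<in> carrier M. g x \<in> reject R N W}"
   have "h (\<sigma> (g x)) = \<zero>\<^bsub>W\<^esub>" if h: "h \<in> rhom R M W" for h
   proof -
    have "compose (carrier N) h \<sigma> (g x) = \<zero>\<^bsub>W\<^esub>"
     using x rhom_compose[OF st(1) h m(3)] unfolding reject_def by blast
    then show ?thesis using x rhom_closed[OF g(1)] by (simp add: compose_def)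
   qed
   then have "\<sigma> (g x) \<in> ?r" using x rhom_closed[OF g(1)] rhom_closed[OF st(1)] by (simp add: reject_def)
   then show "x \<in> ?T <+>\<^bsub>M\<^esub> ?r"
    unfolding M.set_add_iff using st(5)[of x] x rhom_closed[OF st(2)] by (metis (no_types, lifting) image_eqI mem_Collect_eq)
  next
   fix x assume "x \<in> ?T <+>\<^bsub>M\<^esub> ?r"
   then obtain u v where uv: "u \<in> ?T" "v \<in> ?r" "x = u \<oplus>\<^bsub>M\<^esub> v" unfolding M.set_add_iff by blast
   have uc: "u \<in> carrier M" "g u = \<zero>\<^bsub>N\<^esub>" using uv(1) im by auto
   have vc: "v \<in> carrier M" using uv(2) by (simp add: reject_def)
   have "g x = g v" using uv(3) uc vc rhom_closed[OF g(1) vc] by (simp add: rhom_add[OF g(1)])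
   moreover have "h (g v) = \<zero>\<^bsub>W\<^esub>" if h: "h \<in> rhom R N W" for h
   proof -
    have "compose (carrier M) h g v = \<zero>\<^bsub>W\<^esub>"
     using uv(2) rhom_compose[OF g(1) h m(2)] unfolding reject_def by blast
    then show ?thesis using vc by (simp add: compose_def)
   qed
   ultimately show "x \<in> {x \<in> carrier M. g x \<in> reject R N W}"
    using uv(3) uc vc rhom_closed[OF g(1) vc] by (simp add: reject_def)
  qed
  have "chain R (sub_mod M ?T) a (f ` reject R L W) ?T"
   using lat_iso_covers_chain[OF inj_lat_iso[OF m(1,2) f], of "reject R L W" "carrier L" a] a rL by simp
  then have "chain R M a (?T \<inter> ?r) ?T"
   using sub_covers_chain[OF m(2) T, of "f ` reject R L W" a ?T] submodule_image[OF m(1,2) f(1) rL] fr by auto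
  then have 1: "chain R M a ?r (?T <+>\<^bsub>M\<^esub> ?r)"
   using LM.covers_chain_diamond[of ?T ?r a ?T] T r by simp
  have 2: "chain R M b (?T <+>\<^bsub>M\<^esub> ?r) (carrier M)"
   using M.surj_covers_chain_iff[OF m(3) g rN gr[symmetric], of b] b by simp
  have 3: "chain R M (a + b) ?r (carrier M)"
   unfolding relpowp_add using 1 2 by blast
  have theM: "rho R M W = a + b"
   unfolding rho_reject[OF M W(1)] using False by (simp, intro the_equality 3)
    (use LM.covers_chain_unique[OF _ 3] r in simp)
  have theL: "rho R L W = a"
   unfolding rho_reject[OF L W(1)] using False by (simp, intro the_equality a)
    (use LL.covers_chain_unique[OF _ a] rL in simp)
  have theN: "rho R N W = b"
   unfolding rho_reject[OF N W(1)] using False by (simp, intro the_equality b)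
    (use LN.covers_chain_unique[OF _ b] rN in simp)
  show ?thesis using theM theL theN by simp
 qed
qed

end

lemma simple_riso:
 assumes V: "simple_module R V" and V': "right_module R V'" and i: "riso R V V' ~= {}"
 shows "simple_module R V'"
proof -
 have Vm: "right_module R V" using V by (simp add: simple_module_def)
 obtain \<theta> where t: "\<theta> \<in> riso R V V'" using i by blast
 interpret V: right_module R V by (rule Vm)
 have ts: "\<theta> ` carrier V = carrier V'" "inj_on \<theta> (carrier V)" using t by (auto simp: riso_def bij_betw_def)
 show ?thesis
  using V.surj_simple_iff[OF V' riso_rhom[OF t] ts(1)] rhom_inj_iff[OF Vm V' riso_rhom[OF t]] ts V V.simple_iff by simp
qed

lemma ann_riso:
 assumes V: "right_module R V" and W: "right_module R W" and i: "riso R V W ~= {}"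
 shows "ann R V = ann R W"
proof -
 have sub: "ann R V <= ann R W" if V: "right_module R V" and W: "right_module R W" and t: "\<theta> \<in> riso R V W"
  for V :: "('a, 'v) module" and W :: "('a, 'w) module" and \<theta>
 proof
  fix a assume a: "a \<in> ann R V"
  have "a \<odot>\<^bsub>W\<^esub> w = \<zero>\<^bsub>W\<^esub>" if "w \<in> carrier W" for w
  proof -
   have "w \<in> \<theta> ` carrier V" using that t by (simp add: riso_def bij_betw_def)
   then obtain v where v: "v \<in> carrier V" "w = \<theta> v" by auto
   then show ?thesis using a rhom_smult[OF riso_rhom[OF t], of a v] rhom_zero[OF V W riso_rhom[OF t]] by (simp add: ann_def)
  qed
  then show "a \<in> ann R W" using a by (simp add: ann_def)
 qed
 obtain \<theta> where "\<theta> \<in> riso R V W" using i by blast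
 moreover obtain \<theta>' where "\<theta>' \<in> riso R W V" using riso_nonempty_sym[OF V W i] by blast
 ultimately show ?thesis using sub[OF V W] sub[OF W V] by blast
qed

lemma unfaithful_riso:
 assumes V: "unfaithful_simple R V" and W: "right_module R W" "riso R V W ~= {}"
 shows "unfaithful_simple R W"
 using V simple_riso[OF _ W] ann_riso[OF _ W] by (auto simp: unfaithful_simple_def simple_module_def)

lemma zero_riso:
 assumes V: "right_module R V" and W: "right_module R W" and i: "riso R V W ~= {}" and z: "carrier V = nul V"
 shows "carrier W = nul W"
proof -
 obtain \<theta> where t: "\<theta> \<in> riso R V W" using i by blast
 then have "\<theta> ` carrier V = carrier W" by (simp add: riso_def bij_betw_def)
 then show ?thesis using z rhom_zero[OF V W riso_rhom[OF t]] by simp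
qed

locale hnp_universe = hnp R for R :: "('r, 'k) ring_scheme" +
 fixes U :: "'u itself"
 assumes univU: "universe_for U R"

sublocale hnp_universe \<subseteq> hereditary_universe R U
 by (intro hereditary_universe.intro ring_axioms univU hnp_ideal_has_db hnp)

context hnp_universe
begin

lemma modspec_cases:
 assumes "W \<in> (modspec R :: ('r, 'u) module set)"
 shows "right_module R W" "zero_module R W \<or> unfaithful_simple R W"
proof -
 obtain V :: "('r, 'u) module" where V: "unfaithful_simple R V \<or> zero_module R V"
  "W = (SOME W. W \<in> iso_class R V)" using assms unfolding modspec_def by blast
 have Vm: "right_module R V" using V by (auto simp: unfaithful_simple_def simple_module_def zero_module_def)
 have "W \<in> iso_class R V" unfolding V(2) by (rule someI[of _ V]) (rule iso_class_self[OF Vm])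
 then show W: "right_module R W" by (simp add: iso_class_def)
 have "riso R V W ~= {}" using \<open>W \<in> iso_class R V\<close> by (simp add: iso_class_def)
 then show "zero_module R W \<or> unfaithful_simple R W"
  using V(1) unfaithful_riso[OF _ W] zero_riso[OF Vm W] W by (auto simp: zero_module_def)
qed

lemma modspec_admissible:
 assumes "W \<in> (modspec R :: ('r, 'u) module set)"
 shows "right_module R W" "carrier W = nul W \<or> ann R W ~= nul R"
 using modspec_cases[OF assms] by (auto simp: zero_module_def unfaithful_simple_def)

lemma genus_group_comm: "comm_group (genus_group R :: (('r, 'u) module => int) monoid)"
 unfolding genus_group_def
 by (rule group.group_comm_groupI) (auto simp: fun_eq_iff)

lemma genus_exact:
 fixes L M N :: "('r, 'u) module"
 assumes "L \<in> fgproj_modules R" "M \<in> fgproj_modules R" "N \<in> fgproj_modules R" "short_exact R L M N i p"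
 shows "(genus R M :: ('r, 'u) module => int) = genus R L \<otimes>\<^bsub>genus_group R\<^esub> genus R N"
proof -
 have "int (rho R M W) = int (rho R L W) + int (rho R N W)" if "W \<in> (modspec R :: ('r, 'u) module set)" for W
  using rho_exact[OF _ _ _ assms(4) modspec_admissible[OF that]] assms(1-3) by (simp add: fgproj_iff)
 then show ?thesis by (auto simp: genus_def genus_group_def)
qed

text \<open>\<open>genus_plus\<close> is a definite description, so it is usable only after
  existence, from the universal property and additivity of the genus, and uniqueness, from agreement
  on generators and extensionality.\<close>

theorem genus_plus_props:
 defines "h \<equiv> genus_plus R :: ('r, 'u) groth_elem => ('r, 'u) module => int"
 shows "h \<in> hom K (genus_group R)" "!!P :: ('r, 'u) module. P \<in> fgproj_modules R ==> h (kcl P) = genus R P"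
proof -
 let ?G = "genus_group R :: (('r, 'u) module => int) monoid"
 let ?g = "genus R :: ('r, 'u) module => ('r, 'u) module => int"
 interpret G: comm_group ?G by (rule genus_group_comm)
 have gc: "?g P \<in> carrier ?G" for P by (simp add: genus_def genus_group_def)
 have m: "right_module R P" if "P \<in> fgproj_modules R" for P :: "('r, 'u) module"
  using that by (simp add: fgproj_modules_def)
 have "\<exists>h\<in>hom (groth R (fgproj_modules R)) ?G. \<forall>P\<in>fgproj_modules R. h (groth_class R (fgproj_modules R) (iso_class R P) :: ('r, 'u) groth_elem) = ?g P"
 proof (rule groth_universal[where A = ?G and C = "fgproj_modules R" and R = R and f = ?g, OF genus_group_comm])
  fix P Q :: "('r, 'u) module" assume PQ: "P \<in> fgproj_modules R" "Q \<in> fgproj_modules R" "riso R P Q ~= {}"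
  obtain \<theta> where \<theta>: "\<theta> \<in> riso R P Q" using PQ by blast
  have th: "\<theta> \<in> rhom R P Q" "inj_on \<theta> (carrier P)" "\<theta> ` carrier P = carrier Q" using \<theta> by (auto simp: riso_def bij_betw_def)
  interpret P: right_module R P by (rule m[OF PQ(1)])
  interpret Q: right_module R Q by (rule m[OF PQ(2)])
  \<comment> \<open>An isomorphism is an exact sequence with zero left term. The genus of the zero
    module is trivial because that module is an extension of itself by itself.\<close>
  let ?Z = "sub_mod P (nul P)"
  have Z: "?Z \<in> fgproj_modules R" unfolding fgproj_iff
   by (rule has_db_sub) (use PQ(1) in "simp_all add: fgproj_iff")
  have "hker P Q \<theta> = nul P" using rhom_inj_iff[OF P.right_module_axioms Q.right_module_axioms th(1)] th(2) by simp
  then have 1: "short_exact R ?Z P Q (\<lambda>x\<in>nul P. x) \<theta>"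
   using short_exact_sub[OF P.right_module_axioms Q.right_module_axioms th(1)] th(3) by simp
  have zz: "(\<lambda>x\<in>carrier ?Z. x) \<in> rhom R ?Z ?Z" by (rule rhom_id[OF m[OF Z]])
  have 2: "short_exact R ?Z ?Z ?Z (\<lambda>x\<in>carrier ?Z. x) (\<lambda>x\<in>carrier ?Z. x)"
   using zz unfolding short_exact_def by simp
  have "?g ?Z = ?g ?Z \<otimes>\<^bsub>?G\<^esub> ?g ?Z" by (rule genus_exact[OF Z Z Z 2])
  then have "?g ?Z = \<one>\<^bsub>?G\<^esub>" using gc[of ?Z] by (metis G.l_cancel_one')
  then show "?g P = ?g Q" using genus_exact[OF Z PQ(1,2) 1] gc[of Q] by simp
 qed (use m gc genus_exact in auto)
 then obtain k where k: "k \<in> hom K ?G" "!!P :: ('r, 'u) module. P \<in> fgproj_modules R ==> k (kcl P) = ?g P"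
  unfolding K0_def K0_class_def by blast
 let ?P = "\<lambda>h. h \<in> extensional (carrier K) \<and> h \<in> hom K ?G \<and> (\<forall>P\<in>(fgproj_modules R :: ('r, 'u) module set). h (kcl P) = ?g P)"
 have "?P h"
  unfolding h_def genus_plus_def
 proof (rule theI[of ?P "restrict k (carrier K)"])
  interpret K: comm_group K by (rule K_comm_group)
  have "kcl P \<in> carrier K" if "P \<in> (fgproj_modules R :: ('r, 'u) module set)" for P
   using kcl_closed[OF _ small_mod_self, of P] that by (simp add: fgproj_iff)
  then show "?P (restrict k (carrier K))"
   using k by (auto simp: hom_def)
  fix h assume h: "?P h"
  show "h = restrict k (carrier K)"
  proof (rule extensionalityI[of _ "carrier K"])
   fix x assume "x \<in> carrier K"
   then show "h x = restrict k (carrier K) x"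
    using groth_hom_eq[of ?G h R "fgproj_modules R" k x] G.is_group h k unfolding K0_def K0_class_def by auto
  qed (use h in auto)
 qed
 then show "h \<in> hom K (genus_group R)" "!!P :: ('r, 'u) module. P \<in> fgproj_modules R ==> h (kcl P) = genus R P" by auto
qed

end

section \<open>A minimal right ideal forces an HNP ring to be Artinian\<close>

section \<open>Minimal right ideals\<close>

context modular_sets
begin

lemma dcc_between_trans:
 assumes L: "A \<in> L" "B \<in> L" "C \<in> L" "A <= B" "B <= C" and AB: "dcc_between L A B" and BC: "dcc_between L B C"
 shows "dcc_between L A C"
 unfolding dcc_between_def
proof (intro allI impI)
 fix f :: "nat => 'a set" assume f: "\<forall>n. f n \<in> L \<and> A <= f n \<and> f n <= C \<and> f (Suc n) <= f n"
 have "\<forall>n. f n \<inter> B \<in> L \<and> A <= f n \<inter> B \<and> f n \<inter> B <= B \<and> f (Suc n) \<inter> B <= f n \<inter> B"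
  using f L by (auto dest: subsetD)
 then obtain n where n: "\<forall>m\<ge>n. f m \<inter> B = f n \<inter> B"
  using AB unfolding dcc_between_def by (elim allE[of _ "\<lambda>n. f n \<inter> B"]) auto
 have "\<forall>n. B |+| f n \<in> L \<and> B <= B |+| f n \<and> B |+| f n <= C \<and> B |+| f (Suc n) <= B |+| f n"
  using f L by (meson order_refl sup_closed sup_least sup_mono sup_upper1)
 then obtain k where k: "\<forall>m\<ge>k. B |+| f m = B |+| f k"
  using BC unfolding dcc_between_def by (elim allE[of _ "\<lambda>n. B |+| f n"]) auto
 have "f m = f (max n k)" if "m \<ge> max n k" for m
 proof -
  let ?a = "f (max n k)"
  have sub: "f m <= ?a"
   using f lift_Suc_antimono_le[of f "max n k" m] that by blast
  have "?a = (f m |+| B) \<inter> ?a"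
  proof -
   have "?a <= B |+| ?a" using f L sup_upper2 by simp
   also have "\<dots> = f m |+| B"
    using k that f L sup_commute by (metis max.boundedE max.cobounded2)
   finally show ?thesis by auto
  qed
  also have "\<dots> = f m |+| (B \<inter> ?a)"
   using modular f L sub by simp
  also have "B \<inter> ?a = B \<inter> f m"
   using n that by (metis inf_commute max.boundedE max.cobounded1)
  also have "f m |+| (B \<inter> f m) = f m"
   using f L sup_absorb1 by simp
  finally show ?thesis by simp
 qed
 then show "\<exists>n. \<forall>m\<ge>n. f m = f n" by blast
qed

lemma dcc_covers:
 assumes "covers L A B" shows "dcc_between L A B"
 unfolding dcc_between_def
proof (intro allI impI)
 fix f :: "nat => 'a set" assume f: "\<forall>n. f n \<in> L \<and> A <= f n \<and> f n <= B \<and> f (Suc n) <= f n"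
 have "X = A \<or> X = B" if "X \<in> L" "A <= X" "X <= B" for X
  using assms that unfolding covers_def by metis
 then have AB: "f n = A \<or> f n = B" for n using f by blast
 show "\<exists>n. \<forall>m\<ge>n. f m = f n"
 proof (cases "\<exists>n. f n = A")
  case True
  then obtain n where n: "f n = A" by blast
  have "f m = f n" if "m \<ge> n" for m
   using f lift_Suc_antimono_le[of f n m] that n by blast
  then show ?thesis by blast
 next
  case False
  then show ?thesis using AB by metis
 qed
qed

lemma dcc_covers_chain:
 "[|(covers L ^^ n) A B; A \<in> L|] ==> dcc_between L A B"
proof (induction n arbitrary: B)
 case 0
 then have "B = A" by simp
 then show ?case unfolding dcc_between_def by (metis subset_antisym)
next
 case (Suc n)
 then obtain X where X: "(covers L ^^ n) A X" "covers L X B" by auto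
 have "X \<in> L" "A <= X" using covers_chain_mem[OF X(1) Suc.prems(2)] by auto
 moreover have "B \<in> L" "X <= B" using X(2) by (auto simp: covers_def)
 ultimately show ?case
  using dcc_between_trans[of A X B] Suc.IH[OF X(1) Suc.prems(2)] dcc_covers[OF X(2)] Suc.prems(2) by blast
qed

end

lemma right_artinianI:
 assumes "right_module R (reg_module R)" "dcc_between (rideals R) (nul R) (carrier R)"
 shows "right_artinian R"
proof -
 interpret reg: right_module R "reg_module R" by (rule assms(1))
 show ?thesis
  unfolding right_artinian_def
 proof (intro allI impI)
  fix I :: "nat => 'a set" assume I: "\<forall>n. right_ideal (I n) R \<and> I (Suc n) <= I n"
  then have "\<forall>n. I n \<in> rideals R \<and> nul R <= I n \<and> I n <= carrier R \<and> I (Suc n) <= I n"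
   using reg.submoduleD(1,2) by fastforce
  then show "\<exists>n. \<forall>m\<ge>n. I m = I n" using assms(2) unfolding dcc_between_def by blast
 qed
qed

context prime_element_ring
begin

lemma prime_elem_neq:
 "[|a \<in> carrier R; b \<in> carrier R; a ~= \<zero>; b ~= \<zero>|] ==> \<exists>r\<in>carrier R. a \<otimes> r \<otimes> b ~= \<zero>"
 using prime_elem by blast

end

context hnp
begin

sublocale RL: modular_sets "rideals R" "set_add (reg_module R)" "{\<zero>}"
 using reg.modular_submods by simp

lemma lmult_rhom:
 assumes a: "a \<in> carrier R" and I: "right_ideal I R"
 shows "(\<lambda>x\<in>I. a \<otimes> x) \<in> rhom R (sub_mod (reg_module R) I) (reg_module R)"
proof -
 have "I <= carrier R" using I by (simp add: right_ideal_iff)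
 then show ?thesis
  using rhom_restrictI[OF reg.right_module_sub[OF I], of "\<lambda>x. a \<otimes> x" "reg_module R"] a
  by (auto simp: r_distr m_assoc subset_eq)
qed

lemma lmult_image: "[|a \<in> carrier R; right_ideal I R|] ==> right_ideal ((\<lambda>x. a \<otimes> x) ` I) R"
 using submodule_image[OF reg.right_module_sub reg.right_module_axioms lmult_rhom[of a I]]
  right_module.submodule_carrier[OF reg.right_module_sub, of I] by fastforce

lemma right_ideal_carrier: "right_ideal (carrier R) R"
 using reg.submodule_carrier by simp

lemma right_ideal_zero: "right_ideal {\<zero>} R"
 using reg.submodule_zero by simp

lemma right_ideal_subset: "right_ideal I R ==> I <= carrier R"
 by (simp add: right_ideal_iff)

lemma principal_right_ideal: "a \<in> carrier R ==> right_ideal ((\<lambda>x. a \<otimes> x) ` carrier R) R"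
 by (rule lmult_image[OF _ right_ideal_carrier])

text \<open>Brauer's argument. Primeness yields a in \<open>K\<close> with a K nonzero, so left
  multiplication by a is bijective on \<open>K\<close>. Writing a = a e with e in \<open>K\<close>,
  the element e e - e is killed by a, so e is idempotent.\<close>

lemma minimal_idempotent:
 assumes K: "covers (rideals R) {\<zero>} K"
 obtains e where "e \<in> K" "e ~= \<zero>" "e \<otimes> e = e" "K = (\<lambda>x. e \<otimes> x) ` carrier R"
proof -
 have Kr: "right_ideal K R" and K0: "{\<zero>} \<subset> K" and min: "!!X. [|right_ideal X R; X <= K; X ~= {\<zero>}|] ==> X = K"
  using K reg.submoduleD(2) by (auto simp: covers_def)
 have KR: "K <= carrier R" and Kc: "!!x r. [|x \<in> K; r \<in> carrier R|] ==> x \<otimes> r \<in> K" using Kr by (auto simp: right_ideal_iff)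
 obtain k where k: "k \<in> K" "k ~= \<zero>" using K0 by blast
 obtain r where r: "r \<in> carrier R" "k \<otimes> r \<otimes> k ~= \<zero>" using prime_elem_neq[of k k] k KR by blast
 let ?a = "k \<otimes> r"
 have a: "?a \<in> K" "?a \<in> carrier R" using k r Kc KR by auto
 have aK: "(\<lambda>x. ?a \<otimes> x) ` K = K"
 proof (rule min[OF lmult_image[OF a(2) Kr]])
  show "(\<lambda>x. ?a \<otimes> x) ` K <= K" using Kc[OF a(1)] KR by auto
  show "(\<lambda>x. ?a \<otimes> x) ` K ~= {\<zero>}" using k r by auto
 qed
 have ker: "x = \<zero>" if x: "x \<in> K" "?a \<otimes> x = \<zero>" for x
 proof (rule ccontr)
  assume nz: "x ~= \<zero>"
  let ?X = "{x \<in> K. ?a \<otimes> x = \<zero>}"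
  have "right_ideal ?X R"
   unfolding right_ideal_iff using Kr KR a(2) by (auto simp: right_ideal_iff r_distr m_assoc[symmetric] subset_eq)
  then have "?X = K" by (rule min) (use x nz in auto)
  then show False using k r by blast
 qed
 have "?a \<in> (\<lambda>x. ?a \<otimes> x) ` K" unfolding aK by (rule a(1))
 then obtain e where e: "e \<in> K" "?a = ?a \<otimes> e" by blast
 have eR: "e \<in> carrier R" using e KR by auto
 have "?a ~= \<zero>" using r k KR by auto
 then have e0: "e ~= \<zero>" using e a by auto
 have "e \<otimes> e \<ominus> e \<in> K" using reg.submoduleD(6)[OF Kr, of "e \<otimes> e" e] Kc[OF e(1) eR] e(1)
  by (simp add: a_minus_def a_inv_def m_inv_def reg_module_def)
 moreover have "?a \<otimes> (e \<otimes> e \<ominus> e) = \<zero>"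
 proof -
  have "?a \<otimes> (e \<otimes> e) = ?a" using e(2) a(2) eR m_assoc[of ?a e e] by simp
  then show ?thesis using e(2) a(2) eR by (simp add: minus_eq r_distr r_minus r_neg)
 qed
 ultimately have "e \<otimes> e \<ominus> e = \<zero>" by (rule ker)
 then have "e \<otimes> e \<ominus> e \<oplus> e = e" using eR by simp
 then have ee: "e \<otimes> e = e" using eR by (simp add: minus_eq a_assoc l_neg)
 have "(\<lambda>x. e \<otimes> x) ` carrier R = K"
 proof (rule min[OF principal_right_ideal[OF eR]])
  show "(\<lambda>x. e \<otimes> x) ` carrier R <= K" using Kc[OF e(1)] by auto
  have "e \<in> (\<lambda>x. e \<otimes> x) ` carrier R" using ee eR by (metis image_eqI)
  then show "(\<lambda>x. e \<otimes> x) ` carrier R ~= {\<zero>}" using e0 by auto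
 qed
 then show thesis using that e e0 ee by blast
qed

lemma lmult_minimal:
 assumes K: "covers (rideals R) {\<zero>} K" and a: "a \<in> carrier R"
 shows "(\<lambda>x. a \<otimes> x) ` K = {\<zero>} \<or> covers (rideals R) {\<zero>} ((\<lambda>x. a \<otimes> x) ` K)"
proof (rule disjCI)
 assume nc: "\<not> covers (rideals R) {\<zero>} ((\<lambda>x. a \<otimes> x) ` K)"
 have Kr: "right_ideal K R" and K0: "{\<zero>} \<subset> K" and min: "!!X. [|right_ideal X R; X <= K; X ~= {\<zero>}|] ==> X = K"
  using K reg.submoduleD(2) by (auto simp: covers_def)
 note aK = lmult_image[OF a Kr]
 note KR = right_ideal_subset[OF Kr]
 show "(\<lambda>x. a \<otimes> x) ` K = {\<zero>}"
 proof (rule ccontr)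
  assume nz: "(\<lambda>x. a \<otimes> x) ` K ~= {\<zero>}"
  have "Y = {\<zero>} \<or> Y = (\<lambda>x. a \<otimes> x) ` K" if Y: "right_ideal Y R" "Y <= (\<lambda>x. a \<otimes> x) ` K" for Y
  proof -
   let ?X = "{x \<in> K. a \<otimes> x \<in> Y}"
   have X: "right_ideal ?X R"
    unfolding right_ideal_iff using Kr Y(1) KR a
    by (auto simp: right_ideal_iff r_distr m_assoc[symmetric] subset_eq)
   have im: "(\<lambda>x. a \<otimes> x) ` ?X = Y" using Y(2) by auto
   show ?thesis
   proof (cases "?X = {\<zero>}")
    case True
    then have "Y = {a \<otimes> \<zero>}" using im by auto
    then show ?thesis using a by simp
   next
    case False
    then have "?X = K" by (intro min X) auto
    then show ?thesis using im by simp
   qed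
  qed
  moreover have "{\<zero>} \<subset> (\<lambda>x. a \<otimes> x) ` K" using nz aK by (auto simp: right_ideal_iff)
  ultimately have "covers (rideals R) {\<zero>} ((\<lambda>x. a \<otimes> x) ` K)"
   unfolding covers_def using aK right_ideal_zero by simp
  then show False using nc by simp
 qed
qed

text \<open>The two-sided ideal R e R is a sum of right ideals r e R, each zero or minimal. By the
  ascending chain condition finitely many of them suffice, so this nonzero ideal has finite length,
  and above it \<open>dcc_above_ideal\<close> applies.\<close>

lemma minimal_right_artinian:
 assumes K: "covers (rideals R) {\<zero>} K"
 shows "right_artinian R"
proof -
 obtain e where e: "e \<in> K" "e ~= \<zero>" "e \<otimes> e = e" "K = (\<lambda>x. e \<otimes> x) ` carrier R" using minimal_idempotent[OF K] .
 have Kr: "right_ideal K R" using K by (simp add: covers_def)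
 have eR: "e \<in> carrier R" using right_ideal_subset[OF Kr] e by auto
 let ?G = "(\<lambda>r. r \<otimes> e) ` carrier R"
 have G: "?G <= carrier R" using eR by auto
 define P where "P N = (\<exists>F. finite F \<and> F <= ?G \<and> N = rspan R (reg_module R) F)" for N
 have span: "right_ideal (rspan R (reg_module R) F) R" if "F <= ?G" for F
  using reg.submodule_rspan[of F] that G by auto
 have "rspan R (reg_module R) {} = {\<zero>}"
  using reg.rspan_least[of "{\<zero>}" "{}"] right_ideal_zero reg.submoduleD(2)[OF span[of "{}"]] by auto
 then have P0: "P {\<zero>}" unfolding P_def by (intro exI[of _ "{}"]) auto
 from acc_between_maximal[of "rideals R" "{\<zero>}" "carrier R" "{\<zero>}" P, OF hnp_acc[OF hnp] _ order_refl _ P0]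
 obtain H where H: "P H" and max: "!!Z. [|right_ideal Z R; Z <= carrier R; P Z; H <= Z|] ==> Z = H"
  using right_ideal_zero by auto
 from H obtain F where F: "finite F" "F <= ?G" "H = rspan R (reg_module R) F" unfolding P_def by blast
 have Hr: "right_ideal H R" unfolding F(3) by (rule span[OF F(2)])
 have GH: "g \<in> H" if g: "g \<in> ?G" for g
 proof -
  let ?Z = "rspan R (reg_module R) (insert g F)"
  have gF: "insert g F <= ?G" using F g by auto
  have "P ?Z" unfolding P_def using F(1) gF by (intro exI[of _ "insert g F"]) auto
  moreover have "H <= ?Z" unfolding F(3) by (rule reg.rspan_mono) auto
  ultimately have "?Z = H" using max span[OF gF] right_ideal_subset by blast
  then show ?thesis using reg.rspan_incl[of "insert g F"] by auto
 qed
 have Hi: "ideal H R"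
 proof (rule idealI[OF ring_axioms])
  show "subgroup H (add_monoid R)"
   using submodule.axioms(1)[OF Hr] by (simp add: reg_module_def subgroup_def m_inv_def)
  fix h r assume h: "h \<in> H" "r \<in> carrier R"
  show "h \<otimes> r \<in> H" using Hr h by (simp add: right_ideal_iff)
  let ?X = "{x \<in> carrier R. r \<otimes> x \<in> H}"
  have "right_ideal ?X R"
   unfolding right_ideal_iff using Hr h by (auto simp: right_ideal_iff r_distr m_assoc[symmetric])
  moreover have "F <= ?X"
  proof
   fix f assume "f \<in> F"
   then obtain s where s: "s \<in> carrier R" "f = s \<otimes> e" using F(2) by blast
   have "(r \<otimes> s) \<otimes> e \<in> H" using GH s h by blast
   then show "f \<in> ?X" using s h eR by (simp add: m_assoc)
  qed
  ultimately have "H <= ?X" unfolding F(3) by (rule reg.rspan_least)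
  then show "r \<otimes> h \<in> H" using h by blast
 qed
 have "e \<in> ?G" using eR by (intro image_eqI[of _ _ \<one>]) auto
 then have H0: "H ~= {\<zero>}" using GH[of e] e(2) by blast
 have chain: "\<exists>n. chain R (reg_module R) n {\<zero>} (rspan R (reg_module R) F')" if "finite F'" "F' <= ?G" for F'
  using that
 proof (induction F' rule: finite_induct)
  case empty
  show ?case using \<open>rspan R (reg_module R) {} = {\<zero>}\<close> relpowp_0_I by metis
 next
  case (insert g F')
  obtain n where n: "chain R (reg_module R) n {\<zero>} (rspan R (reg_module R) F')" using insert by auto
  obtain r where r: "r \<in> carrier R" "g = r \<otimes> e" using insert.prems by auto
  let ?X = "rspan R (reg_module R) F'" and ?Y = "rspan R (reg_module R) (insert g F')" and ?C = "(\<lambda>x. r \<otimes> x) ` K"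
  have X: "right_ideal ?X R" and Y: "right_ideal ?Y R" and C: "right_ideal ?C R"
   using span insert.prems lmult_image[OF r(1) Kr] by auto
  have XCY: "?C <+>\<^bsub>reg_module R\<^esub> ?X = ?Y"
  proof (rule subset_antisym)
   have gY: "g \<in> ?Y" using reg.rspan_incl[of "insert g F'"] by auto
   have "?C <= ?Y"
   proof
    fix c assume "c \<in> ?C"
    then obtain x where x: "x \<in> carrier R" "c = r \<otimes> (e \<otimes> x)" unfolding e(4) by blast
    then have "c = g \<otimes> x" using r eR by (simp add: m_assoc)
    then show "c \<in> ?Y" using Y gY x by (simp add: right_ideal_iff)
   qed
   then show "?C <+>\<^bsub>reg_module R\<^esub> ?X <= ?Y"
    using RL.sup_least[of ?C ?X ?Y] X Y C reg.rspan_mono[of F' "insert g F'"] by auto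
   have "g \<in> ?C" using r e(1) by auto
   then show "?Y <= ?C <+>\<^bsub>reg_module R\<^esub> ?X"
    using RL.sup_upper1[of ?C ?X] RL.sup_upper2[of ?C ?X] X C reg.rspan_incl[of F']
    by (intro reg.rspan_least reg.submodule_set_add) auto
  qed
  from lmult_minimal[OF K r(1)] show ?case
  proof
   assume "?C = {\<zero>}"
   then have "?Y = ?X" using XCY RL.sup_absorb2[of "{\<zero>}" ?X] X right_ideal_zero RL.bot_least[of ?X] by simp
   then show ?thesis using n by metis
  next
   assume "covers (rideals R) {\<zero>} ?C"
   from RL.covers_sup[OF this, of ?X] X XCY
   have "?X = ?Y \<or> covers (rideals R) ?X ?Y"
    using RL.sup_absorb2[of "{\<zero>}" ?X] RL.bot_least[of ?X] right_ideal_zero by simp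
   then show ?thesis
   proof
    assume "?X = ?Y" then show ?thesis using n by metis
   next
    assume "covers (rideals R) ?X ?Y"
    then show ?thesis using relpowp_Suc_I[OF n] by blast
   qed
  qed
 qed
 obtain n where "chain R (reg_module R) n {\<zero>} H" using chain[OF F(1,2)] F(3) by blast
 then have "dcc_between (rideals R) {\<zero>} H"
  by (rule RL.dcc_covers_chain) (use right_ideal_zero in simp)
 then have "dcc_between (rideals R) {\<zero>} (carrier R)"
  using RL.dcc_between_trans[of "{\<zero>}" H "carrier R"] dcc_above_ideal[OF Hi H0] Hr right_ideal_zero right_ideal_carrier
   right_ideal_subset[OF Hr] RL.bot_least[of H] by simp
 then show ?thesis by (rule right_artinianI[OF reg.right_module_axioms])
qed

text \<open>\<open>artinian_ring\<close> asks for both sides. Minimality of e R makes e R e a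
  division ring, which in turn makes R e a minimal left ideal, and the one-sided result is applied
  to the opposite ring.\<close>

theorem minimal_artinian:
 assumes K: "covers (rideals R) {\<zero>} K"
 shows "artinian_ring R"
proof -
 obtain e where e: "e \<in> K" "e ~= \<zero>" "e \<otimes> e = e" "K = (\<lambda>x. e \<otimes> x) ` carrier R" using minimal_idempotent[OF K] .
 have Kr: "right_ideal K R" and min: "!!X. [|right_ideal X R; X <= K; X ~= {\<zero>}|] ==> X = K"
  using K reg.submoduleD(2) by (auto simp: covers_def)
 have eR: "e \<in> carrier R" using right_ideal_subset[OF Kr] e by auto
 interpret opp: hnp "opp_ring R" by (rule hnp.intro[OF hnp_opp_ring[OF hnp]])
 let ?L = "(\<lambda>x. e \<otimes>\<^bsub>opp_ring R\<^esub> x) ` carrier (opp_ring R)"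
 have L: "right_ideal ?L (opp_ring R)" by (rule opp.principal_right_ideal) (use eR in simp)
 have "e \<in> ?L" using e(3) eR by (auto intro!: image_eqI[of _ _ e])
 \<comment> \<open>For nonzero u in e R e the right ideal u R is all of \<open>K\<close>, so e = u w
   for some w, and w is trimmed to e w e.\<close>
 have right_inverse: "\<exists>v\<in>carrier R. u \<otimes> v = e \<and> e \<otimes> v = v \<and> v \<otimes> e = v" if u: "u \<in> carrier R" "e \<otimes> u = u" "u \<otimes> e = u" "u ~= \<zero>" for u
 proof -
  have uK: "u \<in> K" unfolding e(4) using u(1,2) by (metis image_eqI)
  have "(\<lambda>x. u \<otimes> x) ` carrier R = K"
  proof (rule min[OF principal_right_ideal[OF u(1)]])
   show "(\<lambda>x. u \<otimes> x) ` carrier R <= K" using Kr uK by (auto simp: right_ideal_iff)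
   have "u \<in> (\<lambda>x. u \<otimes> x) ` carrier R" using u(1) by (intro image_eqI[of _ _ \<one>]) auto
   then show "(\<lambda>x. u \<otimes> x) ` carrier R ~= {\<zero>}" using u(4) by auto
  qed
  then obtain w where w: "w \<in> carrier R" "e = u \<otimes> w" using e(1) by blast
  let ?v = "e \<otimes> w \<otimes> e"
  have "u \<otimes> ?v = (u \<otimes> e) \<otimes> w \<otimes> e" using u(1) eR w(1) by (simp add: m_assoc)
  also have "\<dots> = e" using u(3) w(2) e(3) by simp
  finally have "u \<otimes> ?v = e" .
  moreover have "e \<otimes> ?v = (e \<otimes> e) \<otimes> w \<otimes> e" using eR w(1) by (simp add: m_assoc)
  moreover have "?v \<otimes> e = e \<otimes> w \<otimes> (e \<otimes> e)" using eR w(1) by (simp add: m_assoc)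
  ultimately show ?thesis using e(3) eR w(1) by (intro bexI[of _ ?v]) auto
 qed
 have "X = ?L" if X: "right_ideal X (opp_ring R)" "X <= ?L" "X ~= {\<zero>}" for X
 proof -
  have Xc: "r \<otimes> x \<in> X" if "r \<in> carrier R" "x \<in> X" for r x using X(1) that by (simp add: opp.right_ideal_iff)
  have "\<zero> \<in> X" using X(1) by (simp add: opp.right_ideal_iff)
  then obtain x where x: "x \<in> X" "x ~= \<zero>" using X(3) by blast
  obtain r where r: "r \<in> carrier R" "x = r \<otimes> e" using x(1) X(2) by auto
  have xR: "x \<in> carrier R" using r eR by simp
  have xe: "x \<otimes> e = x" using r eR e(3) by (simp add: m_assoc)
  \<comment> \<open>Primeness moves x into e R e: u = e s x is nonzero there. A right inverse v of u
    has a right inverse w, and w = u, so v is also a left inverse and e is a left multiple of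
    x.\<close>
  obtain s where s: "s \<in> carrier R" "e \<otimes> s \<otimes> x ~= \<zero>" using prime_elem_neq[OF eR xR e(2) x(2)] by blast
  let ?u = "e \<otimes> s \<otimes> x"
  have uR: "?u \<in> carrier R" using eR s xR by simp
  have "e \<otimes> ?u = (e \<otimes> e) \<otimes> s \<otimes> x" using eR s(1) xR by (simp add: m_assoc)
  then have eu: "e \<otimes> ?u = ?u" using e(3) by simp
  have "?u \<otimes> e = e \<otimes> s \<otimes> (x \<otimes> e)" using eR s(1) xR by (simp add: m_assoc)
  then have ue: "?u \<otimes> e = ?u" using xe by simp
  obtain v where v: "v \<in> carrier R" "?u \<otimes> v = e" "e \<otimes> v = v" "v \<otimes> e = v"
   using right_inverse[OF uR eu ue s(2)] by blast
  have v0: "v ~= \<zero>" using v(2) uR e(2) by auto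
  obtain w where w: "w \<in> carrier R" "v \<otimes> w = e" "e \<otimes> w = w" using right_inverse[OF v(1,3,4) v0] by blast
  have "w = ?u \<otimes> v \<otimes> w" using v(2) w(3) by simp
  also have "\<dots> = ?u \<otimes> (v \<otimes> w)" using uR v(1) w(1) by (simp add: m_assoc)
  also have "\<dots> = ?u" using w(2) ue by simp
  finally have "v \<otimes> ?u = e" using w(2) by simp
  moreover have "v \<otimes> ?u = (v \<otimes> (e \<otimes> s)) \<otimes> x" using v(1) eR s(1) xR by (simp add: m_assoc)
  ultimately have "e \<in> X" using Xc[OF _ x(1), of "v \<otimes> (e \<otimes> s)"] v(1) eR s(1) by simp
  then have "?L <= X" using Xc by auto
  then show ?thesis using X(2) by blast
 qed
 moreover have "{\<zero>} \<subset> ?L" using \<open>e \<in> ?L\<close> e(2) L by (auto simp: opp.right_ideal_iff)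
 ultimately have "covers (submods (opp_ring R) (reg_module (opp_ring R))) (nul (opp_ring R)) ?L"
  unfolding covers_def using L opp.right_ideal_zero by auto
 then have "right_artinian (opp_ring R)" by (rule opp.minimal_right_artinian)
 then show ?thesis using minimal_right_artinian[OF K] by (simp add: artinian_ring_def)
qed

section \<open>Goldie's argument: essential right ideals contain non-zero-divisors\<close>

section \<open>Regular elements\<close>

definition "ess_ideal I \<longleftrightarrow> essential_in (rideals R) {\<zero>} I (carrier R)"

lemma ess_idealD: "[|ess_ideal I; right_ideal K R; K ~= {\<zero>}|] ==> \<exists>x\<in>K \<inter> I. x ~= \<zero>"
 unfolding ess_ideal_def essential_in_def
 using right_ideal_subset[of K] reg.submoduleD(2)[of K] reg.submoduleD(2)[of I] by auto

lemma ess_idealI: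
 "[|right_ideal I R; !!K. [|right_ideal K R; K ~= {\<zero>}|] ==> \<exists>x\<in>K \<inter> I. x ~= \<zero>|] ==> ess_ideal I"
 unfolding ess_ideal_def essential_in_def
proof (intro conjI ballI impI)
 fix A assume *: "right_ideal I R" "!!K. [|right_ideal K R; K ~= {\<zero>}|] ==> \<exists>x\<in>K \<inter> I. x ~= \<zero>"
  "A \<in> rideals R" "A <= carrier R \<and> A ~= {\<zero>}"
 from *(2)[of A] *(3,4) obtain x where "x \<in> A \<inter> I" "x ~= \<zero>" by auto
 then show "A \<inter> I ~= {\<zero>}" by blast
qed (simp_all add: right_ideal_carrier right_ideal_subset)

lemma ess_ideal_right_ideal: "ess_ideal I ==> right_ideal I R"
 by (simp add: ess_ideal_def essential_in_def)

text \<open>A nonzero right ideal K missing \<open>I\<close> embeds its lattice above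
  \<open>I\<close> by X -> X + \<open>I\<close>, so it satisfies the descending chain condition and
  contains a minimal right ideal, which only an Artinian ring allows here.\<close>

lemma finite_colength_essential:
 assumes na: "\<not> artinian_ring R" and I: "right_ideal I R" and n: "chain R (reg_module R) n I (carrier R)"
 shows "ess_ideal I"
proof (rule ess_idealI[OF I], rule ccontr)
 fix K assume K: "right_ideal K R" "K ~= {\<zero>}" and "\<not> (\<exists>x\<in>K \<inter> I. x ~= \<zero>)"
 then have "x = \<zero>" if "x \<in> K \<inter> I" for x using that by blast
 moreover have "\<zero> \<in> K \<inter> I" using reg.submoduleD(2)[OF K(1)] reg.submoduleD(2)[OF I] by simp
 ultimately have KI: "K \<inter> I = {\<zero>}" by blast
 have dcc: "dcc_between (rideals R) I (carrier R)"
  by (rule RL.dcc_covers_chain[OF n]) (use I in simp)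
 let ?h = "\<lambda>X. X <+>\<^bsub>reg_module R\<^esub> I"
 have "dcc_between (rideals R) {\<zero>} K"
 proof (rule dcc_between_strict_embed[OF dcc, where h = ?h])
  fix X assume X: "X \<in> rideals R"
  then show "?h X \<in> rideals R \<and> I <= ?h X \<and> ?h X <= carrier R"
   using I RL.sup_upper2[of X I] right_ideal_subset reg.submodule_set_add by simp
 next
  fix X Y assume XY: "X \<in> rideals R" "Y \<in> rideals R" "X <= Y"
  then show "?h X <= ?h Y" using I RL.sup_mono[of X I Y I] by simp
 next
  fix X Y assume XY: "X \<in> rideals R" "Y \<in> rideals R" "X <= Y" "Y <= K" "?h X = ?h Y"
  have "?h Z \<inter> K = Z" if "Z \<in> rideals R" "Z <= K" for Z
   using RL.modular[of Z I K] that I K KI RL.sup_absorb1[of Z "{\<zero>}"] RL.bot_least[of Z] right_ideal_zero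
   by (simp add: Int_commute)
  then show "X = Y" using XY by (metis subset_trans)
 qed
 from dcc_between_minimal[of _ _ _ K "\<lambda>X. X ~= {\<zero>}", OF this _ _ order_refl K(2)]
 obtain X where X: "right_ideal X R" "X ~= {\<zero>}" and min: "!!Z. [|right_ideal Z R; Z ~= {\<zero>}; Z <= X|] ==> Z = X"
  using K(1) reg.submoduleD(2) by auto
 have "covers (rideals R) {\<zero>} X"
  unfolding covers_def using X min right_ideal_zero reg.submoduleD(2)[OF X(1)] by auto
 then show False using minimal_artinian na by blast
qed

definition "rann a = {x \<in> carrier R. a \<otimes> x = \<zero>}"

lemma right_ideal_rann: "a \<in> carrier R ==> right_ideal (rann a) R"
 unfolding right_ideal_iff rann_def by (auto simp: r_distr m_assoc[symmetric])

lemma ess_ideal_mono: "[|ess_ideal I; I <= J; right_ideal J R|] ==> ess_ideal J"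
 unfolding ess_ideal_def using RL.essential_mono[of I "carrier R" J] right_ideal_subset by simp

text \<open>Choose \<open>z\<close> in the right singular ideal with maximal annihilator.\<close>

lemma nonsingular:
 assumes y: "y \<in> carrier R" and ess: "ess_ideal (rann y)"
 shows "y = \<zero>"
proof (rule ccontr)
 assume y0: "y ~= \<zero>"
 define P where "P N = (\<exists>z\<in>carrier R. z ~= \<zero> \<and> ess_ideal (rann z) \<and> N = rann z)" for N
 have "P (rann y)" unfolding P_def using y y0 ess by blast
 from acc_between_maximal[of "rideals R" "{\<zero>}" "carrier R" "rann y" P, OF hnp_acc[OF hnp] _ _ _ this]
 obtain N where N: "P N" and max: "!!Z. [|right_ideal Z R; Z <= carrier R; P Z; N <= Z|] ==> Z = N"
  using right_ideal_rann[OF y] reg.submoduleD(1,2) by auto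
 from N obtain z where z: "z \<in> carrier R" "z ~= \<zero>" "ess_ideal (rann z)" "N = rann z" unfolding P_def by blast
 \<comment> \<open>If y s z were nonzero, its right annihilator would equal that of z by maximality.
   But the annihilator of y s is essential and meets z R in some nonzero z t; then t is annihilated
   by y s z and not by z.\<close>
 have ysz: "y \<otimes> s \<otimes> z = \<zero>" if s: "s \<in> carrier R" for s
 proof (rule ccontr)
  assume nz: "y \<otimes> s \<otimes> z ~= \<zero>"
  have c: "y \<otimes> s \<in> carrier R" "y \<otimes> s \<otimes> z \<in> carrier R" using y s z by auto
  have ys: "ess_ideal (rann (y \<otimes> s))"
  proof (rule ess_idealI[OF right_ideal_rann[OF c(1)]])
   fix K assume K: "right_ideal K R" "K ~= {\<zero>}"
   note KR = right_ideal_subset[OF K(1)]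
   obtain k0 where k0: "k0 \<in> K" "k0 ~= \<zero>" using K reg.submoduleD(2)[OF K(1)] by auto
   show "\<exists>x\<in>K \<inter> rann (y \<otimes> s). x ~= \<zero>"
   proof (cases "(\<lambda>x. s \<otimes> x) ` K = {\<zero>}")
    case True
    then have "s \<otimes> k0 = \<zero>" using k0 by blast
    then have "y \<otimes> s \<otimes> k0 = \<zero>" using y s k0 KR by (auto simp: m_assoc)
    then show ?thesis using k0 KR by (auto simp: rann_def)
   next
    case False
    obtain x where x: "x \<in> (\<lambda>x. s \<otimes> x) ` K \<inter> rann y" "x ~= \<zero>"
     using ess_idealD[OF ess lmult_image[OF s K(1)] False] by blast
    then obtain k where k: "k \<in> K" "x = s \<otimes> k" "y \<otimes> (s \<otimes> k) = \<zero>" by (auto simp: rann_def)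
    then have "k ~= \<zero>" "y \<otimes> s \<otimes> k = \<zero>" using x(2) s y KR by (auto simp: m_assoc subset_eq)
    then show ?thesis using k KR by (auto simp: rann_def)
   qed
  qed
  have sub: "rann z <= rann (y \<otimes> s \<otimes> z)" using c z(1) by (auto simp: rann_def m_assoc)
  have "P (rann (y \<otimes> s \<otimes> z))"
   unfolding P_def using nz c(2) ess_ideal_mono[OF z(3) sub right_ideal_rann[OF c(2)]] by blast
  then have eq: "rann (y \<otimes> s \<otimes> z) = rann z"
   using max[OF right_ideal_rann[OF c(2)]] sub z(4) right_ideal_subset[OF right_ideal_rann[OF c(2)]] by blast
  have "z \<in> (\<lambda>x. z \<otimes> x) ` carrier R" using z(1) by (intro image_eqI[of _ _ \<one>]) auto
  then have "(\<lambda>x. z \<otimes> x) ` carrier R ~= {\<zero>}" using z(2) by auto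
  then obtain x where x: "x \<in> (\<lambda>x. z \<otimes> x) ` carrier R \<inter> rann (y \<otimes> s)" "x ~= \<zero>"
   using ess_idealD[OF ys principal_right_ideal[OF z(1)]] by blast
  then obtain t where t: "t \<in> carrier R" "x = z \<otimes> t" "y \<otimes> s \<otimes> (z \<otimes> t) = \<zero>" by (auto simp: rann_def)
  then have "t \<in> rann (y \<otimes> s \<otimes> z)" using c z(1) by (simp add: rann_def m_assoc)
  then have "t \<in> rann z" using eq by simp
  then have "z \<otimes> t = \<zero>" by (simp add: rann_def)
  then show False using x t by simp
 qed
 show False using prime_elem[OF y z(1) ysz] y0 z(2) by blast
qed

lemma pow_shift:
 assumes "u \<in> carrier R" "a \<in> carrier R"
 shows "(u \<otimes> a) [^] Suc n = u \<otimes> ((a \<otimes> u) [^] n) \<otimes> a"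
proof (induction n)
 case (Suc n)
 have "(u \<otimes> a) [^] Suc (Suc n) = u \<otimes> ((a \<otimes> u) [^] n) \<otimes> a \<otimes> (u \<otimes> a)" using Suc by simp
 also have "\<dots> = u \<otimes> ((a \<otimes> u) [^] n \<otimes> (a \<otimes> u)) \<otimes> a" using assms by (simp add: m_assoc)
 finally show ?case by simp
qed (use assms in simp)

text \<open>Suppose \<open>I\<close> is nil and a is a nonzero element of it. Among the nonzero left
  multiples of a choose b with maximal right annihilator; then b t b = 0 for every t, against
  primeness.\<close>

lemma non_nilpotent_element:
 assumes I: "right_ideal I R" "I ~= {\<zero>}"
 shows "\<exists>a\<in>I. \<forall>n :: nat. a [^] n ~= \<zero>"
proof (rule ccontr)
 assume "\<not> (\<exists>a\<in>I. \<forall>n :: nat. a [^] n ~= \<zero>)"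
 then have nil: "\<exists>n :: nat. a [^] n = \<zero>" if "a \<in> I" for a using that by blast
 note IR = right_ideal_subset[OF I(1)]
 obtain a where a: "a \<in> I" "a ~= \<zero>" using I reg.submoduleD(2)[OF I(1)] by auto
 have aR: "a \<in> carrier R" using a IR by auto
 define P where "P N = (\<exists>r\<in>carrier R. r \<otimes> a ~= \<zero> \<and> N = rann (r \<otimes> a))" for N
 have "P (rann a)" unfolding P_def using a aR by (intro bexI[of _ \<one>]) auto
 from acc_between_maximal[of "rideals R" "{\<zero>}" "carrier R" "rann a" P, OF hnp_acc[OF hnp] _ _ _ this]
 obtain N where N: "P N" and max: "!!Z. [|right_ideal Z R; Z <= carrier R; P Z; N <= Z|] ==> Z = N"
  using right_ideal_rann[OF aR] reg.submoduleD(1,2) by auto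
 from N obtain r where r: "r \<in> carrier R" "r \<otimes> a ~= \<zero>" "N = rann (r \<otimes> a)" unfolding P_def by blast
 let ?b = "r \<otimes> a"
 have bR: "?b \<in> carrier R" using r aR by simp
 have "?b \<otimes> t \<otimes> ?b = \<zero>" if t: "t \<in> carrier R" for t
 proof (cases "t \<otimes> ?b = \<zero>")
  case True
  then show ?thesis using bR t by (simp add: m_assoc)
 next
  case False
  let ?c = "t \<otimes> ?b" and ?u = "t \<otimes> r"
  have cR: "?c \<in> carrier R" and uR: "?u \<in> carrier R" using t r bR by auto
  have cu: "?c = ?u \<otimes> a" using t r aR by (simp add: m_assoc)
  \<comment> \<open>a u lies in the nil right ideal, and c = u a is the same product rotated, so c
    is nilpotent by \<open>pow_shift\<close>.\<close>
  obtain n :: nat where "(a \<otimes> ?u) [^] n = \<zero>" using nil[of "a \<otimes> ?u"] a uR I(1) by (auto simp: right_ideal_iff)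
  then have "?c [^] Suc n = \<zero>" unfolding cu pow_shift[OF uR aR] using uR aR by simp
  then have "\<exists>m :: nat. ?c [^] m = \<zero>" by blast
  then obtain m :: nat where m: "?c [^] m = \<zero>" "!!k. k < m ==> ?c [^] k ~= \<zero>"
   unfolding exists_least_iff[of "\<lambda>m :: nat. ?c [^] m = \<zero>"] by blast
  have "m ~= 0" using m(1) one_neq_zero by (intro notI) simp
  moreover have "m ~= 1" using m(1) False cR by (intro notI) simp
  ultimately obtain k where k: "m = Suc (Suc k)" by (metis One_nat_def not0_implies_Suc)
  \<comment> \<open>The last nonzero power of c, with exponent at least one. It is a left multiple
    of b and hence has the same right annihilator as b by maximality, so d c = 0 gives b c =
    0.\<close>
  let ?d = "?c [^] Suc k"
  have d0: "?d ~= \<zero>" using m(2)[of "Suc k"] k by simp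
  have dR: "?d \<in> carrier R" using cR by simp
  have d: "?d = (?c [^] k \<otimes> t) \<otimes> ?b" using cR t bR by (simp add: m_assoc)
  then have d': "?d = (?c [^] k \<otimes> t \<otimes> r) \<otimes> a" using cR t r aR by (simp add: m_assoc)
  have sub: "rann ?b <= rann ?d" unfolding d using cR t bR by (auto simp: rann_def m_assoc)
  have "P (rann ?d)"
   unfolding P_def using d0 d' cR t r(1) by (intro bexI[of _ "?c [^] k \<otimes> t \<otimes> r"]) auto
  then have eq: "rann ?d = rann ?b"
   using max[OF right_ideal_rann[OF dR]] sub r(3) right_ideal_subset[OF right_ideal_rann[OF dR]] by blast
  have "?d \<otimes> ?c = \<zero>" using m(1) k by simp
  then have "?c \<in> rann ?b" using eq cR by (auto simp: rann_def)
  then show ?thesis using bR t by (simp add: rann_def m_assoc)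
 qed
 then show False using prime_elem[OF bR bR] r(2) by blast
qed

text \<open>The right annihilators of the powers of a non-nilpotent element stabilise, so a
  sufficiently high power has the same annihilator as its square.\<close>

lemma element_with_stable_rann:
 assumes I: "right_ideal I R" "I ~= {\<zero>}"
 obtains b where "b \<in> I" "b ~= \<zero>" "!!x. [|x \<in> carrier R; b \<otimes> (b \<otimes> x) = \<zero>|] ==> b \<otimes> x = \<zero>"
proof -
 obtain a where a: "a \<in> I" "!!n :: nat. a [^] n ~= \<zero>" using non_nilpotent_element[OF I] by blast
 have aR: "a \<in> carrier R" using a right_ideal_subset[OF I(1)] by auto
 have inc: "rann (a [^] n) <= rann (a [^] Suc n)" for n :: nat
  unfolding nat_pow_Suc2[OF aR] using aR by (auto simp: rann_def m_assoc)
 have "\<forall>n :: nat. rann (a [^] n) \<in> rideals R \<and> {\<zero>} <= rann (a [^] n) \<and> rann (a [^] n) <= carrier R \<and> rann (a [^] n) <= rann (a [^] Suc n)"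
  using inc right_ideal_rann[OF nat_pow_closed[OF aR]] aR by (auto simp: rann_def)
 moreover have "right_acc R" by (rule hnp_acc[OF hnp])
 ultimately have "\<exists>n :: nat. \<forall>m\<ge>n. rann (a [^] m) = rann (a [^] n)"
  unfolding acc_between_def by (elim allE[of _ "\<lambda>n :: nat. rann (a [^] n)"]) simp
 then obtain n :: nat where n: "!!m. m \<ge> n ==> rann (a [^] m) = rann (a [^] n)" by blast
 \<comment> \<open>The exponent is \<open>Suc n\<close> rather than \<open>n\<close>, since the
   zeroth power need not lie in \<open>I\<close>.\<close>
 let ?b = "a [^] Suc n"
 have bR: "?b \<in> carrier R" using aR by simp
 have "?b = a \<otimes> a [^] n" using nat_pow_Suc2[OF aR] .
 then have "?b \<in> I" using I(1) a(1) nat_pow_closed[OF aR] by (simp add: right_ideal_iff del: nat_pow_Suc)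
 moreover have "?b ~= \<zero>" by (rule a(2))
 moreover have "?b \<otimes> x = \<zero>" if x: "x \<in> carrier R" "?b \<otimes> (?b \<otimes> x) = \<zero>" for x
 proof -
  have "a [^] (Suc n + Suc n) = ?b \<otimes> ?b" using nat_pow_mult[OF aR, of "Suc n" "Suc n"] by simp
  then have "x \<in> rann (a [^] (Suc n + Suc n))" using x bR by (simp add: rann_def m_assoc del: nat_pow_Suc)
  moreover have "rann (a [^] (Suc n + Suc n)) = rann ?b" using n[of "Suc n + Suc n"] n[of "Suc n"] by simp
  ultimately have "x \<in> rann ?b" by (simp only:)
  then show ?thesis unfolding rann_def by blast
 qed
 ultimately show thesis by (rule that)
qed

text \<open>Left multiplication by c embeds R into c R, so c R already contains a direct sum of as
  many uniform right ideals as R admits. A nonzero right ideal missing c R would provide one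
  more.\<close>

lemma right_regular_essential:
 assumes c: "c \<in> carrier R" "rann c = {\<zero>}"
 shows "ess_ideal ((\<lambda>x. c \<otimes> x) ` carrier R)"
proof (rule ess_idealI[OF principal_right_ideal[OF c(1)]], rule ccontr)
 let ?C = "(\<lambda>x. c \<otimes> x) ` carrier R"
 have C: "right_ideal ?C R" by (rule principal_right_ideal[OF c(1)])
 fix K assume K: "right_ideal K R" "K ~= {\<zero>}" and "\<not> (\<exists>x\<in>K \<inter> ?C. x ~= \<zero>)"
 then have "x = \<zero>" if "x \<in> ?C \<inter> K" for x using that by blast
 moreover have "\<zero> \<in> ?C \<inter> K" using reg.submoduleD(2)[OF K(1)] reg.submoduleD(2)[OF C] by simp
 ultimately have CK: "?C \<inter> K = {\<zero>}" by blast
 have acc: "right_acc R" by (rule hnp_acc[OF hnp])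
 obtain n X where X: "uniform_sum (rideals R) (set_add (reg_module R)) {\<zero>} n X"
  "essential_in (rideals R) {\<zero>} X (carrier R)"
  using RL.uniform_sum_exists[OF acc] right_ideal_carrier by auto
 let ?f = "\<lambda>x\<in>carrier R. c \<otimes> x"
 have "sub_mod (reg_module R) (carrier R) = reg_module R" by (simp add: reg_module_def)
 then have f: "?f \<in> rhom R (reg_module R) (reg_module R)"
  using lmult_rhom[OF c(1) right_ideal_carrier] by (simp only:)
 have fi: "inj_on ?f (carrier (reg_module R))"
  using rhom_inj_iff[OF reg.right_module_axioms reg.right_module_axioms f] c by (auto simp: rann_def)
 have XR: "X <= carrier R" using X(2) by (simp add: essential_in_def)
 have fX: "uniform_sum (rideals R) (set_add (reg_module R)) {\<zero>} n (?f ` X)"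
  using inj_uniform_sum(1)[OF reg.right_module_axioms reg.right_module_axioms f fi, of n X] X by simp
 have fXr: "right_ideal (?f ` X) R" using RL.uniform_sum_mem[OF fX] by simp
 obtain U where U: "uniform_in (rideals R) {\<zero>} U" "U <= K"
  using RL.uniform_exists[OF acc, of K] K right_ideal_subset by auto
 have Ur: "right_ideal U R" using U(1) by (simp add: uniform_in_def)
 have "?f ` X <= ?C" using XR by auto
 then have "?f ` X \<inter> U <= {\<zero>}" using CK U(2) by blast
 moreover have "\<zero> \<in> ?f ` X \<inter> U" using reg.submoduleD(2)[OF fXr] reg.submoduleD(2)[OF Ur] by simp
 ultimately have "?f ` X \<inter> U = {\<zero>}" by blast
 then have "uniform_sum (rideals R) (set_add (reg_module R)) {\<zero>} (Suc n) (?f ` X <+>\<^bsub>reg_module R\<^esub> U)"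
  by (intro uniform_sum.uniform_sum_Suc fX U(1))
 moreover have "right_ideal (?f ` X <+>\<^bsub>reg_module R\<^esub> U) R" by (rule reg.submodule_set_add[OF fXr Ur])
 moreover have "X <+>\<^bsub>reg_module R\<^esub> {\<zero>} = X"
  using RL.sup_absorb1[of X "{\<zero>}"] RL.uniform_sum_mem[OF X(1)] RL.bot_least[of X] right_ideal_zero by simp
 ultimately have "Suc n \<le> n"
  using RL.uniform_sum_le[of "Suc n" "?f ` X <+>\<^bsub>reg_module R\<^esub> U" n X "{\<zero>}" "carrier R"] X right_ideal_zero
   right_ideal_subset[of "?f ` X <+>\<^bsub>reg_module R\<^esub> U"] reg.submoduleD(2)[of X] reg.submoduleD(2)[of "?f ` X <+>\<^bsub>reg_module R\<^esub> U"]
   RL.uniform_sum_mem[OF X(1)]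
  by simp
 then show False by simp
qed

text \<open>Choose c in \<open>I\<close> and a right ideal Y containing c R and missing the right
  annihilator of c, with Y maximal. If that annihilator were nonzero it would meet \<open>I\<close>,
  and adding to c an element b of the intersection with stable annihilator would replace Y by the
  larger Y + b R. So c x = 0 forces x = 0. If x c = 0, the annihilator of x contains the essential c
  R, and \<open>nonsingular\<close> gives x = 0.\<close>

theorem essential_regular:
 assumes I: "ess_ideal I"
 shows "\<exists>c\<in>I. non_zero_divisor R c"
proof -
 have Ir: "right_ideal I R" by (rule ess_ideal_right_ideal[OF I])
 note IR = right_ideal_subset[OF Ir]
 define P where "P Y = (\<exists>c\<in>I. (\<forall>x\<in>carrier R. c \<otimes> x \<in> Y) \<and> Y \<inter> rann c = {\<zero>})" for Y
 have "P {\<zero>}"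
  unfolding P_def using reg.submoduleD(2)[OF Ir] by (intro bexI[of _ \<zero>]) (auto simp: rann_def)
 from acc_between_maximal[of "rideals R" "{\<zero>}" "carrier R" "{\<zero>}" P, OF hnp_acc[OF hnp] _ order_refl _ this]
 obtain Y where Y: "right_ideal Y R" "P Y" and max: "!!Z. [|right_ideal Z R; Z <= carrier R; P Z; Y <= Z|] ==> Z = Y"
  using right_ideal_zero by auto
 from Y(2) obtain c where c: "c \<in> I" "!!x. x \<in> carrier R ==> c \<otimes> x \<in> Y" "Y \<inter> rann c = {\<zero>}" unfolding P_def by blast
 have cR: "c \<in> carrier R" using c IR by auto
 note YR = right_ideal_subset[OF Y(1)]
 have rc: "rann c = {\<zero>}"
 proof (rule ccontr)
  assume ne: "rann c ~= {\<zero>}"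
  have "\<exists>x\<in>rann c \<inter> I. x ~= \<zero>" by (rule ess_idealD[OF I right_ideal_rann[OF cR] ne])
  then have "rann c \<inter> I ~= {\<zero>}" by blast
  then obtain b where b: "b \<in> rann c \<inter> I" "b ~= \<zero>" "!!x. [|x \<in> carrier R; b \<otimes> (b \<otimes> x) = \<zero>|] ==> b \<otimes> x = \<zero>"
   using element_with_stable_rann[OF reg.submodule_Int[OF right_ideal_rann[OF cR] Ir]] by metis
  have bR: "b \<in> carrier R" and cb: "c \<otimes> b = \<zero>" and bI: "b \<in> I" using b(1) by (auto simp: rann_def)
  let ?B = "(\<lambda>x. b \<otimes> x) ` carrier R" and ?c = "c \<oplus> b"
  have B: "right_ideal ?B R" by (rule principal_right_ideal[OF bR])
  let ?Z = "Y <+>\<^bsub>reg_module R\<^esub> ?B"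
  have Z: "right_ideal ?Z R" by (rule reg.submodule_set_add[OF Y(1) B])
  have cI: "?c \<in> I" using c(1) bI Ir by (simp add: right_ideal_iff)
  have cZ: "?c \<otimes> x \<in> ?Z" if "x \<in> carrier R" for x
   unfolding reg.set_add_iff using that c(2)[OF that] cR bR by (auto simp: l_distr)
  \<comment> \<open>Apply c to c w + b w = 0: as c b = 0, the element c w lies both in
    \<open>Y\<close> and in the annihilator of c, so c w = 0 and b w = 0. Then the \<open>Y\<close>
    component of w is annihilated by c and vanishes, and b b x = 0 yields b x = 0.\<close>
  have cz0: "w = \<zero>" if w: "w \<in> ?Z" "w \<in> rann ?c" for w
  proof -
   obtain y x where yx: "y \<in> Y" "x \<in> carrier R" "w = y \<oplus> b \<otimes> x" using w(1) unfolding reg.set_add_iff by auto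
   have yR: "y \<in> carrier R" and wR: "w \<in> carrier R" using yx YR bR by auto
   have "c \<otimes> w \<oplus> b \<otimes> w = \<zero>" using w(2) cR bR wR by (simp add: rann_def l_distr)
   have cbx: "c \<otimes> (b \<otimes> x) = \<zero>" using cb cR bR yx(2) by (simp add: m_assoc[symmetric])
   have cbw: "c \<otimes> (b \<otimes> w) = \<zero>" using cb cR bR wR by (simp add: m_assoc[symmetric])
   have "c \<otimes> w \<in> rann c"
   proof -
    have "c \<otimes> (c \<otimes> w \<oplus> b \<otimes> w) = \<zero>" using \<open>c \<otimes> w \<oplus> b \<otimes> w = \<zero>\<close> cR by simp
    then have "c \<otimes> (c \<otimes> w) = \<zero>" using cR bR wR cbw by (simp add: r_distr)
    then show ?thesis using cR wR by (simp add: rann_def)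
   qed
   then have cw: "c \<otimes> w = \<zero>" using c(2)[OF wR] c(3) by blast
   then have bw: "b \<otimes> w = \<zero>" using \<open>c \<otimes> w \<oplus> b \<otimes> w = \<zero>\<close> bR wR by simp
   have "c \<otimes> y = \<zero>" using cw cbx yx yR cR bR by (simp add: r_distr)
   then have "y \<in> rann c" using yR by (simp add: rann_def)
   then have "y = \<zero>" using yx(1) c(3) by blast
   then have "w = b \<otimes> x" using yx bR by simp
   then show ?thesis using bw b(3)[OF yx(2)] by simp
  qed
  have "?Z \<inter> rann ?c = {\<zero>}"
   using cz0 reg.submoduleD(2)[OF Z] cR bR by (auto simp: rann_def)
  then have "P ?Z" unfolding P_def using cI cZ by blast
  moreover have "Y <= ?Z" using RL.sup_upper1[of Y ?B] Y(1) B by simp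
  ultimately have "?Z = Y" using max[OF Z] right_ideal_subset[OF Z] by blast
  moreover have "b \<in> ?Z"
  proof -
   have "b \<in> ?B" using bR by (intro image_eqI[of _ _ \<one>]) auto
   then show ?thesis using RL.sup_upper2[of Y ?B] Y(1) B by auto
  qed
  ultimately have "b \<in> Y \<inter> rann c" using b(1) by blast
  then show False using c(3) b(2) by blast
 qed
 have "non_zero_divisor R c"
  unfolding non_zero_divisor_def
 proof (intro conjI ballI impI cR)
  fix x assume x: "x \<in> carrier R" "c \<otimes> x = \<zero> \<or> x \<otimes> c = \<zero>"
  show "x = \<zero>"
   using x(2)
  proof
   assume "c \<otimes> x = \<zero>"
   then show ?thesis using x(1) rc by (auto simp: rann_def)
  next
   assume xc: "x \<otimes> c = \<zero>"
   have "(\<lambda>y. c \<otimes> y) ` carrier R <= rann x"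
    using x(1) cR xc by (auto simp: rann_def m_assoc[symmetric])
   then show ?thesis
    using nonsingular[OF x(1)] ess_ideal_mono[OF right_regular_essential[OF cR rc] _ right_ideal_rann[OF x(1)]] by blast
  qed
 qed
 then show ?thesis using c(1) by blast
qed

end

section \<open>Realising towers as quotients of R, and \<open>G_max\<close> in terms of
  towers\<close>

section \<open>Towers and right ideals\<close>

lemma rhom_factor_surj:
 assumes M: "right_module R M" and N: "right_module R N" and V: "right_module R V"
  and p: "p \<in> rhom R M N" "p ` carrier M = carrier N" and h: "h \<in> rhom R M V"
  and k: "hker M N p <= hker M V h"
 shows "\<exists>g\<in>rhom R N V. \<forall>x\<in>carrier M. g (p x) = h x"
proof -
 interpret M: right_module R M by (rule M)
 interpret N: right_module R N by (rule N)
 interpret V: right_module R V by (rule V)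
 have eq: "h x = h y" if xy: "x \<in> carrier M" "y \<in> carrier M" "p x = p y" for x y
 proof -
  have "p (x \<ominus>\<^bsub>M\<^esub> y) = \<zero>\<^bsub>N\<^esub>" using rhom_minus[OF M N p(1) xy(1,2)] xy rhom_closed[OF p(1)] by (simp add: N.M.minus_eq N.M.r_neg)
  then have "x \<ominus>\<^bsub>M\<^esub> y \<in> hker M V h" using k xy by (intro subsetD[OF k]) simp
  then have "h x \<ominus>\<^bsub>V\<^esub> h y = \<zero>\<^bsub>V\<^esub>" using rhom_minus[OF M V h xy(1,2)] by simp
  then have "h x \<ominus>\<^bsub>V\<^esub> h y \<oplus>\<^bsub>V\<^esub> h y = h y" using rhom_closed[OF h] xy by simp
  then show ?thesis using rhom_closed[OF h] xy by (simp add: V.M.minus_eq V.M.a_assoc V.M.l_neg)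
 qed
 let ?g = "\<lambda>y\<in>carrier N. h (inv_into (carrier M) p y)"
 have g: "?g (p x) = h x" if "x \<in> carrier M" for x
 proof -
  have "p x \<in> p ` carrier M" using that by blast
  then have "inv_into (carrier M) p (p x) \<in> carrier M" "p (inv_into (carrier M) p (p x)) = p x"
   by (rule inv_into_into, rule f_inv_into_f)
  then have "h (inv_into (carrier M) p (p x)) = h x" using eq that by blast
  then show "?g (p x) = h x" using rhom_closed[OF p(1) that] by simp
 qed
 have ex: "\<exists>x\<in>carrier M. y = p x" if "y \<in> carrier N" for y using that p(2) by (metis imageE)
 have "?g \<in> rhom R N V"
 proof (rule rhomI)
  fix y z assume yz: "y \<in> carrier N" "z \<in> carrier N"
  obtain x x' where x: "x \<in> carrier M" "y = p x" "x' \<in> carrier M" "z = p x'" using ex yz by metis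
  have "?g (y \<oplus>\<^bsub>N\<^esub> z) = ?g (p (x \<oplus>\<^bsub>M\<^esub> x'))" using x rhom_add[OF p(1)] by (simp only:)
  also have "\<dots> = h x \<oplus>\<^bsub>V\<^esub> h x'" using g[of "x \<oplus>\<^bsub>M\<^esub> x'"] x rhom_add[OF h] by (simp only: M.M.a_closed)
  finally show "?g (y \<oplus>\<^bsub>N\<^esub> z) = ?g y \<oplus>\<^bsub>V\<^esub> ?g z" using g x by (simp only:)
 next
  fix a y assume ay: "a \<in> carrier R" "y \<in> carrier N"
  obtain x where x: "x \<in> carrier M" "y = p x" using ex ay by metis
  have "?g (a \<odot>\<^bsub>N\<^esub> y) = ?g (p (a \<odot>\<^bsub>M\<^esub> x))" using x rhom_smult[OF p(1) ay(1)] by (simp only:)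
  also have "\<dots> = a \<odot>\<^bsub>V\<^esub> h x" using g[of "a \<odot>\<^bsub>M\<^esub> x"] x ay rhom_smult[OF h] by (simp only: M.smult_closed)
  finally show "?g (a \<odot>\<^bsub>N\<^esub> y) = a \<odot>\<^bsub>V\<^esub> ?g y" using g x by (simp only:)
 next
  fix y assume "y \<in> carrier N"
  then obtain x where x: "x \<in> carrier M" "y = p x" using ex by metis
  show "?g y \<in> carrier V" unfolding x(2) g[OF x(1)] by (rule rhom_closed[OF h x(1)])
 qed simp
 then show ?thesis using g by blast
qed

lemma schur:
 assumes V: "simple_module R V" and W: "simple_module R W" and g: "g \<in> rhom R V W"
  and x: "x \<in> carrier V" "g x ~= \<zero>\<^bsub>W\<^esub>"
 shows "g \<in> riso R V W"
proof -
 have Vm: "right_module R V" and Wm: "right_module R W" using V W by (auto simp: simple_module_def)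
 have "hker V W g = nul V \<or> hker V W g = carrier V"
  using V submodule_ker[OF Vm Wm g] by (simp add: simple_module_def)
 then have "hker V W g = nul V" using x by blast
 then have inj: "inj_on g (carrier V)" using rhom_inj_iff[OF Vm Wm g] by simp
 have "submodule (g ` carrier V) R W"
  by (rule submodule_image[OF Vm Wm g right_module.submodule_carrier[OF Vm]])
 then have "g ` carrier V = nul W \<or> g ` carrier V = carrier W" using W by (simp add: simple_module_def)
 then have "g ` carrier V = carrier W" using x by blast
 then show ?thesis using g inj by (simp add: riso_def bij_betw_def)
qed

lemma finite_length_riso:
 assumes M: "finite_length R M" and N: "right_module R N" and i: "riso R M N ~= {}"
 shows "finite_length R N"
proof -
 have Mm: "right_module R M" using M by (simp add: finite_length_def)
 interpret M: right_module R M by (rule Mm)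
 obtain \<theta> where t: "\<theta> \<in> riso R M N" using i by blast
 obtain n where n: "chain R M n (nul M) (carrier M)" using M finite_length_iff by blast
 have im: "\<theta> ` nul M = nul N" "\<theta> ` carrier M = carrier N"
  using rhom_zero[OF Mm N riso_rhom[OF t]] t by (simp_all add: riso_def bij_betw_def)
 have "chain R N n (\<theta> ` nul M) (\<theta> ` carrier M)"
  using lat_iso_covers_chain[OF riso_lat_iso[OF Mm N t], of "nul M" "carrier M" n] n by simp
 then show ?thesis using N unfolding im finite_length_iff by blast
qed

lemma short_exact_finite_length:
 assumes L: "finite_length R L" and M: "right_module R M" and N: "finite_length R N" and ex: "short_exact R L M N f g"
 shows "finite_length R M"
proof -
 have Lm: "right_module R L" and Nm: "right_module R N" using L N by (auto simp: finite_length_def)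
 interpret L: right_module R L by (rule Lm)
 interpret M: right_module R M by (rule M)
 interpret N: right_module R N by (rule Nm)
 have f: "f \<in> rhom R L M" "inj_on f (carrier L)" and g: "g \<in> rhom R M N" "g ` carrier M = carrier N"
  and im: "f ` carrier L = hker M N g" using ex by (auto simp: short_exact_def)
 have sub: "submodule (f ` carrier L) R M" by (rule submodule_image[OF Lm M f(1) L.submodule_carrier])
 obtain n where n: "chain R L n (nul L) (carrier L)" using L finite_length_iff by blast
 obtain m where m: "chain R N m (nul N) (carrier N)" using N finite_length_iff by blast
 have "chain R (sub_mod M (f ` carrier L)) n (f ` nul L) (f ` carrier L)"
  using lat_iso_covers_chain[OF inj_lat_iso[OF Lm M f], of "nul L" "carrier L" n] n by simp
 moreover have "f ` nul L = nul M" using rhom_zero[OF Lm M f(1)] by simp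
 moreover have "nul M <= f ` carrier L" using M.submoduleD(2)[OF sub] by simp
 ultimately have 1: "chain R M n (nul M) (f ` carrier L)"
  using sub_covers_chain[OF M sub M.submodule_zero] by simp
 have "chain R M m (hker M N g) (carrier M)"
  using M.surj_covers_chain_iff[OF Nm g N.submodule_zero, of "hker M N g" m] m by simp
 then have "chain R M (n + m) (nul M) (carrier M)"
  unfolding relpowp_add using 1 im by auto
 then show ?thesis using M unfolding finite_length_iff by blast
qed

lemma prod_mod_simps [simp]:
 "carrier (prod_mod M N) = carrier M \<times> carrier N" "\<zero>\<^bsub>prod_mod M N\<^esub> = (\<zero>\<^bsub>M\<^esub>, \<zero>\<^bsub>N\<^esub>)"
 "x \<oplus>\<^bsub>prod_mod M N\<^esub> y = (fst x \<oplus>\<^bsub>M\<^esub> fst y, snd x \<oplus>\<^bsub>N\<^esub> snd y)"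
 "a \<odot>\<^bsub>prod_mod M N\<^esub> x = (a \<odot>\<^bsub>M\<^esub> fst x, a \<odot>\<^bsub>N\<^esub> snd x)"
 by (simp_all add: prod_mod_def)

lemma prod_exact:
 assumes M: "right_module R M" and N: "right_module R N"
 shows "short_exact R M (prod_mod M N) N (\<lambda>x\<in>carrier M. (x, \<zero>\<^bsub>N\<^esub>)) (\<lambda>x\<in>carrier (prod_mod M N). snd x)"
proof -
 interpret M: right_module R M by (rule M)
 interpret N: right_module R N by (rule N)
 interpret P: right_module R "prod_mod M N" by (rule right_module_prod[OF M N])
 have "(\<lambda>x\<in>carrier M. (x, \<zero>\<^bsub>N\<^esub>)) \<in> rhom R M (prod_mod M N)" by (rule rhom_restrictI[OF M]) auto
 moreover have "(\<lambda>x\<in>carrier (prod_mod M N). snd x) \<in> rhom R (prod_mod M N) N"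
  by (rule rhom_restrictI[OF P.right_module_axioms]) auto
 ultimately show ?thesis
  unfolding short_exact_def by (auto simp: inj_on_def image_iff)
qed

context hnp_universe
begin

abbreviation FL :: "('r, 'u) groth_elem monoid" where "FL \<equiv> groth R (fl_modules R)"
abbreviation fcl :: "('r, 'm) module => ('r, 'u) groth_elem" where "fcl M \<equiv> fl_class R M"

lemma simple_finite_length: "simple_module R M ==> finite_length R M"
proof -
 assume s: "simple_module R M"
 then interpret M: right_module R M by (simp add: simple_module_def)
 have "chain R M 1 (nul M) (carrier M)" using s unfolding M.simple_iff by auto
 then show ?thesis using M.right_module_axioms unfolding finite_length_iff by blast
qed

lemma fcl_zero:
 fixes Z :: "('r, 'u) module"
 assumes Z: "right_module R Z" "carrier Z = nul Z"
 shows "finite_length R Z" "fcl Z = \<one>\<^bsub>FL\<^esub>"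
proof -
 interpret F: comm_group FL by (rule groth_comm_group)
 interpret Z: right_module R Z by (rule Z(1))
 have "chain R Z 0 (nul Z) (carrier Z)" using Z(2) by simp
 then show fl: "finite_length R Z" using Z(1) unfolding finite_length_iff by blast
 have id: "(\<lambda>x\<in>carrier Z. x) \<in> rhom R Z Z" by (rule rhom_id[OF Z(1)])
 have "short_exact R Z Z Z (\<lambda>x\<in>carrier Z. x) (\<lambda>x\<in>carrier Z. x)"
  unfolding short_exact_def using id Z(2) by auto
 then have "fcl Z = fcl Z \<otimes>\<^bsub>FL\<^esub> fcl Z"
  unfolding fl_class_def using fl by (intro groth_class_exact) (simp_all add: fl_modules_def)
 moreover have "fcl Z \<in> carrier FL"
  unfolding fl_class_def using fl by (intro groth_class_closed) (simp add: fl_modules_def)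
 ultimately show "fcl Z = \<one>\<^bsub>FL\<^esub>" using F.r_cancel_one by metis
qed

text \<open>Induction on the set of classes. The last conjunct, restricting the simple images of
  \<open>N\<close> to \<open>T\<close>, strengthens the claim so that a new simple module V is not
  an image of \<open>N\<close>. Then the kernel of R -> \<open>N\<close> maps onto V, and R maps
  onto the product of V and \<open>N\<close>.\<close>

lemma distinct_simples_quotient:
 assumes "finite T" "T <= iso_class R ` {W :: ('r, 'u) module. simple_module R W}"
 shows "\<exists>(N :: ('r, 'u) module) p. finite_length R N \<and> p \<in> rhom R (reg_module R) N \<and> p ` carrier R = carrier N \<and>
  fcl N = finprod FL (groth_class R (fl_modules R)) T \<and>
  (\<forall>W :: ('r, 'u) module. \<forall>g\<in>rhom R N W. simple_module R W \<and> (\<exists>x\<in>carrier N. g x ~= \<zero>\<^bsub>W\<^esub>) --> iso_class R W \<in> T)"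
 using assms
proof (induction T rule: finite_induct)
 case empty
 interpret F: comm_group FL by (rule groth_comm_group)
 obtain M :: "('r, 'u) module" where M: "right_module R M"
  using small_copy[OF small_reg[OF univ'] reg.right_module_axioms] by blast
 interpret M: right_module R M by (rule M)
 let ?Z = "sub_mod M (nul M)"
 have Z: "right_module R ?Z" by (rule M.right_module_sub[OF M.submodule_zero])
 interpret Z: right_module R ?Z by (rule Z)
 have Zc: "carrier ?Z = nul ?Z" by simp
 have p: "(\<lambda>x\<in>carrier (reg_module R). \<zero>\<^bsub>?Z\<^esub>) \<in> rhom R (reg_module R) ?Z"
  by (rule rhom_const_zero[OF reg.right_module_axioms Z])
 have im: "(\<lambda>x\<in>carrier (reg_module R). \<zero>\<^bsub>?Z\<^esub>) ` carrier R = carrier ?Z" by auto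
 have hom: "g x = \<zero>\<^bsub>W\<^esub>" if "g \<in> rhom R ?Z W" "right_module R W" "x \<in> carrier ?Z" for g and W :: "('r, 'u) module" and x
  using rhom_zero[OF Z that(2,1)] that(3) by simp
 show ?case
  by (intro exI[of _ ?Z] exI[of _ "\<lambda>x\<in>carrier (reg_module R). \<zero>\<^bsub>?Z\<^esub>"] conjI fcl_zero(1)[OF Z Zc] p im)
   (use fcl_zero(2)[OF Z Zc] hom F.finprod_empty[of "groth_class R (fl_modules R)"] in "auto simp: simple_module_def")
next
 case (insert c T)
 interpret F: comm_group FL by (rule groth_comm_group)
 obtain N :: "('r, 'u) module" and p where N: "finite_length R N"
  and p: "p \<in> rhom R (reg_module R) N" "p ` carrier R = carrier N"
  and cl: "fcl N = finprod FL (groth_class R (fl_modules R)) T"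
  and IH': "\<forall>W :: ('r, 'u) module. \<forall>g\<in>rhom R N W. simple_module R W \<and> (\<exists>x\<in>carrier N. g x ~= \<zero>\<^bsub>W\<^esub>) --> iso_class R W \<in> T"
  using insert.IH insert.prems by (elim meta_impE) (simp, blast)
 have IH: "iso_class R W \<in> T" if "g \<in> rhom R N W" "simple_module R W" "x \<in> carrier N" "g x ~= \<zero>\<^bsub>W\<^esub>"
  for W :: "('r, 'u) module" and g x using IH' that by blast
 obtain V :: "('r, 'u) module" where V: "simple_module R V" "c = iso_class R V" using insert.prems by auto
 have Vm: "right_module R V" and Nm: "right_module R N" using V(1) N by (auto simp: simple_module_def finite_length_def)
 interpret V: right_module R V by (rule Vm)
 interpret N: right_module R N by (rule Nm)
 have "carrier V ~= nul V" using V(1) by (simp add: simple_module_def)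
 then obtain v where v: "v \<in> carrier V" "v ~= \<zero>\<^bsub>V\<^esub>" using V.M.zero_closed by blast
 let ?h = "\<lambda>r\<in>carrier (reg_module R). r \<odot>\<^bsub>V\<^esub> v"
 have h: "?h \<in> rhom R (reg_module R) V"
  by (rule rhom_restrictI[OF reg.right_module_axioms]) (use v in "simp_all add: V.smult_l_distr V.smult_assoc")
 \<comment> \<open>Otherwise r -> v r would factor through \<open>N\<close> and exhibit
   \<open>V\<close> as a simple image of \<open>N\<close>, although its class is new.\<close>
 have "\<not> hker (reg_module R) N p <= hker (reg_module R) V ?h"
 proof
  assume "hker (reg_module R) N p <= hker (reg_module R) V ?h"
  then obtain g where g: "g \<in> rhom R N V" "!!x. x \<in> carrier R ==> g (p x) = ?h x"
   using rhom_factor_surj[OF reg.right_module_axioms Nm Vm p(1) _ h] p(2) by auto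
  have "g (p \<one>\<^bsub>R\<^esub>) ~= \<zero>\<^bsub>V\<^esub>" using g(2)[of "\<one>\<^bsub>R\<^esub>"] v by simp
  then have "iso_class R V \<in> T" using IH[OF g(1) V(1)] rhom_closed[OF p(1), of "\<one>\<^bsub>R\<^esub>"] by simp
  then show False using insert.hyps V(2) by simp
 qed
 then obtain i where "i \<in> hker (reg_module R) N p" "i \<notin> hker (reg_module R) V ?h" unfolding subset_eq by blast
 then have i: "i \<in> carrier R" "p i = \<zero>\<^bsub>N\<^esub>" "?h i ~= \<zero>\<^bsub>V\<^esub>" by simp_all
 let ?I = "hker (reg_module R) N p"
 have I: "right_ideal ?I R" by (rule submodule_ker[OF reg.right_module_axioms Nm p(1)])
 have "submodule (?h ` ?I) R V" by (rule submodule_image[OF reg.right_module_axioms Vm h I])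
 then have "?h ` ?I = nul V \<or> ?h ` ?I = carrier V" using V(1) by (simp add: simple_module_def)
 moreover have "?h i \<in> ?h ` ?I" using i by (intro imageI) simp
 ultimately have hI: "?h ` ?I = carrier V" using i(3) by blast
 let ?P = "prod_mod V N"
 have Pm: "right_module R ?P" by (rule right_module_prod[OF Vm Nm])
 let ?q = "\<lambda>r\<in>carrier (reg_module R). (?h r, p r)"
 have q: "?q \<in> rhom R (reg_module R) ?P"
  by (rule rhom_restrictI[OF reg.right_module_axioms])
   (use v rhom_closed[OF p(1)] rhom_add[OF p(1)] rhom_smult[OF p(1)] in "simp_all add: V.smult_l_distr V.smult_assoc")
 have qs: "?q ` carrier R = carrier ?P"
 proof (rule subset_antisym)
  show "?q ` carrier R <= carrier ?P" using rhom_closed[OF q] by auto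
  show "carrier ?P <= ?q ` carrier R"
  proof
   fix z assume "z \<in> carrier ?P"
   then obtain w n where z: "z = (w, n)" "w \<in> carrier V" "n \<in> carrier N" by auto
   have "n \<in> p ` carrier R" using z p(2) by simp
   then obtain r where r: "r \<in> carrier R" "n = p r" by blast
   \<comment> \<open>After r has hit the second component, the first one is corrected by an element
     of the kernel of \<open>p\<close>, which maps onto \<open>V\<close>.\<close>
   have "w \<ominus>\<^bsub>V\<^esub> ?h r \<in> ?h ` ?I" unfolding hI using z r v by simp
   then obtain j where j: "j \<in> ?I" "w \<ominus>\<^bsub>V\<^esub> ?h r = ?h j" by blast
   have jR: "j \<in> carrier R" using j by simp
   have "w \<ominus>\<^bsub>V\<^esub> r \<odot>\<^bsub>V\<^esub> v \<oplus>\<^bsub>V\<^esub> r \<odot>\<^bsub>V\<^esub> v = w"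
    using r v z(2) by (simp add: V.M.minus_eq V.M.a_assoc V.M.l_neg)
   then have "(r \<oplus>\<^bsub>R\<^esub> j) \<odot>\<^bsub>V\<^esub> v = w"
    using j(2) r jR v z(2) by (simp add: V.smult_l_distr V.M.a_comm)
   moreover have "p (r \<oplus>\<^bsub>R\<^esub> j) = n"
    using r j rhom_add[OF p(1), of r j] rhom_closed[OF p(1), of r] by simp
   ultimately have "?q (r \<oplus>\<^bsub>R\<^esub> j) = z" using r jR z(1) by simp
   moreover have "r \<oplus>\<^bsub>R\<^esub> j \<in> carrier R" using r(1) jR by simp
   ultimately show "z \<in> ?q ` carrier R" by blast
  qed
 qed
 have "small_mod TYPE('u) ?P" by (rule small_surj[OF small_reg[OF univ'], of ?q ?P]) (use qs in "simp only: reg_module_simps")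
 from small_copy[OF this Pm] obtain M :: "('r, 'u) module" where M: "right_module R M" "riso R ?P M ~= {}" by metis
 obtain \<theta> where t: "\<theta> \<in> riso R ?P M" using M(2) by blast
 note th = riso_rhom[OF t]
 have ts: "\<theta> ` carrier ?P = carrier M" using t by (simp add: riso_def bij_betw_def)
 interpret M: right_module R M by (rule M(1))
 have Mfl: "finite_length R M"
  by (rule finite_length_riso[OF short_exact_finite_length[OF simple_finite_length[OF V(1)] Pm N prod_exact[OF Vm Nm]] M])
 obtain f' g' where "short_exact R V M N f' g'"
  using short_exact_riso[OF Vm Pm Nm Vm M(1) Nm riso_id[OF Vm] t riso_id[OF Nm] prod_exact[OF Vm Nm]] by blast
 then have "fcl M = fcl V \<otimes>\<^bsub>FL\<^esub> fcl N"
  unfolding fl_class_def using Mfl N simple_finite_length[OF V(1)]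
  by (intro groth_class_exact) (simp_all add: fl_modules_def)
 moreover have gc: "groth_class R (fl_modules R) d \<in> carrier FL" if d: "d \<in> insert c T" for d
 proof -
  obtain W :: "('r, 'u) module" where "simple_module R W" "d = iso_class R W" using d insert.prems by blast
  then show ?thesis using simple_finite_length by (auto intro!: groth_class_closed simp: fl_modules_def)
 qed
 ultimately have Mcl: "fcl M = finprod FL (groth_class R (fl_modules R)) (insert c T)"
  using F.finprod_insert[OF insert.hyps, of "groth_class R (fl_modules R)"] cl V(2) by (auto simp: fl_class_def)
 have "iso_class R W \<in> insert c T"
  if W: "simple_module R W" and g: "g \<in> rhom R M W" and x: "x \<in> carrier M" "g x ~= \<zero>\<^bsub>W\<^esub>"
  for W :: "('r, 'u) module" and g x
 proof -
  have Wm: "right_module R W" using W by (simp add: simple_module_def)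
  interpret W: right_module R W by (rule Wm)
  have "x \<in> \<theta> ` carrier ?P" using x ts by simp
  then obtain w n where wn: "w \<in> carrier V" "n \<in> carrier N" "x = \<theta> (w, n)" by auto
  have "\<theta> (w, n) = \<theta> (w, \<zero>\<^bsub>N\<^esub>) \<oplus>\<^bsub>M\<^esub> \<theta> (\<zero>\<^bsub>V\<^esub>, n)"
   using rhom_add[OF th, of "(w, \<zero>\<^bsub>N\<^esub>)" "(\<zero>\<^bsub>V\<^esub>, n)"] wn by simp
  then have gx: "g x = g (\<theta> (w, \<zero>\<^bsub>N\<^esub>)) \<oplus>\<^bsub>W\<^esub> g (\<theta> (\<zero>\<^bsub>V\<^esub>, n))"
   using rhom_add[OF g, of "\<theta> (w, \<zero>\<^bsub>N\<^esub>)" "\<theta> (\<zero>\<^bsub>V\<^esub>, n)"] rhom_closed[OF th] wn by simp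
  \<comment> \<open>g is split into its restrictions to the two factors. Whichever is nonzero
    identifies \<open>W\<close>: Schur's lemma on \<open>V\<close>, the induction hypothesis on
    \<open>N\<close>.\<close>
  let ?a = "\<lambda>w\<in>carrier V. g (\<theta> (w, \<zero>\<^bsub>N\<^esub>))" and ?b = "\<lambda>n\<in>carrier N. g (\<theta> (\<zero>\<^bsub>V\<^esub>, n))"
  have ta: "\<theta> (x \<oplus>\<^bsub>V\<^esub> x', y \<oplus>\<^bsub>N\<^esub> y') = \<theta> (x, y) \<oplus>\<^bsub>M\<^esub> \<theta> (x', y')"
   if "x \<in> carrier V" "x' \<in> carrier V" "y \<in> carrier N" "y' \<in> carrier N" for x x' y y'
   using rhom_add[OF th, of "(x, y)" "(x', y')"] that by simp
  have ts: "\<theta> (a \<odot>\<^bsub>V\<^esub> x, a \<odot>\<^bsub>N\<^esub> y) = a \<odot>\<^bsub>M\<^esub> \<theta> (x, y)"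
   if "a \<in> carrier R" "x \<in> carrier V" "y \<in> carrier N" for a x y
   using rhom_smult[OF th that(1), of "(x, y)"] that by simp
  have tc: "\<theta> (x, y) \<in> carrier M" if "x \<in> carrier V" "y \<in> carrier N" for x y
   using rhom_closed[OF th, of "(x, y)"] that by simp
  have a: "?a \<in> rhom R V W"
  proof (rule rhom_restrictI[OF Vm])
   fix x y assume "x \<in> carrier V" "y \<in> carrier V"
   then show "g (\<theta> (x \<oplus>\<^bsub>V\<^esub> y, \<zero>\<^bsub>N\<^esub>)) = g (\<theta> (x, \<zero>\<^bsub>N\<^esub>)) \<oplus>\<^bsub>W\<^esub> g (\<theta> (y, \<zero>\<^bsub>N\<^esub>))"
    using ta[of x y "\<zero>\<^bsub>N\<^esub>" "\<zero>\<^bsub>N\<^esub>"] rhom_add[OF g tc tc] by simp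
  next
   fix r x assume "r \<in> carrier R" "x \<in> carrier V"
   then show "g (\<theta> (r \<odot>\<^bsub>V\<^esub> x, \<zero>\<^bsub>N\<^esub>)) = r \<odot>\<^bsub>W\<^esub> g (\<theta> (x, \<zero>\<^bsub>N\<^esub>))"
    using ts[of r x "\<zero>\<^bsub>N\<^esub>"] rhom_smult[OF g _ tc] by simp
  qed (use rhom_closed[OF g] tc in simp)
  have b: "?b \<in> rhom R N W"
  proof (rule rhom_restrictI[OF Nm])
   fix x y assume "x \<in> carrier N" "y \<in> carrier N"
   then show "g (\<theta> (\<zero>\<^bsub>V\<^esub>, x \<oplus>\<^bsub>N\<^esub> y)) = g (\<theta> (\<zero>\<^bsub>V\<^esub>, x)) \<oplus>\<^bsub>W\<^esub> g (\<theta> (\<zero>\<^bsub>V\<^esub>, y))"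
    using ta[of "\<zero>\<^bsub>V\<^esub>" "\<zero>\<^bsub>V\<^esub>" x y] rhom_add[OF g tc tc] by simp
  next
   fix r x assume "r \<in> carrier R" "x \<in> carrier N"
   then show "g (\<theta> (\<zero>\<^bsub>V\<^esub>, r \<odot>\<^bsub>N\<^esub> x)) = r \<odot>\<^bsub>W\<^esub> g (\<theta> (\<zero>\<^bsub>V\<^esub>, x))"
    using ts[of r "\<zero>\<^bsub>V\<^esub>" x] rhom_smult[OF g _ tc] by simp
  qed (use rhom_closed[OF g] tc in simp)
  show ?thesis
  proof (cases "?a w = \<zero>\<^bsub>W\<^esub>")
   case True
   have "?b n ~= \<zero>\<^bsub>W\<^esub>" using True gx x(2) wn rhom_closed[OF b wn(2)] by auto
   then show ?thesis using IH[OF b W wn(2)] by simp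
  next
   case False
   have "?a \<in> riso R V W" by (rule schur[OF V(1) W a wn(1) False])
   then have "(iso_class R V :: ('r, 'u) module set) = iso_class R W" using iso_class_eq_iff[OF Vm Wm] by blast
   then show ?thesis using V(2) by simp
  qed
 qed
 moreover have "compose (carrier (reg_module R)) \<theta> ?q \<in> rhom R (reg_module R) M"
  by (rule rhom_compose[OF q th reg.right_module_axioms])
 moreover have "compose (carrier (reg_module R)) \<theta> ?q ` carrier R = carrier M"
 proof -
  have "compose (carrier (reg_module R)) \<theta> ?q ` carrier R = \<theta> ` (?q ` carrier R)"
   by (simp add: compose_def image_image)
  then show ?thesis using qs ts by simp
 qed
 ultimately show ?case using Mfl Mcl by blast
qed

lemma tower_ideal_exists:
 assumes na: "\<not> artinian_ring R" and T: "tower R (T :: ('r, 'u) module set list)"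
 shows "\<exists>I. tower_maximal TYPE('u) R I \<and> fcl (quot_module (reg_module R) I) = tower_class R T"
proof -
 have "finite (set T)" "set T <= iso_class R ` {W :: ('r, 'u) module. simple_module R W}"
  using T by (simp_all add: tower_def successor_chain_def)
 from distinct_simples_quotient[OF this]
 obtain N :: "('r, 'u) module" and p where N: "finite_length R N"
  and p: "p \<in> rhom R (reg_module R) N" "p ` carrier R = carrier N"
  and cl: "fcl N = tower_class R T" unfolding tower_class_def by blast
 have Nm: "right_module R N" using N by (simp add: finite_length_def)
 interpret N: right_module R N by (rule Nm)
 let ?I = "hker (reg_module R) N p"
 have I: "right_ideal ?I R" by (rule submodule_ker[OF reg.right_module_axioms Nm p(1)])
 obtain n where "chain R N n (nul N) (carrier N)" using N finite_length_iff by blast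
 then have n: "chain R (reg_module R) n ?I (carrier R)"
  using reg.surj_covers_chain_iff[OF Nm p(1) _ N.submodule_zero, of ?I n] p(2) by simp
 have "\<exists>c\<in>?I. non_zero_divisor R c"
  by (rule essential_regular[OF finite_colength_essential[OF na I n]])
 then have RI: "right_R_ideal ?I R" using I by (simp add: right_R_ideal_def)
 let ?Q = "quot_module (reg_module R) ?I"
 have Qm: "right_module R ?Q" by (rule reg.right_module_quot[OF I])
 note q = reg.quot_map[OF I]
 \<comment> \<open>\<open>tower_maximal\<close> speaks of the quotient module itself, so
   \<open>N\<close> has to be identified with it.\<close>
 obtain g where g: "g \<in> rhom R N ?Q" "!!x. x \<in> carrier R ==> g (p x) = reg.quot_map ?I x"
  using rhom_factor_surj[OF reg.right_module_axioms Nm Qm p(1) _ q(1)] p(2) q(3) by auto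
 have "inj_on g (carrier N)"
  unfolding rhom_inj_iff[OF Nm Qm g(1)]
 proof (rule subset_antisym)
  show "hker N ?Q g <= nul N"
  proof
   fix y assume y: "y \<in> hker N ?Q g"
   then have "y \<in> p ` carrier R" using p(2) by simp
   then obtain x where x: "x \<in> carrier R" "y = p x" by blast
   then have "x \<in> hker (reg_module R) ?Q (reg.quot_map ?I)" using y g(2) by simp
   then show "y \<in> nul N" unfolding q(3) using x by simp
  qed
  show "nul N <= hker N ?Q g" using rhom_zero[OF Nm Qm g(1)] by simp
 qed
 moreover have "g ` carrier N = carrier ?Q"
 proof -
  have "g ` carrier N = (\<lambda>x. g (p x)) ` carrier R" unfolding p(2)[symmetric] by (simp add: image_image)
  also have "\<dots> = reg.quot_map ?I ` carrier R" using g(2) by (intro image_cong) auto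
  finally show ?thesis using q(2) by simp
 qed
 ultimately have "g \<in> riso R N ?Q" using g(1) by (simp add: riso_def bij_betw_def)
 then have NQ: "riso R N ?Q ~= {}" by blast
 have "fcl ?Q = tower_class R T"
  using cl iso_class_cong[OF Nm Qm NQ, where ?'u = 'u] by (simp add: fl_class_def)
 moreover have "finite_length R ?Q" by (rule finite_length_riso[OF N Qm NQ])
 ultimately show ?thesis unfolding tower_maximal_def using RI T by blast
qed

text \<open>The Euler characteristic as a function of isomorphism classes, the form in which a
  product over a tower can be taken. By \<open>euler_iso\<close> and \<open>euler_unique\<close>
  every member of a class gives the same value.\<close>

definition ecl :: "('r, 'u) module set => ('r, 'u) groth_elem" where
 "ecl c = (THE x. \<exists>M\<in>c. right_module R M \<and> euler M x)"

lemma ecl_iso_class: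
 fixes M :: "('r, 'u) module"
 assumes M: "right_module R M" and e: "euler M x"
 shows "ecl (iso_class R M) = x"
 unfolding ecl_def
proof (rule the_equality)
 show "\<exists>M'\<in>iso_class R M :: ('r, 'u) module set. right_module R M' \<and> euler M' x" using iso_class_self[OF M] M e by blast
 fix y assume "\<exists>M'\<in>iso_class R M :: ('r, 'u) module set. right_module R M' \<and> euler M' y"
 then obtain M' :: "('r, 'u) module" where M': "right_module R M'" "riso R M M' ~= {}" "euler M' y" by (auto simp: iso_class_def)
 have "euler M' x" by (rule euler_iso[OF M M'(1,2) e])
 then show "y = x" using euler_unique[OF M'(1)] M'(3) by blast
qed

text \<open>The right-hand side refers to no right ideal, which is what makes it transportable. The
  inverse appears because R/I has Euler characteristic [R] - [I], while \<open>G_max\<close>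
  collects the differences [I] - [R].\<close>

theorem G_max_eq:
 assumes na: "\<not> artinian_ring R"
 shows "(G_max R :: ('r, 'u) groth_elem set) =
  (\<lambda>T. inv\<^bsub>K\<^esub> finprod K ecl (set T)) ` {T :: ('r, 'u) module set list. tower R T}"
proof -
 interpret K: comm_group K by (rule K_comm_group)
 interpret F: comm_group FL by (rule groth_comm_group)
 obtain \<chi> where chi: "\<chi> \<in> hom FL K"
  and e: "!!M :: ('r, 'u) module. finite_length R M ==> euler M (\<chi> (fcl M))"
  using euler_hom unfolding fl_class_def fl_modules_def by auto
 interpret chi: group_hom FL K \<chi> by unfold_locales (rule chi)
 have tc: "\<chi> (tower_class R T) = finprod K ecl (set T)" if T: "tower R T" for T :: "('r, 'u) module set list"
 proof -
  have TS: "set T <= iso_class R ` {W :: ('r, 'u) module. simple_module R W}"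
   using T by (simp add: tower_def successor_chain_def)
  have c: "groth_class R (fl_modules R) c \<in> carrier FL \<and> \<chi> (groth_class R (fl_modules R) c) = ecl c \<and> ecl c \<in> carrier K"
   if "c \<in> set T" for c
  proof -
   obtain W :: "('r, 'u) module" where W: "simple_module R W" "c = iso_class R W"
    using subsetD[OF TS \<open>c \<in> set T\<close>] by blast
   have fl: "finite_length R W" by (rule simple_finite_length[OF W(1)])
   have "groth_class R (fl_modules R) c \<in> carrier FL"
    unfolding W(2) using fl by (intro groth_class_closed) (simp add: fl_modules_def)
   moreover have "\<chi> (groth_class R (fl_modules R) c) = ecl c"
    using ecl_iso_class[OF _ e[OF fl]] W fl by (simp add: finite_length_def fl_class_def)
   ultimately show ?thesis by (metis chi.hom_closed)
  qed
  have "\<chi> (finprod FL (groth_class R (fl_modules R)) A) = finprod K ecl A" if "finite A" "A <= set T" for A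
   using that
  proof (induction A rule: finite_induct)
   case (insert c A)
   then show ?case
    using c F.finprod_closed[of "groth_class R (fl_modules R)" A]
    by (subst F.finprod_insert, simp, simp, blast, blast, subst K.finprod_insert) (auto simp: subset_iff)
  qed simp
  then show ?thesis unfolding tower_class_def by blast
 qed
 have val: "kcl (sub_mod (reg_module R) I) \<otimes>\<^bsub>K\<^esub> inv\<^bsub>K\<^esub> kcl (reg_module R) = inv\<^bsub>K\<^esub> finprod K ecl (set T)"
  if I: "tower_maximal TYPE('u) R I" and T: "tower R T" "fcl (quot_module (reg_module R) I) = tower_class R T"
  for I and T :: "('r, 'u) module set list"
 proof -
  have Ir: "right_ideal I R" and fl: "finite_length R (quot_module (reg_module R) I)"
   using I by (auto simp: tower_maximal_def right_R_ideal_def)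
  let ?Q = "quot_module (reg_module R) I"
  have Qm: "right_module R ?Q" by (rule reg.right_module_quot[OF Ir])
  note q = reg.quot_map[OF Ir]
  have "small_mod TYPE('u) ?Q" by (rule small_surj[OF small_reg[OF univ'] q(2)])
  then obtain N :: "('r, 'u) module" where N: "right_module R N" "riso R ?Q N ~= {}"
   using small_copy[OF _ Qm] by blast
  have Ic: "I <= carrier R" by (rule right_ideal_subset[OF Ir])
  have ex: "short_exact R (sub_mod (reg_module R) I) (reg_module R) ?Q (\<lambda>x\<in>I. x) (reg.quot_map I)"
   unfolding short_exact_def using rhom_incl[OF reg.right_module_axioms Ir] q by (auto simp: inj_on_def)
  note db = has_db_reg[OF ring_axioms] small_reg[OF univ'] hnp_ideal_has_db[OF hnp Ir]
  have sI: "small_mod TYPE('u) (sub_mod (reg_module R) I)" by (rule small_sub[OF small_reg[OF univ']]) (use Ic in simp)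
  have "euler ?Q (kcl (reg_module R) \<otimes>\<^bsub>K\<^esub> inv\<^bsub>K\<^esub> kcl (sub_mod (reg_module R) I))"
   by (rule eulerI[OF db sI Qm ex])
  then have "euler N (kcl (reg_module R) \<otimes>\<^bsub>K\<^esub> inv\<^bsub>K\<^esub> kcl (sub_mod (reg_module R) I))"
   by (rule euler_iso[OF Qm N])
  moreover have "euler N (\<chi> (fcl N))" by (rule e[OF finite_length_riso[OF fl N]])
  moreover have "fcl N = fcl ?Q" using iso_class_cong[OF Qm N, where ?'u = 'u] by (simp add: fl_class_def)
  ultimately have "kcl (reg_module R) \<otimes>\<^bsub>K\<^esub> inv\<^bsub>K\<^esub> kcl (sub_mod (reg_module R) I) = finprod K ecl (set T)"
   using euler_unique[OF N(1)] T(2) tc[OF T(1)] by metis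
  then have "inv\<^bsub>K\<^esub> finprod K ecl (set T) = inv\<^bsub>K\<^esub> (kcl (reg_module R) \<otimes>\<^bsub>K\<^esub> inv\<^bsub>K\<^esub> kcl (sub_mod (reg_module R) I))"
   by simp
  also have "\<dots> = kcl (sub_mod (reg_module R) I) \<otimes>\<^bsub>K\<^esub> inv\<^bsub>K\<^esub> kcl (reg_module R)"
   using kcl_closed[OF db(1,2)] kcl_closed[OF db(3) sI] by (simp add: K.inv_mult_group)
  finally show ?thesis by simp
 qed
 show ?thesis
 proof (intro subset_antisym subsetI)
  fix x :: "('r, 'u) groth_elem" assume "x \<in> G_max R"
  then obtain I where I: "x = kcl (sub_mod (reg_module R) I) \<otimes>\<^bsub>K\<^esub> inv\<^bsub>K\<^esub> kcl (reg_module R)" "tower_maximal TYPE('u) R I"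
   by (auto simp: G_max_def)
  then obtain T :: "('r, 'u) module set list" where T: "tower R T" "fcl (quot_module (reg_module R) I) = tower_class R T"
   by (auto simp: tower_maximal_def)
  have "x = inv\<^bsub>K\<^esub> finprod K ecl (set T)" unfolding I(1) by (rule val[OF I(2) T])
  then show "x \<in> (\<lambda>T. inv\<^bsub>K\<^esub> finprod K ecl (set T)) ` {T. tower R T}" using T(1) by blast
 next
  fix x assume "x \<in> (\<lambda>T. inv\<^bsub>K\<^esub> finprod K ecl (set T)) ` {T :: ('r, 'u) module set list. tower R T}"
  then obtain T :: "('r, 'u) module set list" where T: "tower R T" "x = inv\<^bsub>K\<^esub> finprod K ecl (set T)" by blast
  obtain I where I: "tower_maximal TYPE('u) R I" "fcl (quot_module (reg_module R) I) = tower_class R T"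
   using tower_ideal_exists[OF na T(1)] by blast
  show "x \<in> G_max R" unfolding G_max_def T(2) using val[OF I(1) T(1) I(2)] I(1) by (metis (mono_tags, lifting) mem_Collect_eq)
 qed
qed

end

section \<open>Successors through arbitrary projective presentations\<close>

section \<open>Extensions of simple modules\<close>

text \<open>For a projective presentation Q -> P -> V this expresses the vanishing of Ext^1(V, W).
  It is stated for any map \<open>i\<close> because the canonical free presentation is tied to the
  elements of V, which an equivalence does not preserve.\<close>

definition extends ::
 "('r, 'k) ring_scheme => ('r, 'q) module => ('r, 'p) module => ('r, 'n) module => ('q => 'p) => bool" where
 "extends R Q P W i \<longleftrightarrow> (\<forall>f\<in>rhom R Q W. \<exists>g\<in>rhom R P W. \<forall>x\<in>carrier Q. g (i x) = f x)"

lemma group_hom_group: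
 assumes M: "right_module R M" and N: "right_module R N"
 shows "group (hom_group R M N)"
proof -
 interpret M: right_module R M by (rule M)
 interpret N: right_module R N by (rule N)
 note c = rhom_closed[of _ R M N]
 show ?thesis
 proof (rule groupI)
  fix f g h assume fgh: "f \<in> carrier (hom_group R M N)" "g \<in> carrier (hom_group R M N)" "h \<in> carrier (hom_group R M N)"
  show "f \<otimes>\<^bsub>hom_group R M N\<^esub> g \<otimes>\<^bsub>hom_group R M N\<^esub> h = f \<otimes>\<^bsub>hom_group R M N\<^esub> (g \<otimes>\<^bsub>hom_group R M N\<^esub> h)"
   using fgh c by (auto simp: hom_group_def fun_eq_iff N.M.a_assoc)
 next
  fix f assume f: "f \<in> carrier (hom_group R M N)"
  then have f': "f \<in> rhom R M N" by (simp add: hom_group_def)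
  show "\<one>\<^bsub>hom_group R M N\<^esub> \<otimes>\<^bsub>hom_group R M N\<^esub> f = f"
   using c[OF f'] rhom_ext[OF f'] by (auto simp: hom_group_def fun_eq_iff)
  have "(\<lambda>x\<in>carrier M. \<ominus>\<^bsub>N\<^esub> f x) \<otimes>\<^bsub>hom_group R M N\<^esub> f = \<one>\<^bsub>hom_group R M N\<^esub>"
   using c[OF f'] by (auto simp: hom_group_def fun_eq_iff N.M.l_neg)
  then show "\<exists>g\<in>carrier (hom_group R M N). g \<otimes>\<^bsub>hom_group R M N\<^esub> f = \<one>\<^bsub>hom_group R M N\<^esub>"
   using rhom_uminus[OF M N f'] by (intro bexI) (simp_all add: hom_group_def)
 qed (use rhom_plus[OF M N] rhom_const_zero[OF M N] in "simp_all add: hom_group_def")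
qed

lemma Ext1_trivial_iff:
 assumes V: "right_module R V" and W: "right_module R W"
 shows "carrier (Ext1 R V W) = {\<one>\<^bsub>Ext1 R V W\<^esub>} \<longleftrightarrow>
  extends R (sub_mod (free_on R V) (free_ker R V)) (free_on R V) W (\<lambda>x\<in>free_ker R V. x)"
proof -
 interpret V: right_module R V by (rule V)
 interpret W: right_module R W by (rule W)
 let ?F = "free_on R V" and ?K = "free_ker R V"
 have F: "right_module R ?F" by (rule right_module_free[OF V.R.ring_axioms])
 have ev: "restrict (free_eval R V) (carrier ?F) \<in> rhom R ?F V"
  unfolding free_eval_lin by (rule V.lin_rhom) simp
 have Kh: "?K = hker ?F V (restrict (free_eval R V) (carrier ?F))" by (auto simp: free_ker_def)
 have K: "submodule ?K R ?F" unfolding Kh by (rule submodule_ker[OF F V ev])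
 have Km: "right_module R (sub_mod ?F ?K)" by (rule right_module.right_module_sub[OF F K])
 let ?A = "hom_group R (sub_mod ?F ?K) W" and ?H = "(\<lambda>h. restrict h ?K) ` rhom R ?F W"
 interpret A: group ?A by (rule group_hom_group[OF Km W])
 have KF: "?K <= carrier ?F" by (auto simp: free_ker_def)
 have HA: "?H <= carrier ?A" using rhom_restrict[OF F _ K, of _ W] by (auto simp: hom_group_def)
 have plus: "restrict h ?K \<otimes>\<^bsub>?A\<^esub> restrict h' ?K = restrict (\<lambda>x\<in>carrier ?F. h x \<oplus>\<^bsub>W\<^esub> h' x) ?K" for h h'
  using KF by (auto simp: hom_group_def fun_eq_iff)
 have H: "subgroup ?H ?A"
 proof (rule A.subgroupI[OF HA])
  show "?H ~= {}" using rhom_const_zero[OF F W] by blast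
  fix f assume f: "f \<in> ?H"
  then obtain h where h: "h \<in> rhom R ?F W" "f = restrict h ?K" by blast
  note h' = rhom_uminus[OF F W h(1)]
  have "restrict (\<lambda>x\<in>carrier ?F. \<ominus>\<^bsub>W\<^esub> h x) ?K \<otimes>\<^bsub>?A\<^esub> f = \<one>\<^bsub>?A\<^esub>"
   using KF rhom_closed[OF h(1)] unfolding h(2) by (auto simp: hom_group_def fun_eq_iff W.M.l_neg)
  then have "inv\<^bsub>?A\<^esub> f = restrict (\<lambda>x\<in>carrier ?F. \<ominus>\<^bsub>W\<^esub> h x) ?K"
   using h' f HA by (intro A.inv_equality) auto
  then show "inv\<^bsub>?A\<^esub> f \<in> ?H" using imageI[OF h', of "\<lambda>h. restrict h ?K"] by (simp only:)
 next
  fix f g assume "f \<in> ?H" "g \<in> ?H"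
  then obtain h h' where h: "h \<in> rhom R ?F W" "f = restrict h ?K" "h' \<in> rhom R ?F W" "g = restrict h' ?K" by blast
  show "f \<otimes>\<^bsub>?A\<^esub> g \<in> ?H" unfolding h(2,4) plus by (intro imageI rhom_plus[OF F W h(1,3)])
 qed
 have one: "\<one>\<^bsub>Ext1 R V W\<^esub> = ?H" and car: "carrier (Ext1 R V W) = (\<lambda>f. ?H #>\<^bsub>?A\<^esub> f) ` carrier ?A"
  unfolding Ext1_def FactGroup_def RCOSETS_def by auto
 have coset: "?H #>\<^bsub>?A\<^esub> f = ?H \<longleftrightarrow> f \<in> ?H" if "f \<in> carrier ?A" for f
  using A.coset_join1[OF _ _ H, of f] A.coset_join2[OF _ H, of f] that HA by auto
 have "carrier (Ext1 R V W) = {\<one>\<^bsub>Ext1 R V W\<^esub>} \<longleftrightarrow> (\<forall>f\<in>carrier ?A. ?H #>\<^bsub>?A\<^esub> f = ?H)"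
 proof
  assume "carrier (Ext1 R V W) = {\<one>\<^bsub>Ext1 R V W\<^esub>}"
  then show "\<forall>f\<in>carrier ?A. ?H #>\<^bsub>?A\<^esub> f = ?H" unfolding one car by blast
 next
  assume "\<forall>f\<in>carrier ?A. ?H #>\<^bsub>?A\<^esub> f = ?H"
  then have "(\<lambda>f. ?H #>\<^bsub>?A\<^esub> f) ` carrier ?A = (\<lambda>f. ?H) ` carrier ?A" by (intro image_cong) auto
  also have "\<dots> = {?H}" by (rule image_constant[OF A.one_closed])
  finally show "carrier (Ext1 R V W) = {\<one>\<^bsub>Ext1 R V W\<^esub>}" unfolding one car .
 qed
 also have "\<dots> \<longleftrightarrow> (\<forall>f\<in>rhom R (sub_mod ?F ?K) W. f \<in> ?H)" using coset by (simp add: hom_group_def)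
 also have "\<dots> \<longleftrightarrow> extends R (sub_mod ?F ?K) ?F W (\<lambda>x\<in>?K. x)"
  unfolding extends_def
 proof (intro ball_cong refl)
  fix f assume f: "f \<in> rhom R (sub_mod ?F ?K) W"
  have "f = restrict g ?K \<longleftrightarrow> (\<forall>x\<in>carrier (sub_mod ?F ?K). g ((\<lambda>x\<in>?K. x) x) = f x)" for g
   using rhom_ext[OF f] by (auto simp: fun_eq_iff)
  then show "f \<in> ?H \<longleftrightarrow> (\<exists>g\<in>rhom R ?F W. \<forall>x\<in>carrier (sub_mod ?F ?K). g ((\<lambda>x\<in>?K. x) x) = f x)"
   unfolding image_iff by blast
 qed
 finally show ?thesis .
qed

text \<open>The homomorphism \<open>1 - b a\<close> maps \<open>P1\<close> into \<open>Q1\<close>.\<close>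

lemma extends_transfer:
 assumes m: "right_module R Q1" "right_module R P1" "right_module R Q2" "right_module R P2" "right_module R V" "right_module R W"
  and e1: "short_exact R Q1 P1 V i1 p1" and e2: "short_exact R Q2 P2 V i2 p2"
  and a: "a \<in> rhom R P1 P2" "!!x. x \<in> carrier P1 ==> p2 (a x) = p1 x"
  and b: "b \<in> rhom R P2 P1" "!!x. x \<in> carrier P2 ==> p1 (b x) = p2 x"
  and ext: "extends R Q2 P2 W i2"
 shows "extends R Q1 P1 W i1"
 unfolding extends_def
proof
 interpret Q1: right_module R Q1 by (rule m)
 interpret P1: right_module R P1 by (rule m)
 interpret Q2: right_module R Q2 by (rule m)
 interpret P2: right_module R P2 by (rule m)
 interpret V: right_module R V by (rule m)
 interpret W: right_module R W by (rule m)
 have i1: "i1 \<in> rhom R Q1 P1" "inj_on i1 (carrier Q1)" "i1 ` carrier Q1 = hker P1 V p1" and p1: "p1 \<in> rhom R P1 V"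
  using e1 by (auto simp: short_exact_def)
 have i2: "i2 \<in> rhom R Q2 P2" "i2 ` carrier Q2 = hker P2 V p2" and p2: "p2 \<in> rhom R P2 V"
  using e2 by (auto simp: short_exact_def)
 have p1i: "p1 (i1 x) = \<zero>\<^bsub>V\<^esub>" if "x \<in> carrier Q1" for x using i1(3) that by blast
 have p2i: "p2 (i2 x) = \<zero>\<^bsub>V\<^esub>" if "x \<in> carrier Q2" for x using i2(2) that by blast
 note ac = rhom_closed[OF a(1)] and bc = rhom_closed[OF b(1)] and i1c = rhom_closed[OF i1(1)] and i2c = rhom_closed[OF i2(1)]
 fix f1 assume f1: "f1 \<in> rhom R Q1 W"
 have bi: "compose (carrier Q2) b i2 \<in> rhom R Q2 P1" by (rule rhom_compose[OF i2(1) b(1) m(3)])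
 have "compose (carrier Q2) b i2 ` carrier Q2 <= i1 ` carrier Q1"
  unfolding i1(3) using b(2)[OF i2c] bc[OF i2c] p2i by (auto simp: compose_def)
 then obtain u where u: "u \<in> rhom R Q2 Q1" "compose (carrier Q2) b i2 = compose (carrier Q2) i1 u"
  using rhom_factor[OF m(3) m(1) bi i1(1,2)] by blast
 have u': "i1 (u z) = b (i2 z)" if "z \<in> carrier Q2" for z using fun_cong[OF u(2), of z] that by (simp add: compose_def)
 let ?d = "\<lambda>y\<in>carrier P1. y \<ominus>\<^bsub>P1\<^esub> b (a y)"
 have d: "?d \<in> rhom R P1 P1"
 proof (rule rhom_restrictI[OF m(2)])
  fix x y assume xy: "x \<in> carrier P1" "y \<in> carrier P1"
  show "x \<oplus>\<^bsub>P1\<^esub> y \<ominus>\<^bsub>P1\<^esub> b (a (x \<oplus>\<^bsub>P1\<^esub> y)) = x \<ominus>\<^bsub>P1\<^esub> b (a x) \<oplus>\<^bsub>P1\<^esub> (y \<ominus>\<^bsub>P1\<^esub> b (a y))"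
   using xy rhom_add[OF a(1) xy] rhom_add[OF b(1) ac[OF xy(1)] ac[OF xy(2)]] bc[OF ac]
   by (simp add: P1.M.minus_eq P1.M.minus_add P1.M.a_ac)
 next
  fix r x assume rx: "r \<in> carrier R" "x \<in> carrier P1"
  show "r \<odot>\<^bsub>P1\<^esub> x \<ominus>\<^bsub>P1\<^esub> b (a (r \<odot>\<^bsub>P1\<^esub> x)) = r \<odot>\<^bsub>P1\<^esub> (x \<ominus>\<^bsub>P1\<^esub> b (a x))"
   using rx rhom_smult[OF a(1) rx] rhom_smult[OF b(1) rx(1) ac[OF rx(2)]] bc[OF ac]
   by (simp add: P1.M.minus_eq P1.smult_r_distr P1.smult_minus_right)
 qed (use bc ac in simp)
 have "?d ` carrier P1 <= i1 ` carrier Q1"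
 proof
  fix z assume "z \<in> ?d ` carrier P1"
  then obtain y where y: "y \<in> carrier P1" "z = y \<ominus>\<^bsub>P1\<^esub> b (a y)" by auto
  have "p1 z = p1 y \<ominus>\<^bsub>V\<^esub> p1 (b (a y))" unfolding y(2) by (rule rhom_minus[OF m(2,5) p1 y(1) bc[OF ac[OF y(1)]]])
  then have "p1 z = \<zero>\<^bsub>V\<^esub>" using b(2)[OF ac[OF y(1)]] a(2)[OF y(1)] rhom_closed[OF p1 y(1)] by (simp add: V.M.minus_eq V.M.r_neg)
  then show "z \<in> i1 ` carrier Q1" unfolding i1(3) using y bc[OF ac] by simp
 qed
 then obtain w where w: "w \<in> rhom R P1 Q1" "?d = compose (carrier P1) i1 w"
  using rhom_factor[OF m(2) m(1) d i1(1,2)] by blast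
 have w': "i1 (w y) = y \<ominus>\<^bsub>P1\<^esub> b (a y)" if "y \<in> carrier P1" for y using fun_cong[OF w(2), of y] that by (simp add: compose_def)
 obtain g where g: "g \<in> rhom R P2 W" "!!z. z \<in> carrier Q2 ==> g (i2 z) = f1 (u z)"
  using ext rhom_compose[OF u(1) f1 m(3)] unfolding extends_def by (fastforce simp: compose_def)
 \<comment> \<open>Here g extends the composite of u and f1 from \<open>Q2\<close> to
   \<open>P2\<close>. Writing y as b (a y) plus the remainder explains the two summands: g a serves
   the first part and f1 w the second.\<close>
 let ?h = "\<lambda>y\<in>carrier P1. compose (carrier P1) g a y \<oplus>\<^bsub>W\<^esub> compose (carrier P1) f1 w y"
 have "?h \<in> rhom R P1 W" by (rule rhom_plus[OF m(2,6) rhom_compose[OF a(1) g(1) m(2)] rhom_compose[OF w(1) f1 m(2)]])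
 moreover have "?h (i1 x) = f1 x" if x: "x \<in> carrier Q1" for x
 proof -
  have "a (i1 x) \<in> hker P2 V p2" using a(2)[OF i1c[OF x]] p1i[OF x] ac[OF i1c[OF x]] by simp
  then obtain z where z: "z \<in> carrier Q2" "a (i1 x) = i2 z" unfolding i2(2)[symmetric] by blast
  have uz: "u z \<in> carrier Q1" by (rule rhom_closed[OF u(1) z(1)])
  have "i1 (w (i1 x)) = i1 (x \<ominus>\<^bsub>Q1\<^esub> u z)"
   using w'[OF i1c[OF x]] rhom_minus[OF m(1,2) i1(1) x uz] u'[OF z(1)] z(2) by simp
  then have wx: "w (i1 x) = x \<ominus>\<^bsub>Q1\<^esub> u z"
   using inj_onD[OF i1(2)] rhom_closed[OF w(1) i1c[OF x]] x uz by simp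
  have "?h (i1 x) = f1 (u z) \<oplus>\<^bsub>W\<^esub> f1 (x \<ominus>\<^bsub>Q1\<^esub> u z)"
   using i1c[OF x] g(2)[OF z(1)] z(2) wx by (simp add: compose_def)
  also have "\<dots> = f1 (u z \<oplus>\<^bsub>Q1\<^esub> (x \<ominus>\<^bsub>Q1\<^esub> u z))" using rhom_add[OF f1 uz, of "x \<ominus>\<^bsub>Q1\<^esub> u z"] x uz by simp
  also have "u z \<oplus>\<^bsub>Q1\<^esub> (x \<ominus>\<^bsub>Q1\<^esub> u z) = x"
   using x uz by (simp add: Q1.M.minus_eq Q1.M.a_lcomm[of "u z"] Q1.M.r_neg)
  finally show ?thesis .
 qed
 ultimately show "\<exists>g\<in>rhom R P1 W. \<forall>x\<in>carrier Q1. g (i1 x) = f1 x" by blast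
qed

text \<open>\<open>Ext1\<close> uses the free presentation on all elements of \<open>V\<close>.
  There are maps over \<open>V\<close> between it and \<open>P\<close> in both directions, one by
  projectivity of \<open>P\<close> and one by choosing preimages of the basis elements, so
  \<open>extends_transfer\<close> applies both ways.\<close>

theorem successor_iff:
 assumes Q: "right_module R Q" and P: "has_db R P" and ex: "short_exact R Q P V i p"
  and V: "simple_module R V" and W: "simple_module R W"
 shows "successor R V W \<longleftrightarrow> \<not> extends R Q P W i"
proof -
 have Vm: "right_module R V" and Wm: "right_module R W" using V W by (auto simp: simple_module_def)
 note Pm = has_db_module[OF P]
 interpret V: right_module R V by (rule Vm)
 interpret P: right_module R P by (rule Pm)
 have p: "p \<in> rhom R P V" "p ` carrier P = carrier V" using ex by (auto simp: short_exact_def)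
 let ?F = "free_on R V" and ?K = "free_ker R V" and ?e = "restrict (free_eval R V) (carrier (free_on R V))"
 have F: "right_module R ?F" by (rule right_module_free[OF V.R.ring_axioms])
 have ev: "?e \<in> rhom R ?F V"
  unfolding free_eval_lin by (rule V.lin_rhom) simp
 have es: "?e ` carrier ?F = carrier V"
 proof (rule subset_antisym)
  show "?e ` carrier ?F <= carrier V" using rhom_closed[OF ev] by blast
  show "carrier V <= ?e ` carrier ?F"
  proof
   fix v assume v: "v \<in> carrier V"
   have "?e (V.unit_vec v) = v" using V.unit_vec_closed[OF v] V.lin_unit_vec[of "\<lambda>v. v" v] v by (simp add: free_eval_lin)
   then show "v \<in> ?e ` carrier ?F" using V.unit_vec_closed[OF v] by (metis imageI)
  qed
 qed
 have Kh: "?K = hker ?F V ?e" by (auto simp: free_ker_def)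
 have K: "submodule ?K R ?F" unfolding Kh by (rule submodule_ker[OF F Vm ev])
 have Km: "right_module R (sub_mod ?F ?K)" by (rule right_module.right_module_sub[OF F K])
 have exF: "short_exact R (sub_mod ?F ?K) ?F V (\<lambda>x\<in>?K. x) ?e"
  unfolding short_exact_def using rhom_incl[OF F K] ev es Kh by (auto simp: inj_on_def)
 obtain b where b: "b \<in> rhom R P ?F" "!!x. x \<in> carrier P ==> ?e (b x) = p x"
  using has_db_lift[OF P F Vm ev es p(1)] by metis
 define q where "q v = inv_into (carrier P) p v" for v
 have q: "q v \<in> carrier P" "p (q v) = v" if "v \<in> carrier V" for v
  using that p(2) inv_into_into[of v p "carrier P"] f_inv_into_f[of v p "carrier P"] by (simp_all add: q_def)
 let ?a = "restrict (lin R P q) (carrier ?F)"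
 have a: "?a \<in> rhom R ?F P" by (rule P.lin_rhom) (rule q)
 have pa: "p (?a x) = ?e x" if x: "x \<in> carrier ?F" for x
 proof -
  have "p (lin R P q x) = lin R V (\<lambda>v. p (q v)) x" by (rule P.lin_natural[OF Vm p(1) q(1) x])
  also have "\<dots> = lin R V (\<lambda>v. v) x"
  proof -
   have "finsum V (\<lambda>v. x v \<odot>\<^bsub>V\<^esub> p (q v)) {v. x v ~= \<zero>\<^bsub>R\<^esub>} = finsum V (\<lambda>v. x v \<odot>\<^bsub>V\<^esub> v) {v. x v ~= \<zero>\<^bsub>R\<^esub>}"
    using free_onD[OF x] q(2) by (intro V.M.finsum_cong') auto
   then show ?thesis by (simp only: lin_def)
  qed
  finally show ?thesis using x by (simp add: free_eval_lin)
 qed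
 have "extends R (sub_mod ?F ?K) ?F W (\<lambda>x\<in>?K. x) \<longleftrightarrow> extends R Q P W i"
 proof
  assume "extends R (sub_mod ?F ?K) ?F W (\<lambda>x\<in>?K. x)"
  then show "extends R Q P W i"
   by (rule extends_transfer[where a = b and b = ?a, OF Q Pm Km F Vm Wm ex exF b(1) _ a, rotated -1]) (fact b(2), fact pa)
 next
  assume "extends R Q P W i"
  then show "extends R (sub_mod ?F ?K) ?F W (\<lambda>x\<in>?K. x)"
   by (rule extends_transfer[where a = ?a and b = b, OF Km F Q Pm Vm Wm exF ex a _ b(1), rotated -1]) (fact pa, fact b(2))
 qed
 then show ?thesis unfolding successor_def using V W Ext1_trivial_iff[OF Vm Wm] by blast
qed

lemma extends_riso:
 assumes Q: "right_module R Q" and P: "right_module R P" and W: "right_module R W" "right_module R W'" "riso R W W' ~= {}"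
  and i: "i \<in> rhom R Q P" and ext: "extends R Q P W i"
 shows "extends R Q P W' i"
 unfolding extends_def
proof
 obtain \<theta> where t: "\<theta> \<in> riso R W W'" using W(3) by blast
 obtain \<theta>' where t': "\<theta>' \<in> riso R W' W" "compose (carrier W') \<theta> \<theta>' = (\<lambda>x\<in>carrier W'. x)"
  using riso_inverse[OF W(1,2) t] by metis
 have tt: "\<theta> (\<theta>' x) = x" if "x \<in> carrier W'" for x using fun_cong[OF t'(2), of x] that by (simp add: compose_def)
 fix f assume f: "f \<in> rhom R Q W'"
 obtain g where g: "g \<in> rhom R P W" "!!x. x \<in> carrier Q ==> g (i x) = \<theta>' (f x)"
  using ext rhom_compose[OF f riso_rhom[OF t'(1)] Q] unfolding extends_def by (fastforce simp: compose_def)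
 have "compose (carrier P) \<theta> g \<in> rhom R P W'" by (rule rhom_compose[OF g(1) riso_rhom[OF t] P])
 moreover have "compose (carrier P) \<theta> g (i x) = f x" if "x \<in> carrier Q" for x
  using g(2)[OF that] tt[OF rhom_closed[OF f that]] rhom_closed[OF i that] by (simp add: compose_def)
 ultimately show "\<exists>g\<in>rhom R P W'. \<forall>x\<in>carrier Q. g (i x) = f x" by blast
qed

lemma short_exact_riso_right:
 assumes ex: "short_exact R Q P V i p" and m: "right_module R P" "right_module R V" "right_module R V'" and t: "\<theta> \<in> riso R V V'"
 shows "short_exact R Q P V' i (compose (carrier P) \<theta> p)"
proof -
 have p: "p \<in> rhom R P V" "p ` carrier P = carrier V" using ex by (auto simp: short_exact_def)
 have ts: "\<theta> ` carrier V = carrier V'" "inj_on \<theta> (carrier V)" using t by (auto simp: riso_def bij_betw_def)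
 have z: "\<theta> \<zero>\<^bsub>V\<^esub> = \<zero>\<^bsub>V'\<^esub>" by (rule rhom_zero[OF m(2,3) riso_rhom[OF t]])
 have zc: "\<zero>\<^bsub>V\<^esub> \<in> carrier V" using right_module.submoduleD(2)[OF m(2) right_module.submodule_carrier[OF m(2)]] .
 have "\<theta> (p x) = \<zero>\<^bsub>V'\<^esub> \<longleftrightarrow> p x = \<zero>\<^bsub>V\<^esub>" if "x \<in> carrier P" for x
  using inj_onD[OF ts(2), of "p x" "\<zero>\<^bsub>V\<^esub>"] z zc rhom_closed[OF p(1) that] by auto
 then have "{x \<in> carrier P. p x = \<zero>\<^bsub>V\<^esub>} = hker P V' (compose (carrier P) \<theta> p)" by (auto simp: compose_def)
 moreover have "compose (carrier P) \<theta> p ` carrier P = carrier V'"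
  using p(2) ts(1) by (simp add: compose_def image_image[symmetric, of \<theta> p])
 ultimately show ?thesis
  using ex rhom_compose[OF p(1) riso_rhom[OF t] m(1)] by (simp add: short_exact_def)
qed

lemma rho_riso:
 assumes V: "right_module R V" and W: "right_module R W" and i: "riso R V W ~= {}"
 shows "rho R P V = rho R P W"
 using zero_riso[OF V W i] zero_riso[OF W V riso_nonempty_sym[OF V W i]] ann_riso[OF V W i] by (auto simp: rho_def)

context hereditary_universe
begin

lemma simple_presentation:
 assumes V: "simple_module R (V :: ('r, 'u) module)"
 obtains P Q :: "('r, 'u) module" and i p where "has_db R P" "has_db R Q" "short_exact R Q P V i p"
proof -
 have Vm: "right_module R V" using V by (simp add: simple_module_def)
 interpret V: right_module R V by (rule Vm)
 have "chain R V 1 (nul V) (carrier V)" using V unfolding V.simple_iff by auto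
 then have "finite_length R V" using Vm unfolding finite_length_iff by blast
 then obtain x where "euler V x" using euler_exists[OF Vm finite_length_fin_gen] by blast
 then show thesis using that unfolding euler_def fgproj_iff by blast
qed

text \<open>One presentation serves both \<open>V\<close> and \<open>V'\<close>, after composing its
  last map with an isomorphism; the canonical presentations of the two modules need not be compared
  directly.\<close>

lemma successor_riso:
 fixes V W V' W' :: "('r, 'u) module"
 assumes s: "successor R V W" and V: "right_module R V'" "riso R V V' ~= {}" and W: "right_module R W'" "riso R W W' ~= {}"
 shows "successor R V' W'"
proof -
 have sV: "simple_module R V" and sW: "simple_module R W" using s by (auto simp: successor_def)
 have Vm: "right_module R V" and Wm: "right_module R W" using sV sW by (auto simp: simple_module_def)
 obtain P Q :: "('r, 'u) module" and i p where P: "has_db R P" and Q: "has_db R Q" and ex: "short_exact R Q P V i p"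
  using simple_presentation[OF sV] .
 note Pm = has_db_module[OF P] and Qm = has_db_module[OF Q]
 obtain \<theta> where t: "\<theta> \<in> riso R V V'" using V(2) by blast
 have i: "i \<in> rhom R Q P" using ex by (simp add: short_exact_def)
 have "\<not> extends R Q P W i" using successor_iff[OF Qm P ex sV sW] s by simp
 then have "\<not> extends R Q P W' i"
  using extends_riso[OF Qm Pm W(1) Wm riso_nonempty_sym[OF Wm W] i] by blast
 then show ?thesis
  using successor_iff[OF Qm P short_exact_riso_right[OF ex Pm Vm V(1) t] simple_riso[OF sV V] simple_riso[OF sW W]] by simp
qed

end

section \<open>Transport of towers, genus and projective classes along a Morita equivalence\<close>

section \<open>Morita equivalence\<close>

lemma nat_iso_faithful:
 assumes n: "nat_iso_id R (\<lambda>M. Go (Fo M)) (\<lambda>M N f. Gm (Fo M) (Fo N) (Fm M N f))"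
  and m: "right_module R M" "right_module R N" and f: "f \<in> rhom R M N" and g: "g \<in> rhom R M N" and eq: "Fm M N f = Fm M N g"
 shows "f = g"
proof (rule rhom_eqI[OF f g])
 obtain \<eta> where e: "!!M. right_module R M ==> \<eta> M \<in> riso R M (Go (Fo M))"
  and nat: "!!h. h \<in> rhom R M N ==> compose (carrier M) (Gm (Fo M) (Fo N) (Fm M N h)) (\<eta> M) = compose (carrier M) (\<eta> N) h"
  using n m unfolding nat_iso_id_def by blast
 fix x assume x: "x \<in> carrier M"
 have "compose (carrier M) (\<eta> N) f = compose (carrier M) (\<eta> N) g" using nat[OF f] nat[OF g] eq by simp
 then have "\<eta> N (f x) = \<eta> N (g x)" using fun_cong[of _ _ x] x by (metis compose_eq)
 moreover have "inj_on (\<eta> N) (carrier N)" using e[OF m(2)] by (simp add: riso_def bij_betw_def)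
 ultimately show "f x = g x" using rhom_closed[OF f x] rhom_closed[OF g x] by (simp add: inj_on_def)
qed

text \<open>Fullness is the usual categorical argument: move \<open>Gm\<close> of h through the
  natural isomorphisms to obtain f, observe that \<open>Gm\<close> takes the same value on
  \<open>Fm\<close> of f and on h, and cancel it by faithfulness of the other functor.\<close>

lemma equivalence_module_equiv:
 fixes Fo :: "('r, 'u) module => ('s, 'u) module" and Go :: "('s, 'u) module => ('r, 'u) module"
 assumes R: "ring R" and S: "ring S" and F: "mod_functor R S Fo Fm" and G: "mod_functor S R Go Gm"
  and n: "nat_iso_id R (\<lambda>M. Go (Fo M)) (\<lambda>M N f. Gm (Fo M) (Fo N) (Fm M N f))"
  and n': "nat_iso_id S (\<lambda>M. Fo (Go M)) (\<lambda>M N f. Fm (Go M) (Go N) (Gm M N f))"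
 shows "module_equiv R S Fo Fm"
proof (rule module_equiv.intro)
 have Fo: "right_module S (Fo M)" if "right_module R M" for M
  using F that unfolding mod_functor_def by blast
 have Fm: "Fm M N f \<in> rhom S (Fo M) (Fo N)" if "right_module R M" "right_module R N" "f \<in> rhom R M N" for M N f
  using F that unfolding mod_functor_def by blast
 have Go: "right_module R (Go M)" if "right_module S M" for M
  using G that unfolding mod_functor_def by blast
 have Gm: "Gm M N f \<in> rhom R (Go M) (Go N)" if "right_module S M" "right_module S N" "f \<in> rhom S M N" for M N f
  using G that unfolding mod_functor_def by blast
 show "ring R" "ring S" "mod_functor R S Fo Fm" by fact+
 show "f = g" if "right_module R M" "right_module R N" "f \<in> rhom R M N" "g \<in> rhom R M N" "Fm M N f = Fm M N g" for M N f g
  by (rule nat_iso_faithful[where R = R and Go = Go and Fo = Fo and Gm = Gm and Fm = Fm, OF n that])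
 show "\<exists>f\<in>rhom R M N. Fm M N f = h" if M: "right_module R M" and N: "right_module R N" and h: "h \<in> rhom S (Fo M) (Fo N)" for M N h
 proof -
  obtain \<eta> where e: "!!M. right_module R M ==> \<eta> M \<in> riso R M (Go (Fo M))"
   and nat: "!!f. f \<in> rhom R M N ==> compose (carrier M) (Gm (Fo M) (Fo N) (Fm M N f)) (\<eta> M) = compose (carrier M) (\<eta> N) f"
   using n M N unfolding nat_iso_id_def by blast
  note GFM = Go[OF Fo[OF M]] and GFN = Go[OF Fo[OF N]]
  obtain k where k: "k \<in> riso R (Go (Fo N)) N" "compose (carrier (Go (Fo N))) (\<eta> N) k = (\<lambda>x\<in>carrier (Go (Fo N)). x)"
   using riso_inverse[OF N GFN e[OF N]] by metis
  have k': "\<eta> N (k y) = y" if "y \<in> carrier (Go (Fo N))" for y using fun_cong[OF k(2), of y] that by (simp add: compose_def)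
  note Gh = Gm[OF Fo[OF M] Fo[OF N] h]
  let ?h = "compose (carrier M) (Gm (Fo M) (Fo N) h) (\<eta> M)"
  have hh: "?h \<in> rhom R M (Go (Fo N))" by (rule rhom_compose[OF riso_rhom[OF e[OF M]] Gh M])
  let ?f = "compose (carrier M) k ?h"
  have f: "?f \<in> rhom R M N" by (rule rhom_compose[OF hh riso_rhom[OF k(1)] M])
  have "Gm (Fo M) (Fo N) (Fm M N ?f) = Gm (Fo M) (Fo N) h"
  proof (rule rhom_eqI[OF Gm[OF Fo[OF M] Fo[OF N] Fm[OF M N f]] Gh])
   fix y assume "y \<in> carrier (Go (Fo M))"
   then have "y \<in> \<eta> M ` carrier M" using e[OF M] by (simp add: riso_def bij_betw_def)
   then obtain x where x: "x \<in> carrier M" "y = \<eta> M x" by blast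
   have "Gm (Fo M) (Fo N) (Fm M N ?f) (\<eta> M x) = \<eta> N (?f x)"
    using fun_cong[OF nat[OF f], of x] x(1) by (simp only: compose_eq)
   also have "\<dots> = Gm (Fo M) (Fo N) h (\<eta> M x)" using k'[OF rhom_closed[OF hh x(1)]] x(1) by (simp add: compose_eq)
   finally show "Gm (Fo M) (Fo N) (Fm M N ?f) y = Gm (Fo M) (Fo N) h y" unfolding x(2) .
  qed
  then have "Fm M N ?f = h"
   by (rule nat_iso_faithful[where R = S and Go = Fo and Fo = Go and Gm = Fm and Fm = Gm, OF n' Fo[OF M] Fo[OF N] Fm[OF M N f] h])
  then show ?thesis using f by blast
 qed
 show "\<exists>M. right_module R M \<and> riso S (Fo M) N' ~= {}" if N': "right_module S N'" for N' :: "('s, 'u) module"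
 proof -
  obtain \<eta> where "\<eta> \<in> riso S N' (Fo (Go N'))" using n' N' unfolding nat_iso_id_def by blast
  then have "riso S N' (Fo (Go N')) ~= {}" by blast
  then show ?thesis using riso_nonempty_sym[OF N' Fo[OF Go[OF N']]] Go[OF N'] by blast
 qed
qed

text \<open>A union over the whole class, so that no representative is chosen; on an isomorphism
  class the united sets all coincide.\<close>

definition class_map :: "('s, 'l) ring_scheme => (('r, 'u) module => ('s, 'v) module) => ('r, 'u) module set => ('s, 'v) module set" where
 "class_map S Fo c = (\<Union>M\<in>c. iso_class S (Fo M))"

context module_equiv
begin

lemma class_map_iso_class:
 assumes M: "right_module R M"
 shows "class_map S Fo (iso_class R M) = iso_class S (Fo M)"
proof -
 have "(iso_class S (Fo M') :: ('s, 'u) module set) = iso_class S (Fo M)" if "M' \<in> iso_class R M" for M'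
  using that iso_class_eq_iff[OF Fo_module[OF M] Fo_module, of M'] Fo_iso[OF M, of M'] by (auto simp: iso_class_def)
 then show ?thesis unfolding class_map_def using iso_class_self[OF M] by blast
qed

lemma extends_Fo:
 assumes Q: "right_module R Q" and P: "right_module R P" and W: "right_module R W" and i: "i \<in> rhom R Q P"
 shows "extends S (Fo Q) (Fo P) (Fo W) (Fm Q P i) \<longleftrightarrow> extends R Q P W i"
proof -
 have eq: "(\<forall>x\<in>carrier (Fo Q). Fm P W g (Fm Q P i x) = Fm Q W f x) \<longleftrightarrow> (\<forall>x\<in>carrier Q. g (i x) = f x)"
  if f: "f \<in> rhom R Q W" and g: "g \<in> rhom R P W" for f g
 proof -
  note gi = rhom_compose[OF i g Q]
  note Fgi = rhom_compose[OF Fm_rhom[OF Q P i] Fm_rhom[OF P W g] Fo_module[OF Q]]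
  have "(\<forall>x\<in>carrier (Fo Q). Fm P W g (Fm Q P i x) = Fm Q W f x) \<longleftrightarrow> compose (carrier (Fo Q)) (Fm P W g) (Fm Q P i) = Fm Q W f"
   using rhom_eqI[OF Fgi Fm_rhom[OF Q W f]] by (metis compose_eq)
  also have "\<dots> \<longleftrightarrow> compose (carrier Q) g i = f"
   using faithful[OF Q W gi f] by (metis Fm_compose[OF Q P W i g])
  also have "\<dots> \<longleftrightarrow> (\<forall>x\<in>carrier Q. g (i x) = f x)"
   using rhom_eqI[OF gi f] by (metis compose_eq)
  finally show ?thesis .
 qed
 show ?thesis
 proof
  assume ext: "extends S (Fo Q) (Fo P) (Fo W) (Fm Q P i)"
  show "extends R Q P W i"
   unfolding extends_def
  proof
   fix f assume f: "f \<in> rhom R Q W"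
   obtain g' where g': "g' \<in> rhom S (Fo P) (Fo W)" "\<forall>x\<in>carrier (Fo Q). g' (Fm Q P i x) = Fm Q W f x"
    using ext Fm_rhom[OF Q W f] unfolding extends_def by blast
   obtain g where g: "g \<in> rhom R P W" "Fm P W g = g'" using full[OF P W g'(1)] by blast
   show "\<exists>g\<in>rhom R P W. \<forall>x\<in>carrier Q. g (i x) = f x" using eq[OF f g(1)] g'(2) g by blast
  qed
 next
  assume ext: "extends R Q P W i"
  show "extends S (Fo Q) (Fo P) (Fo W) (Fm Q P i)"
   unfolding extends_def
  proof
   fix f' assume "f' \<in> rhom S (Fo Q) (Fo W)"
   then obtain f where f: "f \<in> rhom R Q W" "Fm Q W f = f'" using full[OF Q W] by blast
   obtain g where g: "g \<in> rhom R P W" "\<forall>x\<in>carrier Q. g (i x) = f x" using ext f(1) unfolding extends_def by blast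
   show "\<exists>g\<in>rhom S (Fo P) (Fo W). \<forall>x\<in>carrier (Fo Q). g (Fm Q P i x) = f' x"
    using eq[OF f(1) g(1)] g(2) f(2) Fm_rhom[OF P W g(1)] by blast
  qed
 qed
qed

lemma Fo_zero_iff:
 assumes M: "right_module R M"
 shows "carrier (Fo M) = nul (Fo M) \<longleftrightarrow> carrier M = nul M"
 using lat_iso_eq[OF Phi_lat_iso[OF M], of "carrier M" "nul M"] Phi_zero[OF M] Phi_carrier[OF M]
  right_module.submodule_carrier[OF M] right_module.submodule_zero[OF M] by simp

text \<open>By fullness the homomorphisms on both sides correspond, and \<open>Phi\<close> sends
  kernels to kernels. The intersection of all kernels is then handled by order alone, as the largest
  submodule below each of them.\<close>

lemma reject_Fo:
 assumes P: "right_module R P" and W: "right_module R W"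
 shows "reject S (Fo P) (Fo W) = Phi P (reject R P W)"
proof (rule subset_antisym)
 note FP = Fo_module[OF P] and FW = Fo_module[OF W]
 have rR: "submodule (reject R P W) R P" by (rule submodule_reject[OF P W])
 have rS: "submodule (reject S (Fo P) (Fo W)) S (Fo P)" by (rule submodule_reject[OF FP FW])
 have ker: "hker P W g \<in> submods R P" if "g \<in> rhom R P W" for g using submodule_ker[OF P W that] by simp
 obtain X where X: "X \<in> submods R P" "reject S (Fo P) (Fo W) = Phi P X"
  using lat_iso_surj[OF Phi_lat_iso[OF P], of "reject S (Fo P) (Fo W)"] rS by blast
 have "X <= hker P W g" if g: "g \<in> rhom R P W" for g
 proof -
  have "reject S (Fo P) (Fo W) <= hker (Fo P) (Fo W) (Fm P W g)"
   using Fm_rhom[OF P W g] by (auto simp: reject_def)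
  then show ?thesis using lat_iso_le[OF Phi_lat_iso[OF P] X(1) ker[OF g]] unfolding X(2) Phi_ker[OF P W g] by simp
 qed
 moreover have "X <= carrier P" using X(1) right_module.submoduleD(1)[OF P] by simp
 ultimately have "X <= reject R P W" by (auto simp: reject_def)
 then show "reject S (Fo P) (Fo W) <= Phi P (reject R P W)"
  using lat_iso_le[OF Phi_lat_iso[OF P] X(1)] rR unfolding X(2) by simp
 have "Phi P (reject R P W) <= hker (Fo P) (Fo W) h" if h: "h \<in> rhom S (Fo P) (Fo W)" for h
 proof -
  obtain g where g: "g \<in> rhom R P W" "Fm P W g = h" using full[OF P W h] by blast
  have "reject R P W <= hker P W g" using g(1) by (auto simp: reject_def)
  then have "Phi P (reject R P W) <= Phi P (hker P W g)"
   using lat_iso_le[OF Phi_lat_iso[OF P] _ ker[OF g(1)]] rR by simp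
  then show ?thesis unfolding Phi_ker[OF P W g(1), symmetric] g(2) .
 qed
 moreover have "Phi P (reject R P W) <= carrier (Fo P)"
  using right_module.submoduleD(1)[OF FP Phi_submodule[OF P rR]] .
 ultimately show "Phi P (reject R P W) <= reject S (Fo P) (Fo W)" by (auto simp: reject_def)
qed

end

context hnp
begin

lemma nonzero_coordinate:
 assumes P: "has_db R P" and x: "x \<in> carrier P" "x ~= \<zero>\<^bsub>P\<^esub>"
 shows "\<exists>f\<in>rhom R P (reg_module R). f x ~= \<zero>"
proof (rule ccontr)
 assume neg: "\<not> (\<exists>f\<in>rhom R P (reg_module R). f x ~= \<zero>)"
 interpret P: right_module R P by (rule has_db_module[OF P])
 obtain l where l: "coords R P P l" "dbsum P l x = x"
  using P x(1) by (auto simp: has_db_def dual_basis_def)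
 have "coords R P P l ==> dbsum P l x = \<zero>\<^bsub>P\<^esub>" for l
  by (induction l) (use neg in auto)
 then show False using l x(2) by simp
qed

text \<open>Faithfulness of \<open>W\<close> becomes a statement about one nonzero projective
  \<open>P\<close>, which an equivalence respects. If the reject is zero, a in the annihilator kills
  \<open>P\<close>; for a coordinate f with f(x) nonzero, f(x) r a = f(x r a) = 0, and primeness
  gives a = 0.\<close>

lemma ann_reject:
 assumes P: "has_db R P" "carrier P ~= nul P" and W: "right_module R W"
 shows "ann R W = {\<zero>} \<longleftrightarrow> reject R P W = nul P"
proof
 interpret P: right_module R P by (rule has_db_module[OF P(1)])
 interpret W: right_module R W by (rule W)
 assume "ann R W = {\<zero>}"
 then have "reject R P W = generate (add_monoid P) {a \<odot>\<^bsub>P\<^esub> x | a x. a \<in> {\<zero>} \<and> x \<in> carrier P}"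
  using mod_mult_ann[OF P(1) W] by (simp add: mod_mult_ideal_def)
 also have "{a \<odot>\<^bsub>P\<^esub> x | a x. a \<in> {\<zero>} \<and> x \<in> carrier P} = nul P" using P.M.zero_closed by force
 also have "generate (add_monoid P) (nul P) = nul P" using group.generate_one[OF P.M.a_group] by simp
 finally show "reject R P W = nul P" .
next
 interpret P: right_module R P by (rule has_db_module[OF P(1)])
 interpret W: right_module R W by (rule W)
 assume rej: "reject R P W = nul P"
 obtain x where x: "x \<in> carrier P" "x ~= \<zero>\<^bsub>P\<^esub>" using P(2) P.M.zero_closed by blast
 obtain f where f: "f \<in> rhom R P (reg_module R)" "f x ~= \<zero>\<^bsub>R\<^esub>" using nonzero_coordinate[OF P(1) x] by blast
 have fx: "f x \<in> carrier R" using rhom_closed[OF f(1) x(1)] by simp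
 have "a = \<zero>\<^bsub>R\<^esub>" if a: "a \<in> ann R W" for a
 proof -
  have aR: "a \<in> carrier R" using a by (simp add: ann_def)
  have kill: "a \<odot>\<^bsub>P\<^esub> y = \<zero>\<^bsub>P\<^esub>" if y: "y \<in> carrier P" for y
  proof -
   have "a \<odot>\<^bsub>P\<^esub> y \<in> reject R P W"
    using a aR y by (auto simp: reject_def ann_def rhom_smult rhom_closed)
   then show ?thesis unfolding rej by simp
  qed
  have "f x \<otimes>\<^bsub>R\<^esub> r \<otimes>\<^bsub>R\<^esub> a = \<zero>\<^bsub>R\<^esub>" if r: "r \<in> carrier R" for r
  proof -
   have "f (a \<odot>\<^bsub>P\<^esub> (r \<odot>\<^bsub>P\<^esub> x)) = f x \<otimes>\<^bsub>R\<^esub> r \<otimes>\<^bsub>R\<^esub> a" using r x(1) aR rhom_smult[OF f(1)] by simp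
   then show ?thesis using kill[of "r \<odot>\<^bsub>P\<^esub> x"] r x(1) rhom_zero[OF P.right_module_axioms reg.right_module_axioms f(1)] by simp
  qed
  from prime_elem[OF fx aR this] show ?thesis using f(2) by simp
 qed
 moreover have "\<zero>\<^bsub>R\<^esub> \<in> ann R W" by (simp add: ann_def)
 ultimately show "ann R W = nul R" by blast
qed

end

text \<open>Naturality has done its work in \<open>module_equiv\<close>; beyond that the functors
  are only known to be inverse on isomorphism classes. The locale is symmetric in the two rings, so
  by \<open>morita_sym\<close> every result for \<open>Fo\<close> also holds for
  \<open>Go\<close>.\<close>

locale morita =
 R: hnp_universe R U + S: hnp_universe S U + F: module_equiv R S Fo Fm + G: module_equiv S R Go Gm
 for R :: "('r, 'k) ring_scheme" and S :: "('s, 'l) ring_scheme" and U :: "'u itself"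
  and Fo :: "('r, 'u) module => ('s, 'u) module" and Fm and Go :: "('s, 'u) module => ('r, 'u) module" and Gm +
 assumes GF: "right_module R M ==> riso R M (Go (Fo M)) ~= {}"
  and FG: "right_module S N ==> riso S N (Fo (Go N)) ~= {}"
  and naR: "\<not> artinian_ring R" and naS: "\<not> artinian_ring S"
begin

lemma morita_sym: "morita S R U Go Gm Fo Fm"
 by unfold_locales (use GF FG naR naS in blast)+

lemma Fo_db: "has_db R P ==> has_db S (Fo P)"
 by (rule F.Fo_has_db[OF R.acc_ring S.univ'])

text \<open>A copy of R in the universe is the nonzero projective test module for
  \<open>ann_reject\<close>. Its image over S need not be free, which is why that lemma allows any
  nonzero projective.\<close>

lemma unfaithful_Fo:
 assumes W: "right_module R W"
 shows "unfaithful_simple S (Fo W) \<longleftrightarrow> unfaithful_simple R W"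
proof -
 obtain P :: "('r, 'u) module" where P: "has_db R P" "right_module R P" "riso R P (reg_module R) ~= {}"
  using R.small_db_copy[OF has_db_reg[OF R.ring_axioms] small_reg[OF R.univ']] unfolding fgproj_iff by metis
 have Pnz: "carrier P ~= nul P"
  using zero_riso[OF P(2) R.reg.right_module_axioms P(3)] R.one_neq_zero R.one_closed by auto
 then have FPnz: "carrier (Fo P) ~= nul (Fo P)" using F.Fo_zero_iff[OF P(2)] by simp
 have "reject S (Fo P) (Fo W) = nul (Fo P) \<longleftrightarrow> reject R P W = nul P"
  using lat_iso_eq[OF F.Phi_lat_iso[OF P(2)], of "reject R P W" "nul P"] submodule_reject[OF P(2) W]
   right_module.submodule_zero[OF P(2)] F.Phi_zero[OF P(2)] F.reject_Fo[OF P(2) W] by simp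
 then show ?thesis
  using S.ann_reject[OF Fo_db[OF P(1)] FPnz F.Fo_module[OF W]] R.ann_reject[OF P(1) Pnz W] F.Fo_simple[OF W]
  by (simp add: unfaithful_simple_def)
qed

lemma successor_Fo:
 assumes V: "right_module R V" and W: "right_module R W"
 shows "successor S (Fo V) (Fo W) \<longleftrightarrow> successor R V W"
proof (cases "simple_module R V \<and> simple_module R W")
 case True
 then have sV: "simple_module R V" and sW: "simple_module R W" by auto
 obtain P Q :: "('r, 'u) module" and i p where P: "has_db R P" and Q: "has_db R Q" and ex: "short_exact R Q P V i p"
  using R.simple_presentation[OF sV] .
 note Pm = has_db_module[OF P] and Qm = has_db_module[OF Q]
 have i: "i \<in> rhom R Q P" using ex by (simp add: short_exact_def)
 show ?thesis
  using successor_iff[OF Qm P ex sV sW] F.extends_Fo[OF Qm Pm W i] F.Fo_simple[OF V] F.Fo_simple[OF W] True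
   successor_iff[OF F.Fo_module[OF Qm] Fo_db[OF P] F.Fm_short_exact[OF Qm Pm V ex], of "Fo W"] by simp
next
 case False
 then show ?thesis using F.Fo_simple[OF V] F.Fo_simple[OF W] by (auto simp: successor_def)
qed

text \<open>A competing unfaithful successor X over S is isomorphic to \<open>Fo (Go X)\<close>, so
  \<open>Go X\<close> is a competitor over R and uniqueness there applies.\<close>

lemma unique_successor_Fo:
 assumes s: "unique_unfaithful_successor R V W"
 shows "unique_unfaithful_successor S (Fo V) (Fo W)"
proof -
 have V: "right_module R V" and W: "right_module R W"
  using s by (auto simp: unique_unfaithful_successor_def successor_def simple_module_def)
 have "riso S (Fo W) X ~= {}" if X: "successor S (Fo V) X" "unfaithful_simple S X" for X :: "('s, 'u) module"
 proof -
  have Xm: "right_module S X" using X(2) by (simp add: unfaithful_simple_def simple_module_def)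
  note GX = G.Fo_module[OF Xm]
  note FGX = F.Fo_module[OF GX]
  have "successor S (Fo V) (Fo (Go X))"
   by (rule S.successor_riso[OF X(1) F.Fo_module[OF V] _ FGX FG[OF Xm]]) (use riso_id[OF F.Fo_module[OF V]] in blast)
  then have "successor R V (Go X)" using successor_Fo[OF V GX] by simp
  moreover have "unfaithful_simple R (Go X)"
   using unfaithful_riso[OF X(2) FGX FG[OF Xm]] unfaithful_Fo[OF GX] by simp
  ultimately have "riso R W (Go X) ~= {}" using s by (simp add: unique_unfaithful_successor_def)
  then have "riso S (Fo W) (Fo (Go X)) ~= {}" by (rule F.Fo_iso[OF W GX])
  then show ?thesis by (rule riso_nonempty_trans[OF F.Fo_module[OF W] _ riso_nonempty_sym[OF Xm FGX FG[OF Xm]]])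
 qed
 then show ?thesis
  using s successor_Fo[OF V W] unfaithful_Fo[OF W] by (simp add: unique_unfaithful_successor_def)
qed

lemma class_map_inverse:
 fixes M :: "('r, 'u) module"
 assumes M: "right_module R M"
 shows "class_map R Go (class_map S Fo (iso_class R M)) = (iso_class R M :: ('r, 'u) module set)"
proof -
 have "class_map R Go (class_map S Fo (iso_class R M)) = iso_class R (Go (Fo M))"
  using F.class_map_iso_class[OF M] G.class_map_iso_class[OF F.Fo_module[OF M]] by simp
 also have "\<dots> = iso_class R M" using iso_class_eq_iff[OF M G.Fo_module[OF F.Fo_module[OF M]]] GF[OF M] by simp
 finally show ?thesis .
qed

lemma successor_chain_map:
 assumes c: "successor_chain R (cs :: ('r, 'u) module set list)"
 shows "successor_chain S (map (class_map S Fo) cs)" "map (class_map R Go) (map (class_map S Fo) cs) = cs"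
  "inj_on (class_map S Fo) (set cs)"
proof -
 have simp: "set cs <= iso_class R ` {W :: ('r, 'u) module. simple_module R W}" and dist: "distinct cs" and ne: "cs ~= []"
  and suc: "!!i. Suc i < length cs ==> \<exists>V\<in>cs ! i. \<exists>W\<in>cs ! Suc i. unique_unfaithful_successor R V W"
  using c unfolding successor_chain_def by blast+
 have inv: "class_map R Go (class_map S Fo x) = x" if x: "x \<in> set cs" for x
 proof -
  obtain W :: "('r, 'u) module" where "simple_module R W" "x = iso_class R W" using simp x by blast
  then show ?thesis using class_map_inverse by (simp add: simple_module_def)
 qed
 show "map (class_map R Go) (map (class_map S Fo) cs) = cs" using inv by (simp add: map_idI)
 show inj: "inj_on (class_map S Fo) (set cs)" using inv by (metis inj_onI)
 have "set (map (class_map S Fo) cs) <= iso_class S ` {W :: ('s, 'u) module. simple_module S W}"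
 proof
  fix y assume "y \<in> set (map (class_map S Fo) cs)"
  then obtain x where x: "x \<in> set cs" "y = class_map S Fo x" by auto
  obtain W :: "('r, 'u) module" where W: "simple_module R W" "x = iso_class R W" using simp x by blast
  have Wm: "right_module R W" using W(1) by (simp add: simple_module_def)
  have "simple_module S (Fo W)" using F.Fo_simple[OF Wm] W(1) by simp
  then show "y \<in> iso_class S ` {W :: ('s, 'u) module. simple_module S W}"
   unfolding x(2) W(2) F.class_map_iso_class[OF Wm] by blast
 qed
 moreover have "\<exists>V\<in>map (class_map S Fo) cs ! i. \<exists>W\<in>map (class_map S Fo) cs ! Suc i. unique_unfaithful_successor S V W"
  if i: "Suc i < length (map (class_map S Fo) cs)" for i
 proof -
  obtain V W where VW: "V \<in> cs ! i" "W \<in> cs ! Suc i" "unique_unfaithful_successor R V W" using suc[of i] i by auto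
  have V: "right_module R V" and W: "right_module R W"
   using VW(3) by (auto simp: unique_unfaithful_successor_def successor_def simple_module_def)
  have "Fo V \<in> class_map S Fo (cs ! i)" "Fo W \<in> class_map S Fo (cs ! Suc i)"
   unfolding class_map_def using VW iso_class_self[OF F.Fo_module[OF V]] iso_class_self[OF F.Fo_module[OF W]] by blast+
  then show ?thesis using unique_successor_Fo[OF VW(3)] i by (auto simp del: map_map)
 qed
 ultimately show "successor_chain S (map (class_map S Fo) cs)"
  unfolding successor_chain_def using ne dist inj by (simp add: distinct_map)
qed

text \<open>Maximality is tested by mapping a longer chain over S back along \<open>Go\<close>,
  where maximality of \<open>T\<close> applies; going back and forth is the identity on chains of
  isomorphism classes.\<close>

lemma tower_map:
 assumes T: "tower R (T :: ('r, 'u) module set list)"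
 shows "tower S (map (class_map S Fo) T)"
 unfolding tower_def
proof (intro conjI allI impI)
 interpret sym: morita S R U Go Gm Fo Fm by (rule morita_sym)
 have c: "successor_chain R T" and max: "!!ds. [|successor_chain R ds; sublist T ds|] ==> ds = T"
  using T by (auto simp: tower_def)
 show "successor_chain S (map (class_map S Fo) T)" by (rule successor_chain_map(1)[OF c])
 fix ds :: "('s, 'u) module set list" assume ds: "successor_chain S ds \<and> sublist (map (class_map S Fo) T) ds"
 have "sublist (map (class_map R Go) (map (class_map S Fo) T)) (map (class_map R Go) ds)"
  using ds by (intro map_mono_sublist) simp
 then have "sublist T (map (class_map R Go) ds)" unfolding successor_chain_map(2)[OF c] .
 then have "map (class_map R Go) ds = T" using max[OF sym.successor_chain_map(1)] ds by simp
 then show "ds = map (class_map S Fo) T" using sym.successor_chain_map(2)[of ds] ds by simp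
qed

lemma rho_Fo:
 assumes P: "has_db R P" and W: "right_module R W"
 shows "rho S (Fo P) (Fo W) = rho R P W"
proof -
 note Pm = has_db_module[OF P]
 interpret P: right_module R P by (rule Pm)
 interpret FP: right_module S "Fo P" by (rule F.Fo_module[OF Pm])
 note iso = F.Phi_lat_iso[OF Pm]
 have "udim S (Fo P) = udim R P"
 proof -
  interpret L: modular_sets "submods R P" "set_add P" "nul P" by (rule P.modular_submods)
  obtain n X where X: "unisum R P n X" "ess_in R P X (carrier P)"
   using L.uniform_sum_exists[OF P.acc_fin_gen[OF R.acc_ring has_db_fin_gen[OF P]]] by auto
  have "udim S (Fo P) = n"
   by (rule FP.udim_uniform_sum[OF lat_iso_uniform_sum[OF P.modular_submods FP.modular_submods iso X(1)]])
    (use lat_iso_essential[OF P.modular_submods FP.modular_submods iso X(2)] F.Phi_carrier[OF Pm] in simp)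
  then show ?thesis using P.udim_uniform_sum[OF X] by simp
 qed
 moreover have "chain S (Fo P) n (reject S (Fo P) (Fo W)) (carrier (Fo P)) \<longleftrightarrow>
   chain R P n (reject R P W) (carrier P)" for n
  using lat_iso_covers_chain[OF iso, of "reject R P W" "carrier P" n] submodule_reject[OF Pm W]
  by (simp add: F.reject_Fo[OF Pm W] F.Phi_carrier[OF Pm])
 ultimately show ?thesis
  using rho_reject[OF P W] rho_reject[OF Fo_db[OF P] F.Fo_module[OF W]] F.Fo_zero_iff[OF W] by simp
qed

definition induced :: "(('r, 'u) groth_elem => ('s, 'u) groth_elem) => bool" where
 "induced \<phi> \<longleftrightarrow> \<phi> \<in> hom R.K S.K \<and> (\<forall>P :: ('r, 'u) module. has_db R P --> \<phi> (R.kcl P) = S.kcl (Fo P))"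

lemma induced_exists: "\<exists>\<phi>. induced \<phi>"
proof -
 let ?C = "fgproj_modules R :: ('r, 'u) module set"
 have "\<exists>h\<in>hom (groth R ?C) S.K. \<forall>M\<in>?C. h (groth_class R ?C (iso_class R M)) = S.kcl (Fo M)"
 proof (rule groth_universal[OF S.K_comm_group])
  fix M :: "('r, 'u) module" assume M: "M \<in> fgproj_modules R"
  then show "right_module R M" using has_db_module by (simp add: fgproj_iff)
  show "S.kcl (Fo M) \<in> carrier S.K"
   using S.kcl_closed[OF Fo_db small_mod_self] M by (simp add: fgproj_iff)
 next
  fix M N :: "('r, 'u) module" assume MN: "M \<in> fgproj_modules R" "N \<in> fgproj_modules R" "riso R M N ~= {}"
  then have m: "right_module R M" "right_module R N" using has_db_module by (auto simp: fgproj_iff)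
  show "S.kcl (Fo M) = S.kcl (Fo N)"
   using iso_class_cong[OF F.Fo_module[OF m(1)] F.Fo_module[OF m(2)] F.Fo_iso[OF m MN(3)], where ?'u = 'u]
   by (simp add: K0_class_def)
 next
  fix L M N :: "('r, 'u) module" and i p
  assume LMN: "L \<in> fgproj_modules R" "M \<in> fgproj_modules R" "N \<in> fgproj_modules R" and ex: "short_exact R L M N i p"
  have db: "has_db R L" "has_db R M" "has_db R N" using LMN by (simp_all add: fgproj_iff)
  note m = db[THEN has_db_module]
  show "S.kcl (Fo M) = S.kcl (Fo L) \<otimes>\<^bsub>S.K\<^esub> S.kcl (Fo N)"
   by (rule S.kcl_exact[OF Fo_db[OF db(1)] small_mod_self F.Fo_module[OF m(2)] small_mod_self Fo_db[OF db(3)] small_mod_self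
     F.Fm_short_exact[OF m ex]])
 qed
 then show ?thesis unfolding induced_def K0_def K0_class_def by (auto simp: fgproj_iff)
qed

lemma induced_euler:
 assumes phi: "induced \<phi>" and V: "right_module R V" and e: "R.euler V x"
 shows "S.euler (Fo V) (\<phi> x)"
proof -
 interpret RK: comm_group R.K by (rule R.K_comm_group)
 interpret SK: comm_group S.K by (rule S.K_comm_group)
 interpret phi: group_hom R.K S.K \<phi> using phi by unfold_locales (simp add: induced_def)
 obtain P Q :: "('r, 'u) module" and i p where P: "has_db R P" and Q: "has_db R Q" and ex: "short_exact R Q P V i p"
  and x: "x = R.kcl P \<otimes>\<^bsub>R.K\<^esub> inv\<^bsub>R.K\<^esub> R.kcl Q"
  using e unfolding R.euler_def fgproj_iff by blast
 have "\<phi> x = S.kcl (Fo P) \<otimes>\<^bsub>S.K\<^esub> inv\<^bsub>S.K\<^esub> S.kcl (Fo Q)"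
  using R.kcl_closed[OF P small_mod_self] R.kcl_closed[OF Q small_mod_self] phi P Q unfolding x by (simp add: induced_def)
 moreover have "short_exact S (Fo Q) (Fo P) (Fo V) (Fm Q P i) (Fm P V p)"
  by (rule F.Fm_short_exact[OF has_db_module[OF Q] has_db_module[OF P] V ex])
 ultimately show ?thesis unfolding S.euler_def fgproj_iff using Fo_db[OF P] Fo_db[OF Q] by blast
qed

lemma induced_G_max:
 assumes phi: "induced \<phi>"
 shows "\<phi> ` G_max R <= G_max S"
proof -
 interpret RK: comm_group R.K by (rule R.K_comm_group)
 interpret SK: comm_group S.K by (rule S.K_comm_group)
 interpret phi: group_hom R.K S.K \<phi> using phi by unfold_locales (simp add: induced_def)
 have "\<phi> (inv\<^bsub>R.K\<^esub> finprod R.K R.ecl (set T)) \<in> G_max S" if T: "tower R T" for T :: "('r, 'u) module set list"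
 proof -
  have c: "successor_chain R T" using T by (simp add: tower_def)
  then have TS: "set T <= iso_class R ` {W :: ('r, 'u) module. simple_module R W}" by (simp add: successor_chain_def)
  have e: "R.ecl x \<in> carrier R.K \<and> \<phi> (R.ecl x) = S.ecl (class_map S Fo x)" if x: "x \<in> set T" for x
  proof -
   obtain W :: "('r, 'u) module" where W: "simple_module R W" "x = iso_class R W" using subsetD[OF TS x] by blast
   have Wm: "right_module R W" using W(1) by (simp add: simple_module_def)
   obtain y where y: "R.euler W y" using R.euler_exists[OF Wm R.finite_length_fin_gen[OF R.simple_finite_length[OF W(1)]]] by blast
   show ?thesis
    using R.ecl_iso_class[OF Wm y] R.euler_closed[OF y] W(2) F.class_map_iso_class[OF Wm]
     S.ecl_iso_class[OF F.Fo_module[OF Wm] induced_euler[OF phi Wm y]] by simp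
  qed
  \<comment> \<open>Injectivity keeps the classes of the tower distinct after mapping, so the two
    products correspond factor by factor.\<close>
  have inj: "inj_on (class_map S Fo) (set T)" by (rule successor_chain_map(3)[OF c])
  have "finprod R.K R.ecl A \<in> carrier R.K \<and> \<phi> (finprod R.K R.ecl A) = finprod S.K S.ecl (class_map S Fo ` A)"
   if "finite A" "A <= set T" for A
   using that
  proof (induction A rule: finite_induct)
   case (insert x A)
   have x: "class_map S Fo x \<notin> class_map S Fo ` A" "x \<in> set T" "A <= set T"
    using insert.prems insert.hyps inj by (auto simp: inj_on_def)
   have cl: "S.ecl y \<in> carrier S.K" if y: "y \<in> class_map S Fo ` set T" for y
   proof -
    obtain x where "x \<in> set T" "y = class_map S Fo x" using y by blast
    then show ?thesis using e[of x] phi.hom_closed by metis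
   qed
   have "finprod R.K R.ecl (insert x A) = R.ecl x \<otimes>\<^bsub>R.K\<^esub> finprod R.K R.ecl A"
    using e x insert.hyps by (intro RK.finprod_insert) auto
   moreover have "finprod S.K S.ecl (insert (class_map S Fo x) (class_map S Fo ` A)) =
     S.ecl (class_map S Fo x) \<otimes>\<^bsub>S.K\<^esub> finprod S.K S.ecl (class_map S Fo ` A)"
    using cl x insert.hyps by (intro SK.finprod_insert) auto
   ultimately show ?case using e[OF x(2)] insert.IH[OF x(3)] by simp
  qed simp
  then have "\<phi> (inv\<^bsub>R.K\<^esub> finprod R.K R.ecl (set T)) = inv\<^bsub>S.K\<^esub> finprod S.K S.ecl (set (map (class_map S Fo) T))" by simp
  then show ?thesis unfolding S.G_max_eq[OF naS] using tower_map[OF T] by blast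
 qed
 then show ?thesis unfolding R.G_max_eq[OF naR] by blast
qed

text \<open>Each \<open>W'\<close> in \<open>modspec S\<close> is matched with the chosen
  representative \<open>W\<close> of \<open>Go W'\<close>. The genus coordinate at \<open>W'\<close>
  after \<phi> and the genus coordinate at \<open>W\<close> are homomorphisms that agree on
  projective classes, so vanishing over R gives vanishing over S.\<close>

lemma induced_kernel:
 assumes phi: "induced \<phi>" and x: "x \<in> kernel R.K (genus_group R) (genus_plus R)"
 shows "\<phi> x \<in> kernel S.K (genus_group S) (genus_plus S)"
proof -
 let ?gR = "genus_plus R :: ('r, 'u) groth_elem => ('r, 'u) module => int"
 let ?gS = "genus_plus S :: ('s, 'u) groth_elem => ('s, 'u) module => int"
 have ph: "\<phi> \<in> hom R.K S.K" using phi by (simp add: induced_def)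
 have xK: "x \<in> carrier R.K" and x1: "?gR x = \<one>\<^bsub>genus_group R\<^esub>" using x by (auto simp: kernel_def)
 have pK: "\<phi> x \<in> carrier S.K" using ph xK by (auto simp: hom_def)
 note gR = R.genus_plus_props and gS = S.genus_plus_props
 have val: "?gS (\<phi> x) W' = 0" if W': "W' \<in> (modspec S :: ('s, 'u) module set)" for W'
 proof -
  have Wm: "right_module S W'" by (rule S.modspec_cases[OF W'])
  note GW = G.Fo_module[OF Wm]
  have "zero_module R (Go W') \<or> unfaithful_simple R (Go W')"
   using S.modspec_cases[OF W'] G.Fo_zero_iff[OF Wm] GW unfaithful_Fo[OF GW]
    unfaithful_riso[OF _ F.Fo_module[OF GW] FG[OF Wm]] by (auto simp: zero_module_def)
  then have "(SOME W. W \<in> iso_class R (Go W')) \<in> (modspec R :: ('r, 'u) module set)" unfolding modspec_def by blast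
  moreover have "(SOME W. W \<in> iso_class R (Go W')) \<in> (iso_class R (Go W') :: ('r, 'u) module set)"
   by (rule someI[of _ "Go W'"]) (rule iso_class_self[OF GW])
  ultimately obtain W :: "('r, 'u) module" where W: "W \<in> modspec R" "W \<in> iso_class R (Go W')" by blast
  have W2: "right_module R W" "riso R (Go W') W ~= {}" using W(2) by (auto simp: iso_class_def)
  have rho: "rho S (Fo P) W' = rho R P W" if P: "has_db R P" for P :: "('r, 'u) module"
   using rho_riso[OF Wm F.Fo_module[OF GW] FG[OF Wm], of "Fo P"] rho_Fo[OF P GW] rho_riso[OF GW W2] by simp
  have hR: "(\<lambda>y. ?gR y W) \<in> hom R.K integer_group"
   using gR(1) W(1) by (fastforce simp: hom_def genus_group_def)
  have hS: "(\<lambda>y. ?gS (\<phi> y) W') \<in> hom R.K integer_group"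
   using hom_compose[OF ph gS(1)] W' by (fastforce simp: hom_def genus_group_def)
  have "?gS (\<phi> x) W' = ?gR x W"
  proof (rule groth_hom_eq[of integer_group "\<lambda>y. ?gS (\<phi> y) W'" R "fgproj_modules R" "\<lambda>y. ?gR y W" x])
   fix P :: "('r, 'u) module" assume P: "P \<in> fgproj_modules R"
   then have db: "has_db R P" by (simp add: fgproj_iff)
   have "?gS (\<phi> (R.kcl P)) W' = int (rho S (Fo P) W')"
    using phi db gS(2)[of "Fo P"] Fo_db[OF db] W' by (simp add: induced_def fgproj_iff genus_def)
   also have "\<dots> = ?gR (R.kcl P) W" using gR(2)[OF P] rho[OF db] W(1) by (simp add: genus_def)
   finally show "?gS (\<phi> (groth_class R (fgproj_modules R) (iso_class R P))) W' = ?gR (groth_class R (fgproj_modules R) (iso_class R P)) W"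
    by (simp add: K0_class_def)
  qed (use hR hS xK in "simp_all add: K0_def")
  then show ?thesis using x1 W(1) by (simp add: genus_group_def)
 qed
 have "?gS (\<phi> x) \<in> carrier (genus_group S)" using gS(1) pK by (auto simp: hom_def)
 then have "?gS (\<phi> x) = \<one>\<^bsub>genus_group S\<^esub>"
  using val by (auto simp: genus_group_def fun_eq_iff PiE_def extensional_def)
 then show ?thesis using pK by (simp add: kernel_def)
qed

lemma induced_inverse:
 assumes phi: "induced \<phi>" and psi: "morita.induced S R Go \<psi>" and x: "x \<in> carrier R.K"
 shows "\<psi> (\<phi> x) = x"
proof -
 interpret sym: morita S R U Go Gm Fo Fm by (rule morita_sym)
 have h: "(\<lambda>x. \<psi> (\<phi> x)) \<in> hom R.K R.K"
  using hom_compose[of \<phi> R.K S.K \<psi> R.K] phi psi by (simp add: induced_def sym.induced_def comp_def)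
 show ?thesis
 proof (rule groth_hom_eq[of "R.K" "\<lambda>x. \<psi> (\<phi> x)" R "fgproj_modules R" "\<lambda>x. x" x])
  fix P :: "('r, 'u) module" assume "P \<in> fgproj_modules R"
  then have db: "has_db R P" by (simp add: fgproj_iff)
  note m = has_db_module[OF db]
  have "\<psi> (\<phi> (R.kcl P)) = R.kcl (Go (Fo P))"
   using phi psi db Fo_db[OF db] by (simp add: induced_def sym.induced_def)
  also have "\<dots> = R.kcl P"
   using iso_class_cong[OF m G.Fo_module[OF F.Fo_module[OF m]] GF[OF m], where ?'u = 'u] by (simp add: K0_class_def)
  finally show "\<psi> (\<phi> (groth_class R (fgproj_modules R) (iso_class R P))) = groth_class R (fgproj_modules R) (iso_class R P)"
   by (simp add: K0_class_def)
 qed (use h x R.K_comm_group in "simp_all add: K0_def comm_group_def hom_def")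
qed

text \<open>Exchanging the two rings yields an inverse \<psi> for \<phi> with the same properties,
  so for the kernels as well as for \<open>G_max\<close> one inclusion in each direction
  suffices.\<close>

theorem class_group_iso:
 "\<exists>\<phi> \<in> iso (class_group R :: ('r, 'u) groth_elem monoid) (class_group S :: ('s, 'u) groth_elem monoid). \<phi> ` G_max R = G_max S"
proof -
 interpret sym: morita S R U Go Gm Fo Fm by (rule morita_sym)
 obtain \<phi> where phi: "induced \<phi>" using induced_exists by blast
 obtain \<psi> where psi: "sym.induced \<psi>" using sym.induced_exists by blast
 interpret SK: comm_group S.K by (rule S.K_comm_group)
 let ?A = "kernel R.K (genus_group R) (genus_plus R)" and ?B = "kernel S.K (genus_group S) (genus_plus S)"
 have inv: "\<psi> (\<phi> x) = x" if "x \<in> carrier R.K" for x by (rule induced_inverse[OF phi psi that])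
 have inv': "\<phi> (\<psi> y) = y" if "y \<in> carrier S.K" for y by (rule sym.induced_inverse[OF psi phi that])
 have AK: "?A <= carrier R.K" and BK: "?B <= carrier S.K" by (auto simp: kernel_def)
 have "bij_betw \<phi> ?A ?B"
 proof (rule bij_betw_byWitness[of _ \<psi>])
  show "\<forall>x\<in>?A. \<psi> (\<phi> x) = x" "\<forall>y\<in>?B. \<phi> (\<psi> y) = y" using inv inv' AK BK by blast+
  show "\<phi> ` ?A <= ?B" "\<psi> ` ?B <= ?A"
   by (auto intro: induced_kernel[OF phi] sym.induced_kernel[OF psi])
 qed
 moreover have "\<phi> \<in> hom (class_group R) (class_group S)"
 proof (rule homI)
  fix x y :: "('r, 'u) groth_elem" assume "x \<in> carrier (class_group R)" "y \<in> carrier (class_group R)"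
  then have xy: "x \<in> ?A" "y \<in> ?A" by (simp_all add: class_group_def)
  show "\<phi> x \<in> carrier (class_group S)" using induced_kernel[OF phi xy(1)] by (simp add: class_group_def)
  have "\<phi> (x \<otimes>\<^bsub>R.K\<^esub> y) = \<phi> x \<otimes>\<^bsub>S.K\<^esub> \<phi> y"
   by (rule hom_mult[of \<phi> R.K S.K]) (use phi xy AK in "auto simp: induced_def")
  then show "\<phi> (x \<otimes>\<^bsub>class_group R\<^esub> y) = \<phi> x \<otimes>\<^bsub>class_group S\<^esub> \<phi> y" by (simp add: class_group_def)
 qed
 ultimately have "\<phi> \<in> iso (class_group R) (class_group S)" by (simp add: iso_def class_group_def)
 moreover have "\<phi> ` G_max R = G_max S"
 proof (rule subset_antisym[OF induced_G_max[OF phi]])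
  show "G_max S <= \<phi> ` G_max R"
  proof
   fix y :: "('s, 'u) groth_elem" assume y: "y \<in> G_max S"
   then obtain I where I: "y = S.kcl (sub_mod (reg_module S) I) \<otimes>\<^bsub>S.K\<^esub> inv\<^bsub>S.K\<^esub> S.kcl (reg_module S)" "right_ideal I S"
    by (auto simp: G_max_def tower_maximal_def right_R_ideal_def)
   note small = small_reg[OF S.univ']
   have "S.kcl (sub_mod (reg_module S) I) \<in> carrier S.K"
    by (rule S.kcl_closed[OF hnp_ideal_has_db[OF S.hnp I(2)] small_sub[OF small]]) (use S.right_ideal_subset[OF I(2)] in simp)
   then have "y \<in> carrier S.K" using S.kcl_closed[OF has_db_reg[OF S.ring_axioms] small] by (simp add: I(1))
   then show "y \<in> \<phi> ` G_max R" using inv' sym.induced_G_max[OF psi] y by (metis image_eqI image_subset_iff)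
  qed
 qed
 ultimately show ?thesis by blast
qed

end

theorem theorem3p24:
  fixes R :: "('r, 'k) ring_scheme" and S :: "('s, 'l) ring_scheme"
  assumes "hnp_ring R" and "\<not> artinian_ring R"
    and "hnp_ring S" and "\<not> artinian_ring S"
    and "universe_for TYPE('u) R" and "universe_for TYPE('u) S"
    and "morita_equivalent TYPE('u) R S"
  shows "\<exists>\<phi> \<in> iso (class_group R :: ('r, 'u) groth_elem monoid)
                 (class_group S :: ('s, 'u) groth_elem monoid).
           \<phi> ` G_max R = G_max S"
proof -
  interpret R: hnp_universe R "TYPE('u)" by unfold_locales fact+
  interpret S: hnp_universe S "TYPE('u)" by unfold_locales fact+
  obtain Fo :: "('r, 'u) module \<Rightarrow> ('s, 'u) module" and Fm and Go :: "('s, 'u) module \<Rightarrow> ('r, 'u) module" and Gm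
    where F: "mod_functor R S Fo Fm" and G: "mod_functor S R Go Gm"
      and n: "nat_iso_id R (\<lambda>M. Go (Fo M)) (\<lambda>M N f. Gm (Fo M) (Fo N) (Fm M N f))"
      and n': "nat_iso_id S (\<lambda>M. Fo (Go M)) (\<lambda>M N f. Fm (Go M) (Go N) (Gm M N f))"
    using assms(7) unfolding morita_equivalent_def by blast
  interpret F: module_equiv R S Fo Fm
    by (rule equivalence_module_equiv[OF R.ring_axioms S.ring_axioms F G n n'])
  interpret G: module_equiv S R Go Gm
    by (rule equivalence_module_equiv[OF S.ring_axioms R.ring_axioms G F n' n])
  interpret morita R S "TYPE('u)" Fo Fm Go Gm
  proof
    show "riso R M (Go (Fo M)) \<noteq> {}" if "right_module R M" for M
      using n that unfolding nat_iso_id_def by blast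
    show "riso S N (Fo (Go N)) \<noteq> {}" if "right_module S N" for N
      using n' that unfolding nat_iso_id_def by blast
  qed fact+
  show ?thesis by (rule class_group_iso)
qed

end
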